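(* Let $X=\{X(t)\}$ be a supOU process with characteristic quadruple $(a,b,\mu_L,\pi)$, $\mu_L\not\equiv 0$, with finite variance and zero mean, such that the cumulant function $\kappa_X(\zeta)=\log\mathbb{E}e^{i\zeta X(1)}$ is analytic in a neighborhood of the origin, and let $X^*(t)=\int_0^t X(s)\,ds$, $t\ge 0$. Suppose that $\pi$ has a density $p$ satisfying $p(x)\sim\alpha\,\ell(x^{-1})\,x^{\alpha-1}$ as $x\to0$ for some $\alpha\in(0,1)$ and some function $\ell$ slowly varying at infinity, and that $b=0$ and $\beta_{BG}<1+\alpha$, where $$\beta_{BG}=\inf\left\{\gamma\ge 0:\int_{|x|\le 1}|x|^\gamma\mu_L(dx)<\infty\right\}.$$ Then for every $q>0$ the limit $\tau_{X^*}(q)=\lim_{t\to\infty}\frac{\log\mathbb{E}|X^*(t)|^q}{\log t}$ exists and $$\tau_{X^*}(q)=\begin{cases}\frac{1}{1+\alpha}\,q,&0<q\le1+\alpha,\\ q-\alpha,&q\ge1+\alpha.\end{cases}$$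
   Context: SupOU process: let $\pi$ be a probability measure on $\mathbb{R}_+=(0,\infty)$ and let $\kappa_L(\zeta)=\log \mathbb{E}e^{i\zeta L(1)}$ be the cumulant function of an infinitely divisible random variable $L(1)$ with Lévy–Khintchine triplet $(a,b,\mu_L)$: $\kappa_L(\zeta)=i\zeta a-\frac{\zeta^2}{2}b+\int_{\mathbb{R}}(e^{i\zeta x}-1-i\zeta x\mathbf{1}_{[-1,1]}(x))\mu_L(dx)$. Let $\Lambda$ be the homogeneous Lévy basis (independently scattered infinitely divisible random measure) on $\mathbb{R}_+\times\mathbb{R}$ with $\log\mathbb{E}e^{i\zeta\Lambda(A)}=(\pi\times \mathrm{Leb})(A)\,\kappa_L(\zeta)$ for Borel sets $A$ (of finite measure). The supOU process with characteristic quadruple $(a,b,\mu_L,\pi)$ is the strictly stationary process $$X(t)=\int_{\mathbb{R}_+}\int_{\mathbb{R}}e^{-\xi t+s}\mathbf{1}_{[0,\infty)}(\xi t-s)\,\Lambda(d\xi,ds),\quad t\in\mathbb{R},$$ where the stochastic integral is in the sense of Rajput–Rosiński: for $\Lambda$-integrable $f$, $\log\mathbb{E}\exp(i\zeta\int f\,d\Lambda)=\int\int\kappa_L(\zeta f(\xi,s))\,ds\,\pi(d\xi)$. Under zero mean and finite variance of $X$, $\int x^2\mu_L(dx)<\infty$, $\mathbb{E}L(1)=0$ and $\kappa_L(\zeta)=-\frac{\zeta^2}{2}b+\int_{\mathbb{R}}(e^{i\zeta x}-1-i\zeta x)\mu_L(dx)$. Analyticity of $\kappa_X$ near the origin is equivalent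 to exponential decay of the tails of the distribution of $X(1)$; in particular all moments are finite. *)

theory Defs
  imports "HOL-Probability.Probability" "HOL-Complex_Analysis.Complex_Analysis"
    "HOL-Library.Landau_Symbols"
begin

definition levy_measure :: "real measure \<Rightarrow> bool" where
  "levy_measure \<mu> \<longleftrightarrow> sets \<mu> = sets borel \<and> emeasure \<mu> {0} = 0 \<and>
     (\<integral>\<^sup>+x. ennreal (min 1 (x\<^sup>2)) \<partial>\<mu>) < \<infinity>"

definition levy_khintchine :: "real \<Rightarrow> real \<Rightarrow> real measure \<Rightarrow> real \<Rightarrow> complex" where
  "levy_khintchine a b \<mu> \<zeta> =
     \<i> * complex_of_real (\<zeta> * a) - complex_of_real (\<zeta>\<^sup>2 / 2 * b)
     + (CLINT x|\<mu>. iexp (\<zeta> * x) - 1 - \<i> * complex_of_real (\<zeta> * x * indicator {-1..1} x))"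

definition blumenthal_getoor_index :: "real measure \<Rightarrow> real" where
  "blumenthal_getoor_index \<mu> =
     Inf {\<gamma>. 0 \<le> \<gamma> \<and> (\<integral>\<^sup>+x\<in>{-1..1}. ennreal (\<bar>x\<bar> powr \<gamma>) \<partial>\<mu>) < \<infinity>}"

(* For an infinitely divisible law N this is the distinguished logarithm of the characteristic
   function, which then exists and is unique. *)
definition has_cumulant_function :: "real measure \<Rightarrow> (real \<Rightarrow> complex) \<Rightarrow> bool" where
  "has_cumulant_function N \<kappa> \<longleftrightarrow>
     continuous_on UNIV \<kappa> \<and> \<kappa> 0 = 0 \<and> (\<forall>\<zeta>. char N \<zeta> = exp (\<kappa> \<zeta>))"

(* Analyticity of a function of a real variable near 0: it is the restriction of a function that is
   holomorphic on a complex neighbourhood of 0. *)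
definition analytic_near_zero :: "(real \<Rightarrow> complex) \<Rightarrow> bool" where
  "analytic_near_zero \<kappa> \<longleftrightarrow>
     (\<exists>g. g analytic_on {0} \<and> (\<forall>\<^sub>F \<zeta> in nhds 0. \<kappa> \<zeta> = g (complex_of_real \<zeta>)))"

definition slowly_varying :: "(real \<Rightarrow> real) \<Rightarrow> bool" where
  "slowly_varying l \<longleftrightarrow>
     (\<exists>x0. (\<forall>x\<ge>x0. 0 < l x) \<and> set_borel_measurable borel {x0..} l) \<and>
     (\<forall>c>0. ((\<lambda>x. l (c * x) / l x) \<longlongrightarrow> 1) at_top)"

definition converges_in_probability ::
    "'w measure \<Rightarrow> (nat \<Rightarrow> 'w \<Rightarrow> real) \<Rightarrow> ('w \<Rightarrow> real) \<Rightarrow> bool" where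
  "converges_in_probability M Y Z \<longleftrightarrow>
     (\<forall>n. Y n \<in> borel_measurable M) \<and> Z \<in> borel_measurable M \<and>
     (\<forall>\<epsilon>>0. (\<lambda>n. measure M {\<omega>\<in>space M. \<bar>Y n \<omega> - Z \<omega>\<bar> > \<epsilon>}) \<longlonglongrightarrow> 0)"

definition finite_measure_sets :: "'s measure \<Rightarrow> 's set set" where
  "finite_measure_sets m = {A \<in> sets m. emeasure m A < \<infinity>}"

(* Homogeneous Levy basis with control measure m and cumulant function \<kappa>: an independently
   scattered random measure \<Lambda>, whose value on A is the random variable \<Lambda> A. Only the values on sets
   of finite m-measure are meaningful. *)
definition levy_basis ::
    "'w measure \<Rightarrow> 's measure \<Rightarrow> (real \<Rightarrow> complex) \<Rightarrow> ('s set \<Rightarrow> 'w \<Rightarrow> real) \<Rightarrow> bool" where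
  "levy_basis M m \<kappa> \<Lambda> \<longleftrightarrow>
     (\<forall>A\<in>finite_measure_sets m. \<Lambda> A \<in> borel_measurable M) \<and>
     (\<forall>A. range A \<subseteq> finite_measure_sets m \<longrightarrow> disjoint_family A \<longrightarrow>
        prob_space.indep_vars M (\<lambda>_. borel) (\<lambda>n::nat. \<Lambda> (A n)) UNIV \<and>
        ((\<Union>n. A n) \<in> finite_measure_sets m \<longrightarrow>
          (AE \<omega> in M. (\<lambda>n. \<Lambda> (A n) \<omega>) sums \<Lambda> (\<Union>n. A n) \<omega>))) \<and>
     (\<forall>A\<in>finite_measure_sets m. \<forall>\<zeta>.
        char (distr M borel (\<Lambda> A)) \<zeta> = exp (complex_of_real (measure m A) * \<kappa> \<zeta>))"

(* The integral over A of a simple function with support of finite measure; the level set of the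
   value 0, whose measure may be infinite, contributes 0. *)
definition simple_stochastic_integral ::
    "'s measure \<Rightarrow> ('s set \<Rightarrow> 'w \<Rightarrow> real) \<Rightarrow> 's set \<Rightarrow> ('s \<Rightarrow> real) \<Rightarrow> 'w \<Rightarrow> real" where
  "simple_stochastic_integral m \<Lambda> A f \<omega> =
     (\<Sum>y\<in>f ` space m. y * \<Lambda> {x\<in>A. f x = y} \<omega>)"

(* Rajput-Rosinski: f is \<Lambda>-integrable with integral Y (determined up to a null set). *)
definition has_stochastic_integral ::
    "'w measure \<Rightarrow> 's measure \<Rightarrow> ('s set \<Rightarrow> 'w \<Rightarrow> real) \<Rightarrow> ('s \<Rightarrow> real) \<Rightarrow> ('w \<Rightarrow> real) \<Rightarrow> bool" where
  "has_stochastic_integral M m \<Lambda> f Y \<longleftrightarrow>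
     f \<in> borel_measurable m \<and>
     (\<exists>F::nat \<Rightarrow> 's \<Rightarrow> real.
        (\<forall>n. Bochner_Integration.simple_bochner_integrable m (F n)) \<and>
        (AE x in m. (\<lambda>n. F n x) \<longlonglongrightarrow> f x) \<and>
        (\<forall>A\<in>sets m. \<exists>Z.
           converges_in_probability M (\<lambda>n. simple_stochastic_integral m \<Lambda> A (F n)) Z) \<and>
        converges_in_probability M (\<lambda>n. simple_stochastic_integral m \<Lambda> (space m) (F n)) Y)"

(* \<pi> lives on the half-line {0<..} itself, not on all of the reals. *)
definition characteristic_quadruple ::
    "real \<Rightarrow> real \<Rightarrow> real measure \<Rightarrow> real measure \<Rightarrow> bool" where
  "characteristic_quadruple a b \<mu> \<pi> \<longleftrightarrow>
     0 \<le> b \<and> levy_measure \<mu> \<and> prob_space \<pi> \<and> sets \<pi> = sets (restrict_space borel {0<..})"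

definition supOU_kernel :: "real \<Rightarrow> real \<times> real \<Rightarrow> real" where
  "supOU_kernel t = (\<lambda>(\<xi>, s). exp (- \<xi> * t + s) * indicator {0..} (\<xi> * t - s))"

(* The stochastic integral fixes X t only up to a null set for each t; joint measurability selects a
   version for which the path integral over [0,t] makes sense. *)
definition supOU_process ::
    "'w measure \<Rightarrow> real \<Rightarrow> real \<Rightarrow> real measure \<Rightarrow> real measure \<Rightarrow> (real \<Rightarrow> 'w \<Rightarrow> real) \<Rightarrow> bool" where
  "supOU_process M a b \<mu> \<pi> X \<longleftrightarrow>
     prob_space M \<and> characteristic_quadruple a b \<mu> \<pi> \<and>
     (\<lambda>(t, \<omega>). X t \<omega>) \<in> borel_measurable (borel \<Otimes>\<^sub>M M) \<and>
     (\<exists>\<Lambda>. levy_basis M (\<pi> \<Otimes>\<^sub>M lborel) (levy_khintchine a b \<mu>) \<Lambda> \<and>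
        (\<forall>t. has_stochastic_integral M (\<pi> \<Otimes>\<^sub>M lborel) \<Lambda> (supOU_kernel t) (X t)))"

definition integrated_process :: "(real \<Rightarrow> 'w \<Rightarrow> real) \<Rightarrow> real \<Rightarrow> 'w \<Rightarrow> real" where
  "integrated_process X t \<omega> = (LINT s:{0..t}|lborel. X s \<omega>)"

(* The scaling function of Y at q exists and equals \<tau>. For \<tau> > 0 the junk values 0 of the integral
   of a non-integrable function and of ln 0 cannot interfere: the limit forces the q-th absolute
   moment of Y t to be finite and positive for all large t. *)
definition has_scaling_exponent ::
    "'w measure \<Rightarrow> (real \<Rightarrow> 'w \<Rightarrow> real) \<Rightarrow> real \<Rightarrow> real \<Rightarrow> bool" where
  "has_scaling_exponent M Y q \<tau> \<longleftrightarrow>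
     ((\<lambda>t. ln (LINT \<omega>|M. \<bar>Y t \<omega>\<bar> powr q) / ln t) \<longlongrightarrow> \<tau>) at_top"

end

theory Submission
  imports Defs
begin

text \<open>
  The integrated process $X^*(t)$ is an $L^2$ limit of Riemann sums of stochastic integrals, hence itself a centred
  infinitely divisible variable whose characteristic exponent is
  $\int (e^{i \zeta F_t x} - 1 - i \zeta F_t x) \, d\pi \, ds \, d\mu_L$ with the explicit kernel
  $F_t(\xi, s) = \int_0^t e^{-\xi u + s} 1_{s \le \xi u} \, du$. Three moment estimates can be read off this exponent:
  $E|X^*(t)|^\gamma \le C t$ for $\gamma < 1 + \alpha$ close to $1 + \alpha$, by integrating $1 - \mathrm{Re}\,\phi$ against
  $\zeta^{-1-\gamma}$; $E X^*(t)^2 = t^{2-\alpha+o(1)}$; and $E|X^*(t)|^q \ge t^{q/(1+\alpha)-o(1)}$ for $q \le 2$, because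
  $\phi_{X^*(t)}$ stays away from 1 at $\zeta = t^{-1/(1+\alpha)+\epsilon}$. Finally $E|X^*(t)|^q \le t^q E|X(1)|^q$, which is
  finite by analyticity. Since $q \mapsto \log E|X^*(t)|^q$ is convex, these bounds determine all exponents: the chord
  joining $(2, 2 - \alpha)$ to $(q, q)$ has slope tending to 1 as $q \to \infty$, so the crude bound at large $q$ is enough.
\<close>

section \<open>Variables with a given characteristic exponent\<close>

text \<open>Where the exponents come from: at rate \<xi> the kernel F_t has size about min(t,
  1/\<xi>) on a range of s of length about 1 + \<xi> t, and rates near y carry mass y^\<alpha> up to
  slowly varying factors. The variance is dominated by rates near 1/t (mass t^(-\<alpha>), kernel
  size t). Typical fluctuations come from rates near y = t^(-1/(1+\<alpha>)), where mass times
  length is of order one and the kernel has size 1/y. The main obstacle is the law of a stochastic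
  integral: its definition offers only convergence in probability of integrals of simple functions,
  whose drifts are not under control. So the jump part is estimated through moduli of characteristic
  functions, only the characters iexp(\<zeta> d_n) of the drifts are shown to converge, and zero
  mean with finite variance forces their limit, after full compensation, to be 1. Regular variation
  enters through p(x/2)/p(x) -> 2^(1-\<alpha>): iterated halving loses a factor t^e, invisible in
  the exponents. Moments are reached through difference quotients and Fatou, so that their
  finiteness is a conclusion and not a prerequisite.\<close>

text \<open>The full linear term is subtracted, without truncation, which suits centred laws of
  finite variance. N may be any measure: for a probability space and a centred square integrable y
  the value is the characteristic function of y minus 1, so one estimate serves both the jump side
  and the probability side.\<close>

definition levy_exponent :: "'s measure \<Rightarrow> ('s \<Rightarrow> real) \<Rightarrow> real \<Rightarrow> complex" where
  "levy_exponent N y \<zeta> = (CLINT x|N. iexp (\<zeta> * y x) - 1 - \<i> * complex_of_real (\<zeta> * y x))"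

section \<open>Elementary bounds for the complex exponential and the cosine\<close>

lemma norm_iexp_diff_1_le: "cmod (iexp x - 1) \<le> \<bar>x\<bar>"
  using iexp_approx1[of x 0] by simp

lemma norm_iexp_diff_le: "cmod (iexp x - iexp y) \<le> \<bar>x - y\<bar>"
proof -
  have "iexp x - iexp y = iexp y * (iexp (x - y) - 1)"
    by (simp add: right_diff_distrib exp_add[symmetric])
  then show ?thesis using norm_iexp_diff_1_le[of "x - y"] by (simp add: norm_mult)
qed

lemma norm_iexp_taylor1_le: "cmod (iexp x - 1 - \<i> * complex_of_real x) \<le> x\<^sup>2 / 2"
  using iexp_approx1[of x 1] by (simp add: power2_eq_square algebra_simps)

lemma norm_iexp_taylor1_le': "cmod (iexp x - 1 - \<i> * complex_of_real x) \<le> 2 * \<bar>x\<bar>"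
  using iexp_approx2[of x 1] by (simp add: algebra_simps)

lemma cos_ge_quadratic: "1 - x\<^sup>2 / 2 \<le> cos (x::real)"
  using norm_iexp_taylor1_le[of x] abs_Re_le_cmod[of "iexp x - 1 - \<i> * complex_of_real x"]
  by (simp add: Re_exp)

text \<open>Taylor expansion to order 3: for |x| <= 1 the remainder x^4/24 is at most x^2/24, so 1/4
  is a safe constant in place of 1/2.\<close>

lemma one_minus_cos_ge:
  fixes x :: real assumes "\<bar>x\<bar> \<le> 1" shows "x\<^sup>2 / 4 \<le> 1 - cos x"
proof -
  have "cmod (iexp x - (\<Sum>k\<le>3. (\<i> * x)^k / fact k)) \<le> x^4 / 24"
    using iexp_approx1[of x 3] by (simp add: fact_numeral)
  then have "\<bar>Re (iexp x - (\<Sum>k\<le>3. (\<i> * x)^k / fact k))\<bar> \<le> x^4 / 24"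
    using abs_Re_le_cmod order_trans by blast
  moreover have "Re (iexp x - (\<Sum>k\<le>3. (\<i> * x)^k / fact k)) = cos x - 1 + x\<^sup>2 / 2"
    by (simp add: numeral_eq_Suc Re_exp fact_numeral)
  ultimately have "cos x - 1 + x\<^sup>2 / 2 \<le> x^4 / 24" by linarith
  moreover have "x^4 \<le> x\<^sup>2"
  proof -
    have "x\<^sup>2 \<le> 1" using assms by (simp add: abs_square_le_1)
    then have "x\<^sup>2 * x\<^sup>2 \<le> x\<^sup>2 * 1" by (intro mult_left_mono) auto
    then show ?thesis by (simp add: power2_eq_square power4_eq_xxxx mult.assoc)
  qed
  ultimately show ?thesis using zero_le_power2[of x] by argo
qed

text \<open>The quotient is minus the symmetric second difference quotient of u |-> cos(u y) at 0
  with step h; by the half-angle formula it is a squared sinc times y^2.\<close>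

lemma tendsto_second_difference_cos:
  fixes y :: real and h :: "nat \<Rightarrow> real"
  assumes "h \<longlonglongrightarrow> 0" "\<And>n. h n \<noteq> 0"
  shows "(\<lambda>n. (2 - 2 * cos (h n * y)) / (h n)\<^sup>2) \<longlonglongrightarrow> y\<^sup>2"
proof (cases "y = 0")
  case False
  have "((\<lambda>x::real. sin x / x) \<longlongrightarrow> 1) (at 0)"
    using DERIV_sin[of "0::real"] by (simp add: has_field_derivative_iff)
  moreover have "filterlim (\<lambda>n. h n * y / 2) (at 0) sequentially"
    using assms False by (auto intro!: filterlim_atI tendsto_eq_intros)
  ultimately have "((\<lambda>n. sin (h n * y / 2) / (h n * y / 2)) \<longlonglongrightarrow> 1)"
    by (rule filterlim_compose)
  from tendsto_mult[OF tendsto_power[OF this, of 2] tendsto_const[of "y\<^sup>2"]]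
  have "((\<lambda>n. (sin (h n * y / 2) / (h n * y / 2))\<^sup>2 * y\<^sup>2) \<longlonglongrightarrow> y\<^sup>2)" by simp
  moreover have "(sin (h n * y / 2) / (h n * y / 2))\<^sup>2 * y\<^sup>2 = (2 - 2 * cos (h n * y)) / (h n)\<^sup>2" for n
  proof -
    have "cos (h n * y) = 1 - 2 * (sin (h n * y / 2))\<^sup>2"
      using cos_double_sin[of "h n * y / 2"] by simp
    then show ?thesis using False assms(2)[of n] by (simp add: field_simps power2_eq_square)
  qed
  ultimately show ?thesis by simp
qed simp

section \<open>Second moments read off characteristic functions\<close>

text \<open>Moments are bounded before they are known to exist: the nonnegative quotients converge
  pointwise to f^(2k), and Fatou turns a uniform bound on their integrals into a bound on the
  moment. The case k = 1 is used on the probability space and on the space of jumps, general k for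
  analytic characteristic functions.\<close>

lemma nn_integral_even_power_le_Fatou:
  fixes f :: "'s \<Rightarrow> real" and h :: "nat \<Rightarrow> real"
  assumes [measurable]: "f \<in> borel_measurable N"
    and h: "h \<longlonglongrightarrow> 0" "\<And>n. h n \<noteq> 0"
    and le: "\<forall>\<^sub>F n in sequentially. (\<integral>\<^sup>+x. ennreal (((2 - 2 * cos (h n * f x)) / (h n)\<^sup>2)^k) \<partial>N) \<le> B"
  shows "(\<integral>\<^sup>+x. ennreal (f x ^ (2*k)) \<partial>N) \<le> B"
proof -
  have "(\<integral>\<^sup>+x. ennreal (f x ^ (2*k)) \<partial>N)
     = (\<integral>\<^sup>+x. liminf (\<lambda>n. ennreal (((2 - 2 * cos (h n * f x)) / (h n)\<^sup>2)^k)) \<partial>N)"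
  proof (rule nn_integral_cong)
    fix x
    have "(\<lambda>n. ennreal (((2 - 2 * cos (h n * f x)) / (h n)\<^sup>2)^k)) \<longlonglongrightarrow> ennreal ((f x ^ 2)^k)"
      by (intro tendsto_ennrealI tendsto_power tendsto_second_difference_cos h)
    from lim_imp_Liminf[OF _ this]
    show "ennreal (f x ^ (2*k)) = liminf (\<lambda>n. ennreal (((2 - 2 * cos (h n * f x)) / (h n)\<^sup>2)^k))"
      by (simp add: power_mult)
  qed
  also have "\<dots> \<le> liminf (\<lambda>n. \<integral>\<^sup>+x. ennreal (((2 - 2 * cos (h n * f x)) / (h n)\<^sup>2)^k) \<partial>N)"
    by (rule nn_integral_liminf) simp
  also have "\<dots> \<le> B"
    using Liminf_mono[OF le] by (simp add: Liminf_const)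
  finally show ?thesis .
qed

lemma nn_integral_square_le_Fatou:
  fixes f :: "'s \<Rightarrow> real" and h :: "nat \<Rightarrow> real"
  assumes [measurable]: "f \<in> borel_measurable N"
    and h: "h \<longlonglongrightarrow> 0" "\<And>n. h n \<noteq> 0"
    and le: "\<forall>\<^sub>F n in sequentially. (\<integral>\<^sup>+x. ennreal ((2 - 2 * cos (h n * f x)) / (h n)\<^sup>2) \<partial>N) \<le> B"
  shows "(\<integral>\<^sup>+x. ennreal ((f x)\<^sup>2) \<partial>N) \<le> B"
  using nn_integral_even_power_le_Fatou[OF assms(1-3), of 1 B] le by simp

lemma (in prob_space) one_minus_Re_char:
  fixes Y :: "'a \<Rightarrow> real"
  assumes [measurable]: "Y \<in> borel_measurable M"
  shows "(\<integral>\<^sup>+\<omega>. ennreal (1 - cos (\<zeta> * Y \<omega>)) \<partial>M) = ennreal (1 - Re (char (distr M borel Y) \<zeta>))"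
proof -
  have int: "integrable M (\<lambda>\<omega>. iexp (\<zeta> * Y \<omega>))" by (intro integrable_iexp) auto
  have "char (distr M borel Y) \<zeta> = (CLINT \<omega>|M. iexp (\<zeta> * Y \<omega>))"
    unfolding char_def by (subst integral_distr) auto
  then have "Re (char (distr M borel Y) \<zeta>) = (LINT \<omega>|M. cos (\<zeta> * Y \<omega>))"
    using integral_Re[OF int] by (simp add: Re_exp)
  moreover have "integrable M (\<lambda>\<omega>. cos (\<zeta> * Y \<omega>))"
    by (rule integrable_const_bound[of _ 1]) auto
  ultimately have "(LINT \<omega>|M. 1 - cos (\<zeta> * Y \<omega>)) = 1 - Re (char (distr M borel Y) \<zeta>)"
    and "integrable M (\<lambda>\<omega>. 1 - cos (\<zeta> * Y \<omega>))"
    by (auto simp: prob_space)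
  then show ?thesis by (subst nn_integral_eq_integral) auto
qed

lemma levy_exponent_integrable:
  assumes "y \<in> borel_measurable N" "integrable N (\<lambda>x. (y x)\<^sup>2)"
  shows "integrable N (\<lambda>x. iexp (\<zeta> * y x) - 1 - \<i> * complex_of_real (\<zeta> * y x))"
proof (rule Bochner_Integration.integrable_bound[OF integrable_mult_right[OF assms(2), of "\<zeta>\<^sup>2 / 2"]])
  show "(\<lambda>x. iexp (\<zeta> * y x) - 1 - \<i> * complex_of_real (\<zeta> * y x)) \<in> borel_measurable N"
    using assms(1) by measurable
  show "AE x in N. cmod (iexp (\<zeta> * y x) - 1 - \<i> * complex_of_real (\<zeta> * y x))
     \<le> norm (\<zeta>\<^sup>2 / 2 * (y x)\<^sup>2)"
    using norm_iexp_taylor1_le[of "\<zeta> * y _"] by (intro always_eventually) (simp add: power_mult_distrib)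
qed

lemma norm_levy_exponent_le:
  assumes "y \<in> borel_measurable N" "integrable N (\<lambda>x. (y x)\<^sup>2)"
  shows "cmod (levy_exponent N y \<zeta>) \<le> \<zeta>\<^sup>2 / 2 * (LINT x|N. (y x)\<^sup>2)"
proof -
  have "cmod (levy_exponent N y \<zeta>) \<le> (LINT x|N. \<zeta>\<^sup>2 / 2 * (y x)\<^sup>2)"
    unfolding levy_exponent_def
  proof (rule order_trans[OF integral_norm_bound integral_mono])
    show "cmod (iexp (\<zeta> * y x) - 1 - \<i> * complex_of_real (\<zeta> * y x)) \<le> \<zeta>\<^sup>2 / 2 * (y x)\<^sup>2" for x
      using norm_iexp_taylor1_le[of "\<zeta> * y x"] by (simp add: power_mult_distrib)
  qed (use levy_exponent_integrable[OF assms] assms in auto)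
  then show ?thesis by simp
qed

text \<open>The form with a nonnegative integral lets Fatou and pointwise lower bounds act directly
  on the exponent.\<close>

lemma Re_levy_exponent:
  assumes "y \<in> borel_measurable N" "integrable N (\<lambda>x. (y x)\<^sup>2)"
  shows "(\<integral>\<^sup>+x. ennreal (1 - cos (\<zeta> * y x)) \<partial>N) = ennreal (- Re (levy_exponent N y \<zeta>))"
    and "Re (levy_exponent N y \<zeta>) \<le> 0"
proof -
  note int = levy_exponent_integrable[OF assms, of \<zeta>]
  have eq: "- Re (levy_exponent N y \<zeta>) = (LINT x|N. 1 - cos (\<zeta> * y x))"
    unfolding levy_exponent_def
    by (subst integral_Re[OF int, symmetric], subst integral_minus[symmetric]) (simp add: Re_exp)
  have "integrable N (\<lambda>x. - Re (iexp (\<zeta> * y x) - 1 - \<i> * complex_of_real (\<zeta> * y x)))"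
    using integrable_Re[OF int] by (rule integrable_minus)
  then have i: "integrable N (\<lambda>x. 1 - cos (\<zeta> * y x))" by (simp add: Re_exp)
  show "(\<integral>\<^sup>+x. ennreal (1 - cos (\<zeta> * y x)) \<partial>N) = ennreal (- Re (levy_exponent N y \<zeta>))"
    unfolding eq using i by (subst nn_integral_eq_integral) auto
  have "0 \<le> (LINT x|N. 1 - cos (\<zeta> * y x))" by (intro integral_nonneg_AE) auto
  then show "Re (levy_exponent N y \<zeta>) \<le> 0" using eq by linarith
qed

text \<open>Mean value inequality on the convex left half-plane, where the derivative of exp has
  modulus at most 1.\<close>

lemma norm_exp_minus_1_le:
  fixes z :: complex assumes "Re z \<le> 0" shows "cmod (exp z - 1) \<le> cmod z"
proof -
  have "norm (exp z - exp 0) \<le> 1 * norm (z - 0)"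
  proof (rule field_differentiable_bound[where S="{z. Re z \<le> 0}" and f' = exp])
    show "convex {z. Re z \<le> 0}" by (rule convex_halfspace_Re_le)
    show "(exp has_field_derivative exp w) (at w within {z. Re z \<le> 0})" for w
      by (auto intro: derivative_eq_intros)
  qed (use assms in auto)
  then show ?thesis by simp
qed

text \<open>For every step h one has 1 - Re phi(h) <= |psi(h)| <= h^2 V / 2, with V the second
  moment of y under N; Fatou does the rest. This transfers mean-square estimates from kernels to
  random variables.\<close>

lemma (in prob_space) nn_integral_square_le:
  fixes Y :: "'a \<Rightarrow> real"
  assumes [measurable]: "Y \<in> borel_measurable M" "y \<in> borel_measurable N"
    and int: "integrable N (\<lambda>x. (y x)\<^sup>2)"
    and char: "\<And>\<zeta>. char (distr M borel Y) \<zeta> = exp (levy_exponent N y \<zeta>)"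
  shows "(\<integral>\<^sup>+\<omega>. ennreal ((Y \<omega>)\<^sup>2) \<partial>M) \<le> ennreal (LINT x|N. (y x)\<^sup>2)"
proof (rule nn_integral_square_le_Fatou[where h = "\<lambda>n. inverse (real (Suc n))"])
  show "(\<lambda>n. inverse (real (Suc n))) \<longlonglongrightarrow> 0" by (rule LIMSEQ_inverse_real_of_nat)
  have "(\<integral>\<^sup>+x. ennreal ((2 - 2 * cos (h * Y x)) / h\<^sup>2) \<partial>M) \<le> ennreal (LINT x|N. (y x)\<^sup>2)"
    if "h > 0" for h :: real
  proof -
    have "(\<integral>\<^sup>+x. ennreal ((2 - 2 * cos (h * Y x)) / h\<^sup>2) \<partial>M)
      = (\<integral>\<^sup>+x. ennreal (2 / h\<^sup>2) * ennreal (1 - cos (h * Y x)) \<partial>M)"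
      by (intro nn_integral_cong) (simp add: ennreal_mult'[symmetric] diff_divide_distrib right_diff_distrib)
    also have "\<dots> = ennreal (2 / h\<^sup>2) * ennreal (1 - Re (char (distr M borel Y) h))"
      by (subst nn_integral_cmult) (auto simp: one_minus_Re_char)
    also have "\<dots> = ennreal (2 / h\<^sup>2 * (1 - Re (char (distr M borel Y) h)))"
      using that by (simp add: ennreal_mult'[symmetric])
    also have "\<dots> \<le> ennreal (LINT x|N. (y x)\<^sup>2)"
    proof (rule ennreal_leI)
      have "1 - Re (char (distr M borel Y) h) \<le> cmod (char (distr M borel Y) h - 1)"
        using abs_Re_le_cmod[of "char (distr M borel Y) h - 1"] by simp
      also have "\<dots> \<le> cmod (levy_exponent N y h)"
        unfolding char by (rule norm_exp_minus_1_le) (rule Re_levy_exponent(2), use int in auto)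
      also have "\<dots> \<le> h\<^sup>2 / 2 * (LINT x|N. (y x)\<^sup>2)"
        by (rule norm_levy_exponent_le) (use int in auto)
      finally show "2 / h\<^sup>2 * (1 - Re (char (distr M borel Y) h)) \<le> (LINT x|N. (y x)\<^sup>2)"
        using that by (simp add: field_simps)
    qed
    finally show ?thesis .
  qed
  then show "\<forall>\<^sub>F n in sequentially. (\<integral>\<^sup>+x. ennreal ((2 - 2 * cos (inverse (real (Suc n)) * Y x)) / (inverse (real (Suc n)))\<^sup>2) \<partial>M) \<le> ennreal (LINT x|N. (y x)\<^sup>2)"
    by (intro always_eventually allI) simp
qed auto

text \<open>Only the modulus of the characteristic function enters, so the lemma applies while the
  drift is still unknown, as in \<open>char_approximates\<close>. The factor 2 is the price of
  comparing exp(-u) with 1 - u/2 on [0, 1].\<close>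

lemma (in prob_space) nn_integral_square_ge:
  fixes Y :: "'a \<Rightarrow> real"
  assumes [measurable]: "Y \<in> borel_measurable M" "y \<in> borel_measurable N"
    and int: "integrable M (\<lambda>\<omega>. (Y \<omega>)\<^sup>2)" and zero: "expectation Y = 0"
    and char: "\<And>\<zeta>. cmod (char (distr M borel Y) \<zeta>) = exp (- Q \<zeta>)"
    and Q: "\<And>\<zeta>. (\<integral>\<^sup>+x. ennreal (1 - cos (\<zeta> * y x)) \<partial>N) = ennreal (Q \<zeta>)" "\<And>\<zeta>. 0 \<le> Q \<zeta>"
  shows "(\<integral>\<^sup>+x. ennreal ((y x)\<^sup>2) \<partial>N) \<le> ennreal (2 * expectation (\<lambda>\<omega>. (Y \<omega>)\<^sup>2))"
proof -
  define v where "v = expectation (\<lambda>\<omega>. (Y \<omega>)\<^sup>2)"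
  have v0: "0 \<le> v" unfolding v_def by (intro integral_nonneg_AE) auto
  have iY: "integrable M Y" using square_integrable_imp_integrable[OF _ int] by simp
  have iexp: "integrable M (\<lambda>\<omega>. iexp (\<zeta> * Y \<omega>))" for \<zeta> by (intro integrable_iexp) auto
  have dev: "cmod (char (distr M borel Y) \<zeta> - 1) \<le> \<zeta>\<^sup>2 / 2 * v" for \<zeta>
  proof -
    \<comment> \<open>Since Y is centred, subtracting the linear term changes nothing, and the
      quadratic bound for exponents applies with the probability space as N.\<close>
    have "char (distr M borel Y) \<zeta> - 1 = levy_exponent M Y \<zeta>"
      unfolding char_def levy_exponent_def
      by (subst integral_distr) (use iexp iY zero in \<open>auto simp: prob_space\<close>)
    then show ?thesis using norm_levy_exponent_le[OF assms(1) int] by (simp add: v_def)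
  qed
  have Qle: "Q \<zeta> \<le> \<zeta>\<^sup>2 * v" if "\<zeta>\<^sup>2 * v \<le> 1" for \<zeta>
  proof -
    have "1 - \<zeta>\<^sup>2 * v / 2 \<le> exp (- Q \<zeta>)"
    proof -
      have "1 \<le> cmod (char (distr M borel Y) \<zeta>) + cmod (char (distr M borel Y) \<zeta> - 1)"
        using norm_triangle_ineq4[of "char (distr M borel Y) \<zeta>" "char (distr M borel Y) \<zeta> - 1"] by simp
      then show ?thesis using dev[of \<zeta>] char[of \<zeta>] by simp
    qed
    \<comment> \<open>For 0 <= u <= 1 the product (1 - u/2)(1 + u) = 1 + u(1 - u)/2 is at least 1,
      and exp u >= 1 + u.\<close>
    moreover have "exp (- (\<zeta>\<^sup>2 * v)) \<le> 1 - \<zeta>\<^sup>2 * v / 2"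
    proof -
      define u where "u = \<zeta>\<^sup>2 * v"
      have u: "0 \<le> u" "u \<le> 1" using that v0 by (auto simp: u_def)
      have "1 \<le> (1 - u / 2) * (1 + u)" using u by (simp add: field_simps) (metis mult_left_le)
      also have "\<dots> \<le> (1 - u/2) * exp u" using u by (intro mult_left_mono) auto
      finally show ?thesis unfolding u_def[symmetric] by (simp add: exp_minus field_simps)
    qed
    ultimately have "exp (- (\<zeta>\<^sup>2 * v)) \<le> exp (- Q \<zeta>)" by linarith
    then show ?thesis by simp
  qed
  have "(\<integral>\<^sup>+x. ennreal ((y x)\<^sup>2) \<partial>N) \<le> ennreal (2 * v)"
  proof (rule nn_integral_square_le_Fatou[where h = "\<lambda>n. inverse (real (Suc n))"])
    show lim: "(\<lambda>n. inverse (real (Suc n))) \<longlonglongrightarrow> 0" by (rule LIMSEQ_inverse_real_of_nat)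
    have "(\<lambda>n. (inverse (real (Suc n)))\<^sup>2 * v) \<longlonglongrightarrow> 0\<^sup>2 * v" by (intro tendsto_intros lim)
    then have "\<forall>\<^sub>F n in sequentially. (inverse (real (Suc n)))\<^sup>2 * v < 1"
      by (rule order_tendstoD) simp
    then show "\<forall>\<^sub>F n in sequentially. (\<integral>\<^sup>+x. ennreal ((2 - 2 * cos (inverse (real (Suc n)) * y x)) / (inverse (real (Suc n)))\<^sup>2) \<partial>N) \<le> ennreal (2 * v)"
    proof eventually_elim
      case (elim n)
      define h where "h = inverse (real (Suc n))"
      have "(\<integral>\<^sup>+x. ennreal ((2 - 2 * cos (h * y x)) / h\<^sup>2) \<partial>N)
        = (\<integral>\<^sup>+x. ennreal (2 / h\<^sup>2) * ennreal (1 - cos (h * y x)) \<partial>N)"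
        by (intro nn_integral_cong) (simp add: ennreal_mult'[symmetric] diff_divide_distrib right_diff_distrib)
      also have "\<dots> = ennreal (2 / h\<^sup>2) * ennreal (Q h)"
        by (subst nn_integral_cmult) (auto simp: Q)
      also have "\<dots> = ennreal (2 / h\<^sup>2 * Q h)" by (simp add: ennreal_mult'[symmetric])
      also have "\<dots> \<le> ennreal (2 * v)"
      proof (rule ennreal_leI)
        have "h > 0" by (simp add: h_def)
        moreover have "Q h \<le> h\<^sup>2 * v" using elim by (intro Qle) (simp add: h_def)
        ultimately show "2 / h\<^sup>2 * Q h \<le> 2 * v" by (simp add: field_simps)
      qed
      finally show ?case unfolding h_def .
    qed
  qed auto
  then show ?thesis unfolding v_def .
qed


section \<open>Fractional moments as integrals over frequencies\<close>

text \<open>By scaling the whole integral is a multiple of |y|^g. It is enough to keep z <= c =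
  1/|y|, where 1 - cos(z y) >= (z y)^2/4 and z^(1-g) is integrable at 0 because g < 2.\<close>

lemma nn_integral_one_minus_cos_powr_ge:
  fixes y :: real assumes g: "1 < g" "g < 2"
  shows "ennreal (1 / (4 * (2 - g)) * \<bar>y\<bar> powr g)
    \<le> (\<integral>\<^sup>+z. ennreal ((1 - cos (z * y)) * z powr (- 1 - g)) * indicator {0<..} z \<partial>lborel)"
proof (cases "y = 0")
  case False
  define c where "c = 1 / \<bar>y\<bar>"
  have c: "c > 0" using False by (simp add: c_def)
  have "((\<lambda>z. z powr (1 - g)) has_integral (c powr (2 - g) / (2 - g))) {0..c}"
    using has_integral_powr_from_0[of "1 - g" c] g c by simp
  then have hi: "((\<lambda>z. y\<^sup>2 / 4 * z powr (1 - g)) has_integral (y\<^sup>2 / 4 * (c powr (2 - g) / (2 - g)))) {0..c}"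
    by (rule has_integral_mult_right)
  have "c powr (2 - g) = \<bar>y\<bar> powr (g - 2)"
    using False by (simp add: c_def powr_divide powr_minus_divide[symmetric])
  moreover have "y\<^sup>2 = \<bar>y\<bar> powr 2" using False by simp
  ultimately have "y\<^sup>2 * c powr (2 - g) = \<bar>y\<bar> powr g"
    by (metis add.commute diff_add_cancel powr_add)
  then have "ennreal (1 / (4 * (2 - g)) * \<bar>y\<bar> powr g) = ennreal (y\<^sup>2 / 4 * (c powr (2 - g) / (2 - g)))"
    by (simp add: field_simps)
  also have "\<dots> = (\<integral>\<^sup>+z. ennreal (y\<^sup>2 / 4 * z powr (1 - g)) * indicator {0..c} z \<partial>lborel)"
    by (rule nn_integral_has_integral_lebesgue'[OF _ hi, symmetric]) simp
  also have "\<dots> \<le> (\<integral>\<^sup>+z. ennreal ((1 - cos (z * y)) * z powr (- 1 - g)) * indicator {0<..} z \<partial>lborel)"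
  proof (rule nn_integral_mono)
    fix z
    show "ennreal (y\<^sup>2 / 4 * z powr (1 - g)) * indicator {0..c} z
       \<le> ennreal ((1 - cos (z * y)) * z powr (- 1 - g)) * indicator {0<..} z"
    proof (cases "z \<in> {0<..c}")
      case True
      then have "\<bar>z * y\<bar> \<le> 1" using False by (simp add: c_def abs_mult field_simps)
      from one_minus_cos_ge[OF this]
      have "(z * y)\<^sup>2 / 4 * z powr (- 1 - g) \<le> (1 - cos (z * y)) * z powr (- 1 - g)"
        by (intro mult_right_mono) auto
      moreover have "z\<^sup>2 * z powr (-1 - g) = z powr (1 - g)"
        using True powr_add[of z 2 "-1 - g"] by simp
      ultimately have "y\<^sup>2 / 4 * z powr (1 - g) \<le> (1 - cos (z * y)) * z powr (- 1 - g)"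
        by (simp add: power_mult_distrib mult_ac)
      then show ?thesis using True by (auto intro: ennreal_leI)
    next
      case F: False
      \<comment> \<open>The point z = 0 lies in {0..c} but not in {0<..}; the left-hand side
        vanishes there since \<open>0 powr (1 - g)\<close> is 0.\<close>
      then show ?thesis by (cases "z = 0") (auto simp: indicator_def)
    qed
  qed
  finally show ?thesis .
qed simp

text \<open>The cut at c = 1/|y| balances two Taylor bounds: (z y)^2/2 below c, integrable against
  z^(-1-g) since g < 2, and 2|z y| above c, integrable since g > 1. Both pieces scale like |y|^g and
  give the two summands of the constant.\<close>

lemma nn_integral_norm_taylor1_powr_le:
  fixes y :: real assumes g: "1 < g" "g < 2"
  shows "(\<integral>\<^sup>+z. ennreal (cmod (iexp (z * y) - 1 - \<i> * complex_of_real (z * y)) * z powr (- 1 - g)) * indicator {0<..} z \<partial>lborel)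
     \<le> ennreal ((1 / (2 * (2 - g)) + 2 / (g - 1)) * \<bar>y\<bar> powr g)" (is "?L \<le> _")
proof (cases "y = 0")
  case False
  define c where "c = 1 / \<bar>y\<bar>"
  have c: "c > 0" using False by (simp add: c_def)
  have "((\<lambda>z. z powr (1 - g)) has_integral (c powr (2 - g) / (2 - g))) {0..c}"
    using has_integral_powr_from_0[of "1 - g" c] g c by simp
  then have hi1: "((\<lambda>z. y\<^sup>2 / 2 * z powr (1 - g)) has_integral (y\<^sup>2 / 2 * (c powr (2 - g) / (2 - g)))) {0..c}"
    by (rule has_integral_mult_right)
  have "((\<lambda>z. z powr - g) has_integral (c powr (1 - g) / (g - 1))) {c..}"
    using has_integral_powr_to_inf[of "- g" c] g c minus_divide_right[of "c powr (1 - g)" "1 - g"] by simp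
  then have hi2: "((\<lambda>z. 2 * \<bar>y\<bar> * z powr - g) has_integral (2 * \<bar>y\<bar> * (c powr (1 - g) / (g - 1)))) {c..}"
    by (rule has_integral_mult_right)
  have cp: "c powr (2 - g) = \<bar>y\<bar> powr (g - 2)" "c powr (1 - g) = \<bar>y\<bar> powr (g - 1)"
    using False by (simp_all add: c_def powr_divide powr_minus_divide[symmetric])
  have e1: "y\<^sup>2 * c powr (2 - g) = \<bar>y\<bar> powr g"
    using powr_add[of "\<bar>y\<bar>" 2 "g - 2"] False by (simp add: cp)
  have e2: "\<bar>y\<bar> * c powr (1 - g) = \<bar>y\<bar> powr g"
    using powr_add[of "\<bar>y\<bar>" 1 "g - 1"] False by (simp add: cp)
  have "?L \<le> (\<integral>\<^sup>+z. (ennreal (y\<^sup>2 / 2 * z powr (1 - g)) * indicator {0..c} z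
       + ennreal (2 * \<bar>y\<bar> * z powr - g) * indicator {c..} z) \<partial>lborel)"
  proof (rule nn_integral_mono)
    fix z
    show "ennreal (cmod (iexp (z * y) - 1 - \<i> * complex_of_real (z * y)) * z powr (- 1 - g)) * indicator {0<..} z
      \<le> ennreal (y\<^sup>2 / 2 * z powr (1 - g)) * indicator {0..c} z
       + ennreal (2 * \<bar>y\<bar> * z powr - g) * indicator {c..} z"
    proof (cases "z > 0")
      case z: True
      show ?thesis
      proof (cases "z \<le> c")
        case True
        have "cmod (iexp (z * y) - 1 - \<i> * complex_of_real (z * y)) * z powr (- 1 - g) \<le> (z * y)\<^sup>2 / 2 * z powr (- 1 - g)"
          using norm_iexp_taylor1_le[of "z * y"] by (intro mult_right_mono) auto
        moreover have "z\<^sup>2 * z powr (-1 - g) = z powr (1 - g)"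
          using z powr_add[of z 2 "-1 - g"] by simp
        ultimately have "cmod (iexp (z * y) - 1 - \<i> * complex_of_real (z * y)) * z powr (- 1 - g) \<le> y\<^sup>2 / 2 * z powr (1 - g)"
          by (simp add: power_mult_distrib mult_ac)
        then show ?thesis using z True by (auto intro!: ennreal_leI order_trans[OF _ add_increasing2])
      next
        case F: False
        have "cmod (iexp (z * y) - 1 - \<i> * complex_of_real (z * y)) * z powr (- 1 - g) \<le> (2 * \<bar>z * y\<bar>) * z powr (- 1 - g)"
          using norm_iexp_taylor1_le'[of "z * y"] by (intro mult_right_mono) auto
        moreover have "z * z powr (-1 - g) = z powr - g"
          using z powr_add[of z 1 "-1 - g"] by simp
        moreover have "(2 * \<bar>z * y\<bar>) * z powr (- 1 - g) = 2 * \<bar>y\<bar> * (z * z powr (- 1 - g))"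
          using z by (simp add: abs_mult)
        ultimately have "cmod (iexp (z * y) - 1 - \<i> * complex_of_real (z * y)) * z powr (- 1 - g) \<le> 2 * \<bar>y\<bar> * z powr - g"
          by (simp only:)
        then show ?thesis using z F by (auto intro!: ennreal_leI)
      qed
    qed auto
  qed
  also have "\<dots> = ennreal (y\<^sup>2 / 2 * (c powr (2 - g) / (2 - g))) + ennreal (2 * \<bar>y\<bar> * (c powr (1 - g) / (g - 1)))"
  proof -
    have I1: "(\<integral>\<^sup>+z. ennreal (y\<^sup>2 / 2 * z powr (1 - g)) * indicator {0..c} z \<partial>lborel) = ennreal (y\<^sup>2 / 2 * (c powr (2 - g) / (2 - g)))"
      by (rule nn_integral_has_integral_lebesgue'[OF _ hi1]) simp
    have I2: "(\<integral>\<^sup>+z. ennreal (2 * \<bar>y\<bar> * z powr - g) * indicator {c..} z \<partial>lborel) = ennreal (2 * \<bar>y\<bar> * (c powr (1 - g) / (g - 1)))"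
      by (rule nn_integral_has_integral_lebesgue'[OF _ hi2]) simp
    show ?thesis unfolding I1[symmetric] I2[symmetric] by (rule nn_integral_add) measurable
  qed
  also have "\<dots> = ennreal (y\<^sup>2 / 2 * (c powr (2 - g) / (2 - g)) + 2 * \<bar>y\<bar> * (c powr (1 - g) / (g - 1)))"
    using g by (subst ennreal_plus) auto
  also have "y\<^sup>2 / 2 * (c powr (2 - g) / (2 - g)) + 2 * \<bar>y\<bar> * (c powr (1 - g) / (g - 1))
     = (1 / (2 * (2 - g)) + 2 / (g - 1)) * \<bar>y\<bar> powr g"
    using e1 e2 g by (simp add: distrib_right)
  finally show ?thesis .
qed simp

text \<open>An inequality of von Bahr-Esseen type for infinitely divisible laws. The chain 1 - Re
  phi <= |exp psi - 1| <= |psi| is integrated against z^(-1-g), and Tonelli on either side reduces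
  it to the two scalar integrals computed before.\<close>

lemma (in prob_space) abs_moment_le_levy_moment:
  fixes Y :: "'a \<Rightarrow> real"
  assumes [measurable]: "Y \<in> borel_measurable M" "y \<in> borel_measurable N"
    and N: "sigma_finite_measure N"
    and int: "integrable N (\<lambda>x. (y x)\<^sup>2)"
    and char: "\<And>\<zeta>. char (distr M borel Y) \<zeta> = exp (levy_exponent N y \<zeta>)"
    and g: "1 < g" "g < 2"
  shows "ennreal (1 / (4 * (2 - g))) * (\<integral>\<^sup>+\<omega>. ennreal (\<bar>Y \<omega>\<bar> powr g) \<partial>M)
    \<le> ennreal (1 / (2 * (2 - g)) + 2 / (g - 1)) * (\<integral>\<^sup>+x. ennreal (\<bar>y x\<bar> powr g) \<partial>N)"
proof -
  interpret N: sigma_finite_measure N by fact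
  interpret LM: pair_sigma_finite lborel M ..
  interpret LN: pair_sigma_finite lborel N ..
  have "ennreal (1 / (4 * (2 - g))) * (\<integral>\<^sup>+\<omega>. ennreal (\<bar>Y \<omega>\<bar> powr g) \<partial>M)
     = (\<integral>\<^sup>+\<omega>. ennreal (1 / (4 * (2 - g)) * \<bar>Y \<omega>\<bar> powr g) \<partial>M)"
    using g by (subst nn_integral_cmult[symmetric]) (auto simp: ennreal_mult'[symmetric])
  also have "\<dots> \<le> (\<integral>\<^sup>+\<omega>. (\<integral>\<^sup>+z. ennreal ((1 - cos (z * Y \<omega>)) * z powr (- 1 - g)) * indicator {0<..} z \<partial>lborel) \<partial>M)"
    by (intro nn_integral_mono nn_integral_one_minus_cos_powr_ge g)
  also have "\<dots> = (\<integral>\<^sup>+z. (\<integral>\<^sup>+\<omega>. ennreal ((1 - cos (z * Y \<omega>)) * z powr (- 1 - g)) * indicator {0<..} z \<partial>M) \<partial>lborel)"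
    by (rule LM.Fubini') measurable
  also have "\<dots> \<le> (\<integral>\<^sup>+z. (\<integral>\<^sup>+x. ennreal (cmod (iexp (z * y x) - 1 - \<i> * complex_of_real (z * y x)) * z powr (- 1 - g)) * indicator {0<..} z \<partial>N) \<partial>lborel)"
  proof (rule nn_integral_mono)
    fix z :: real
    have "1 - Re (char (distr M borel Y) z) \<le> cmod (char (distr M borel Y) z - 1)"
      using abs_Re_le_cmod[of "char (distr M borel Y) z - 1"] by simp
    also have "\<dots> \<le> cmod (levy_exponent N y z)"
      unfolding char by (rule norm_exp_minus_1_le) (rule Re_levy_exponent(2), use int in auto)
    finally have "ennreal (1 - Re (char (distr M borel Y) z)) \<le> ennreal (cmod (levy_exponent N y z))"
      by (rule ennreal_leI)
    also have "\<dots> \<le> (\<integral>\<^sup>+x. ennreal (cmod (iexp (z * y x) - 1 - \<i> * complex_of_real (z * y x))) \<partial>N)"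
      unfolding levy_exponent_def
      by (rule integral_norm_bound_ennreal) (rule levy_exponent_integrable, use int in auto)
    finally have le: "(\<integral>\<^sup>+\<omega>. ennreal (1 - cos (z * Y \<omega>)) \<partial>M)
       \<le> (\<integral>\<^sup>+x. ennreal (cmod (iexp (z * y x) - 1 - \<i> * complex_of_real (z * y x))) \<partial>N)"
      by (simp add: one_minus_Re_char)
    have "(\<integral>\<^sup>+\<omega>. ennreal ((1 - cos (z * Y \<omega>)) * z powr (- 1 - g)) * indicator {0<..} z \<partial>M)
      = (\<integral>\<^sup>+\<omega>. ennreal (1 - cos (z * Y \<omega>)) \<partial>M) * (ennreal (z powr (- 1 - g)) * indicator {0<..} z)"
      by (subst nn_integral_multc[symmetric]) (auto simp: ennreal_mult'' mult_ac)
    also have "\<dots> \<le> (\<integral>\<^sup>+x. ennreal (cmod (iexp (z * y x) - 1 - \<i> * complex_of_real (z * y x))) \<partial>N) * (ennreal (z powr (- 1 - g)) * indicator {0<..} z)"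
      using le by (rule mult_right_mono) simp
    also have "\<dots> = (\<integral>\<^sup>+x. ennreal (cmod (iexp (z * y x) - 1 - \<i> * complex_of_real (z * y x)) * z powr (- 1 - g)) * indicator {0<..} z \<partial>N)"
      by (subst nn_integral_multc[symmetric]) (auto simp: ennreal_mult'' mult_ac)
    finally show "(\<integral>\<^sup>+\<omega>. ennreal ((1 - cos (z * Y \<omega>)) * z powr (- 1 - g)) * indicator {0<..} z \<partial>M)
      \<le> (\<integral>\<^sup>+x. ennreal (cmod (iexp (z * y x) - 1 - \<i> * complex_of_real (z * y x)) * z powr (- 1 - g)) * indicator {0<..} z \<partial>N)" .
  qed
  also have "\<dots> = (\<integral>\<^sup>+x. (\<integral>\<^sup>+z. ennreal (cmod (iexp (z * y x) - 1 - \<i> * complex_of_real (z * y x)) * z powr (- 1 - g)) * indicator {0<..} z \<partial>lborel) \<partial>N)"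
    by (rule LN.Fubini'[symmetric]) measurable
  also have "\<dots> \<le> (\<integral>\<^sup>+x. ennreal ((1 / (2 * (2 - g)) + 2 / (g - 1)) * \<bar>y x\<bar> powr g) \<partial>N)"
    by (intro nn_integral_mono nn_integral_norm_taylor1_powr_le g)
  also have "\<dots> = ennreal (1 / (2 * (2 - g)) + 2 / (g - 1)) * (\<integral>\<^sup>+x. ennreal (\<bar>y x\<bar> powr g) \<partial>N)"
    using g by (subst nn_integral_cmult[symmetric]) (auto simp: ennreal_mult' intro!: add_nonneg_nonneg)
  finally show ?thesis .
qed

text \<open>Because 1 - cos u <= 2 |u|^q for q <= 2 (quadratic near 0, at most 2 elsewhere), a
  characteristic function bounded away from 1 at frequency z forces a q-th moment of order at least
  z^(-q).\<close>

lemma (in prob_space) abs_moment_ge_char: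
  fixes Y :: "'a \<Rightarrow> real"
  assumes [measurable]: "Y \<in> borel_measurable M"
    and q: "0 < q" "q \<le> 2" and z: "z > 0" and int: "integrable M (\<lambda>\<omega>. \<bar>Y \<omega>\<bar> powr q)"
    and char: "cmod (char (distr M borel Y) z) \<le> exp (- c)"
  shows "(1 - exp (- c)) / (2 * z powr q) \<le> expectation (\<lambda>\<omega>. \<bar>Y \<omega>\<bar> powr q)"
proof -
  have pt: "1 - cos (z * u) \<le> 2 * z powr q * \<bar>u\<bar> powr q" for u
  proof (cases "\<bar>z * u\<bar> \<le> 1")
    case True
    have "1 - cos (z * u) \<le> \<bar>z * u\<bar> powr 2"
    proof (cases "z * u = 0")
      case False
      then have "\<bar>z * u\<bar> powr 2 = (z * u)\<^sup>2" by simp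
      then show ?thesis using cos_ge_quadratic[of "z * u"] zero_le_power2[of "z * u"] by linarith
    qed auto
    also have "\<dots> \<le> \<bar>z * u\<bar> powr q" using True q by (intro powr_mono') auto
    also have "\<dots> = z powr q * \<bar>u\<bar> powr q" using z by (simp add: abs_mult powr_mult)
    also have "\<dots> \<le> 2 * (z powr q * \<bar>u\<bar> powr q)" by simp
    finally show ?thesis by simp
  next
    case False
    have "1 - cos (z * u) \<le> 2" using cos_ge_minus_one[of "z * u"] by linarith
    also have "\<dots> \<le> 2 * \<bar>z * u\<bar> powr q" using False q by (simp add: ge_one_powr_ge_zero)
    also have "\<dots> = 2 * z powr q * \<bar>u\<bar> powr q" using z by (simp add: abs_mult powr_mult)
    finally show ?thesis .
  qed
  have "ennreal (1 - Re (char (distr M borel Y) z)) = (\<integral>\<^sup>+\<omega>. ennreal (1 - cos (z * Y \<omega>)) \<partial>M)"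
    by (simp add: one_minus_Re_char)
  also have "\<dots> \<le> (\<integral>\<^sup>+\<omega>. ennreal (2 * z powr q * \<bar>Y \<omega>\<bar> powr q) \<partial>M)"
    by (intro nn_integral_mono ennreal_leI pt)
  also have "\<dots> = ennreal (2 * z powr q * expectation (\<lambda>\<omega>. \<bar>Y \<omega>\<bar> powr q))"
    using int by (subst nn_integral_eq_integral) auto
  finally have "1 - Re (char (distr M borel Y) z) \<le> 2 * z powr q * expectation (\<lambda>\<omega>. \<bar>Y \<omega>\<bar> powr q)"
    by (subst (asm) ennreal_le_iff) (auto intro!: mult_nonneg_nonneg integral_nonneg_AE)
  moreover have "Re (char (distr M borel Y) z) \<le> exp (- c)"
    using complex_Re_le_cmod[of "char (distr M borel Y) z"] char by linarith
  ultimately show ?thesis using z by (simp add: field_simps)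
qed

section \<open>Moments and analyticity of the characteristic function\<close>

text \<open>Its k-th iterate stands in for the 2k-th derivative. On iexp(x Y) it acts as
  multiplication by 2 cos(h Y) - 2, so the expectation never has to be differentiated.\<close>

definition sdiff :: "complex \<Rightarrow> (complex \<Rightarrow> complex) \<Rightarrow> complex \<Rightarrow> complex" where
  "sdiff h f z = f (z + h) + f (z - h) - 2 * f z"

text \<open>Cauchy's inequality on discs of radius \<rho>/2 bounds the second derivative by 8
  B/\<rho>^2 on the ball of radius s + \<rho>, which contains z, z + h and z - h. Adding the two
  first-order Taylor expansions cancels the linear terms. The bound is linear in B and hence ready
  for iteration.\<close>

lemma norm_sdiff_le:
  assumes hol: "H holomorphic_on ball 0 r" and B: "\<And>z. z \<in> ball 0 r \<Longrightarrow> cmod (H z) \<le> B"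
    and r: "0 < \<rho>" "s + 2 * \<rho> \<le> r" and h: "cmod h < \<rho>" and z: "z \<in> ball 0 s"
  shows "cmod (sdiff h H z) \<le> 16 / \<rho>\<^sup>2 * B * cmod h ^ 2"
proof -
  let ?S = "ball (0::complex) (s + \<rho>)"
  have H'': "cmod ((deriv ^^ 2) H w) \<le> 8 * B / \<rho>\<^sup>2" if "w \<in> ?S" for w
  proof -
    have sub: "cball w (\<rho>/2) \<subseteq> ball 0 r"
    proof
      fix u assume "u \<in> cball w (\<rho>/2)"
      then have "cmod u \<le> cmod w + \<rho>/2" using norm_triangle_sub[of u w] by (simp add: dist_norm norm_minus_commute)
      then show "u \<in> ball 0 r" using that r by simp
    qed
    have "cmod ((deriv ^^ 2) H w) \<le> fact 2 * B / (\<rho>/2)^2"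
    proof (rule Cauchy_inequality)
      show "H holomorphic_on ball w (\<rho>/2)" using hol sub ball_subset_cball holomorphic_on_subset by blast
      show "continuous_on (cball w (\<rho>/2)) H"
        using holomorphic_on_imp_continuous_on[OF hol] sub continuous_on_subset by blast
      show "cmod (H u) \<le> B" if "cmod (w - u) = \<rho>/2" for u
        using that sub by (intro B) (auto simp: dist_norm)
    qed (use r in auto)
    then show ?thesis by (simp add: field_simps)
  qed
  have T: "cmod (H u - (H z + deriv H z * (u - z))) \<le> 8 * B / \<rho>\<^sup>2 * cmod (u - z)^2" if "u \<in> ?S" for u
  proof -
    have "cmod ((deriv ^^ 0) H u - (\<Sum>i\<le>1. (deriv ^^ i) H z * (u - z) ^ i / fact i)) \<le> 8 * B / \<rho>\<^sup>2 * cmod (u - z) ^ Suc 1 / fact 1"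
    proof (rule complex_Taylor)
      show "((deriv ^^ i) H has_field_derivative (deriv ^^ Suc i) H x) (at x within ?S)" if "x \<in> ?S" for i x
        using that r holomorphic_derivI[OF holomorphic_higher_deriv[OF hol, of i], of x]
        by (auto intro: has_field_derivative_at_within)
      show "cmod ((deriv ^^ Suc 1) H x) \<le> 8 * B / \<rho>\<^sup>2" if "x \<in> ?S" for x
        using H''[OF that] by (simp add: numeral_2_eq_2)
    qed (use that z r in auto)
    then show ?thesis by (simp add: power2_eq_square)
  qed
  have "z + h \<in> ?S" "z - h \<in> ?S"
    using z h norm_triangle_ineq[of z h] norm_triangle_ineq4[of z h] by auto
  from T[OF this(1)] T[OF this(2)]
  have "cmod (H (z + h) - (H z + deriv H z * h)) \<le> 8 * B / \<rho>\<^sup>2 * cmod h ^ 2"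
    "cmod (H (z - h) - (H z - deriv H z * h)) \<le> 8 * B / \<rho>\<^sup>2 * cmod h ^ 2" by simp_all
  moreover have "sdiff h H z = (H (z + h) - (H z + deriv H z * h)) + (H (z - h) - (H z - deriv H z * h))"
    by (simp add: sdiff_def)
  ultimately show ?thesis
    using norm_triangle_ineq[of "H (z + h) - (H z + deriv H z * h)" "H (z - h) - (H z - deriv H z * h)"] by simp
qed

text \<open>C and \<delta> are chosen before H, B and h because the induction hypothesis is applied
  to \<open>sdiff h H\<close>, which itself depends on h. The radius r is generalised since every
  difference uses up part of the disc.\<close>

lemma norm_sdiff_funpow_le:
  assumes "s < r"
  shows "\<exists>C\<ge>0. \<exists>\<delta>>0. \<forall>H B h. H holomorphic_on ball 0 r \<longrightarrow> (\<forall>z\<in>ball 0 r. cmod (H z) \<le> B) \<longrightarrow> cmod h < \<delta> \<longrightarrow>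
     (\<forall>z\<in>ball 0 s. cmod ((sdiff h ^^ k) H z) \<le> C * B * cmod h ^ (2*k))"
  using assms
proof (induction k arbitrary: r)
  case 0
  then show ?case by (intro exI[of _ 1]) (auto intro!: exI[of _ 1])
next
  case (Suc k)
  \<comment> \<open>A quarter of the margin: r' = s + \<rho> still leaves the 2\<rho> that
    \<open>norm_sdiff_le\<close> consumes.\<close>
  define \<rho> where "\<rho> = (r - s) / 4"
  have \<rho>: "\<rho> > 0" using Suc.prems by (simp add: \<rho>_def)
  define r' where "r' = s + \<rho>"
  have r': "s < r'" "r' + 2 * \<rho> \<le> r" "r' + \<rho> \<le> r" using Suc.prems by (simp_all add: r'_def \<rho>_def field_simps)
  obtain C \<delta> where C: "C \<ge> 0" and \<delta>: "\<delta> > 0"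
    and IH: "\<And>H B h z. H holomorphic_on ball 0 r' \<Longrightarrow> (\<forall>z\<in>ball 0 r'. cmod (H z) \<le> B) \<Longrightarrow> cmod h < \<delta> \<Longrightarrow>
       z\<in>ball 0 s \<Longrightarrow> cmod ((sdiff h ^^ k) H z) \<le> C * B * cmod h ^ (2*k)"
    using Suc.IH[OF r'(1)] by blast
  have main: "\<forall>H B h. H holomorphic_on ball 0 r \<longrightarrow> (\<forall>z\<in>ball 0 r. cmod (H z) \<le> B) \<longrightarrow> cmod h < min \<delta> \<rho> \<longrightarrow>
     (\<forall>z\<in>ball 0 s. cmod ((sdiff h ^^ Suc k) H z) \<le> C * (16 / \<rho>\<^sup>2) * B * cmod h ^ (2 * Suc k))"
  proof (intro allI impI ballI)
    fix H B h z
    assume hol: "H holomorphic_on ball 0 r" and B: "\<forall>z\<in>ball 0 r. cmod (H z) \<le> B"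
      and h: "cmod h < min \<delta> \<rho>" and z: "z \<in> ball (0::complex) s"
    have shift: "(\<lambda>z. H (z + w)) holomorphic_on ball 0 r'" if "cmod w < \<rho>" for w
    proof -
      have "(H \<circ> (\<lambda>z. z + w)) holomorphic_on ball 0 r'"
      proof (rule holomorphic_on_compose_gen[OF _ hol])
        show "(\<lambda>z. z + w) ` ball 0 r' \<subseteq> ball 0 r"
        proof
          fix u assume "u \<in> (\<lambda>z. z + w) ` ball 0 r'"
          then obtain v where "u = v + w" "cmod v < r'" by auto
          then show "u \<in> ball 0 r" using that r' norm_triangle_ineq[of v w] by simp
        qed
      qed (intro holomorphic_intros)
      then show ?thesis by (simp add: o_def)
    qed
    have "(\<lambda>z. H (z + h) + H (z + (- h)) - 2 * H (z + 0)) holomorphic_on ball 0 r'"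
      using h \<rho> by (intro holomorphic_intros shift) auto
    then have "sdiff h H holomorphic_on ball 0 r'" unfolding sdiff_def by simp
    moreover have "\<forall>z\<in>ball 0 r'. cmod (sdiff h H z) \<le> 16 / \<rho>\<^sup>2 * B * cmod h ^ 2"
      using B h r' \<rho> by (intro ballI norm_sdiff_le[OF hol]) auto
    ultimately have "cmod ((sdiff h ^^ k) (sdiff h H) z) \<le> C * (16 / \<rho>\<^sup>2 * B * cmod h ^ 2) * cmod h ^ (2*k)"
      using h z by (intro IH) auto
    then show "cmod ((sdiff h ^^ Suc k) H z) \<le> C * (16 / \<rho>\<^sup>2) * B * cmod h ^ (2 * Suc k)"
      by (simp add: funpow_Suc_right power_add power2_eq_square mult_ac del: funpow.simps)
  qed
  have "0 \<le> C * (16 / \<rho>\<^sup>2)" "0 < min \<delta> \<rho>" using C \<delta> \<rho> by auto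
  with main show ?case by blast
qed

text \<open>At real points with a real step the differences see only real arguments, so agreement of
  G with the characteristic function on (-d, d) is enough; the condition on x, k and h keeps all
  shifted points inside. Each difference multiplies the integrand by iexp(h Y) + iexp(-h Y) - 2 = 2
  cos(h Y) - 2.\<close>

lemma (in prob_space) sdiff_funpow_char:
  fixes Y :: "'a \<Rightarrow> real"
  assumes [measurable]: "Y \<in> borel_measurable M"
    and G: "\<And>u. \<bar>u\<bar> < d \<Longrightarrow> G (complex_of_real u) = char (distr M borel Y) u"
  shows "\<bar>x\<bar> + real k * \<bar>h\<bar> < d \<Longrightarrow> (sdiff (complex_of_real h) ^^ k) G (complex_of_real x)
    = (CLINT \<omega>|M. iexp (x * Y \<omega>) * complex_of_real ((2 * cos (h * Y \<omega>) - 2) ^ k))"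
proof (induction k arbitrary: x)
  case 0
  then show ?case by (simp add: G char_def integral_distr)
next
  case (Suc k)
  define J where "J x = (CLINT \<omega>|M. iexp (x * Y \<omega>) * complex_of_real ((2 * cos (h * Y \<omega>) - 2) ^ k))" for x
  have le: "\<bar>(2 * cos (h * Y \<omega>) - 2) ^ k\<bar> \<le> 4 ^ k" for \<omega>
  proof -
    have "\<bar>2 * cos (h * Y \<omega>) - 2\<bar> \<le> 4" using cos_ge_minus_one[of "h * Y \<omega>"] cos_le_one[of "h * Y \<omega>"] by arith
    then show ?thesis unfolding power_abs by (intro power_mono) auto
  qed
  have int: "integrable M (\<lambda>\<omega>. iexp (x * Y \<omega>) * complex_of_real ((2 * cos (h * Y \<omega>) - 2) ^ k))" for x
  proof (rule integrable_const_bound[of _ "4 ^ k"])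
    show "AE \<omega> in M. cmod (iexp (x * Y \<omega>) * complex_of_real ((2 * cos (h * Y \<omega>) - 2) ^ k)) \<le> 4 ^ k"
      by (intro always_eventually allI) (simp only: norm_mult norm_exp_i_times norm_of_real mult_1 le)
  qed simp
  have b: "\<bar>x\<bar> + \<bar>h\<bar> + real k * \<bar>h\<bar> < d" using Suc.prems by (simp add: algebra_simps)
  have IH: "(sdiff (complex_of_real h) ^^ k) G (complex_of_real y) = J y" if "\<bar>y\<bar> \<le> \<bar>x\<bar> + \<bar>h\<bar>" for y
    unfolding J_def using that b by (intro Suc.IH) linarith
  have "(sdiff (complex_of_real h) ^^ Suc k) G (complex_of_real x) = J (x + h) + J (x - h) - 2 * J x"
    using IH[of "x + h"] IH[of "x - h"] IH[of x] by (simp add: sdiff_def)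
  also have "\<dots> = (CLINT \<omega>|M. iexp ((x + h) * Y \<omega>) * complex_of_real ((2 * cos (h * Y \<omega>) - 2) ^ k)
     + iexp ((x - h) * Y \<omega>) * complex_of_real ((2 * cos (h * Y \<omega>) - 2) ^ k)
     - 2 * (iexp (x * Y \<omega>) * complex_of_real ((2 * cos (h * Y \<omega>) - 2) ^ k)))"
    unfolding J_def
    by (subst Bochner_Integration.integral_diff Bochner_Integration.integral_add integral_mult_right_zero[symmetric];
      (intro int Bochner_Integration.integrable_add integrable_mult_right)?)+ (rule refl)
  also have "\<dots> = (CLINT \<omega>|M. iexp (x * Y \<omega>) * complex_of_real ((2 * cos (h * Y \<omega>) - 2) ^ Suc k))"
  proof (rule Bochner_Integration.integral_cong[OF refl])
    fix \<omega>
    have "iexp ((x + h) * Y \<omega>) = iexp (x * Y \<omega>) * iexp (h * Y \<omega>)" "iexp ((x - h) * Y \<omega>) = iexp (x * Y \<omega>) * iexp (- (h * Y \<omega>))"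
      by (simp_all add: exp_add[symmetric] algebra_simps)
    note e = this
    have "iexp (h * Y \<omega>) + iexp (- (h * Y \<omega>)) - 2 = complex_of_real (2 * cos (h * Y \<omega>) - 2)"
      by (simp add: complex_eq_iff Re_exp Im_exp)
    then have c: "iexp (h * Y \<omega>) + iexp (- (h * Y \<omega>)) = 2 + complex_of_real (2 * cos (h * Y \<omega>) - 2)"
      by (simp only: diff_eq_eq add.commute)
    have gen: "A * B * P + A * C * P - 2 * (A * P) = A * (c * P)" if "B + C = 2 + c" for A B C P c :: complex
    proof -
      have "A * B * P + A * C * P - 2 * (A * P) = A * (B + C) * P - 2 * (A * P)" by (simp add: distrib_left distrib_right)
      then show ?thesis unfolding that by (simp add: distrib_left distrib_right)
    qed
    have K: "complex_of_real ((2 * cos (h * Y \<omega>) - 2) ^ Suc k) = complex_of_real (2 * cos (h * Y \<omega>) - 2) * complex_of_real ((2 * cos (h * Y \<omega>) - 2) ^ k)"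
      by (simp only: power_Suc of_real_mult)
    show "iexp ((x + h) * Y \<omega>) * complex_of_real ((2 * cos (h * Y \<omega>) - 2) ^ k)
     + iexp ((x - h) * Y \<omega>) * complex_of_real ((2 * cos (h * Y \<omega>) - 2) ^ k)
     - 2 * (iexp (x * Y \<omega>) * complex_of_real ((2 * cos (h * Y \<omega>) - 2) ^ k))
     = iexp (x * Y \<omega>) * complex_of_real ((2 * cos (h * Y \<omega>) - 2) ^ Suc k)"
      unfolding e K by (rule gen[OF c])
  qed
  finally show ?case .
qed

text \<open>exp(g) is a holomorphic continuation of the characteristic function, where g continues
  the cumulant function. Its k-th iterated difference at 0 equals (-1)^k E(2 - 2 cos(h Y))^k and is
  O(h^(2k)) by Cauchy's inequality; Fatou then bounds E Y^(2k).\<close>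

lemma (in prob_space) even_moments_finite_of_analytic:
  fixes Y :: "'a \<Rightarrow> real"
  assumes [measurable]: "Y \<in> borel_measurable M"
    and cum: "has_cumulant_function (distr M borel Y) \<kappa>" and an: "analytic_near_zero \<kappa>"
  shows "(\<integral>\<^sup>+\<omega>. ennreal (Y \<omega> ^ (2 * k)) \<partial>M) < \<infinity>"
proof -
  obtain g where "g analytic_on {0}" and "\<forall>\<^sub>F \<zeta> in nhds 0. \<kappa> \<zeta> = g (complex_of_real \<zeta>)"
    using an unfolding analytic_near_zero_def by blast
  then obtain r0 d0 where r0: "r0 > 0" "g holomorphic_on ball 0 r0"
    and d0: "d0 > 0" "\<And>u. \<bar>u\<bar> < d0 \<Longrightarrow> \<kappa> u = g (complex_of_real u)"
    unfolding analytic_on_def eventually_nhds_metric by (auto simp: dist_norm)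
  \<comment> \<open>Half the radius, so that \<open>cball 0 r\<close> is a compact part of the
    domain and exp(g) is bounded on it.\<close>
  define r where "r = r0 / 2"
  have hol: "(\<lambda>z. exp (g z)) holomorphic_on ball 0 r0" using r0(2) by (intro holomorphic_intros)
  have "compact ((\<lambda>z. exp (g z)) ` cball 0 r)"
    using r0 by (intro compact_continuous_image continuous_on_subset[OF holomorphic_on_imp_continuous_on[OF hol]])
      (auto simp: r_def)
  then obtain B where B: "\<And>z. z \<in> cball 0 r \<Longrightarrow> cmod (exp (g z)) \<le> B"
    by (meson compact_imp_bounded bounded_iff imageI)
  have hol': "(\<lambda>z. exp (g z)) holomorphic_on ball 0 r"
    using hol by (rule holomorphic_on_subset) (use r0 in \<open>auto simp: r_def\<close>)
  have "r / 2 < r" using r0 by (simp add: r_def)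
  from norm_sdiff_funpow_le[OF this, of k]
  obtain C \<delta> where "\<delta> > 0" and *: "\<And>H B h. H holomorphic_on ball 0 r \<Longrightarrow> (\<forall>z\<in>ball 0 r. cmod (H z) \<le> B) \<Longrightarrow> cmod h < \<delta> \<Longrightarrow>
     (\<forall>z\<in>ball 0 (r/2). cmod ((sdiff h ^^ k) H z) \<le> C * B * cmod h ^ (2*k))" by blast
  have G: "exp (g (complex_of_real u)) = char (distr M borel Y) u" if "\<bar>u\<bar> < d0" for u
    using cum d0(2)[OF that] unfolding has_cumulant_function_def by simp
  have main: "(\<integral>\<^sup>+\<omega>. ennreal (((2 - 2 * cos (h * Y \<omega>)) / h\<^sup>2) ^ k) \<partial>M) \<le> ennreal (C * B)"
    if h: "h > 0" "h < \<delta>" "real k * h < d0" for h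
  proof -
    have nonneg: "0 \<le> 2 - 2 * cos (h * y)" for y using cos_le_one[of "h * y"] by linarith
    have le4: "(2 - 2 * cos (h * y)) ^ k \<le> 4 ^ k" for y
      using cos_ge_minus_one[of "h * y"] nonneg[of y] by (intro power_mono) linarith+
    have int: "integrable M (\<lambda>\<omega>. (2 - 2 * cos (h * Y \<omega>)) ^ k)"
      by (rule integrable_const_bound[of _ "4 ^ k"]) (use le4 nonneg in \<open>auto intro!: always_eventually\<close>)
    have "(sdiff (complex_of_real h) ^^ k) (\<lambda>z. exp (g z)) (complex_of_real 0)
        = (CLINT \<omega>|M. iexp (0 * Y \<omega>) * complex_of_real ((2 * cos (h * Y \<omega>) - 2) ^ k))"
      using h by (intro sdiff_funpow_char[where d = d0] G) auto
    also have "\<dots> = (CLINT \<omega>|M. complex_of_real ((-1) ^ k * (2 - 2 * cos (h * Y \<omega>)) ^ k))"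
      by (simp add: power_mult_distrib[symmetric])
    also have "\<dots> = complex_of_real ((-1) ^ k * (LINT \<omega>|M. (2 - 2 * cos (h * Y \<omega>)) ^ k))"
      by (subst integral_complex_of_real) simp
    finally have "\<bar>LINT \<omega>|M. (2 - 2 * cos (h * Y \<omega>)) ^ k\<bar>
       = cmod ((sdiff (complex_of_real h) ^^ k) (\<lambda>z. exp (g z)) 0)"
      by (simp add: abs_mult power_abs del: of_real_mult)
    also have "\<dots> \<le> C * B * h ^ (2 * k)"
      using *[OF hol', of B "complex_of_real h"] B h r0 by (auto simp: r_def)
    finally have le: "(LINT \<omega>|M. (2 - 2 * cos (h * Y \<omega>)) ^ k) \<le> C * B * h ^ (2 * k)" by linarith
    have "(\<integral>\<^sup>+\<omega>. ennreal (((2 - 2 * cos (h * Y \<omega>)) / h\<^sup>2) ^ k) \<partial>M)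
       = ennreal (LINT \<omega>|M. (2 - 2 * cos (h * Y \<omega>)) ^ k / h ^ (2 * k))"
      using int nonneg h by (subst nn_integral_eq_integral[symmetric]) (auto simp: power_divide power_mult)
    also have "(LINT \<omega>|M. (2 - 2 * cos (h * Y \<omega>)) ^ k / h ^ (2 * k)) = (LINT \<omega>|M. (2 - 2 * cos (h * Y \<omega>)) ^ k) / h ^ (2 * k)"
      by simp
    also have "ennreal \<dots> \<le> ennreal (C * B)"
      using le h by (intro ennreal_leI) (simp add: field_simps)
    finally show ?thesis .
  qed
  have "(\<integral>\<^sup>+\<omega>. ennreal (Y \<omega> ^ (2 * k)) \<partial>M) \<le> ennreal (C * B)"
  proof (rule nn_integral_even_power_le_Fatou[where h = "\<lambda>n. inverse (real (Suc n))"])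
    show lim: "(\<lambda>n. inverse (real (Suc n))) \<longlonglongrightarrow> 0" by (rule LIMSEQ_inverse_real_of_nat)
    have "(\<lambda>n. real k * inverse (real (Suc n))) \<longlonglongrightarrow> real k * 0" by (intro tendsto_intros lim)
    then have "\<forall>\<^sub>F n in sequentially. real k * inverse (real (Suc n)) < d0"
      by (rule order_tendstoD) (use d0 in simp)
    moreover have "\<forall>\<^sub>F n in sequentially. inverse (real (Suc n)) < \<delta>"
      by (rule order_tendstoD[OF lim]) fact
    ultimately show "\<forall>\<^sub>F n in sequentially. (\<integral>\<^sup>+\<omega>. ennreal (((2 - 2 * cos (inverse (real (Suc n)) * Y \<omega>)) / (inverse (real (Suc n)))\<^sup>2) ^ k) \<partial>M) \<le> ennreal (C * B)"
      by eventually_elim (rule main, auto)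
  qed auto
  then show ?thesis using ennreal_less_top le_less_trans by (metis infinity_ennreal_def)
qed

section \<open>Regular variation of the rate distribution\<close>

text \<open>Slow variation is applied at the ratio 2, since 1/(x/2) = 2 (1/x); the power
  x^(\<alpha>-1) contributes the factor 2^(1-\<alpha>).\<close>

lemma density_ratio_tendsto:
  fixes p l :: "real \<Rightarrow> real"
  assumes alpha: "0 < \<alpha>" and sv: "slowly_varying l"
    and asymp: "p \<sim>[at_right 0] (\<lambda>x. \<alpha> * l (1 / x) * x powr (\<alpha> - 1))"
  shows "((\<lambda>x. p (x / 2) / p x) \<longlongrightarrow> 2 powr (1 - \<alpha>)) (at_right 0)"
    and "\<forall>\<^sub>F x in at_right 0. 0 < p x"
proof -
  define g where "g x = \<alpha> * l (1 / x) * x powr (\<alpha> - 1)" for x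
  obtain x0 where l0: "\<And>x. x \<ge> x0 \<Longrightarrow> 0 < l x" and ll: "((\<lambda>x. l (2 * x) / l x) \<longlongrightarrow> 1) at_top"
    using sv unfolding slowly_varying_def by (meson zero_less_numeral)
  have inv: "filterlim (\<lambda>x::real. 1 / x) at_top (at_right 0)"
    using filterlim_inverse_at_top_right by (simp add: inverse_eq_divide)
  have half: "filterlim (\<lambda>x::real. x / 2) (at_right 0) (at_right 0)"
    by (auto simp: filterlim_at eventually_at_filter intro!: tendsto_eq_intros always_eventually)
  have gpos: "\<forall>\<^sub>F x in at_right 0. 0 < g x"
  proof -
    have "\<forall>\<^sub>F x in at_right 0. x0 \<le> 1 / x" using inv by (simp add: filterlim_at_top)
    moreover have "\<forall>\<^sub>F x::real in at_right 0. 0 < x" by (simp add: eventually_at_filter)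
    ultimately show ?thesis
      by eventually_elim (use alpha l0 in \<open>auto simp: g_def intro!: mult_pos_pos\<close>)
  qed
  have pg: "((\<lambda>x. p x / g x) \<longlongrightarrow> 1) (at_right 0)"
  proof -
    \<comment> \<open>Asymptotic equivalence counts 0/0 as 1; eventual positivity of g removes this
      case.\<close>
    have "((\<lambda>x. if p x = 0 \<and> g x = 0 then 1 else p x / g x) \<longlongrightarrow> 1) (at_right 0)"
      using asymp unfolding asymp_equiv_def g_def .
    then show ?thesis
      by (rule Lim_transform_eventually) (use gpos in eventually_elim, auto)
  qed
  have pg': "((\<lambda>x. p (x / 2) / g (x / 2)) \<longlongrightarrow> 1) (at_right 0)"
    using filterlim_compose[OF pg half] .
  have gp: "((\<lambda>x. g x / p x) \<longlongrightarrow> 1) (at_right 0)"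
    using tendsto_inverse[OF pg] by simp
  show pos: "\<forall>\<^sub>F x in at_right 0. 0 < p x"
    using order_tendstoD(1)[OF pg zero_less_one] gpos by eventually_elim (simp add: zero_less_divide_iff)
  have gpos': "\<forall>\<^sub>F x in at_right 0. 0 < g (x / 2)"
    using filterlim_iff[THEN iffD1, OF half, rule_format, OF gpos] .
  have "((\<lambda>x. l (2 * (1 / x)) / l (1 / x)) \<longlongrightarrow> 1) (at_right 0)"
    using filterlim_compose[OF ll inv] .
  then have "((\<lambda>x. l (2 * (1 / x)) / l (1 / x) * 2 powr (1 - \<alpha>)) \<longlongrightarrow> 1 * 2 powr (1 - \<alpha>)) (at_right 0)"
    by (intro tendsto_intros)
  moreover have "\<forall>\<^sub>F x in at_right 0. l (2 * (1 / x)) / l (1 / x) * 2 powr (1 - \<alpha>) = g (x / 2) / g x"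
  proof -
    have "\<forall>\<^sub>F x::real in at_right 0. 0 < x" by (simp add: eventually_at_filter)
    then show ?thesis
    proof eventually_elim
      case (elim x)
      have "(x / 2) powr (\<alpha> - 1) = x powr (\<alpha> - 1) * 2 powr (1 - \<alpha>)"
        using elim by (simp add: powr_divide powr_diff field_simps)
      then show ?case using alpha elim by (simp add: g_def field_simps)
    qed
  qed
  ultimately have gg: "((\<lambda>x. g (x / 2) / g x) \<longlongrightarrow> 1 * 2 powr (1 - \<alpha>)) (at_right 0)"
    by (rule Lim_transform_eventually)
  have "((\<lambda>x. p (x / 2) / g (x / 2) * (g (x / 2) / g x) * (g x / p x)) \<longlongrightarrow> 1 * (1 * 2 powr (1 - \<alpha>)) * 1) (at_right 0)"
    by (intro tendsto_mult pg' gg gp)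
  moreover have "\<forall>\<^sub>F x in at_right 0. p (x / 2) / g (x / 2) * (g (x / 2) / g x) * (g x / p x) = p (x / 2) / p x"
    using gpos gpos' by eventually_elim simp
  ultimately have "((\<lambda>x. p (x / 2) / p x) \<longlongrightarrow> 1 * (1 * 2 powr (1 - \<alpha>)) * 1) (at_right 0)"
    by (rule Lim_transform_eventually)
  then show "((\<lambda>x. p (x / 2) / p x) \<longlongrightarrow> 2 powr (1 - \<alpha>)) (at_right 0)" by simp
qed

text \<open>Takes the place of Potter bounds: with the ratio controlled on all of (0, x0], halving
  can be iterated down to 0.\<close>

lemma density_ratio_bounds:
  fixes p l :: "real \<Rightarrow> real"
  assumes "0 < \<alpha>" "slowly_varying l"
    and "p \<sim>[at_right 0] (\<lambda>x. \<alpha> * l (1 / x) * x powr (\<alpha> - 1))"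
    and r: "r1 < 2 powr (1 - \<alpha>)" "2 powr (1 - \<alpha>) < r2"
  obtains x0 where "x0 > 0" "\<And>x. 0 < x \<Longrightarrow> x \<le> x0 \<Longrightarrow> 0 < p x \<and> r1 * p x \<le> p (x / 2) \<and> p (x / 2) \<le> r2 * p x"
proof -
  note D = density_ratio_tendsto[OF assms(1-3)]
  have "\<forall>\<^sub>F x in at_right 0. 0 < p x \<and> r1 * p x \<le> p (x / 2) \<and> p (x / 2) \<le> r2 * p x"
    using D(2) order_tendstoD(1)[OF D(1) r(1)] order_tendstoD(2)[OF D(1) r(2)]
    by eventually_elim (auto simp: field_simps)
  then obtain b where "b > 0" "\<And>x. 0 < x \<Longrightarrow> x < b \<Longrightarrow> 0 < p x \<and> r1 * p x \<le> p (x / 2) \<and> p (x / 2) \<le> r2 * p x"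
    unfolding eventually_at_right_field by blast
  then show ?thesis by (intro that[of "b / 2"]) auto
qed

lemma nn_integral_density_halfline:
  fixes p :: "real \<Rightarrow> real" and f :: "real \<Rightarrow> ennreal"
  assumes p: "p \<in> borel_measurable (restrict_space lborel {0<..})"
    and \<pi>: "\<pi> = density (restrict_space lborel {0<..}) (\<lambda>x. ennreal (p x))"
    and f: "f \<in> borel_measurable borel"
  shows "(\<integral>\<^sup>+x. f x \<partial>\<pi>) = (\<integral>\<^sup>+x. f x * ennreal (p x * indicator {0<..} x) \<partial>lborel)"
proof -
  have "(\<integral>\<^sup>+x. f x \<partial>\<pi>) = (\<integral>\<^sup>+x. ennreal (p x) * f x \<partial>restrict_space lborel {0<..})"
    unfolding \<pi>
  proof (rule nn_integral_density)
    show "(\<lambda>x. ennreal (p x)) \<in> borel_measurable (restrict_space lborel {0<..})" using p by measurable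
    show "f \<in> borel_measurable (restrict_space lborel {0<..})" using f by (intro measurable_restrict_space1) simp
  qed
  also have "\<dots> = (\<integral>\<^sup>+x. f x * ennreal (p x * indicator {0<..} x) \<partial>lborel)"
    by (subst nn_integral_restrict_space) (auto intro!: nn_integral_cong simp: indicator_def mult.commute)
  finally show ?thesis .
qed

lemma borel_measurable_density_halfline:
  fixes p :: "real \<Rightarrow> real"
  assumes p: "p \<in> borel_measurable (restrict_space lborel {0<..})"
  shows "(\<lambda>x. p x * indicator {0<..} x) \<in> borel_measurable borel"
proof -
  have "(\<lambda>x. indicator {0<..} x *\<^sub>R p x) \<in> borel_measurable lborel"
    using p by (subst (asm) borel_measurable_restrict_space_iff) auto
  then show ?thesis by (simp add: mult.commute)
qed

lemma nn_integral_halved_interval: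
  fixes p :: "real \<Rightarrow> real" and w :: "real \<Rightarrow> ennreal"
  assumes p: "p \<in> borel_measurable (restrict_space lborel {0<..})"
    and \<pi>: "\<pi> = density (restrict_space lborel {0<..}) (\<lambda>x. ennreal (p x))"
    and w[measurable]: "w \<in> borel_measurable borel"
  shows "(\<integral>\<^sup>+x. w x * indicator {a/2<..b/2} x \<partial>\<pi>)
    = ennreal (1/2) * (\<integral>\<^sup>+x. w (x / 2) * indicator {a<..b} x * ennreal (p (x / 2) * indicator {0<..} x) \<partial>lborel)"
proof -
  note [measurable] = borel_measurable_density_halfline[OF p]
  have "(\<integral>\<^sup>+x. w x * indicator {a/2<..b/2} x \<partial>\<pi>)
    = (\<integral>\<^sup>+x. w x * indicator {a/2<..b/2} x * ennreal (p x * indicator {0<..} x) \<partial>lborel)"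
    by (rule nn_integral_density_halfline[OF p \<pi>]) simp
  also have "\<dots> = ennreal \<bar>1/2\<bar> * (\<integral>\<^sup>+x. w (0 + 1/2 * x) * indicator {a/2<..b/2} (0 + 1/2 * x) * ennreal (p (0 + 1/2 * x) * indicator {0<..} (0 + 1/2 * x)) \<partial>lborel)"
    by (rule nn_integral_real_affine) auto
  finally show ?thesis
    by (simp add: indicator_def)
qed

text \<open>Halving an interval changes its mass by a factor between r1/2 and r2/2, where 1/2 is the
  Jacobian of x |-> x/2; with ratios near 2^(1-\<alpha>) this is about 2^(-\<alpha>). The weight w
  is constant for the mass bound and a negative power for the moment bound.\<close>

lemma nn_integral_halved_interval_bounds:
  fixes p :: "real \<Rightarrow> real" and w :: "real \<Rightarrow> ennreal"
  assumes p: "p \<in> borel_measurable (restrict_space lborel {0<..})"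
    and \<pi>: "\<pi> = density (restrict_space lborel {0<..}) (\<lambda>x. ennreal (p x))"
    and w[measurable]: "w \<in> borel_measurable borel" and b: "b \<le> x0"
    and r: "\<And>x. 0 < x \<Longrightarrow> x \<le> x0 \<Longrightarrow> 0 < p x \<and> r1 * p x \<le> p (x / 2) \<and> p (x / 2) \<le> r2 * p x"
  shows "0 \<le> r2 \<Longrightarrow> (\<integral>\<^sup>+x. w x * indicator {a/2<..b/2} x \<partial>\<pi>) \<le> ennreal (r2 / 2) * (\<integral>\<^sup>+x. w (x / 2) * indicator {a<..b} x \<partial>\<pi>)"
    and "0 \<le> r1 \<Longrightarrow> (\<integral>\<^sup>+x. w x * indicator {a/2<..b/2} x \<partial>\<pi>) \<ge> ennreal (r1 / 2) * (\<integral>\<^sup>+x. w (x / 2) * indicator {a<..b} x \<partial>\<pi>)"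
proof -
  note [measurable] = borel_measurable_density_halfline[OF p]
  have r': "r1 * p x \<le> p (x / 2)" "p (x / 2) \<le> r2 * p x" if "0 < x" "x \<le> b" for x
    using r[of x] that b by auto
  have eq: "ennreal (c / 2) * (\<integral>\<^sup>+x. w (x / 2) * indicator {a<..b} x \<partial>\<pi>)
     = ennreal (1/2) * (\<integral>\<^sup>+x. w (x / 2) * indicator {a<..b} x * ennreal (c * (p x * indicator {0<..} x)) \<partial>lborel)"
    if "c \<ge> 0" for c
  proof -
    have "(\<integral>\<^sup>+x. w (x / 2) * indicator {a<..b} x * ennreal (c * (p x * indicator {0<..} x)) \<partial>lborel)
      = ennreal c * (\<integral>\<^sup>+x. w (x / 2) * indicator {a<..b} x * ennreal (p x * indicator {0<..} x) \<partial>lborel)"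
      using that by (subst nn_integral_cmult[symmetric]) (auto simp: ennreal_mult' mult_ac)
    also have "\<dots> = ennreal c * (\<integral>\<^sup>+x. w (x / 2) * indicator {a<..b} x \<partial>\<pi>)"
      by (subst nn_integral_density_halfline[OF p \<pi>]) auto
    finally show ?thesis using that ennreal_mult[of "1/2" c] by (simp add: mult.assoc)
  qed
  show "(\<integral>\<^sup>+x. w x * indicator {a/2<..b/2} x \<partial>\<pi>) \<le> ennreal (r2 / 2) * (\<integral>\<^sup>+x. w (x / 2) * indicator {a<..b} x \<partial>\<pi>)" if "0 \<le> r2"
    unfolding eq[OF that] nn_integral_halved_interval[OF p \<pi> w]
  proof (rule mult_left_mono, rule nn_integral_mono)
    fix x
    show "w (x / 2) * indicator {a<..b} x * ennreal (p (x / 2) * indicator {0<..} x) \<le> w (x / 2) * indicator {a<..b} x * ennreal (r2 * (p x * indicator {0<..} x))"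
    proof (cases "x \<in> {a<..b} \<and> 0 < x")
      case True
      then show ?thesis using r'[of x] by (auto intro!: mult_left_mono ennreal_leI)
    qed (auto simp: indicator_def)
  qed simp
  show "(\<integral>\<^sup>+x. w x * indicator {a/2<..b/2} x \<partial>\<pi>) \<ge> ennreal (r1 / 2) * (\<integral>\<^sup>+x. w (x / 2) * indicator {a<..b} x \<partial>\<pi>)" if "0 \<le> r1"
    unfolding eq[OF that] nn_integral_halved_interval[OF p \<pi> w]
  proof (rule mult_left_mono, rule nn_integral_mono)
    fix x
    show "w (x / 2) * indicator {a<..b} x * ennreal (r1 * (p x * indicator {0<..} x)) \<le> w (x / 2) * indicator {a<..b} x * ennreal (p (x / 2) * indicator {0<..} x)"
    proof (cases "x \<in> {a<..b} \<and> 0 < x")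
      case True
      then show ?thesis using r'[of x] by (auto intro!: mult_left_mono ennreal_leI)
    qed (auto simp: indicator_def)
  qed simp
qed

text \<open>The window at y is reached from a fixed one by about log2(y1/y) halvings, each keeping
  at least the fraction 2^(-\<alpha>-e) of the mass. The window {y<..4*y} spans two octaves because
  a power of 2 moves y to y1 only up to a factor 2.\<close>

lemma regular_variation_mass_ge:
  fixes p l :: "real \<Rightarrow> real"
  assumes prob: "prob_space \<pi>"
    and p: "p \<in> borel_measurable (restrict_space lborel {0<..})"
    and \<pi>: "\<pi> = density (restrict_space lborel {0<..}) (\<lambda>x. ennreal (p x))"
    and alpha: "0 < \<alpha>" and sv: "slowly_varying l"
    and asymp: "p \<sim>[at_right 0] (\<lambda>x. \<alpha> * l (1 / x) * x powr (\<alpha> - 1))"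
    and e: "e > 0"
  obtains c y1 where "c > 0" "y1 > 0" "\<And>y. 0 < y \<Longrightarrow> y \<le> y1 \<Longrightarrow>
     ennreal (c * y powr (\<alpha> + e)) \<le> (\<integral>\<^sup>+x. indicator {y<..4*y} x \<partial>\<pi>)"
proof -
  interpret prob_space \<pi> by fact
  note [measurable] = borel_measurable_density_halfline[OF p]
  \<comment> \<open>Just below the limit ratio 2^(1-\<alpha>), so that r1/2 is exactly
    2^(-\<alpha>-e).\<close>
  define r1 where "r1 = 2 powr (1 - \<alpha> - e)"
  have "r1 < 2 powr (1 - \<alpha>)" "2 powr (1 - \<alpha>) < 2 powr (1 - \<alpha>) + 1" using e by (auto simp: r1_def)
  from density_ratio_bounds[OF alpha sv asymp this] obtain x0 where x0: "x0 > 0"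
    and r: "\<And>x. 0 < x \<Longrightarrow> x \<le> x0 \<Longrightarrow> 0 < p x \<and> r1 * p x \<le> p (x / 2) \<and> p (x / 2) \<le> (2 powr (1 - \<alpha>) + 1) * p x"
    by metis
  have "r1 = 2 powr 1 * 2 powr (- \<alpha> - e)" unfolding r1_def by (subst powr_add[symmetric]) (simp add: algebra_simps)
  then have r1: "0 \<le> r1" "r1 / 2 = 2 powr (- \<alpha> - e)" by simp_all
  define V where "V a b = (\<integral>\<^sup>+x. indicator {a<..b} x \<partial>\<pi>)" for a b
  have step: "ennreal (2 powr (- \<alpha> - e)) * V a b \<le> V (a/2) (b/2)" if "b \<le> x0" for a b
    using nn_integral_halved_interval_bounds(2)[OF p \<pi> _ that r r1(1), of "\<lambda>_. 1" a] r1(2) by (simp add: V_def)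
  have iter: "ennreal ((2 powr (- \<alpha> - e)) ^ n) * V (2^n * y) (4 * (2^n * y)) \<le> V y (4 * y)"
    if "4 * (2^n * y) \<le> x0" "0 < y" for n y
    using that
  proof (induction n)
    case (Suc n)
    have "ennreal ((2 powr (- \<alpha> - e)) ^ Suc n) * V (2^Suc n * y) (4 * (2^Suc n * y))
      = ennreal ((2 powr (- \<alpha> - e)) ^ n) * (ennreal (2 powr (- \<alpha> - e)) * V (2^Suc n * y) (4 * (2^Suc n * y)))"
      by (simp add: ennreal_mult' mult_ac)
    also have "\<dots> \<le> ennreal ((2 powr (- \<alpha> - e)) ^ n) * V (2^n * y) (4 * (2^n * y))"
    proof (rule mult_left_mono)
      have "2^Suc n * y / 2 = 2^n * y" "4 * (2^Suc n * y) / 2 = 4 * (2^n * y)" by simp_all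
      then show "ennreal (2 powr (- \<alpha> - e)) * V (2^Suc n * y) (4 * (2^Suc n * y)) \<le> V (2^n * y) (4 * (2^n * y))"
        using step[OF Suc.prems(1), of "2^Suc n * y"] by (simp only:)
    qed simp
    also have "\<dots> \<le> V y (4 * y)"
    proof (rule Suc.IH)
      have "4 * (2^n * y) \<le> 4 * (2^Suc n * y)" using Suc.prems by simp
      then show "4 * (2^n * y) \<le> x0" using Suc.prems by linarith
    qed fact
    finally show ?case .
  qed simp
  \<comment> \<open>The quarter ensures 4 (2^n y) <= x0 as soon as 2^n y <= y1.\<close>
  define y1 where "y1 = x0 / 4"
  have y1: "y1 > 0" using x0 by (simp add: y1_def)
  \<comment> \<open>p is strictly positive on this interval, which has positive length.\<close>
  have Vpos: "V y1 (2 * y1) > 0"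
  proof (rule ccontr)
    assume "\<not> V y1 (2 * y1) > 0"
    then have "(\<integral>\<^sup>+x. indicator {y1<..2*y1} x * ennreal (p x * indicator {0<..} x) \<partial>lborel) = 0"
      unfolding V_def by (subst (asm) nn_integral_density_halfline[OF p \<pi>]) auto
    then have "AE x in lborel. indicator {y1<..2*y1} x * ennreal (p x * indicator {0<..} x) = 0"
      by (subst (asm) nn_integral_0_iff_AE) auto
    then have "AE x in lborel. x \<notin> {y1<..2*y1}"
    proof eventually_elim
      case (elim x)
      show ?case
      proof
        assume x: "x \<in> {y1<..2*y1}"
        then have "0 < p x" using r[of x] y1 by (simp add: y1_def)
        with elim x y1 show False by simp
      qed
    qed
    then have "{y1<..2*y1} \<in> null_sets lborel"
      by (subst AE_iff_null_sets) simp_all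
    then have "emeasure lborel {y1<..2*y1} = 0" by (rule null_setsD1)
    then show False using y1 by (simp add: ennreal_eq_0_iff)
  qed
  have Vfin: "V y1 (2 * y1) \<le> 1"
  proof -
    have "V y1 (2 * y1) \<le> (\<integral>\<^sup>+x. 1 \<partial>\<pi>)"
      unfolding V_def by (intro nn_integral_mono) (simp add: indicator_def)
    then show ?thesis by (simp add: emeasure_space_1)
  qed
  then obtain v where v: "V y1 (2 * y1) = ennreal v" "v > 0"
    using Vpos by (cases "V y1 (2 * y1)") (auto simp: top_unique)
  show ?thesis
  proof (rule that[of "v * y1 powr (- \<alpha> - e)" y1])
    fix y :: real assume y: "0 < y" "y \<le> y1"
    \<comment> \<open>The largest n with 2^n y <= y1. Then y1/2 < 2^n y, so {y1<..2*y1} is contained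
      in the window that starts at 2^n y.\<close>
    define n where "n = nat \<lfloor>log 2 (y1 / y)\<rfloor>"
    have "0 \<le> log 2 (y1 / y)" using y by simp
    then have n: "real n \<le> log 2 (y1 / y)" "log 2 (y1 / y) < real n + 1" unfolding n_def by linarith+
    have "2 powr real n \<le> y1 / y" "y1 / y < 2 powr (real n + 1)"
      using n y by (simp_all add: le_log_iff log_less_iff)
    then have n2: "2 ^ n * y \<le> y1" "y1 < 2 * (2 ^ n * y)" and n3: "2 ^ n \<le> y1 / y"
      using y by (simp_all add: powr_realpow powr_add field_simps)
    have "(y1 / y) powr (- \<alpha> - e) \<le> (2 ^ n) powr (- \<alpha> - e)"
      using n3 y alpha e by (intro powr_mono2') auto
    also have "(2 ^ n) powr (- \<alpha> - e) = (2 powr (- \<alpha> - e)) ^ n"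
      by (simp add: powr_realpow[symmetric] powr_powr mult.commute)
    finally have *: "(y1 / y) powr (- \<alpha> - e) \<le> (2 powr (- \<alpha> - e)) ^ n" .
    have "v * y1 powr (- \<alpha> - e) * y powr (\<alpha> + e) = (y1 / y) powr (- \<alpha> - e) * v"
      using y y1 by (simp add: powr_divide powr_minus powr_diff powr_add field_simps)
    then have "ennreal (v * y1 powr (- \<alpha> - e) * y powr (\<alpha> + e)) \<le> ennreal ((2 powr (- \<alpha> - e)) ^ n) * V y1 (2 * y1)"
      unfolding v using * v by (simp add: ennreal_mult'[symmetric] mult_right_mono)
    also have "\<dots> \<le> ennreal ((2 powr (- \<alpha> - e)) ^ n) * V (2^n * y) (4 * (2^n * y))"
      unfolding V_def using n2 by (intro mult_left_mono nn_integral_mono) (auto simp: indicator_def)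
    also have "\<dots> \<le> V y (4 * y)"
      using n2 y by (intro iter) (auto simp: y1_def)
    finally show "ennreal (v * y1 powr (- \<alpha> - e) * y powr (\<alpha> + e)) \<le> (\<integral>\<^sup>+x. indicator {y<..4*y} x \<partial>\<pi>)"
      unfolding V_def .
  qed (use v y1 in auto)
qed

text \<open>The integrals S n over {x0/2^n<..x0} satisfy S(n+1) <= S 1 + q S n: halving multiplies
  the mass by at most r2/2 and the weight by 2^\<beta>. As q < 1, all S n stay below the fixed point
  s/(1 - q) of this recursion.\<close>

lemma regular_variation_neg_moment_finite:
  fixes p l :: "real \<Rightarrow> real"
  assumes prob: "prob_space \<pi>"
    and p: "p \<in> borel_measurable (restrict_space lborel {0<..})"
    and \<pi>: "\<pi> = density (restrict_space lborel {0<..}) (\<lambda>x. ennreal (p x))"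
    and alpha: "0 < \<alpha>" and sv: "slowly_varying l"
    and asymp: "p \<sim>[at_right 0] (\<lambda>x. \<alpha> * l (1 / x) * x powr (\<alpha> - 1))"
    and \<beta>: "0 \<le> \<beta>" "\<beta> < \<alpha>"
  shows "(\<integral>\<^sup>+x. ennreal (x powr - \<beta>) \<partial>\<pi>) < \<infinity>"
proof -
  interpret prob_space \<pi> by fact
  have sets: "sets \<pi> = sets (restrict_space borel {0<..})"
    unfolding \<pi> by (simp add: sets_restrict_space)
  have space: "space \<pi> = {0<..}" using sets_eq_imp_space_eq[OF sets] by (simp add: space_restrict_space)
  have meas: "f \<in> borel_measurable \<pi>" if "f \<in> borel_measurable borel" for f :: "real \<Rightarrow> ennreal"
    using that by (simp add: measurable_cong_sets[OF sets refl] measurable_restrict_space1)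
  \<comment> \<open>The midpoint of 2^(1-\<alpha>) and 2^(1-\<beta>): above the first, so that it
    bounds the density ratio, and below the second, so that q < 1.\<close>
  define r2 where "r2 = (2 powr (1 - \<alpha>) + 2 powr (1 - \<beta>)) / 2"
  have lt: "2 powr (1 - \<alpha>) < 2 powr (1 - \<beta>)" using \<beta> by simp
  have "0 < 2 powr (1 - \<alpha>)" "2 powr (1 - \<alpha>) < r2" using lt by (auto simp: r2_def)
  from density_ratio_bounds[OF alpha sv asymp this] obtain x0 where x0: "x0 > 0"
    and r: "\<And>x. 0 < x \<Longrightarrow> x \<le> x0 \<Longrightarrow> 0 < p x \<and> 0 * p x \<le> p (x / 2) \<and> p (x / 2) \<le> r2 * p x"
    by metis
  define q where "q = 2 powr \<beta> * (r2 / 2)"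
  have "r2 < 2 powr (1 - \<beta>)" using lt by (simp add: r2_def)
  then have "q < 2 powr \<beta> * (2 powr (1 - \<beta>) / 2)" unfolding q_def by (intro mult_strict_left_mono) auto
  then have q: "0 \<le> q" "q < 1" by (auto simp: q_def r2_def powr_add[symmetric] add_nonneg_nonneg)
  define S where "S n = (\<integral>\<^sup>+x. ennreal (x powr - \<beta>) * indicator {x0/2^n<..x0} x \<partial>\<pi>)" for n :: nat
  have tail: "(\<integral>\<^sup>+x. ennreal (x powr - \<beta>) * indicator {a<..} x \<partial>\<pi>) \<le> ennreal (a powr - \<beta>)" if "a > 0" for a
  proof -
    have "(\<integral>\<^sup>+x. ennreal (x powr - \<beta>) * indicator {a<..} x \<partial>\<pi>) \<le> (\<integral>\<^sup>+x. ennreal (a powr - \<beta>) \<partial>\<pi>)"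
      using that \<beta> by (intro nn_integral_mono) (auto simp: indicator_def intro!: ennreal_leI powr_mono2')
    then show ?thesis by (simp add: emeasure_space_1)
  qed
  have "S 1 \<le> ennreal ((x0 / 2) powr - \<beta>)"
    unfolding S_def using x0 by (intro order_trans[OF nn_integral_mono tail]) (auto simp: indicator_def)
  then obtain s where s: "S 1 = ennreal s" "0 \<le> s" by (cases "S 1") (auto simp: top_unique)
  have S: "S n \<le> ennreal (s / (1 - q))" for n
  proof (induction n)
    case 0
    then show ?case by (simp add: S_def)
  next
    case (Suc n)
    \<comment> \<open>The interval from x0/2^(n+1) to x0 is {x0/2<..x0}, which gives S 1, together
      with the halved copy of {x0/2^n<..x0}.\<close>
    have "S (Suc n) \<le> S 1 + (\<integral>\<^sup>+x. ennreal (x powr - \<beta>) * indicator {(x0/2^n)/2<..x0/2} x \<partial>\<pi>)"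
      unfolding S_def
      by (subst nn_integral_add[symmetric]; (intro meas)?) (auto intro!: nn_integral_mono simp: indicator_def)
    also have "(\<integral>\<^sup>+x. ennreal (x powr - \<beta>) * indicator {(x0/2^n)/2<..x0/2} x \<partial>\<pi>)
       \<le> ennreal (r2 / 2) * (\<integral>\<^sup>+x. ennreal ((x / 2) powr - \<beta>) * indicator {x0/2^n<..x0} x \<partial>\<pi>)"
      by (rule nn_integral_halved_interval_bounds(1)[OF p \<pi> _ order_refl r]) (auto simp: r2_def add_nonneg_nonneg)
    also have "(\<integral>\<^sup>+x. ennreal ((x / 2) powr - \<beta>) * indicator {x0/2^n<..x0} x \<partial>\<pi>) = ennreal (2 powr \<beta>) * S n"
      unfolding S_def
      by (subst nn_integral_cmult[symmetric], intro meas, simp, rule nn_integral_cong)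
        (auto simp: space powr_divide powr_minus ennreal_mult'[symmetric] mult.assoc[symmetric] field_simps)
    also have "S 1 + ennreal (r2 / 2) * (ennreal (2 powr \<beta>) * S n) \<le> S 1 + ennreal q * ennreal (s / (1 - q))"
      using Suc.IH unfolding mult.assoc[symmetric] q_def
      by (intro add_left_mono mult_mono) (auto simp: ennreal_mult'[symmetric] mult.commute r2_def)
    also have "\<dots> = ennreal (s + q * (s / (1 - q)))"
      using s q by (simp add: ennreal_mult'[symmetric] del: times_divide_eq_right)
    also have "s + q * (s / (1 - q)) = s / (1 - q)" using q by (simp add: field_simps)
    finally show ?case by (simp add: add_left_mono)
  qed
  have "(\<integral>\<^sup>+x. ennreal (x powr - \<beta>) * indicator {0<..x0} x \<partial>\<pi>) = (SUP n. S n)"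
  proof -
    have "(\<integral>\<^sup>+x. ennreal (x powr - \<beta>) * indicator {0<..x0} x \<partial>\<pi>)
      = (\<integral>\<^sup>+x. (SUP n. ennreal (x powr - \<beta>) * indicator {x0/2^n<..x0} x) \<partial>\<pi>)"
    proof (rule nn_integral_cong)
      fix x :: real
      show "ennreal (x powr - \<beta>) * indicator {0<..x0} x = (SUP n. ennreal (x powr - \<beta>) * indicator {x0/2^n<..x0} x)"
      proof (cases "0 < x \<and> x \<le> x0")
        case True
        have "(\<lambda>n. x0 / 2 ^ n) \<longlonglongrightarrow> 0"
          using tendsto_mult_right_zero[OF LIMSEQ_power_zero[of "1/2::real"], of x0] by (simp add: power_divide)
        then have "\<forall>\<^sub>F n in sequentially. x0 / 2 ^ n < x" by (rule order_tendstoD) (use True in simp)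
        then obtain n where "x0 / 2 ^ n < x" by (auto simp: eventually_sequentially)
        with True show ?thesis
          by (intro antisym SUP_upper2[of n] SUP_least) (auto simp: indicator_def)
      next
        case False
        have "x \<notin> {x0/2^n<..x0}" for n :: nat
          using False x0 by (meson greaterThanAtMost_iff le_less_trans less_eq_real_def zero_less_divide_iff zero_less_numeral zero_less_power)
        then have "indicator {x0/2^n<..x0} x = (0::ennreal)" for n :: nat by (auto simp: indicator_def)
        then show ?thesis using False by simp
      qed
    qed
    also have "\<dots> = (SUP n. S n)"
      unfolding S_def
    proof (rule nn_integral_monotone_convergence_SUP)
      show "incseq (\<lambda>n x. ennreal (x powr - \<beta>) * indicator {x0/2^n<..x0} x)"
      proof (intro incseq_SucI le_funI mult_left_mono)
        fix n and x :: real
        have "x0 / 2 ^ Suc n \<le> x0 / 2 ^ n" using x0 by (intro divide_left_mono) auto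
        then show "indicator {x0/2^n<..x0} x \<le> (indicator {x0/2^Suc n<..x0} x :: ennreal)"
          by (auto simp: indicator_def)
      qed auto
    qed (intro meas, simp)
    finally show ?thesis .
  qed
  also have "\<dots> \<le> ennreal (s / (1 - q))" by (intro SUP_least S)
  finally have A: "(\<integral>\<^sup>+x. ennreal (x powr - \<beta>) * indicator {0<..x0} x \<partial>\<pi>) \<le> ennreal (s / (1 - q))" .
  have "(\<integral>\<^sup>+x. ennreal (x powr - \<beta>) \<partial>\<pi>) =
    (\<integral>\<^sup>+x. ennreal (x powr - \<beta>) * indicator {0<..x0} x \<partial>\<pi>) + (\<integral>\<^sup>+x. ennreal (x powr - \<beta>) * indicator {x0<..} x \<partial>\<pi>)"
    by (subst nn_integral_add[symmetric]; (intro meas)?) (auto intro!: nn_integral_cong simp: indicator_def space)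
  also have "\<dots> \<le> ennreal (s / (1 - q)) + ennreal (x0 powr - \<beta>)"
    using A tail[OF x0] by (rule add_mono)
  also have "\<dots> < \<infinity>" by simp
  finally show ?thesis .
qed

section \<open>Stochastic integrals of simple functions\<close>

locale levy_basis_space = prob_space M for M :: "'w measure" +
  fixes m :: "'s measure" and \<kappa> :: "real \<Rightarrow> complex" and \<Lambda> :: "'s set \<Rightarrow> 'w \<Rightarrow> real"
  assumes levy_basis: "levy_basis M m \<kappa> \<Lambda>"
begin

lemma Lambda_measurable [measurable (raw)]: "A \<in> finite_measure_sets m \<Longrightarrow> \<Lambda> A \<in> borel_measurable M"
  using levy_basis unfolding levy_basis_def by blast

lemma empty_finite_measure [simp]: "{} \<in> finite_measure_sets m"
  by (simp add: finite_measure_sets_def)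

text \<open>Countable additivity for a sequence of empty sets: a constant series converges only if
  its terms vanish.\<close>

lemma Lambda_empty: "AE \<omega> in M. \<Lambda> {} \<omega> = 0"
proof -
  have "range (\<lambda>_::nat. {}) \<subseteq> finite_measure_sets m" "disjoint_family (\<lambda>_::nat. {}::'s set)"
    "(\<Union>n::nat. {}) \<in> finite_measure_sets m"
    by (auto simp: disjoint_family_on_def)
  then have "AE \<omega> in M. (\<lambda>n::nat. \<Lambda> {} \<omega>) sums \<Lambda> (\<Union>n::nat. {}) \<omega>"
    using levy_basis unfolding levy_basis_def by blast
  then show ?thesis
  proof eventually_elim
    case (elim \<omega>)
    then have "(\<lambda>n::nat. \<Lambda> {} \<omega>) \<longlonglongrightarrow> 0" by (intro summable_LIMSEQ_zero sums_summable)
    then show ?case using LIMSEQ_unique tendsto_const by blast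
  qed
qed

text \<open>The axioms of a Levy basis speak of sequences of disjoint sets; a finite family is
  enumerated and padded with empty sets, on which the basis vanishes almost surely.\<close>

lemma finite_disjoint_enum:
  assumes J: "finite J" "disjoint_family_on B J" "\<And>j. j \<in> J \<Longrightarrow> B j \<in> finite_measure_sets m"
  obtains f A where "bij_betw f {0..<card J} J" "A = (\<lambda>k. if k < card J then B (f k) else {})"
    "range A \<subseteq> finite_measure_sets m" "disjoint_family A" "(\<Union>n. A n) = (\<Union>j\<in>J. B j)"
    "(\<Union>n. A n) \<in> finite_measure_sets m"
proof -
  obtain f where f: "bij_betw f {0..<card J} J" using ex_bij_betw_nat_finite[OF J(1)] by blast
  define A where "A k = (if k < card J then B (f k) else {})" for k
  have fJ: "f k \<in> J" if "k < card J" for k using f that by (auto simp: bij_betw_def)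
  have inj: "f k = f l \<longleftrightarrow> k = l" if "k < card J" "l < card J" for k l
    using f that by (auto simp: bij_betw_def inj_on_def)
  have U: "(\<Union>n. A n) = (\<Union>j\<in>J. B j)"
  proof -
    have "(\<Union>n. A n) = (\<Union>k\<in>{0..<card J}. B (f k))" by (auto simp: A_def split: if_splits)
    also have "\<dots> = (\<Union>j\<in>f ` {0..<card J}. B j)" by simp
    finally show ?thesis unfolding bij_betw_imp_surj_on[OF f] .
  qed
  have "(\<Union>j\<in>J. B j) \<in> finite_measure_sets m"
  proof -
    have B: "\<And>j. j \<in> J \<Longrightarrow> B j \<in> sets m" "\<And>j. j \<in> J \<Longrightarrow> emeasure m (B j) < \<infinity>"
      using J(3) by (auto simp: finite_measure_sets_def)
    have "emeasure m (\<Union>j\<in>J. B j) \<le> (\<Sum>j\<in>J. emeasure m (B j))"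
      using J(1) B by (intro emeasure_subadditive_finite) auto
    also have "\<dots> < \<infinity>" using B J(1) by simp
    finally show ?thesis using J(1) B by (auto simp: finite_measure_sets_def)
  qed
  show ?thesis
  proof (rule that[of f A])
    show "disjoint_family A"
      unfolding disjoint_family_on_def
    proof (intro ballI impI)
      fix k l :: nat assume "k \<noteq> l"
      show "A k \<inter> A l = {}"
      proof (cases "k < card J \<and> l < card J")
        case True
        then have "f k \<noteq> f l" using inj \<open>k \<noteq> l\<close> by blast
        then show ?thesis using True J(2) fJ by (simp add: A_def disjoint_family_on_def)
      qed (auto simp: A_def)
    qed
    show "range A \<subseteq> finite_measure_sets m" using J(3) fJ by (auto simp: A_def)
  qed (use f U \<open>(\<Union>j\<in>J. B j) \<in> _\<close> in \<open>auto simp: A_def\<close>)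
qed

lemma Lambda_finite_additive:
  assumes J: "finite J" "disjoint_family_on B J" "\<And>j. j \<in> J \<Longrightarrow> B j \<in> finite_measure_sets m"
  shows "AE \<omega> in M. \<Lambda> (\<Union>j\<in>J. B j) \<omega> = (\<Sum>j\<in>J. \<Lambda> (B j) \<omega>)"
proof -
  obtain f A where f: "bij_betw f {0..<card J} J" and A: "A = (\<lambda>k. if k < card J then B (f k) else {})"
    "range A \<subseteq> finite_measure_sets m" "disjoint_family A" "(\<Union>n. A n) = (\<Union>j\<in>J. B j)"
    "(\<Union>n. A n) \<in> finite_measure_sets m"
    using finite_disjoint_enum[OF J] by blast
  have "AE \<omega> in M. (\<lambda>n. \<Lambda> (A n) \<omega>) sums \<Lambda> (\<Union>n. A n) \<omega>"
    using levy_basis A(2,3,5) unfolding levy_basis_def by blast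
  with Lambda_empty show ?thesis
  proof eventually_elim
    case (elim \<omega>)
    have "(\<lambda>n. \<Lambda> (A n) \<omega>) sums (\<Sum>n\<in>{0..<card J}. \<Lambda> (A n) \<omega>)"
      using elim(1) by (intro sums_finite) (auto simp: A(1))
    then have "\<Lambda> (\<Union>n. A n) \<omega> = (\<Sum>n\<in>{0..<card J}. \<Lambda> (A n) \<omega>)"
      using elim(2) sums_unique2 by blast
    also have "\<dots> = (\<Sum>n\<in>{0..<card J}. \<Lambda> (B (f n)) \<omega>)" by (simp add: A(1))
    also have "\<dots> = (\<Sum>j\<in>J. \<Lambda> (B j) \<omega>)" by (rule sum.reindex_bij_betw[OF f])
    finally show ?case by (simp add: A(4))
  qed
qed

text \<open>The summands are independent by the axiom for sequences, and each constant c j moves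
  into the frequency.\<close>

lemma char_sum_Lambda:
  assumes J: "finite J" "disjoint_family_on B J" "\<And>j. j \<in> J \<Longrightarrow> B j \<in> finite_measure_sets m"
  shows "char (distr M borel (\<lambda>\<omega>. \<Sum>j\<in>J. c j * \<Lambda> (B j) \<omega>)) \<zeta>
    = exp (\<Sum>j\<in>J. complex_of_real (measure m (B j)) * \<kappa> (\<zeta> * c j))"
proof -
  obtain f A where f: "bij_betw f {0..<card J} J" and A: "A = (\<lambda>k. if k < card J then B (f k) else {})"
    "range A \<subseteq> finite_measure_sets m" "disjoint_family A" "(\<Union>n. A n) = (\<Union>j\<in>J. B j)"
    "(\<Union>n. A n) \<in> finite_measure_sets m"
    using finite_disjoint_enum[OF J] by blast
  have Am [measurable]: "\<Lambda> (A n) \<in> borel_measurable M" for n using A(2) by (intro Lambda_measurable) auto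
  have "indep_vars (\<lambda>_. borel) (\<lambda>n. \<Lambda> (A n)) UNIV"
    using levy_basis A(2,3) unfolding levy_basis_def by blast
  then have "indep_vars (\<lambda>_. borel) (\<lambda>n. \<Lambda> (A n)) {0..<card J}" by (rule indep_vars_subset) simp
  then have ind: "indep_vars (\<lambda>_. borel) (\<lambda>n \<omega>. c (f n) * \<Lambda> (A n) \<omega>) {0..<card J}"
    by (rule indep_vars_compose2[where Y = "\<lambda>n x. c (f n) * x"]) measurable
  have single: "char (distr M borel (\<lambda>\<omega>. c * \<Lambda> (A n) \<omega>)) \<zeta> = exp (complex_of_real (measure m (A n)) * \<kappa> (\<zeta> * c))" for n c
  proof -
    have "char (distr M borel (\<lambda>\<omega>. c * \<Lambda> (A n) \<omega>)) \<zeta> = char (distr M borel (\<Lambda> (A n))) (\<zeta> * c)"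
      by (simp add: char_def integral_distr mult.assoc)
    then show ?thesis using levy_basis A(2) unfolding levy_basis_def by auto
  qed
  have "(\<lambda>\<omega>. \<Sum>j\<in>J. c j * \<Lambda> (B j) \<omega>) = (\<lambda>\<omega>. \<Sum>n\<in>{0..<card J}. c (f n) * \<Lambda> (A n) \<omega>)"
    by (subst sum.reindex_bij_betw[OF f, symmetric]) (simp add: A(1))
  then have "char (distr M borel (\<lambda>\<omega>. \<Sum>j\<in>J. c j * \<Lambda> (B j) \<omega>)) \<zeta>
    = (\<Prod>n\<in>{0..<card J}. char (distr M borel (\<lambda>\<omega>. c (f n) * \<Lambda> (A n) \<omega>)) \<zeta>)"
    using char_distr_sum[OF ind, of \<zeta>] by simp
  also have "\<dots> = exp (\<Sum>n\<in>{0..<card J}. complex_of_real (measure m (A n)) * \<kappa> (\<zeta> * c (f n)))"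
    by (simp add: single exp_sum)
  also have "(\<Sum>n\<in>{0..<card J}. complex_of_real (measure m (A n)) * \<kappa> (\<zeta> * c (f n)))
     = (\<Sum>n\<in>{0..<card J}. complex_of_real (measure m (B (f n))) * \<kappa> (\<zeta> * c (f n)))"
    by (simp add: A(1))
  also have "\<dots> = (\<Sum>j\<in>J. complex_of_real (measure m (B j)) * \<kappa> (\<zeta> * c j))"
    by (rule sum.reindex_bij_betw[OF f])
  finally show ?thesis .
qed

abbreviation Sint :: "('s \<Rightarrow> real) \<Rightarrow> 'w \<Rightarrow> real" where
  "Sint \<equiv> simple_stochastic_integral m \<Lambda> (space m)"

lemma simple_level_finite_measure:
  fixes F :: "'s \<Rightarrow> real"
  assumes "Bochner_Integration.simple_bochner_integrable m F" "y \<noteq> 0"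
  shows "{x\<in>space m. F x = y} \<in> finite_measure_sets m"
proof -
  have F: "F \<in> borel_measurable m" using assms(1) by (simp add: borel_measurable_simple_function simple_bochner_integrable.simps)
  then have sets: "{x\<in>space m. F x = y} \<in> sets m" "{x\<in>space m. F x \<noteq> 0} \<in> sets m" by measurable
  have "emeasure m {x\<in>space m. F x = y} \<le> emeasure m {x\<in>space m. F x \<noteq> 0}"
    using assms(2) sets by (intro emeasure_mono) auto
  then show ?thesis
    using assms(1) sets by (auto simp: finite_measure_sets_def simple_bochner_integrable.simps top.not_eq_extremum le_less_trans)
qed

lemma Sint_measurable:
  assumes "Bochner_Integration.simple_bochner_integrable m F"
  shows "Sint F \<in> borel_measurable M"
proof -
  have "(\<lambda>\<omega>. y * \<Lambda> {x\<in>space m. F x = y} \<omega>) \<in> borel_measurable M" for y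
  proof (cases "y = 0")
    case False
    then have [measurable]: "\<Lambda> {x\<in>space m. F x = y} \<in> borel_measurable M"
      using assms by (intro Lambda_measurable simple_level_finite_measure)
    show ?thesis by measurable
  qed simp
  then show ?thesis unfolding simple_stochastic_integral_def[abs_def] by (intro borel_measurable_sum)
qed

text \<open>The integral is defined through the level sets of F. Here it is computed on any finer
  finite partition: blocks with equal value are merged by additivity, hence the almost sure
  statement, and nonempty blocks guarantee that every c j is a value of F.\<close>

lemma Sint_eq_sum:
  assumes F: "Bochner_Integration.simple_bochner_integrable m F"
    and J: "finite J" "disjoint_family_on B J" "\<And>j. j \<in> J \<Longrightarrow> B j \<in> finite_measure_sets m"
    and ne: "\<And>j. j \<in> J \<Longrightarrow> B j \<noteq> {}"
    and val: "\<And>j x. j \<in> J \<Longrightarrow> x \<in> B j \<Longrightarrow> F x = c j"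
    and zero: "\<And>x. x \<in> space m \<Longrightarrow> x \<notin> (\<Union>j\<in>J. B j) \<Longrightarrow> F x = 0"
  shows "AE \<omega> in M. Sint F \<omega> = (\<Sum>j\<in>J. c j * \<Lambda> (B j) \<omega>)"
proof -
  have fin: "finite (F ` space m)" using F by (simp add: simple_bochner_integrable.simps simple_function_def)
  have sub: "B j \<subseteq> space m" if "j \<in> J" for j
    using J(3)[OF that] sets.sets_into_space by (auto simp: finite_measure_sets_def)
  have level: "AE \<omega> in M. y * \<Lambda> {x\<in>space m. F x = y} \<omega> = (\<Sum>j\<in>{j\<in>J. c j = y}. c j * \<Lambda> (B j) \<omega>)" for y
  proof (cases "y = 0")
    case False
    have eq: "{x\<in>space m. F x = y} = (\<Union>j\<in>{j\<in>J. c j = y}. B j)"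
      using False val zero sub by fastforce
    have "AE \<omega> in M. \<Lambda> (\<Union>j\<in>{j\<in>J. c j = y}. B j) \<omega> = (\<Sum>j\<in>{j\<in>J. c j = y}. \<Lambda> (B j) \<omega>)"
      using J by (intro Lambda_finite_additive) (auto simp: disjoint_family_on_def)
    then show ?thesis unfolding eq
      by eventually_elim (simp add: sum_distrib_left)
  qed simp
  have "AE \<omega> in M. \<forall>y\<in>F ` space m. y * \<Lambda> {x\<in>space m. F x = y} \<omega> = (\<Sum>j\<in>{j\<in>J. c j = y}. c j * \<Lambda> (B j) \<omega>)"
    unfolding AE_finite_all[OF fin] by (intro ballI level)
  then show ?thesis
  proof eventually_elim
    case (elim \<omega>)
    have "c ` J \<subseteq> F ` space m"
    proof
      fix y assume "y \<in> c ` J"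
      then obtain j where j: "j \<in> J" "y = c j" by blast
      then obtain x where "x \<in> B j" using ne by blast
      then show "y \<in> F ` space m" using val[of j x] j sub by force
    qed
    then have "(\<Sum>y\<in>F ` space m. \<Sum>j\<in>{j\<in>J. c j = y}. c j * \<Lambda> (B j) \<omega>) = (\<Sum>j\<in>J. c j * \<Lambda> (B j) \<omega>)"
      using fin J(1) by (intro sum.group) auto
    moreover have "Sint F \<omega> = (\<Sum>y\<in>F ` space m. \<Sum>j\<in>{j\<in>J. c j = y}. c j * \<Lambda> (B j) \<omega>)"
      unfolding simple_stochastic_integral_def using elim by (intro sum.cong) blast+
    ultimately show ?case by simp
  qed
qed

text \<open>The value 0 is split off because its level set may have infinite measure, where
  \<open>levy_basis\<close> prescribes no law.\<close>

lemma char_Sint: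
  assumes F: "Bochner_Integration.simple_bochner_integrable m F"
  shows "char (distr M borel (Sint F)) \<zeta>
    = exp (\<Sum>y\<in>F ` space m - {0}. complex_of_real (measure m {x\<in>space m. F x = y}) * \<kappa> (\<zeta> * y))"
proof -
  define B where "B y = {x\<in>space m. F x = y}" for y
  have J: "finite (F ` space m - {0})" "disjoint_family_on B (F ` space m - {0})"
    "\<And>y. y \<in> F ` space m - {0} \<Longrightarrow> B y \<in> finite_measure_sets m"
    using F simple_level_finite_measure[OF F]
    by (auto simp: simple_bochner_integrable.simps simple_function_def disjoint_family_on_def B_def)
  have "AE \<omega> in M. Sint F \<omega> = (\<Sum>y\<in>F ` space m - {0}. y * \<Lambda> (B y) \<omega>)"
    by (rule Sint_eq_sum[OF F J]) (auto simp: B_def)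
  then have "distr M borel (Sint F) = distr M borel (\<lambda>\<omega>. \<Sum>y\<in>F ` space m - {0}. y * \<Lambda> (B y) \<omega>)"
    using Sint_measurable[OF F] J(3) by (intro distr_cong_AE) (auto intro!: borel_measurable_sum borel_measurable_times Lambda_measurable)
  then show ?thesis using char_sum_Lambda[OF J, of "\<lambda>y. y"] by (simp add: B_def)
qed

lemma simple_bochner_integrable_lincomb:
  fixes F G :: "'s \<Rightarrow> real"
  assumes F: "Bochner_Integration.simple_bochner_integrable m F" and G: "Bochner_Integration.simple_bochner_integrable m G"
  shows "Bochner_Integration.simple_bochner_integrable m (\<lambda>x. c * F x + d * G x)"
proof -
  have "Bochner_Integration.simple_bochner_integrable m (\<lambda>x. c * F x)" "Bochner_Integration.simple_bochner_integrable m (\<lambda>x. d * G x)"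
    using F G by (auto intro: simple_bochner_integrable_compose2[where p = "\<lambda>x y. c * x" and f = F and g = F]
      simple_bochner_integrable_compose2[where p = "\<lambda>x y. d * x" and f = G and g = G])
  then show ?thesis by (intro simple_bochner_integrable_compose2[where p = "(+)"]) auto
qed

text \<open>F, G and their combination have different level sets, so all three are computed on the
  joint level sets of (F, G). The pair (0, 0) is left out since its level set may have infinite
  measure.\<close>

lemma Sint_lincomb:
  assumes F: "Bochner_Integration.simple_bochner_integrable m F" and G: "Bochner_Integration.simple_bochner_integrable m G"
  shows "AE \<omega> in M. Sint (\<lambda>x. c * F x + d * G x) \<omega> = c * Sint F \<omega> + d * Sint G \<omega>"
proof -
  define J where "J = (\<lambda>x. (F x, G x)) ` space m - {(0, 0)}"
  define B where "B j = {x\<in>space m. F x = fst j \<and> G x = snd j}" for j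
  have "finite (F ` space m \<times> G ` space m)"
    using F G by (simp add: simple_bochner_integrable.simps simple_function_def)
  then have fin: "finite J" by (rule finite_subset[rotated]) (auto simp: J_def)
  have [measurable]: "F \<in> borel_measurable m" "G \<in> borel_measurable m"
    using F G by (simp_all add: borel_measurable_simple_function simple_bochner_integrable.simps)
  have fms: "B j \<in> finite_measure_sets m" if "j \<in> J" for j
  proof -
    have s: "B j \<in> sets m" unfolding B_def by measurable
    have "fst j \<noteq> 0 \<or> snd j \<noteq> 0" using that by (auto simp: J_def)
    then have "emeasure m (B j) < \<infinity>"
    proof
      assume "fst j \<noteq> 0"
      from simple_level_finite_measure[OF F this] show ?thesis
        by (auto simp: finite_measure_sets_def B_def elim!: le_less_trans[rotated] intro!: emeasure_mono)
    next
      assume "snd j \<noteq> 0"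
      from simple_level_finite_measure[OF G this] show ?thesis
        by (auto simp: finite_measure_sets_def B_def elim!: le_less_trans[rotated] intro!: emeasure_mono)
    qed
    with s show ?thesis by (simp add: finite_measure_sets_def)
  qed
  have dis: "disjoint_family_on B J" by (auto simp: disjoint_family_on_def B_def prod_eq_iff)
  have ne: "B j \<noteq> {}" if "j \<in> J" for j using that by (auto simp: J_def B_def)
  have zero: "F x = 0 \<and> G x = 0" if "x \<in> space m" "x \<notin> (\<Union>j\<in>J. B j)" for x
  proof (rule ccontr)
    assume "\<not> ?thesis"
    then have "(F x, G x) \<in> J" "x \<in> B (F x, G x)" using that by (auto simp: J_def B_def)
    then show False using that by blast
  qed
  have "AE \<omega> in M. Sint F \<omega> = (\<Sum>j\<in>J. fst j * \<Lambda> (B j) \<omega>)"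
    using zero by (intro Sint_eq_sum[OF F fin dis fms ne]) (auto simp: B_def)
  moreover have "AE \<omega> in M. Sint G \<omega> = (\<Sum>j\<in>J. snd j * \<Lambda> (B j) \<omega>)"
    using zero by (intro Sint_eq_sum[OF G fin dis fms ne]) (auto simp: B_def)
  moreover have "AE \<omega> in M. Sint (\<lambda>x. c * F x + d * G x) \<omega> = (\<Sum>j\<in>J. (c * fst j + d * snd j) * \<Lambda> (B j) \<omega>)"
  proof (rule Sint_eq_sum[OF simple_bochner_integrable_lincomb[OF F G] fin dis fms ne])
    fix x assume "x \<in> space m" "x \<notin> (\<Union>j\<in>J. B j)"
    from zero[OF this] show "c * F x + d * G x = 0" by simp
  qed (auto simp: B_def)
  ultimately show ?thesis
    by eventually_elim (simp add: sum.distrib sum_distrib_left distrib_right mult.assoc)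
qed

end

section \<open>The compensated exponent\<close>

text \<open>The truncation function of the Levy-Khintchine formula is replaced by sin, which is
  bounded, Lipschitz and equal to the identity up to second order. The exponent then depends
  continuously on the kernel without any moment assumption; the jumps of an indicator would destroy
  this.\<close>

definition levy_comp :: "real \<Rightarrow> real \<Rightarrow> complex" where
  "levy_comp \<zeta> y = iexp (\<zeta> * y) - 1 - \<i> * complex_of_real (\<zeta> * sin y)"

lemma levy_comp_0 [simp]: "levy_comp \<zeta> 0 = 0"
  by (simp add: levy_comp_def)

lemma levy_comp_measurable [measurable]: "levy_comp \<zeta> \<in> borel_measurable borel"
  unfolding levy_comp_def[abs_def] by measurable

lemma Re_levy_comp: "Re (levy_comp \<zeta> y) = cos (\<zeta> * y) - 1"
  by (simp add: levy_comp_def Re_exp)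

lemma abs_sin_diff_le: "\<bar>sin x - sin y\<bar> \<le> \<bar>x - (y::real)\<bar>"
  using norm_iexp_diff_le[of x y] abs_Im_le_cmod[of "iexp x - iexp y"] by (simp add: Im_exp)

text \<open>Imaginary part of the first-order expansion of iexp at y, where replacing the factor
  iexp y by 1 costs |x - y| |y|.\<close>

lemma abs_sin_diff_linear_le: "\<bar>(x - y) - (sin x - sin (y::real))\<bar> \<le> \<bar>x - y\<bar> * \<bar>y\<bar> + (x - y)\<^sup>2"
proof -
  have "cmod (iexp x - iexp y - \<i> * complex_of_real (x - y)) \<le> \<bar>x - y\<bar> * \<bar>y\<bar> + (x - y)\<^sup>2 / 2"
  proof -
    have "iexp x - iexp y - \<i> * complex_of_real (x - y)
      = iexp y * (iexp (x - y) - 1 - \<i> * complex_of_real (x - y)) + \<i> * complex_of_real (x - y) * (iexp y - 1)"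
      by (simp add: algebra_simps exp_add[symmetric])
    then have "cmod (iexp x - iexp y - \<i> * complex_of_real (x - y))
      \<le> cmod (iexp (x - y) - 1 - \<i> * complex_of_real (x - y)) + \<bar>x - y\<bar> * cmod (iexp y - 1)"
      using norm_triangle_ineq[of "iexp y * (iexp (x - y) - 1 - \<i> * complex_of_real (x - y))" "\<i> * complex_of_real (x - y) * (iexp y - 1)"]
      by (simp add: norm_mult del: of_real_diff) 
    moreover have "\<bar>x - y\<bar> * cmod (iexp y - 1) \<le> \<bar>x - y\<bar> * \<bar>y\<bar>"
      by (intro mult_left_mono norm_iexp_diff_1_le) simp
    ultimately show ?thesis using norm_iexp_taylor1_le[of "x - y"] by linarith
  qed
  then have "\<bar>Im (iexp x - iexp y - \<i> * complex_of_real (x - y))\<bar> \<le> \<bar>x - y\<bar> * \<bar>y\<bar> + (x - y)\<^sup>2 / 2"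
    using abs_Im_le_cmod order_trans by blast
  moreover have "Im (iexp x - iexp y - \<i> * complex_of_real (x - y)) = - ((x - y) - (sin x - sin y))"
    by (simp add: Im_exp)
  ultimately show ?thesis using zero_le_power2[of "x - y"] by linarith
qed

text \<open>One bound for three regimes: for |x - y| >= 1 both values are bounded, for |y| >= 1 a
  Lipschitz estimate suffices, and otherwise the difference is of second order, |x - y| |y| + (x -
  y)^2. The factor is the sum of the constants 4 + 2|\<zeta>|, \<zeta>^2 + |\<zeta>| and 2|\<zeta>|
  of the three cases.\<close>

lemma levy_comp_diff_le:
  "cmod (levy_comp \<zeta> x - levy_comp \<zeta> y)
    \<le> (4 + 5 * \<bar>\<zeta>\<bar> + \<zeta>\<^sup>2) * (min 1 \<bar>x - y\<bar> * min 1 \<bar>y\<bar> + min 1 ((x - y)\<^sup>2))"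
proof -
  define \<Delta> where "\<Delta> = cmod (levy_comp \<zeta> x - levy_comp \<zeta> y)"
  define d where "d = \<bar>x - y\<bar>"
  have d0: "0 \<le> d" and d2: "(x - y)\<^sup>2 = d\<^sup>2" by (simp_all add: d_def)
  have b: "cmod (levy_comp \<zeta> u) \<le> 2 + \<bar>\<zeta>\<bar>" for u
  proof -
    have "cmod (levy_comp \<zeta> u) \<le> cmod (iexp (\<zeta> * u)) + 1 + cmod (\<i> * complex_of_real (\<zeta> * sin u))"
      unfolding levy_comp_def by (metis norm_triangle_ineq4 norm_one order_trans add_right_mono)
    moreover have "cmod (\<i> * complex_of_real (\<zeta> * sin u)) = \<bar>\<zeta>\<bar> * \<bar>sin u\<bar>" by (simp add: norm_mult abs_mult)
    moreover have "\<bar>\<zeta>\<bar> * \<bar>sin u\<bar> \<le> \<bar>\<zeta>\<bar> * 1" by (intro mult_left_mono) auto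
    ultimately show ?thesis by simp
  qed
  have A1: "\<Delta> \<le> 4 + 2 * \<bar>\<zeta>\<bar>"
    using norm_triangle_ineq4[of "levy_comp \<zeta> x" "levy_comp \<zeta> y"] b[of x] b[of y] by (simp add: \<Delta>_def)
  have A3: "\<Delta> \<le> 2 * \<bar>\<zeta>\<bar> * d"
  proof -
    have "levy_comp \<zeta> x - levy_comp \<zeta> y = (iexp (\<zeta> * x) - iexp (\<zeta> * y)) - \<i> * complex_of_real (\<zeta> * (sin x - sin y))"
      by (simp add: levy_comp_def algebra_simps)
    then have "\<Delta> \<le> cmod (iexp (\<zeta> * x) - iexp (\<zeta> * y)) + cmod (\<i> * complex_of_real (\<zeta> * (sin x - sin y)))"
      unfolding \<Delta>_def by (metis norm_triangle_ineq4)
    also have "cmod (\<i> * complex_of_real (\<zeta> * (sin x - sin y))) = \<bar>\<zeta>\<bar> * \<bar>sin x - sin y\<bar>"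
      by (simp only: norm_mult norm_ii norm_of_real abs_mult mult_1)
    also have "\<dots> \<le> \<bar>\<zeta>\<bar> * d" unfolding d_def by (intro mult_left_mono abs_sin_diff_le) auto
    also have "cmod (iexp (\<zeta> * x) - iexp (\<zeta> * y)) \<le> \<bar>\<zeta>\<bar> * d"
      using norm_iexp_diff_le[of "\<zeta> * x" "\<zeta> * y"] by (simp add: d_def abs_mult[symmetric] right_diff_distrib)
    finally show ?thesis by (simp add: mult_ac)
  qed
  have A2: "\<Delta> \<le> (\<zeta>\<^sup>2 + \<bar>\<zeta>\<bar>) * (d * \<bar>y\<bar> + d\<^sup>2)"
  proof -
    \<comment> \<open>Three errors: the second-order remainder in x - y, the deviation of
      iexp(\<zeta> y) from 1 in the linear term, and the deviation of sin from the identity.\<close>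
    let ?t1 = "iexp (\<zeta> * y) * (iexp (\<zeta> * (x - y)) - 1 - \<i> * complex_of_real (\<zeta> * (x - y)))"
    let ?t2 = "\<i> * complex_of_real (\<zeta> * (x - y)) * (iexp (\<zeta> * y) - 1)"
    let ?t3 = "\<i> * complex_of_real (\<zeta> * ((x - y) - (sin x - sin y)))"
    have "levy_comp \<zeta> x - levy_comp \<zeta> y = ?t1 + ?t2 + ?t3"
      by (simp add: levy_comp_def algebra_simps exp_add[symmetric])
    then have "\<Delta> \<le> cmod ?t1 + cmod ?t2 + cmod ?t3"
      unfolding \<Delta>_def by (metis norm_triangle_ineq norm_triangle_mono order_refl)
    moreover have "cmod ?t1 \<le> \<zeta>\<^sup>2 * d\<^sup>2"
    proof -
      have "cmod ?t1 \<le> (\<zeta> * (x - y))\<^sup>2 / 2"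
        using norm_iexp_taylor1_le[of "\<zeta> * (x - y)"] by (simp only: norm_mult norm_exp_i_times mult_1)
      also have "\<dots> \<le> \<zeta>\<^sup>2 * d\<^sup>2" by (simp add: power_mult_distrib d_def)
      finally show ?thesis .
    qed
    moreover have "cmod ?t2 \<le> \<zeta>\<^sup>2 * (d * \<bar>y\<bar>)"
    proof -
      have "cmod ?t2 = (\<bar>\<zeta>\<bar> * d) * cmod (iexp (\<zeta> * y) - 1)"
        by (simp only: norm_mult norm_ii norm_of_real abs_mult mult_1 d_def)
      also have "\<dots> \<le> (\<bar>\<zeta>\<bar> * d) * \<bar>\<zeta> * y\<bar>" using d0 by (intro mult_left_mono norm_iexp_diff_1_le) auto
      also have "\<dots> = \<bar>\<zeta>\<bar> * \<bar>\<zeta>\<bar> * (d * \<bar>y\<bar>)" by (simp add: abs_mult)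
      finally show ?thesis by (simp only: power2_eq_square abs_mult_self_eq)
    qed
    moreover have "cmod ?t3 \<le> \<bar>\<zeta>\<bar> * (d * \<bar>y\<bar> + d\<^sup>2)"
    proof -
      have "cmod ?t3 = \<bar>\<zeta>\<bar> * \<bar>(x - y) - (sin x - sin y)\<bar>"
        by (simp only: norm_mult norm_ii norm_of_real abs_mult mult_1)
      also have "\<dots> \<le> \<bar>\<zeta>\<bar> * (d * \<bar>y\<bar> + d\<^sup>2)"
        using abs_sin_diff_linear_le[of x y] by (intro mult_left_mono) (auto simp: d_def)
      finally show ?thesis .
    qed
    ultimately show ?thesis by (simp add: distrib_right distrib_left)
  qed
  define R where "R = min 1 d * min 1 \<bar>y\<bar> + min 1 (d\<^sup>2)"
  define c1 where "c1 = 4 + 2 * \<bar>\<zeta>\<bar>"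
  define c2 where "c2 = \<zeta>\<^sup>2 + \<bar>\<zeta>\<bar>"
  define c3 where "c3 = 2 * \<bar>\<zeta>\<bar>"
  have c: "0 \<le> c1" "0 \<le> c2" "0 \<le> c3" by (auto simp: c1_def c2_def c3_def)
  have "\<Delta> \<le> (c1 + c2 + c3) * R"
  proof (cases "1 \<le> d")
    case True
    then have "1 \<le> d\<^sup>2" by (simp add: one_le_power)
    then have "1 \<le> R" using d0 by (simp add: R_def)
    then have "c1 * 1 \<le> c1 * R" using c by (intro mult_left_mono) auto
    moreover have "0 \<le> c2 * R" "0 \<le> c3 * R" using c \<open>1 \<le> R\<close> by (auto intro!: mult_nonneg_nonneg)
    ultimately show ?thesis using A1 by (simp add: c1_def distrib_right)
  next
    case False
    then have d1: "min 1 d = d" "min 1 (d\<^sup>2) = d\<^sup>2" using d0 power_le_one[of d 2] by simp_all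
    have R0: "0 \<le> R" unfolding R_def using d0 by (intro add_nonneg_nonneg mult_nonneg_nonneg) auto
    show ?thesis
    proof (cases "1 \<le> \<bar>y\<bar>")
      case True
      then have "d \<le> R" by (simp add: R_def d1)
      then have "c3 * d \<le> c3 * R" using c by (intro mult_left_mono) auto
      moreover have "0 \<le> c1 * R" "0 \<le> c2 * R" using c R0 by (auto intro!: mult_nonneg_nonneg)
      ultimately show ?thesis using A3 by (simp add: c3_def distrib_right)
    next
      case F: False
      then have "R = d * \<bar>y\<bar> + d\<^sup>2" by (simp add: R_def d1)
      moreover have "0 \<le> c1 * R" "0 \<le> c3 * R" using c R0 by (auto intro!: mult_nonneg_nonneg)
      ultimately show ?thesis using A2 by (simp add: c2_def distrib_right)
    qed
  qed
  moreover have "c1 + c2 + c3 = 4 + 5 * \<bar>\<zeta>\<bar> + \<zeta>\<^sup>2" by (simp add: c1_def c2_def c3_def)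
  ultimately show ?thesis unfolding \<Delta>_def R_def d2 d_def by simp
qed

lemma levy_comp_le: "cmod (levy_comp \<zeta> x) \<le> (4 + 5 * \<bar>\<zeta>\<bar> + \<zeta>\<^sup>2) * min 1 (x\<^sup>2)"
  using levy_comp_diff_le[of \<zeta> x 0] by simp

text \<open>The product is split by p q <= e q^2 + p^2/e. In limits, e is fixed first to make the
  term in y small, after which the term in x - y tends to 0.\<close>

lemma levy_comp_diff_le_weighted:
  assumes "e > 0"
  shows "cmod (levy_comp \<zeta> x - levy_comp \<zeta> y)
    \<le> (4 + 5 * \<bar>\<zeta>\<bar> + \<zeta>\<^sup>2) * (e * min 1 (y\<^sup>2) + (1 / e + 1) * min 1 ((x - y)\<^sup>2))"
proof -
  have sq: "min 1 (u\<^sup>2) = (min 1 \<bar>u\<bar>)\<^sup>2" for u :: real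
  proof (cases "\<bar>u\<bar> \<le> 1")
    case True
    then have "u\<^sup>2 \<le> 1" by (simp add: abs_square_le_1)
    then show ?thesis using True by (simp add: min_absorb2)
  next
    case False
    then have "1 \<le> u\<^sup>2" using one_le_power[of "\<bar>u\<bar>" 2] by simp
    then show ?thesis using False by (simp add: min_absorb1)
  qed
  define p q where "p = min 1 \<bar>x - y\<bar>" and "q = min 1 \<bar>y\<bar>"
  have "e * (p / e - q)\<^sup>2 = p\<^sup>2 / e - 2 * (p * q) + e * q\<^sup>2"
    using assms by (simp add: power2_eq_square field_simps)
  moreover have "0 \<le> e * (p / e - q)\<^sup>2" "0 \<le> p\<^sup>2 / e" "0 \<le> e * q\<^sup>2"
    using assms by simp_all
  ultimately have "p * q \<le> e * q\<^sup>2 + p\<^sup>2 / e" by linarith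
  then have "p * q + p\<^sup>2 \<le> e * q\<^sup>2 + (1 / e + 1) * p\<^sup>2" by (simp add: distrib_right)
  then have "(4 + 5 * \<bar>\<zeta>\<bar> + \<zeta>\<^sup>2) * (p * q + p\<^sup>2) \<le> (4 + 5 * \<bar>\<zeta>\<bar> + \<zeta>\<^sup>2) * (e * q\<^sup>2 + (1 / e + 1) * p\<^sup>2)"
    by (intro mult_left_mono) auto
  then show ?thesis using levy_comp_diff_le[of \<zeta> x y] unfolding sq p_def q_def by linarith
qed

section \<open>Recovering truncated squares by averaging over frequencies\<close>

text \<open>For |y| <= 2 the Taylor expansion of sin gives at least y^2/6 - y^4/120 >= 2 y^2/15; for
  larger |y| one has |sin y / y| <= 1/2. Both leave room for 1/8.\<close>

lemma one_minus_sinc_ge: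
  fixes y :: real assumes "y \<noteq> 0" shows "min 1 (y\<^sup>2) / 8 \<le> 1 - sin y / y"
proof (cases "\<bar>y\<bar> \<le> 2")
  case True
  have "cmod (iexp y - (\<Sum>k\<le>4. (\<i> * y)^k / fact k)) \<le> \<bar>y\<bar>^5 / 120"
    using iexp_approx1[of y 4] by (simp add: fact_numeral)
  then have "\<bar>Im (iexp y - (\<Sum>k\<le>4. (\<i> * y)^k / fact k))\<bar> \<le> \<bar>y\<bar>^5 / 120"
    using abs_Im_le_cmod order_trans by blast
  moreover have "Im (iexp y - (\<Sum>k\<le>4. (\<i> * y)^k / fact k)) = sin y - y + y^3 / 6"
    by (simp add: numeral_eq_Suc Im_exp fact_numeral)
  ultimately have "\<bar>sin y - y + y^3 / 6\<bar> \<le> \<bar>y\<bar>^5 / 120" by simp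
  then have "\<bar>(sin y - y + y^3 / 6) / y\<bar> \<le> \<bar>y\<bar>^5 / 120 / \<bar>y\<bar>"
    unfolding abs_divide using assms by (intro divide_right_mono) auto
  moreover have "(sin y - y + y^3 / 6) / y = sin y / y - 1 + y\<^sup>2 / 6"
    using assms by (simp add: field_simps power2_eq_square power3_eq_cube)
  moreover have "\<bar>y\<bar>^5 / 120 / \<bar>y\<bar> = y\<^sup>2 * y\<^sup>2 / 120"
    using assms by (simp add: field_simps numeral_eq_Suc abs_mult[symmetric])
  ultimately have "y\<^sup>2 / 6 - y\<^sup>2 * y\<^sup>2 / 120 \<le> 1 - sin y / y" by linarith
  moreover have "y\<^sup>2 * y\<^sup>2 \<le> y\<^sup>2 * 4"
    using power_mono[OF True, of 2] by (intro mult_left_mono) auto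
  moreover have "min 1 (y\<^sup>2) \<le> y\<^sup>2" "0 \<le> y\<^sup>2" by simp_all
  ultimately show ?thesis by linarith
next
  case False
  have "\<bar>sin y / y\<bar> \<le> 1 / 2"
    unfolding abs_divide by (subst pos_divide_le_eq) (use False abs_sin_le_one[of y] in linarith)+
  then have "sin y / y \<le> 1 / 2" by linarith
  then show ?thesis using min.cobounded1[of 1 "y\<^sup>2"] by linarith
qed

text \<open>The average of 1 - cos(z y) over 0 <= z <= 1 is 1 - sin y / y. Control of an exponent on
  [0, 1] therefore controls the integral of min(1, y^2).\<close>

lemma nn_integral_one_minus_cos_ge:
  fixes y :: real
  shows "ennreal (min 1 (y\<^sup>2) / 8) \<le> (\<integral>\<^sup>+z. ennreal (1 - cos (z * y)) * indicator {0..1} z \<partial>lborel)"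
proof (cases "y = 0")
  case False
  have "(\<integral>\<^sup>+z. ennreal (1 - cos (z * y)) * indicator {0..1} z \<partial>lborel) = ennreal ((1 - sin (1 * y) / y) - (0 - sin (0 * y) / y))"
    using False by (intro nn_integral_FTC_Icc) (auto intro!: derivative_eq_intros)
  then show ?thesis using one_minus_sinc_ge[OF False] by (simp add: ennreal_leI)
qed simp

text \<open>The cover consists of the null set {0} and the sets |x| >= 1/(n+1), which are finite by
  Chebyshev's inequality.\<close>

lemma levy_measure_sigma_finite:
  assumes "levy_measure \<mu>" shows "sigma_finite_measure \<mu>"
proof
  have sets: "sets \<mu> = sets borel" and z: "emeasure \<mu> {0} = 0" and fin: "(\<integral>\<^sup>+x. ennreal (min 1 (x\<^sup>2)) \<partial>\<mu>) < \<infinity>"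
    using assms by (auto simp: levy_measure_def)
  note [measurable_cong] = sets
  define A where "A n = {x::real. inverse (real (Suc n)) \<le> \<bar>x\<bar>}" for n
  have As [measurable]: "A n \<in> sets \<mu>" for n unfolding A_def by simp
  have "emeasure \<mu> (A n) \<noteq> \<infinity>" for n
  proof -
    define e where "e = (inverse (real (Suc n)))\<^sup>2"
    have e: "e > 0" "e \<le> 1" by (auto simp: e_def power_le_one inverse_le_1_iff)
    have "ennreal e * emeasure \<mu> (A n) = (\<integral>\<^sup>+x. ennreal e * indicator (A n) x \<partial>\<mu>)"
      by (subst nn_integral_cmult_indicator) auto
    also have "\<dots> \<le> (\<integral>\<^sup>+x. ennreal (min 1 (x\<^sup>2)) \<partial>\<mu>)"
    proof (rule nn_integral_mono)
      fix x
      show "ennreal e * indicator (A n) x \<le> ennreal (min 1 (x\<^sup>2))"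
      proof (cases "x \<in> A n")
        case True
        then have "e \<le> \<bar>x\<bar>\<^sup>2" unfolding e_def A_def by (intro power_mono) auto
        then show ?thesis using True e by (auto intro!: ennreal_leI)
      qed simp
    qed
    also have "\<dots> < \<infinity>" by fact
    finally show ?thesis using e by (auto simp: ennreal_mult_eq_top_iff ennreal_mult_less_top top.not_eq_extremum)
  qed
  moreover have "(\<Union>n. A n) \<union> {0} = UNIV"
  proof -
    have "x \<in> (\<Union>n. A n)" if "x \<noteq> 0" for x
    proof -
      from reals_Archimedean[of "\<bar>x\<bar>"] that obtain n where "inverse (real (Suc n)) < \<bar>x\<bar>" by auto
      then show ?thesis by (auto simp: A_def intro!: exI[of _ n])
    qed
    then show ?thesis by blast
  qed
  moreover have "space \<mu> = UNIV" using sets_eq_imp_space_eq[OF sets] by simp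
  ultimately show "\<exists>A. countable A \<and> A \<subseteq> sets \<mu> \<and> \<Union> A = space \<mu> \<and> (\<forall>a\<in>A. emeasure \<mu> a \<noteq> \<infinity>)"
    using z sets by (intro exI[of _ "insert {0} (range A)"]) (auto simp: countable_image)
qed

lemma levy_measure_integrable:
  fixes h :: "real \<Rightarrow> 'b::{banach, second_countable_topology}"
  assumes \<mu>: "levy_measure \<mu>" and h: "h \<in> borel_measurable borel"
    and le: "\<And>x. norm (h x) \<le> C * min 1 (x\<^sup>2)"
  shows "integrable \<mu> h"
proof -
  have sets [measurable_cong]: "sets \<mu> = sets borel" and fin: "(\<integral>\<^sup>+x. ennreal (min 1 (x\<^sup>2)) \<partial>\<mu>) < \<infinity>"
    using \<mu> by (auto simp: levy_measure_def)
  have "integrable \<mu> (\<lambda>x::real. min 1 (x\<^sup>2))"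
    using fin by (intro integrableI_nonneg) auto
  then have "integrable \<mu> (\<lambda>x::real. C * min 1 (x\<^sup>2))" by simp
  moreover have "h \<in> borel_measurable \<mu>" using h by measurable
  ultimately show ?thesis
    by (rule Bochner_Integration.integrable_bound) (use le in \<open>auto intro!: always_eventually order_trans[OF le] \<close>)
qed

text \<open>\<open>levy_khintchine\<close> truncates the jump x, \<open>levy_comp\<close> the
  product y x. The discrepancy sin(y x) - y x 1_[-1,1](x) is O(x^2) near 0 and bounded far out,
  hence integrable; it is multiplied by i \<zeta>, so it only joins the drift e y.\<close>

lemma levy_khintchine_eq_levy_comp:
  assumes \<mu>: "levy_measure \<mu>"
  obtains e :: "real \<Rightarrow> real" where
    "\<And>\<zeta> y. levy_khintchine a 0 \<mu> (\<zeta> * y) = \<i> * complex_of_real (\<zeta> * e y) + (CLINT x|\<mu>. levy_comp \<zeta> (y * x))"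
    "\<And>\<zeta> y. complex_integrable \<mu> (\<lambda>x. levy_comp \<zeta> (y * x))"
proof -
  have mm: "min 1 ((y * x)\<^sup>2) \<le> (1 + y\<^sup>2) * min 1 (x\<^sup>2)" for x y :: real
  proof (cases "x\<^sup>2 \<le> 1")
    case True
    then have "(1 + y\<^sup>2) * min 1 (x\<^sup>2) = x\<^sup>2 + (y * x)\<^sup>2" by (simp add: min_absorb2 distrib_right power_mult_distrib)
    then show ?thesis by (simp add: min.coboundedI2)
  next
    case False
    then have "(1 + y\<^sup>2) * min 1 (x\<^sup>2) = 1 + y\<^sup>2" by (simp add: min_absorb1)
    then show ?thesis using min.cobounded1[of 1 "(y * x)\<^sup>2"] zero_le_power2[of y] by linarith
  qed
  have i1: "complex_integrable \<mu> (\<lambda>x. levy_comp \<zeta> (y * x))" for \<zeta> y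
  proof (rule levy_measure_integrable[OF \<mu>])
    show "cmod (levy_comp \<zeta> (y * x)) \<le> ((4 + 5 * \<bar>\<zeta>\<bar> + \<zeta>\<^sup>2) * (1 + y\<^sup>2)) * min 1 (x\<^sup>2)" for x
      using order_trans[OF levy_comp_le mult_left_mono[OF mm]] by (simp add: mult.assoc)
  qed measurable
  have i2: "integrable \<mu> (\<lambda>x. sin (y * x) - y * x * indicator {-1..1} x)" for y
  proof (rule levy_measure_integrable[OF \<mu>])
    show "norm (sin (y * x) - y * x * indicator {-1..1} x) \<le> (1 + y\<^sup>2) * min 1 (x\<^sup>2)" for x
    proof (cases "\<bar>x\<bar> \<le> 1")
      case True
      then have "x\<^sup>2 \<le> 1" by (simp add: abs_square_le_1)
      have "\<bar>sin (y * x) - y * x\<bar> \<le> (y * x)\<^sup>2"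
        using abs_sin_diff_linear_le[of "y * x" 0] by simp
      also have "\<dots> \<le> (1 + y\<^sup>2) * x\<^sup>2" by (simp add: power_mult_distrib distrib_right)
      finally show ?thesis using True \<open>x\<^sup>2 \<le> 1\<close> by (auto simp: indicator_def min_def abs_le_iff)
    next
      case False
      then have "1 \<le> x\<^sup>2" using one_le_power[of "\<bar>x\<bar>" 2] by simp
      moreover have "\<bar>sin (y * x)\<bar> \<le> 1 + y\<^sup>2" using abs_sin_le_one[of "y * x"] zero_le_power2[of y] by linarith
      ultimately show ?thesis using False by (auto simp: indicator_def min_def abs_le_iff)
    qed
  qed measurable
  define e where "e y = y * a + (LINT x|\<mu>. sin (y * x) - y * x * indicator {-1..1} x)" for y
  show ?thesis
  proof (rule that[of e])
    show "levy_khintchine a 0 \<mu> (\<zeta> * y) = \<i> * complex_of_real (\<zeta> * e y) + (CLINT x|\<mu>. levy_comp \<zeta> (y * x))" for \<zeta> y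
    proof -
      have i3: "complex_integrable \<mu> (\<lambda>x. \<i> * complex_of_real (\<zeta> * (sin (y * x) - y * x * indicator {-1..1} x)))"
        by (intro integrable_mult_right integrable_of_real i2)
      have "(CLINT x|\<mu>. iexp (\<zeta> * y * x) - 1 - \<i> * complex_of_real (\<zeta> * y * x * indicator {-1..1} x))
        = (CLINT x|\<mu>. levy_comp \<zeta> (y * x) + \<i> * complex_of_real (\<zeta> * (sin (y * x) - y * x * indicator {-1..1} x)))"
        by (intro Bochner_Integration.integral_cong) (auto simp: levy_comp_def algebra_simps)
      also have "\<dots> = (CLINT x|\<mu>. levy_comp \<zeta> (y * x)) + (CLINT x|\<mu>. \<i> * complex_of_real (\<zeta> * (sin (y * x) - y * x * indicator {-1..1} x)))"
        by (rule Bochner_Integration.integral_add[OF i1 i3])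
      also have "(CLINT x|\<mu>. \<i> * complex_of_real (\<zeta> * (sin (y * x) - y * x * indicator {-1..1} x)))
        = \<i> * complex_of_real (\<zeta> * (LINT x|\<mu>. sin (y * x) - y * x * indicator {-1..1} x))"
        by (simp only: integral_mult_right_zero integral_complex_of_real)
      finally show ?thesis unfolding levy_khintchine_def e_def by (simp add: algebra_simps)
    qed
  qed (rule i1)
qed

text \<open>The condition at 0 removes the level set of 0, whose measure may be infinite.\<close>

lemma integral_simple_bochner_compose:
  fixes F :: "'s \<Rightarrow> real" and \<phi> :: "real \<Rightarrow> complex"
  assumes F: "Bochner_Integration.simple_bochner_integrable m F" and \<phi>: "\<phi> 0 = 0"
  shows "complex_integrable m (\<lambda>x. \<phi> (F x))"
    and "(CLINT x|m. \<phi> (F x)) = (\<Sum>y\<in>F ` space m - {0}. complex_of_real (measure m {x\<in>space m. F x = y}) * \<phi> y)"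
proof -
  have sf: "simple_function m F" and fin0: "emeasure m {x\<in>space m. F x \<noteq> 0} \<noteq> \<infinity>"
    using F by (auto simp: Bochner_Integration.simple_bochner_integrable.simps)
  have [measurable]: "F \<in> borel_measurable m" using sf by (rule borel_measurable_simple_function)
  have fin: "finite (F ` space m - {0})" using sf by (simp add: simple_function_def)
  have hb: "has_bochner_integral m (\<lambda>x. \<Sum>y\<in>F ` space m - {0}. indicator {x\<in>space m. F x = y} x *\<^sub>R \<phi> y)
     (\<Sum>y\<in>F ` space m - {0}. measure m {x\<in>space m. F x = y} *\<^sub>R \<phi> y)"
  proof (intro has_bochner_integral_sum has_bochner_integral_scaleR_left has_bochner_integral_real_indicator)
    fix y assume y: "y \<in> F ` space m - {0}"
    have "emeasure m {x\<in>space m. F x = y} \<le> emeasure m {x\<in>space m. F x \<noteq> 0}"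
      using y by (intro emeasure_mono) auto
    then show "emeasure m {x\<in>space m. F x = y} < \<infinity>" using fin0 by (simp add: top.not_eq_extremum le_less_trans)
  qed measurable
  have eq: "(\<Sum>y\<in>F ` space m - {0}. indicator {x\<in>space m. F x = y} x *\<^sub>R \<phi> y) = \<phi> (F x)" if x: "x \<in> space m" for x
  proof -
    have "(\<Sum>y\<in>F ` space m - {0}. indicator {x\<in>space m. F x = y} x *\<^sub>R \<phi> y)
      = (\<Sum>y\<in>F ` space m - {0}. if y = F x then \<phi> (F x) else 0)"
      using x by (intro sum.cong) (auto simp: indicator_def)
    also have "\<dots> = \<phi> (F x)" using fin x \<phi> by (auto simp: sum.delta)
    finally show ?thesis .
  qed
  have hb2: "has_bochner_integral m (\<lambda>x. \<phi> (F x)) (\<Sum>y\<in>F ` space m - {0}. measure m {x\<in>space m. F x = y} *\<^sub>R \<phi> y)"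
    using hb by (subst has_bochner_integral_cong[OF refl eq[symmetric] refl]) simp_all
  show "complex_integrable m (\<lambda>x. \<phi> (F x))" using hb2 by (rule integrable.intros)
  show "(CLINT x|m. \<phi> (F x)) = (\<Sum>y\<in>F ` space m - {0}. complex_of_real (measure m {x\<in>space m. F x = y}) * \<phi> y)"
    using has_bochner_integral_integral_eq[OF hb2] by (simp add: scaleR_conv_of_real)
qed

section \<open>Convergence in probability through E min(1, |U - V|)\<close>

text \<open>The difference of the exponentials is at most |\<zeta>| |U - V| and at most 2, so the
  metric of convergence in probability controls characteristic functions.\<close>

lemma (in prob_space) char_diff_le:
  assumes [measurable]: "U \<in> borel_measurable M" "V \<in> borel_measurable M"
  shows "cmod (char (distr M borel U) \<zeta> - char (distr M borel V) \<zeta>)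
     \<le> (2 + \<bar>\<zeta>\<bar>) * expectation (\<lambda>\<omega>. min 1 \<bar>U \<omega> - V \<omega>\<bar>)"
proof -
  have iU: "integrable M (\<lambda>\<omega>. iexp (\<zeta> * U \<omega>))" and iV: "integrable M (\<lambda>\<omega>. iexp (\<zeta> * V \<omega>))"
    by (intro integrable_iexp; simp)+
  have im: "integrable M (\<lambda>\<omega>. (2 + \<bar>\<zeta>\<bar>) * min 1 \<bar>U \<omega> - V \<omega>\<bar>)"
    by (intro integrable_mult_right integrable_const_bound[of _ 1]) auto
  have "char (distr M borel U) \<zeta> - char (distr M borel V) \<zeta> = (CLINT \<omega>|M. iexp (\<zeta> * U \<omega>) - iexp (\<zeta> * V \<omega>))"
    using iU iV unfolding char_def by (simp add: integral_distr)
  then have "cmod (char (distr M borel U) \<zeta> - char (distr M borel V) \<zeta>) \<le> expectation (\<lambda>\<omega>. cmod (iexp (\<zeta> * U \<omega>) - iexp (\<zeta> * V \<omega>)))"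
    by (simp only: integral_norm_bound)
  also have "\<dots> \<le> expectation (\<lambda>\<omega>. (2 + \<bar>\<zeta>\<bar>) * min 1 \<bar>U \<omega> - V \<omega>\<bar>)"
  proof (rule integral_mono[OF _ im])
    show "integrable M (\<lambda>\<omega>. cmod (iexp (\<zeta> * U \<omega>) - iexp (\<zeta> * V \<omega>)))"
      using iU iV by auto
    fix \<omega>
    show "cmod (iexp (\<zeta> * U \<omega>) - iexp (\<zeta> * V \<omega>)) \<le> (2 + \<bar>\<zeta>\<bar>) * min 1 \<bar>U \<omega> - V \<omega>\<bar>"
    proof (cases "\<bar>U \<omega> - V \<omega>\<bar> \<le> 1")
      case True
      have "cmod (iexp (\<zeta> * U \<omega>) - iexp (\<zeta> * V \<omega>)) \<le> \<bar>\<zeta>\<bar> * \<bar>U \<omega> - V \<omega>\<bar>"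
        using norm_iexp_diff_le[of "\<zeta> * U \<omega>" "\<zeta> * V \<omega>"] by (simp add: abs_mult[symmetric] right_diff_distrib)
      also have "\<dots> \<le> (2 + \<bar>\<zeta>\<bar>) * \<bar>U \<omega> - V \<omega>\<bar>" by (intro mult_right_mono) auto
      finally show ?thesis using True by (simp add: min_absorb2)
    next
      case False
      have "cmod (iexp (\<zeta> * U \<omega>) - iexp (\<zeta> * V \<omega>)) \<le> 1 + 1"
        using norm_triangle_ineq4[of "iexp (\<zeta> * U \<omega>)" "iexp (\<zeta> * V \<omega>)"] by simp
      then show ?thesis using False by (simp add: min_absorb1)
    qed
  qed
  finally show ?thesis by simp
qed

text \<open>Replaces probabilities of deviations by a single expectation that satisfies the triangle
  inequality, which makes Cauchy estimates between approximants simple.\<close>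

lemma (in prob_space) converges_in_probability_imp_L0:
  assumes c: "converges_in_probability M Y Z"
  shows "(\<lambda>n. expectation (\<lambda>\<omega>. min 1 \<bar>Y n \<omega> - Z \<omega>\<bar>)) \<longlonglongrightarrow> 0"
proof (rule LIMSEQ_I)
  fix r :: real assume r: "r > 0"
  have [measurable]: "Y n \<in> borel_measurable M" "Z \<in> borel_measurable M" for n
    using c by (auto simp: converges_in_probability_def)
  have "(\<lambda>n. prob {\<omega>\<in>space M. \<bar>Y n \<omega> - Z \<omega>\<bar> > r/2}) \<longlonglongrightarrow> 0"
    using c r half_gt_zero[OF r] unfolding converges_in_probability_def by blast
  then have "\<forall>\<^sub>F n in sequentially. prob {\<omega>\<in>space M. \<bar>Y n \<omega> - Z \<omega>\<bar> > r/2} < r / 2"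
    using r by (intro order_tendstoD) auto
  then obtain n0 where n0: "\<And>n. n \<ge> n0 \<Longrightarrow> prob {\<omega>\<in>space M. \<bar>Y n \<omega> - Z \<omega>\<bar> > r/2} < r / 2"
    by (auto simp: eventually_sequentially)
  show "\<exists>no. \<forall>n\<ge>no. norm (expectation (\<lambda>\<omega>. min 1 \<bar>Y n \<omega> - Z \<omega>\<bar>) - 0) < r"
  proof (intro exI[of _ n0] allI impI)
    fix n assume n: "n \<ge> n0"
    let ?A = "{\<omega>\<in>space M. \<bar>Y n \<omega> - Z \<omega>\<bar> > r/2}"
    have "expectation (\<lambda>\<omega>. min 1 \<bar>Y n \<omega> - Z \<omega>\<bar>) \<le> expectation (\<lambda>\<omega>. r / 2 + indicator ?A \<omega>)"
    proof (rule integral_mono)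
      show "integrable M (\<lambda>\<omega>. min 1 \<bar>Y n \<omega> - Z \<omega>\<bar>)" by (intro integrable_const_bound[of _ 1]) auto
      show "integrable M (\<lambda>\<omega>. r / 2 + indicat_real ?A \<omega>)"
        by (intro Bochner_Integration.integrable_add integrable_const integrable_real_indicator) (auto simp: emeasure_eq_measure)
      show "min 1 \<bar>Y n \<omega> - Z \<omega>\<bar> \<le> r / 2 + indicator ?A \<omega>" if "\<omega> \<in> space M" for \<omega>
        using that r by (auto simp: indicator_def min_def)
    qed
    also have "\<dots> = r / 2 + prob ?A"
      by (subst Bochner_Integration.integral_add) (auto simp: prob_space emeasure_eq_measure)
    also have "\<dots> < r" using n0[OF n] by simp
    finally have "expectation (\<lambda>\<omega>. min 1 \<bar>Y n \<omega> - Z \<omega>\<bar>) < r" .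
    moreover have "0 \<le> expectation (\<lambda>\<omega>. min 1 \<bar>Y n \<omega> - Z \<omega>\<bar>)" by (intro integral_nonneg_AE) auto
    ultimately show "norm (expectation (\<lambda>\<omega>. min 1 \<bar>Y n \<omega> - Z \<omega>\<bar>) - 0) < r" by simp
  qed
qed

context levy_basis_space
begin

text \<open>The approximating sequence is made explicit, so that the sequences of two integrals can
  be combined, and convergence in probability is expressed by the metric E min(1, |.|).\<close>

definition approximates :: "(nat \<Rightarrow> 's \<Rightarrow> real) \<Rightarrow> ('s \<Rightarrow> real) \<Rightarrow> ('w \<Rightarrow> real) \<Rightarrow> bool" where
  "approximates F f Y \<longleftrightarrow> (\<forall>n. Bochner_Integration.simple_bochner_integrable m (F n)) \<and>
     f \<in> borel_measurable m \<and> Y \<in> borel_measurable M \<and> (AE x in m. (\<lambda>n. F n x) \<longlonglongrightarrow> f x) \<and>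
     (\<lambda>n. expectation (\<lambda>\<omega>. min 1 \<bar>Sint (F n) \<omega> - Y \<omega>\<bar>)) \<longlonglongrightarrow> 0"

lemma has_stochastic_integral_imp_approximates:
  assumes "has_stochastic_integral M m \<Lambda> f Y" obtains F where "approximates F f Y"
proof -
  obtain F where "\<forall>n. Bochner_Integration.simple_bochner_integrable m (F n)"
    "AE x in m. (\<lambda>n. F n x) \<longlonglongrightarrow> f x" and c: "converges_in_probability M (\<lambda>n. Sint (F n)) Y"
    and "f \<in> borel_measurable m"
    using assms unfolding has_stochastic_integral_def by blast
  moreover have "Y \<in> borel_measurable M" using c by (simp add: converges_in_probability_def)
  ultimately have "approximates F f Y"
    using converges_in_probability_imp_L0[OF c] unfolding approximates_def by blast
  then show ?thesis by (rule that)
qed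

lemma min_1_lincomb_le:
  "min 1 \<bar>c * u + d * v\<bar> \<le> (1 + \<bar>c\<bar>) * min 1 \<bar>u\<bar> + (1 + \<bar>d\<bar>) * min 1 \<bar>v::real\<bar>"
proof -
  have *: "min 1 \<bar>c * u\<bar> \<le> (1 + \<bar>c\<bar>) * min 1 \<bar>u\<bar>" for c u :: real
  proof (cases "\<bar>u\<bar> \<le> 1")
    case True
    have "min 1 \<bar>c * u\<bar> \<le> \<bar>c\<bar> * \<bar>u\<bar>" by (simp add: abs_mult min.coboundedI2)
    also have "\<dots> \<le> (1 + \<bar>c\<bar>) * \<bar>u\<bar>" by (intro mult_right_mono) auto
    finally show ?thesis using True by (simp add: min_absorb2)
  qed (simp add: min_absorb1 min.coboundedI1)
  have "min 1 \<bar>c * u + d * v\<bar> \<le> min 1 \<bar>c * u\<bar> + min 1 \<bar>d * v\<bar>" by (auto simp: min_def)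
  then show ?thesis using *[of c u] *[of d v] by linarith
qed

text \<open>Combining the approximating sequences termwise makes the stochastic integral linear;
  this is what turns Riemann sums of X into stochastic integrals.\<close>

lemma approximates_lincomb:
  assumes F: "approximates F f Y" and G: "approximates G g Z"
  shows "approximates (\<lambda>n x. c * F n x + d * G n x) (\<lambda>x. c * f x + d * g x) (\<lambda>\<omega>. c * Y \<omega> + d * Z \<omega>)"
proof -
  have sF: "Bochner_Integration.simple_bochner_integrable m (F n)" and sG: "Bochner_Integration.simple_bochner_integrable m (G n)" for n
    using F G by (auto simp: approximates_def)
  have [measurable]: "Sint (F n) \<in> borel_measurable M" "Sint (G n) \<in> borel_measurable M" for n
    using sF sG by (auto intro: Sint_measurable)
  have sH: "Bochner_Integration.simple_bochner_integrable m (\<lambda>x. c * F n x + d * G n x)" for n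
    by (rule simple_bochner_integrable_lincomb[OF sF sG])
  have [measurable]: "Sint (\<lambda>x. c * F n x + d * G n x) \<in> borel_measurable M" for n
    using sH by (rule Sint_measurable)
  have [measurable]: "f \<in> borel_measurable m" "g \<in> borel_measurable m" "Y \<in> borel_measurable M" "Z \<in> borel_measurable M"
    using F G by (auto simp: approximates_def)
  have int: "integrable M (\<lambda>\<omega>. min 1 \<bar>U \<omega>\<bar>)" if [measurable]: "U \<in> borel_measurable M" for U :: "'w \<Rightarrow> real"
    by (intro integrable_const_bound[of _ 1]) auto
  have "AE x in m. (\<lambda>n. c * F n x + d * G n x) \<longlonglongrightarrow> c * f x + d * g x"
    using F G unfolding approximates_def by (auto elim!: eventually_elim2 intro!: tendsto_intros)
  moreover have "(\<lambda>n. expectation (\<lambda>\<omega>. min 1 \<bar>Sint (\<lambda>x. c * F n x + d * G n x) \<omega> - (c * Y \<omega> + d * Z \<omega>)\<bar>)) \<longlonglongrightarrow> 0"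
  proof (rule tendsto_sandwich[where f = "\<lambda>_. 0"])
    show "\<forall>\<^sub>F n in sequentially. 0 \<le> expectation (\<lambda>\<omega>. min 1 \<bar>Sint (\<lambda>x. c * F n x + d * G n x) \<omega> - (c * Y \<omega> + d * Z \<omega>)\<bar>)"
      by (intro always_eventually allI integral_nonneg_AE) auto
    have "(\<lambda>n. (1 + \<bar>c\<bar>) * expectation (\<lambda>\<omega>. min 1 \<bar>Sint (F n) \<omega> - Y \<omega>\<bar>) + (1 + \<bar>d\<bar>) * expectation (\<lambda>\<omega>. min 1 \<bar>Sint (G n) \<omega> - Z \<omega>\<bar>))
       \<longlonglongrightarrow> (1 + \<bar>c\<bar>) * 0 + (1 + \<bar>d\<bar>) * 0"
      using F G unfolding approximates_def by (intro tendsto_intros) auto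
    then show "(\<lambda>n. (1 + \<bar>c\<bar>) * expectation (\<lambda>\<omega>. min 1 \<bar>Sint (F n) \<omega> - Y \<omega>\<bar>) + (1 + \<bar>d\<bar>) * expectation (\<lambda>\<omega>. min 1 \<bar>Sint (G n) \<omega> - Z \<omega>\<bar>))
       \<longlonglongrightarrow> 0" by simp
    show "\<forall>\<^sub>F n in sequentially. expectation (\<lambda>\<omega>. min 1 \<bar>Sint (\<lambda>x. c * F n x + d * G n x) \<omega> - (c * Y \<omega> + d * Z \<omega>)\<bar>)
       \<le> (1 + \<bar>c\<bar>) * expectation (\<lambda>\<omega>. min 1 \<bar>Sint (F n) \<omega> - Y \<omega>\<bar>) + (1 + \<bar>d\<bar>) * expectation (\<lambda>\<omega>. min 1 \<bar>Sint (G n) \<omega> - Z \<omega>\<bar>)"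
    proof (intro always_eventually allI)
      fix n
      have "expectation (\<lambda>\<omega>. min 1 \<bar>Sint (\<lambda>x. c * F n x + d * G n x) \<omega> - (c * Y \<omega> + d * Z \<omega>)\<bar>)
        = expectation (\<lambda>\<omega>. min 1 \<bar>c * (Sint (F n) \<omega> - Y \<omega>) + d * (Sint (G n) \<omega> - Z \<omega>)\<bar>)"
        using Sint_lincomb[OF sF[of n] sG[of n], of c d]
        by (intro integral_cong_AE) (auto elim!: eventually_mono simp: algebra_simps)
      also have "\<dots> \<le> expectation (\<lambda>\<omega>. (1 + \<bar>c\<bar>) * min 1 \<bar>Sint (F n) \<omega> - Y \<omega>\<bar> + (1 + \<bar>d\<bar>) * min 1 \<bar>Sint (G n) \<omega> - Z \<omega>\<bar>)"
        by (intro integral_mono int Bochner_Integration.integrable_add integrable_mult_right min_1_lincomb_le) measurable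
      also have "\<dots> = (1 + \<bar>c\<bar>) * expectation (\<lambda>\<omega>. min 1 \<bar>Sint (F n) \<omega> - Y \<omega>\<bar>) + (1 + \<bar>d\<bar>) * expectation (\<lambda>\<omega>. min 1 \<bar>Sint (G n) \<omega> - Z \<omega>\<bar>)"
        by (subst Bochner_Integration.integral_add) (auto intro!: int integrable_mult_right)
      finally show "expectation (\<lambda>\<omega>. min 1 \<bar>Sint (\<lambda>x. c * F n x + d * G n x) \<omega> - (c * Y \<omega> + d * Z \<omega>)\<bar>)
       \<le> (1 + \<bar>c\<bar>) * expectation (\<lambda>\<omega>. min 1 \<bar>Sint (F n) \<omega> - Y \<omega>\<bar>) + (1 + \<bar>d\<bar>) * expectation (\<lambda>\<omega>. min 1 \<bar>Sint (G n) \<omega> - Z \<omega>\<bar>)" .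
    qed
  qed auto
  ultimately show ?thesis using sH unfolding approximates_def by simp
qed

end

section \<open>The exponent of an integral controls its kernel\<close>

locale pure_jump_levy_basis = levy_basis_space M m "levy_khintchine a 0 \<mu>" \<Lambda> + m: sigma_finite_measure m
  for M :: "'w measure" and m :: "'s measure" and a :: real and \<mu> :: "real measure" and \<Lambda> +
  assumes levy: "levy_measure \<mu>"
begin

sublocale mu: sigma_finite_measure \<mu>
  by (rule levy_measure_sigma_finite[OF levy])

sublocale N: pair_sigma_finite m \<mu> ..

lemma sets_mu [measurable_cong]: "sets \<mu> = sets borel"
  using levy by (simp add: levy_measure_def)

abbreviation jump :: "('s \<Rightarrow> real) \<Rightarrow> 's \<times> real \<Rightarrow> real" where
  "jump f z \<equiv> f (fst z) * snd z"

text \<open>The jump part of the Rajput-Rosinski modular; its finiteness makes the integral of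
  \<open>levy_comp\<close> along the kernel converge.\<close>

definition modular :: "('s \<Rightarrow> real) \<Rightarrow> ennreal" where
  "modular f = (\<integral>\<^sup>+z. ennreal (min 1 ((jump f z)\<^sup>2)) \<partial>(m \<Otimes>\<^sub>M \<mu>))"

lemma integrable_levy_comp:
  assumes [measurable]: "f \<in> borel_measurable m" and fin: "modular f < \<infinity>"
  shows "complex_integrable (m \<Otimes>\<^sub>M \<mu>) (\<lambda>z. levy_comp \<zeta> (jump f z))"
proof (rule Bochner_Integration.integrable_bound)
  show "integrable (m \<Otimes>\<^sub>M \<mu>) (\<lambda>z. (4 + 5 * \<bar>\<zeta>\<bar> + \<zeta>\<^sup>2) * min 1 ((jump f z)\<^sup>2))"
    using fin unfolding modular_def by (intro integrable_mult_right integrableI_nonneg) auto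
  show "AE z in m \<Otimes>\<^sub>M \<mu>. cmod (levy_comp \<zeta> (jump f z)) \<le> norm ((4 + 5 * \<bar>\<zeta>\<bar> + \<zeta>\<^sup>2) * min 1 ((jump f z)\<^sup>2))"
    by (intro always_eventually allI order_trans[OF levy_comp_le]) simp
qed measurable

lemma modular_simple_finite:
  assumes F: "Bochner_Integration.simple_bochner_integrable m F"
  shows "modular F < \<infinity>"
proof -
  have sf: "simple_function m F" and fin0: "emeasure m {x\<in>space m. F x \<noteq> 0} \<noteq> \<infinity>"
    using F by (auto simp: Bochner_Integration.simple_bochner_integrable.simps)
  have [measurable]: "F \<in> borel_measurable m" using sf by (rule borel_measurable_simple_function)
  have "finite (F ` space m)" using sf by (simp add: simple_function_def)
  then obtain B where B: "\<And>x. x \<in> space m \<Longrightarrow> \<bar>F x\<bar> \<le> B"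
    by (metis finite_imp_bounded bounded_iff imageI real_norm_def)
  let ?S = "{x\<in>space m. F x \<noteq> 0}"
  have "modular F \<le> (\<integral>\<^sup>+z. indicator ?S (fst z) * (ennreal (1 + B\<^sup>2) * ennreal (min 1 ((snd z)\<^sup>2))) \<partial>(m \<Otimes>\<^sub>M \<mu>))"
    unfolding modular_def
  proof (rule nn_integral_mono)
    fix z assume z: "z \<in> space (m \<Otimes>\<^sub>M \<mu>)"
    then have s: "fst z \<in> space m" by (auto simp: space_pair_measure)
    show "ennreal (min 1 ((jump F z)\<^sup>2)) \<le> indicator ?S (fst z) * (ennreal (1 + B\<^sup>2) * ennreal (min 1 ((snd z)\<^sup>2)))"
    proof (cases "F (fst z) = 0")
      case False
      have FB: "(F (fst z))\<^sup>2 \<le> B\<^sup>2" using B[OF s] by (simp add: abs_le_square_iff[symmetric])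
      have "min 1 ((jump F z)\<^sup>2) \<le> (1 + B\<^sup>2) * min 1 ((snd z)\<^sup>2)"
      proof (cases "(snd z)\<^sup>2 \<le> 1")
        case True
        have "(jump F z)\<^sup>2 \<le> (1 + B\<^sup>2) * (snd z)\<^sup>2"
          unfolding power_mult_distrib using FB by (intro mult_right_mono) auto
        then show ?thesis using True by (simp add: min_absorb2 min.coboundedI2)
      next
        case F: False
        then have "(1 + B\<^sup>2) * min 1 ((snd z)\<^sup>2) = 1 + B\<^sup>2" by (simp add: min_absorb1)
        then show ?thesis using min.cobounded1[of 1 "(jump F z)\<^sup>2"] zero_le_power2[of B] by linarith
      qed
      then have "ennreal (min 1 ((jump F z)\<^sup>2)) \<le> ennreal (1 + B\<^sup>2) * ennreal (min 1 ((snd z)\<^sup>2))"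
        by (subst ennreal_mult[symmetric]) (auto intro: ennreal_leI)
      then show ?thesis using s False by simp
    qed simp
  qed
  also have "\<dots> = (\<integral>\<^sup>+x. \<integral>\<^sup>+u. indicator ?S x * (ennreal (1 + B\<^sup>2) * ennreal (min 1 (u\<^sup>2))) \<partial>\<mu> \<partial>m)"
    by (subst mu.nn_integral_fst[symmetric]) auto
  also have "\<dots> = emeasure m ?S * (ennreal (1 + B\<^sup>2) * (\<integral>\<^sup>+u. ennreal (min 1 (u\<^sup>2)) \<partial>\<mu>))"
    by (simp add: nn_integral_cmult nn_integral_multc)
  also have "\<dots> < \<infinity>"
    using levy fin0 by (auto simp: levy_measure_def ennreal_mult_less_top top.not_eq_extremum)
  finally show ?thesis .
qed

text \<open>The drift d is a finite sum of drifts e y weighted by the level sets. Only its existence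
  is recorded, since along an approximating sequence these numbers are not under control.\<close>

lemma char_Sint_levy:
  assumes F: "Bochner_Integration.simple_bochner_integrable m F"
  obtains d where "\<And>\<zeta>. char (distr M borel (Sint F)) \<zeta>
     = exp (\<i> * complex_of_real (\<zeta> * d) + (CLINT z|(m \<Otimes>\<^sub>M \<mu>). levy_comp \<zeta> (jump F z)))"
proof -
  have [measurable]: "F \<in> borel_measurable m"
    using F by (auto simp: Bochner_Integration.simple_bochner_integrable.simps intro: borel_measurable_simple_function)
  obtain e :: "real \<Rightarrow> real" where e: "\<And>\<zeta> y. levy_khintchine a 0 \<mu> (\<zeta> * y) = \<i> * complex_of_real (\<zeta> * e y) + (CLINT x|\<mu>. levy_comp \<zeta> (y * x))"
    using levy_khintchine_eq_levy_comp[OF levy] by metis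
  define w where "w y = measure m {x\<in>space m. F x = y}" for y
  define J where "J = F ` space m - {0}"
  have "char (distr M borel (Sint F)) \<zeta>
     = exp (\<i> * complex_of_real (\<zeta> * (\<Sum>y\<in>J. w y * e y)) + (CLINT z|(m \<Otimes>\<^sub>M \<mu>). levy_comp \<zeta> (jump F z)))" for \<zeta>
  proof -
    have "(CLINT z|(m \<Otimes>\<^sub>M \<mu>). levy_comp \<zeta> (jump F z)) = (CLINT x|m. CLINT u|\<mu>. levy_comp \<zeta> (F x * u))"
      using N.integral_fst'[OF integrable_levy_comp[OF _ modular_simple_finite[OF F]]] by simp
    also have "\<dots> = (\<Sum>y\<in>J. complex_of_real (w y) * (CLINT u|\<mu>. levy_comp \<zeta> (y * u)))"
      unfolding J_def w_def by (rule integral_simple_bochner_compose(2)[OF F]) simp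
    finally have G: "(CLINT z|(m \<Otimes>\<^sub>M \<mu>). levy_comp \<zeta> (jump F z)) = (\<Sum>y\<in>J. complex_of_real (w y) * (CLINT u|\<mu>. levy_comp \<zeta> (y * u)))" .
    have "(\<Sum>y\<in>J. complex_of_real (w y) * levy_khintchine a 0 \<mu> (\<zeta> * y))
      = (\<Sum>y\<in>J. complex_of_real (w y) * (\<i> * complex_of_real (\<zeta> * e y))) + (CLINT z|(m \<Otimes>\<^sub>M \<mu>). levy_comp \<zeta> (jump F z))"
      unfolding e G distrib_left sum.distrib ..
    also have "(\<Sum>y\<in>J. complex_of_real (w y) * (\<i> * complex_of_real (\<zeta> * e y))) = \<i> * complex_of_real (\<zeta> * (\<Sum>y\<in>J. w y * e y))"
      by (simp add: sum_distrib_left mult_ac)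
    finally have "(\<Sum>y\<in>J. complex_of_real (w y) * levy_khintchine a 0 \<mu> (\<zeta> * y))
      = \<i> * complex_of_real (\<zeta> * (\<Sum>y\<in>J. w y * e y)) + (CLINT z|(m \<Otimes>\<^sub>M \<mu>). levy_comp \<zeta> (jump F z))" .
    then show ?thesis using char_Sint[OF F, of \<zeta>] by (simp add: J_def w_def)
  qed
  then show ?thesis by (rule that)
qed

lemma one_minus_cos_jump:
  assumes [measurable]: "f \<in> borel_measurable m" and fin: "modular f < \<infinity>"
  shows "(\<integral>\<^sup>+z. ennreal (1 - cos (\<zeta> * jump f z)) \<partial>(m \<Otimes>\<^sub>M \<mu>))
      = ennreal (- Re (CLINT z|(m \<Otimes>\<^sub>M \<mu>). levy_comp \<zeta> (jump f z)))"
    and "Re (CLINT z|(m \<Otimes>\<^sub>M \<mu>). levy_comp \<zeta> (jump f z)) \<le> 0"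
proof -
  note int = integrable_levy_comp[OF assms, of \<zeta>]
  have eq: "- Re (CLINT z|(m \<Otimes>\<^sub>M \<mu>). levy_comp \<zeta> (jump f z)) = (LINT z|(m \<Otimes>\<^sub>M \<mu>). 1 - cos (\<zeta> * jump f z))"
    by (subst integral_Re[OF int, symmetric], subst integral_minus[symmetric]) (simp add: Re_levy_comp)
  have "integrable (m \<Otimes>\<^sub>M \<mu>) (\<lambda>z. - Re (levy_comp \<zeta> (jump f z)))"
    using integrable_Re[OF int] by (rule integrable_minus)
  then have i: "integrable (m \<Otimes>\<^sub>M \<mu>) (\<lambda>z. 1 - cos (\<zeta> * jump f z))" by (simp add: Re_levy_comp)
  show "(\<integral>\<^sup>+z. ennreal (1 - cos (\<zeta> * jump f z)) \<partial>(m \<Otimes>\<^sub>M \<mu>))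
      = ennreal (- Re (CLINT z|(m \<Otimes>\<^sub>M \<mu>). levy_comp \<zeta> (jump f z)))"
    unfolding eq using i by (subst nn_integral_eq_integral) auto
  have "0 \<le> (LINT z|(m \<Otimes>\<^sub>M \<mu>). 1 - cos (\<zeta> * jump f z))" by (intro integral_nonneg_AE) auto
  then show "Re (CLINT z|(m \<Otimes>\<^sub>M \<mu>). levy_comp \<zeta> (jump f z)) \<le> 0" using eq by linarith
qed

text \<open>The a priori estimate: an integral small in probability has a small kernel. On [0, 1]
  the characteristic function is within 3r of 1, so minus the real part of the exponent is at most
  6r there; the drift drops out of the modulus. Averaging over frequencies costs 8, hence
  48.\<close>

lemma modular_le:
  assumes F: "Bochner_Integration.simple_bochner_integrable m F"
    and r: "expectation (\<lambda>\<omega>. min 1 \<bar>Sint F \<omega>\<bar>) \<le> r" "6 * r \<le> 1"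
  shows "modular F \<le> ennreal (48 * r)"
proof -
  have [measurable]: "F \<in> borel_measurable m"
    using F by (auto simp: Bochner_Integration.simple_bochner_integrable.simps intro: borel_measurable_simple_function)
  note [measurable] = Sint_measurable[OF F]
  have "0 \<le> expectation (\<lambda>\<omega>. min 1 \<bar>Sint F \<omega>\<bar>)" by (intro integral_nonneg_AE) auto
  then have r0: "0 \<le> r" using r by linarith
  obtain d where d: "\<And>\<zeta>. char (distr M borel (Sint F)) \<zeta>
     = exp (\<i> * complex_of_real (\<zeta> * d) + (CLINT z|(m \<Otimes>\<^sub>M \<mu>). levy_comp \<zeta> (jump F z)))"
    using char_Sint_levy[OF F] by blast
  have Q: "(\<integral>\<^sup>+z. ennreal (1 - cos (\<zeta> * jump F z)) \<partial>(m \<Otimes>\<^sub>M \<mu>)) \<le> ennreal (6 * r)" if \<zeta>: "0 \<le> \<zeta>" "\<zeta> \<le> 1" for \<zeta>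
  proof -
    define q where "q = - Re (CLINT z|(m \<Otimes>\<^sub>M \<mu>). levy_comp \<zeta> (jump F z))"
    have "cmod (char (distr M borel (Sint F)) \<zeta>) = exp (- q)" unfolding d q_def by simp
    moreover have "cmod (char (distr M borel (Sint F)) \<zeta> - 1) \<le> 3 * r"
    proof -
      have "char (distr M borel (\<lambda>_. 0::real)) \<zeta> = 1"
        unfolding char_def by (subst integral_distr) (auto simp: prob_space)
      then have "cmod (char (distr M borel (Sint F)) \<zeta> - 1) \<le> (2 + \<bar>\<zeta>\<bar>) * expectation (\<lambda>\<omega>. min 1 \<bar>Sint F \<omega>\<bar>)"
        using char_diff_le[of "Sint F" "\<lambda>_. 0" \<zeta>] by simp
      also have "\<dots> \<le> 3 * r" using \<zeta> r r0 by (intro mult_mono) auto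
      finally show ?thesis .
    qed
    ultimately have "1 - 3 * r \<le> exp (- q)"
      using norm_triangle_ineq4[of "char (distr M borel (Sint F)) \<zeta>" "char (distr M borel (Sint F)) \<zeta> - 1"] by simp
    moreover have "exp (- (6 * r)) \<le> 1 - 3 * r"
    proof -
      define u where "u = 6 * r"
      have u: "0 \<le> u" "u \<le> 1" using r r0 by (auto simp: u_def)
      have "1 \<le> (1 - u / 2) * (1 + u)" using u by (simp add: field_simps) (metis mult_left_le)
      also have "\<dots> \<le> (1 - u/2) * exp u" using u by (intro mult_left_mono) auto
      finally have "exp (- u) \<le> 1 - u / 2" by (simp add: exp_minus field_simps)
      then show ?thesis by (simp add: u_def)
    qed
    ultimately have "exp (- (6 * r)) \<le> exp (- q)" by linarith
    then have "q \<le> 6 * r" by simp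
    then show ?thesis using one_minus_cos_jump(1)[OF _ modular_simple_finite[OF F]] by (simp add: q_def ennreal_leI)
  qed
  interpret LN: pair_sigma_finite lborel "m \<Otimes>\<^sub>M \<mu>"
    by (intro pair_sigma_finite.intro lborel.sigma_finite_measure_axioms N.sigma_finite_measure_axioms)
  have "(\<integral>\<^sup>+z. ennreal (min 1 ((jump F z)\<^sup>2) / 8) \<partial>(m \<Otimes>\<^sub>M \<mu>))
     \<le> (\<integral>\<^sup>+z. (\<integral>\<^sup>+\<zeta>. ennreal (1 - cos (\<zeta> * jump F z)) * indicator {0..1} \<zeta> \<partial>lborel) \<partial>(m \<Otimes>\<^sub>M \<mu>))"
    by (intro nn_integral_mono nn_integral_one_minus_cos_ge)
  also have "\<dots> = (\<integral>\<^sup>+\<zeta>. (\<integral>\<^sup>+z. ennreal (1 - cos (\<zeta> * jump F z)) * indicator {0..1} \<zeta> \<partial>(m \<Otimes>\<^sub>M \<mu>)) \<partial>lborel)"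
    by (rule LN.Fubini') measurable
  also have "\<dots> \<le> (\<integral>\<^sup>+\<zeta>. ennreal (6 * r) * indicator {0..1} (\<zeta>::real) \<partial>lborel)"
  proof (rule nn_integral_mono)
    fix \<zeta> :: real
    show "(\<integral>\<^sup>+z. ennreal (1 - cos (\<zeta> * jump F z)) * indicator {0..1} \<zeta> \<partial>(m \<Otimes>\<^sub>M \<mu>)) \<le> ennreal (6 * r) * indicator {0..1} \<zeta>"
      using Q[of \<zeta>] by (cases "\<zeta> \<in> {0..1}") simp_all
  qed
  also have "\<dots> = ennreal (6 * r)" by (subst nn_integral_cmult_indicator) auto
  finally have *: "(\<integral>\<^sup>+z. ennreal (min 1 ((jump F z)\<^sup>2) / 8) \<partial>(m \<Otimes>\<^sub>M \<mu>)) \<le> ennreal (6 * r)" .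
  have "modular F = (\<integral>\<^sup>+z. ennreal 8 * ennreal (min 1 ((jump F z)\<^sup>2) / 8) \<partial>(m \<Otimes>\<^sub>M \<mu>))"
    unfolding modular_def by (intro nn_integral_cong) (simp add: ennreal_mult'[symmetric] del: ennreal_numeral)
  also have "\<dots> = ennreal 8 * (\<integral>\<^sup>+z. ennreal (min 1 ((jump F z)\<^sup>2) / 8) \<partial>(m \<Otimes>\<^sub>M \<mu>))"
    by (rule nn_integral_cmult) measurable
  also have "\<dots> \<le> ennreal 8 * ennreal (6 * r)" using * by (rule mult_left_mono) simp
  also have "\<dots> = ennreal (48 * r)" using r0 by (subst ennreal_mult'[symmetric]) auto
  finally show ?thesis .
qed

end

section \<open>The law of a stochastic integral\<close>

context pure_jump_levy_basis
begin

lemma AE_fst: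
  assumes "AE x in m. P x" shows "AE z in m \<Otimes>\<^sub>M \<mu>. P (fst z)"
proof -
  obtain S where S: "{x\<in>space m. \<not> P x} \<subseteq> S" "S \<in> sets m" "emeasure m S = 0"
    using assms by (auto elim: AE_E)
  show ?thesis
  proof (rule AE_I)
    show "{z \<in> space (m \<Otimes>\<^sub>M \<mu>). \<not> P (fst z)} \<subseteq> S \<times> space \<mu>"
      using S(1) by (auto simp: space_pair_measure)
    show "emeasure (m \<Otimes>\<^sub>M \<mu>) (S \<times> space \<mu>) = 0"
      using S by (subst mu.emeasure_pair_measure_Times) auto
    show "S \<times> space \<mu> \<in> sets (m \<Otimes>\<^sub>M \<mu>)" using S by simp
  qed
qed

text \<open>\<open>modular_le\<close> is applied to F n - F k, whose integral is eventually within
  2\<delta> of 0, hence 96. Fatou in k then replaces F k by its almost everywhere limit f.\<close>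

lemma modular_limit_le:
  assumes F: "approximates F f Y" and small: "12 * \<delta> \<le> 1"
    and n: "expectation (\<lambda>\<omega>. min 1 \<bar>Sint (F n) \<omega> - Y \<omega>\<bar>) \<le> \<delta>" and \<delta>: "0 < \<delta>"
  shows "modular (\<lambda>x. F n x - f x) \<le> ennreal (96 * \<delta>)"
proof -
  have sF: "Bochner_Integration.simple_bochner_integrable m (F n)" for n using F by (auto simp: approximates_def)
  have [measurable]: "Sint (F n) \<in> borel_measurable M" for n using sF by (rule Sint_measurable)
  have [measurable]: "F n \<in> borel_measurable m" for n
    using sF[of n] by (auto simp: Bochner_Integration.simple_bochner_integrable.simps intro: borel_measurable_simple_function)
  have [measurable]: "f \<in> borel_measurable m" "Y \<in> borel_measurable M" using F by (auto simp: approximates_def)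
  have lim: "AE x in m. (\<lambda>n. F n x) \<longlonglongrightarrow> f x" and \<rho>: "(\<lambda>n. expectation (\<lambda>\<omega>. min 1 \<bar>Sint (F n) \<omega> - Y \<omega>\<bar>)) \<longlonglongrightarrow> 0"
    using F by (auto simp: approximates_def)
  have int: "integrable M (\<lambda>\<omega>. min 1 \<bar>U \<omega>\<bar>)" if [measurable]: "U \<in> borel_measurable M" for U :: "'w \<Rightarrow> real"
    by (intro integrable_const_bound[of _ 1]) auto
  have "\<forall>\<^sub>F k in sequentially. modular (\<lambda>x. F n x - F k x) \<le> ennreal (96 * \<delta>)"
  proof -
    have "\<forall>\<^sub>F k in sequentially. expectation (\<lambda>\<omega>. min 1 \<bar>Sint (F k) \<omega> - Y \<omega>\<bar>) < \<delta>"
      by (rule order_tendstoD(2)[OF \<rho> \<delta>])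
    then show ?thesis
    proof eventually_elim
      case (elim k)
      \<comment> \<open>The difference is written with coefficients 1 and -1 to fit the rule for
        linear combinations.\<close>
      let ?H = "\<lambda>x. 1 * F n x + (- 1) * F k x"
      have sH: "Bochner_Integration.simple_bochner_integrable m ?H"
        by (rule simple_bochner_integrable_lincomb[OF sF sF])
      note [measurable] = Sint_measurable[OF sH]
      have "expectation (\<lambda>\<omega>. min 1 \<bar>Sint ?H \<omega>\<bar>) = expectation (\<lambda>\<omega>. min 1 \<bar>(Sint (F n) \<omega> - Y \<omega>) - (Sint (F k) \<omega> - Y \<omega>)\<bar>)"
      proof (rule integral_cong_AE)
        show "(\<lambda>\<omega>. min 1 \<bar>Sint ?H \<omega>\<bar>) \<in> borel_measurable M" by measurable
        show "AE \<omega> in M. min 1 \<bar>Sint ?H \<omega>\<bar> = min 1 \<bar>(Sint (F n) \<omega> - Y \<omega>) - (Sint (F k) \<omega> - Y \<omega>)\<bar>"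
          using Sint_lincomb[OF sF[of n] sF[of k], of 1 "-1"] by eventually_elim simp
      qed measurable
      also have "\<dots> \<le> expectation (\<lambda>\<omega>. min 1 \<bar>Sint (F n) \<omega> - Y \<omega>\<bar> + min 1 \<bar>Sint (F k) \<omega> - Y \<omega>\<bar>)"
        by (intro integral_mono int Bochner_Integration.integrable_add) (auto simp: min_def)
      also have "\<dots> = expectation (\<lambda>\<omega>. min 1 \<bar>Sint (F n) \<omega> - Y \<omega>\<bar>) + expectation (\<lambda>\<omega>. min 1 \<bar>Sint (F k) \<omega> - Y \<omega>\<bar>)"
        by (intro Bochner_Integration.integral_add int) measurable
      also have "\<dots> \<le> 2 * \<delta>" using n elim by simp
      finally have "modular ?H \<le> ennreal (48 * (2 * \<delta>))"
        using small by (intro modular_le[OF sH]) auto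
      then show ?case by simp
    qed
  qed
  then have "liminf (\<lambda>k. modular (\<lambda>x. F n x - F k x)) \<le> liminf (\<lambda>k::nat. ennreal (96 * \<delta>))" by (rule Liminf_mono)
  then have le: "liminf (\<lambda>k. modular (\<lambda>x. F n x - F k x)) \<le> ennreal (96 * \<delta>)" by (simp add: Liminf_const)
  have "modular (\<lambda>x. F n x - f x)
     = (\<integral>\<^sup>+z. liminf (\<lambda>k. ennreal (min 1 ((jump (\<lambda>x. F n x - F k x) z)\<^sup>2))) \<partial>(m \<Otimes>\<^sub>M \<mu>))"
    unfolding modular_def
  proof (rule nn_integral_cong_AE)
    show "AE z in m \<Otimes>\<^sub>M \<mu>. ennreal (min 1 ((jump (\<lambda>x. F n x - f x) z)\<^sup>2))
       = liminf (\<lambda>k. ennreal (min 1 ((jump (\<lambda>x. F n x - F k x) z)\<^sup>2)))"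
      using AE_fst[OF lim]
    proof eventually_elim
      case (elim z)
      have "(\<lambda>k. ennreal (min 1 ((jump (\<lambda>x. F n x - F k x) z)\<^sup>2))) \<longlonglongrightarrow> ennreal (min 1 ((jump (\<lambda>x. F n x - f x) z)\<^sup>2))"
        using elim by (intro tendsto_ennrealI tendsto_intros)
      then show ?case by (intro lim_imp_Liminf[symmetric]) auto
    qed
  qed
  also have "\<dots> \<le> liminf (\<lambda>k. modular (\<lambda>x. F n x - F k x))"
    unfolding modular_def by (rule nn_integral_liminf) measurable
  also note le
  finally show ?thesis .
qed

text \<open>One F n at finite modular distance from f is enough, because the modular of a simple
  function is finite and (u - v)^2 <= 2u^2 + 2v^2.\<close>

lemma modular_limit_finite:
  assumes F: "approximates F f Y" shows "modular f < \<infinity>"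
proof -
  have sF: "Bochner_Integration.simple_bochner_integrable m (F n)" for n using F by (auto simp: approximates_def)
  have [measurable]: "F n \<in> borel_measurable m" for n
    using sF[of n] by (auto simp: Bochner_Integration.simple_bochner_integrable.simps intro: borel_measurable_simple_function)
  have [measurable]: "f \<in> borel_measurable m" and \<rho>: "(\<lambda>n. expectation (\<lambda>\<omega>. min 1 \<bar>Sint (F n) \<omega> - Y \<omega>\<bar>)) \<longlonglongrightarrow> 0"
    using F by (auto simp: approximates_def)
  have "\<forall>\<^sub>F n in sequentially. expectation (\<lambda>\<omega>. min 1 \<bar>Sint (F n) \<omega> - Y \<omega>\<bar>) < 1 / 12"
    by (rule order_tendstoD(2)[OF \<rho>]) simp
  then obtain n where n: "expectation (\<lambda>\<omega>. min 1 \<bar>Sint (F n) \<omega> - Y \<omega>\<bar>) \<le> 1 / 12"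
    by (auto simp: eventually_sequentially intro: less_imp_le)
  have A: "modular (\<lambda>x. F n x - f x) \<le> ennreal (96 * (1/12))"
    by (rule modular_limit_le[OF F _ n]) auto
  have sq: "min 1 ((u - v)\<^sup>2) \<le> 2 * min 1 (u\<^sup>2) + 2 * min 1 (v\<^sup>2)" for u v :: real
  proof -
    have "(u - v)\<^sup>2 \<le> 2 * u\<^sup>2 + 2 * v\<^sup>2" using zero_le_power2[of "u + v"] by (simp add: power2_eq_square algebra_simps)
    moreover have "min 1 c \<le> 2 * min 1 a + 2 * min 1 b" if "c \<le> 2 * a + 2 * b" "0 \<le> a" "0 \<le> b" for a b c :: real
      using that by (auto simp: min_def)
    ultimately show ?thesis by simp
  qed
  have "modular f \<le> (\<integral>\<^sup>+z. 2 * ennreal (min 1 ((jump (F n) z)\<^sup>2)) + 2 * ennreal (min 1 ((jump (\<lambda>x. F n x - f x) z)\<^sup>2)) \<partial>(m \<Otimes>\<^sub>M \<mu>))"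
    unfolding modular_def
  proof (rule nn_integral_mono)
    fix z
    have "ennreal (min 1 ((jump f z)\<^sup>2)) \<le> ennreal (2 * min 1 ((jump (F n) z)\<^sup>2) + 2 * min 1 ((jump (\<lambda>x. F n x - f x) z)\<^sup>2))"
      using sq[of "jump (F n) z" "jump (\<lambda>x. F n x - f x) z"] by (intro ennreal_leI) (simp add: left_diff_distrib)
    also have "\<dots> = 2 * ennreal (min 1 ((jump (F n) z)\<^sup>2)) + 2 * ennreal (min 1 ((jump (\<lambda>x. F n x - f x) z)\<^sup>2))"
      by (simp add: ennreal_mult')
    finally show "ennreal (min 1 ((jump f z)\<^sup>2)) \<le> 2 * ennreal (min 1 ((jump (F n) z)\<^sup>2)) + 2 * ennreal (min 1 ((jump (\<lambda>x. F n x - f x) z)\<^sup>2))" .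
  qed
  also have "\<dots> = 2 * modular (F n) + 2 * modular (\<lambda>x. F n x - f x)"
    unfolding modular_def by (subst nn_integral_add) (auto simp: nn_integral_cmult)
  also have "\<dots> < \<infinity>"
    using modular_simple_finite[OF sF, of n] A by (simp add: ennreal_mult_less_top le_less_trans)
  finally show ?thesis .
qed

lemma modular_tendsto:
  assumes F: "approximates F f Y" and e: "0 < e"
  shows "\<forall>\<^sub>F n in sequentially. modular (\<lambda>x. F n x - f x) \<le> ennreal e"
proof -
  define \<delta> where "\<delta> = min (1/12) (e / 96)"
  have \<delta>: "0 < \<delta>" "12 * \<delta> \<le> 1" "96 * \<delta> \<le> e" using e by (auto simp: \<delta>_def min_def)
  have \<rho>: "(\<lambda>n. expectation (\<lambda>\<omega>. min 1 \<bar>Sint (F n) \<omega> - Y \<omega>\<bar>)) \<longlonglongrightarrow> 0"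
    using F by (auto simp: approximates_def)
  from order_tendstoD(2)[OF this \<delta>(1)] show ?thesis
  proof eventually_elim
    case (elim n)
    have "modular (\<lambda>x. F n x - f x) \<le> ennreal (96 * \<delta>)"
      using elim \<delta> by (intro modular_limit_le[OF F]) auto
    also have "\<dots> \<le> ennreal e" using \<delta> by (intro ennreal_leI)
    finally show ?case .
  qed
qed

lemma levy_comp_integral_tendsto:
  assumes F: "approximates F f Y"
  shows "(\<lambda>n. CLINT z|(m \<Otimes>\<^sub>M \<mu>). levy_comp \<zeta> (jump (F n) z)) \<longlonglongrightarrow> (CLINT z|(m \<Otimes>\<^sub>M \<mu>). levy_comp \<zeta> (jump f z))"
proof (rule LIMSEQ_I)
  fix r :: real assume r: "0 < r"
  have sF: "Bochner_Integration.simple_bochner_integrable m (F n)" for n using F by (auto simp: approximates_def)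
  have [measurable]: "F n \<in> borel_measurable m" for n
    using sF[of n] by (auto simp: Bochner_Integration.simple_bochner_integrable.simps intro: borel_measurable_simple_function)
  have [measurable]: "f \<in> borel_measurable m" using F by (auto simp: approximates_def)
  define K where "K = 4 + 5 * \<bar>\<zeta>\<bar> + \<zeta>\<^sup>2"
  have K: "K > 0" unfolding K_def by (intro add_pos_nonneg) auto
  have fin: "modular f < \<infinity>" by (rule modular_limit_finite[OF F])
  obtain V where V: "modular f = ennreal V" "0 \<le> V" using fin by (cases "modular f") auto
  define W where "W = V + 1"
  have W: "V < W" "0 < W" using V by (auto simp: W_def)
  \<comment> \<open>Sized so that the error term K e V, which does not shrink with n, stays below
    r/2; W = V + 1 avoids a division by zero.\<close>
  define e where "e = r / (2 * K * W)"
  have e: "e > 0" using r K W by (simp add: e_def)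
  have Ke: "K * (e * V) < r / 2"
  proof -
    have "K * (e * V) < K * (e * W)" using K e W by (intro mult_strict_left_mono) auto
    also have "\<dots> = r / 2" using K W by (simp add: e_def)
    finally show ?thesis .
  qed
  define c where "c = K * (1 / e + 1)"
  have c: "c > 0" using K e by (simp add: c_def add_pos_pos)
  have "\<forall>\<^sub>F n in sequentially. modular (\<lambda>x. F n x - f x) \<le> ennreal (r / (2 * c))"
    using r c by (intro modular_tendsto[OF F]) simp
  then obtain n0 where n0: "\<And>n. n \<ge> n0 \<Longrightarrow> modular (\<lambda>x. F n x - f x) \<le> ennreal (r / (2 * c))"
    by (auto simp: eventually_sequentially)
  show "\<exists>no. \<forall>n\<ge>no. norm ((CLINT z|(m \<Otimes>\<^sub>M \<mu>). levy_comp \<zeta> (jump (F n) z)) - (CLINT z|(m \<Otimes>\<^sub>M \<mu>). levy_comp \<zeta> (jump f z))) < r"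
  proof (intro exI[of _ n0] allI impI)
    fix n assume n: "n \<ge> n0"
    have i1: "complex_integrable (m \<Otimes>\<^sub>M \<mu>) (\<lambda>z. levy_comp \<zeta> (jump (F n) z))"
      by (rule integrable_levy_comp[OF _ modular_simple_finite[OF sF]]) measurable
    have i2: "complex_integrable (m \<Otimes>\<^sub>M \<mu>) (\<lambda>z. levy_comp \<zeta> (jump f z))"
      by (rule integrable_levy_comp[OF _ fin]) measurable
    have "ennreal (norm ((CLINT z|(m \<Otimes>\<^sub>M \<mu>). levy_comp \<zeta> (jump (F n) z)) - (CLINT z|(m \<Otimes>\<^sub>M \<mu>). levy_comp \<zeta> (jump f z))))
      = ennreal (norm (CLINT z|(m \<Otimes>\<^sub>M \<mu>). levy_comp \<zeta> (jump (F n) z) - levy_comp \<zeta> (jump f z)))"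
      using i1 i2 by simp
    also have "\<dots> \<le> (\<integral>\<^sup>+z. ennreal (norm (levy_comp \<zeta> (jump (F n) z) - levy_comp \<zeta> (jump f z))) \<partial>(m \<Otimes>\<^sub>M \<mu>))"
      by (intro integral_norm_bound_ennreal Bochner_Integration.integrable_diff i1 i2)
    also have "\<dots> \<le> (\<integral>\<^sup>+z. ennreal (K * e) * ennreal (min 1 ((jump f z)\<^sup>2)) + ennreal c * ennreal (min 1 ((jump (\<lambda>x. F n x - f x) z)\<^sup>2)) \<partial>(m \<Otimes>\<^sub>M \<mu>))"
    proof (rule nn_integral_mono)
      fix z
      have "norm (levy_comp \<zeta> (jump (F n) z) - levy_comp \<zeta> (jump f z))
         \<le> (K * e) * min 1 ((jump f z)\<^sup>2) + c * min 1 ((jump (\<lambda>x. F n x - f x) z)\<^sup>2)"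
      proof -
        have "K * (e * A + (1 / e + 1) * B) = (K * e) * A + c * B" for A B by (simp add: c_def algebra_simps)
        then show ?thesis
          using levy_comp_diff_le_weighted[OF e, of \<zeta> "jump (F n) z" "jump f z"]
          by (simp add: K_def[symmetric] left_diff_distrib)
      qed
      then have "ennreal (norm (levy_comp \<zeta> (jump (F n) z) - levy_comp \<zeta> (jump f z)))
         \<le> ennreal ((K * e) * min 1 ((jump f z)\<^sup>2) + c * min 1 ((jump (\<lambda>x. F n x - f x) z)\<^sup>2))"
        by (rule ennreal_leI)
      also have "\<dots> = ennreal (K * e) * ennreal (min 1 ((jump f z)\<^sup>2)) + ennreal c * ennreal (min 1 ((jump (\<lambda>x. F n x - f x) z)\<^sup>2))"
        using K e c by (simp add: ennreal_mult')
      finally show "ennreal (norm (levy_comp \<zeta> (jump (F n) z) - levy_comp \<zeta> (jump f z)))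
        \<le> ennreal (K * e) * ennreal (min 1 ((jump f z)\<^sup>2)) + ennreal c * ennreal (min 1 ((jump (\<lambda>x. F n x - f x) z)\<^sup>2))" .
    qed
    also have "\<dots> = ennreal (K * e) * modular f + ennreal c * modular (\<lambda>x. F n x - f x)"
      unfolding modular_def by (subst nn_integral_add) (auto simp: nn_integral_cmult)
    also have "\<dots> \<le> ennreal (K * e) * ennreal V + ennreal c * ennreal (r / (2 * c))"
      unfolding V using n0[OF n] by (intro add_mono mult_left_mono) auto
    also have "\<dots> = ennreal (K * (e * V) + r / 2)"
      using K e V c r by (simp add: ennreal_mult'[symmetric] mult.assoc)
    finally have "norm ((CLINT z|(m \<Otimes>\<^sub>M \<mu>). levy_comp \<zeta> (jump (F n) z)) - (CLINT z|(m \<Otimes>\<^sub>M \<mu>). levy_comp \<zeta> (jump f z))) \<le> K * (e * V) + r / 2"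
      by (subst (asm) ennreal_le_iff) (use K e V r in auto)
    then show "norm ((CLINT z|(m \<Otimes>\<^sub>M \<mu>). levy_comp \<zeta> (jump (F n) z)) - (CLINT z|(m \<Otimes>\<^sub>M \<mu>). levy_comp \<zeta> (jump f z))) < r"
      using Ke by linarith
  qed
qed

text \<open>The drifts d n may diverge as far as is known here, but iexp(\<zeta> d n) is the n-th
  characteristic function divided by exp(Gn n \<zeta>), and both of these converge. The limit
  \<theta> inherits modulus 1 and multiplicativity.\<close>

lemma char_approximates_aux:
  assumes F: "approximates F f Y"
  defines "G \<equiv> \<lambda>\<zeta>. CLINT z|(m \<Otimes>\<^sub>M \<mu>). levy_comp \<zeta> (jump f z)"
  obtains \<theta> where "\<And>\<zeta>. char (distr M borel Y) \<zeta> = \<theta> \<zeta> * exp (G \<zeta>)" "\<And>\<zeta>. cmod (\<theta> \<zeta>) = 1"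
    "\<And>\<zeta> \<eta>. \<theta> (\<zeta> + \<eta>) = \<theta> \<zeta> * \<theta> \<eta>"
proof -
  have sF: "Bochner_Integration.simple_bochner_integrable m (F n)" for n using F by (auto simp: approximates_def)
  have [measurable]: "Sint (F n) \<in> borel_measurable M" for n using sF by (rule Sint_measurable)
  have [measurable]: "Y \<in> borel_measurable M" and \<rho>: "(\<lambda>n. expectation (\<lambda>\<omega>. min 1 \<bar>Sint (F n) \<omega> - Y \<omega>\<bar>)) \<longlonglongrightarrow> 0"
    using F by (auto simp: approximates_def)
  define Gn where "Gn n \<zeta> = (CLINT z|(m \<Otimes>\<^sub>M \<mu>). levy_comp \<zeta> (jump (F n) z))" for n \<zeta>
  have "\<forall>n. \<exists>d. \<forall>\<zeta>. char (distr M borel (Sint (F n))) \<zeta> = exp (\<i> * complex_of_real (\<zeta> * d) + Gn n \<zeta>)"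
    unfolding Gn_def using char_Sint_levy[OF sF] by metis
  then obtain d where d: "\<And>n \<zeta>. char (distr M borel (Sint (F n))) \<zeta> = exp (\<i> * complex_of_real (\<zeta> * d n) + Gn n \<zeta>)"
    by metis
  define \<theta> where "\<theta> \<zeta> = char (distr M borel Y) \<zeta> / exp (G \<zeta>)" for \<zeta>
  have ch: "(\<lambda>n. char (distr M borel (Sint (F n))) \<zeta>) \<longlonglongrightarrow> char (distr M borel Y) \<zeta>" for \<zeta>
  proof -
    have "(\<lambda>n. (2 + \<bar>\<zeta>\<bar>) * expectation (\<lambda>\<omega>. min 1 \<bar>Sint (F n) \<omega> - Y \<omega>\<bar>)) \<longlonglongrightarrow> (2 + \<bar>\<zeta>\<bar>) * 0"
      by (intro tendsto_intros \<rho>)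
    then have lim0: "(\<lambda>n. (2 + \<bar>\<zeta>\<bar>) * expectation (\<lambda>\<omega>. min 1 \<bar>Sint (F n) \<omega> - Y \<omega>\<bar>)) \<longlonglongrightarrow> 0" by simp
    have "(\<lambda>n. char (distr M borel (Sint (F n))) \<zeta> - char (distr M borel Y) \<zeta>) \<longlonglongrightarrow> 0"
    proof (rule Lim_null_comparison[OF _ lim0])
      show "\<forall>\<^sub>F n in sequentially. cmod (char (distr M borel (Sint (F n))) \<zeta> - char (distr M borel Y) \<zeta>)
         \<le> (2 + \<bar>\<zeta>\<bar>) * expectation (\<lambda>\<omega>. min 1 \<bar>Sint (F n) \<omega> - Y \<omega>\<bar>)"
        by (intro always_eventually allI char_diff_le) measurable
    qed
    then show ?thesis by (simp add: LIM_zero_iff)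
  qed
  have lim: "(\<lambda>n. iexp (\<zeta> * d n)) \<longlonglongrightarrow> \<theta> \<zeta>" for \<zeta>
  proof -
    have "(\<lambda>n. char (distr M borel (Sint (F n))) \<zeta> / exp (Gn n \<zeta>)) \<longlonglongrightarrow> \<theta> \<zeta>"
      unfolding \<theta>_def
      by (intro tendsto_divide ch tendsto_exp) (auto simp: Gn_def G_def intro!: levy_comp_integral_tendsto[OF F])
    then show ?thesis by (simp add: d exp_add)
  qed
  show ?thesis
  proof (rule that[of \<theta>])
    show "char (distr M borel Y) \<zeta> = \<theta> \<zeta> * exp (G \<zeta>)" for \<zeta> by (simp add: \<theta>_def)
    show "cmod (\<theta> \<zeta>) = 1" for \<zeta>
    proof -
      have "(\<lambda>n. 1) \<longlonglongrightarrow> cmod (\<theta> \<zeta>)" using tendsto_norm[OF lim[of \<zeta>]] by (simp only: norm_exp_i_times)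
      then show ?thesis using LIMSEQ_unique tendsto_const by blast
    qed
    show "\<theta> (\<zeta> + \<eta>) = \<theta> \<zeta> * \<theta> \<eta>" for \<zeta> \<eta>
    proof (rule LIMSEQ_unique[OF lim])
      have "(\<lambda>n. iexp (\<zeta> * d n) * iexp (\<eta> * d n)) \<longlonglongrightarrow> \<theta> \<zeta> * \<theta> \<eta>" by (intro tendsto_mult lim)
      moreover have "iexp ((\<zeta> + \<eta>) * d n) = iexp (\<zeta> * d n) * iexp (\<eta> * d n)" for n
        by (simp add: exp_add distrib_right distrib_left)
      ultimately show "(\<lambda>n. iexp ((\<zeta> + \<eta>) * d n)) \<longlonglongrightarrow> \<theta> \<zeta> * \<theta> \<eta>" by simp
    qed
  qed
qed

text \<open>The unknown character is trivial: after full compensation it equals the characteristic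
  function of Y divided by exp \<psi>, both of which are 1 + O(h^2) for a centred Y of finite
  variance, and a multiplicative function of modulus 1 with \<phi> h = 1 + O(h^2) is
  constant.\<close>

theorem char_approximates:
  assumes F: "approximates F f Y" and int: "integrable M (\<lambda>\<omega>. (Y \<omega>)\<^sup>2)" and zero: "expectation Y = 0"
  shows "integrable (m \<Otimes>\<^sub>M \<mu>) (\<lambda>z. (jump f z)\<^sup>2)"
    and "char (distr M borel Y) \<zeta> = exp (levy_exponent (m \<Otimes>\<^sub>M \<mu>) (jump f) \<zeta>)"
proof -
  have [measurable]: "f \<in> borel_measurable m" "Y \<in> borel_measurable M" using F by (auto simp: approximates_def)
  have fin: "modular f < \<infinity>" by (rule modular_limit_finite[OF F])
  define G where "G \<zeta> = (CLINT z|(m \<Otimes>\<^sub>M \<mu>). levy_comp \<zeta> (jump f z))" for \<zeta>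
  obtain \<theta> where \<theta>: "\<And>\<zeta>. char (distr M borel Y) \<zeta> = \<theta> \<zeta> * exp (G \<zeta>)" "\<And>\<zeta>. cmod (\<theta> \<zeta>) = 1"
    "\<And>\<zeta> \<eta>. \<theta> (\<zeta> + \<eta>) = \<theta> \<zeta> * \<theta> \<eta>"
    using char_approximates_aux[OF F] unfolding G_def by blast
  define v where "v = expectation (\<lambda>\<omega>. (Y \<omega>)\<^sup>2)"
  have v0: "0 \<le> v" unfolding v_def by (intro integral_nonneg_AE) auto
  have "(\<integral>\<^sup>+z. ennreal ((jump f z)\<^sup>2) \<partial>(m \<Otimes>\<^sub>M \<mu>)) \<le> ennreal (2 * v)"
    unfolding v_def
  \<comment> \<open>The modulus of the characteristic function is exp(Re G) whatever \<theta> is.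
    This gives the square integrability of the kernel on which full compensation rests.\<close>
  proof (rule nn_integral_square_ge[where Q = "\<lambda>\<zeta>. - Re (G \<zeta>)"])
    show "cmod (char (distr M borel Y) \<zeta>) = exp (- (- Re (G \<zeta>)))" for \<zeta>
      by (simp add: \<theta> norm_mult)
    show "(\<integral>\<^sup>+z. ennreal (1 - cos (\<zeta> * jump f z)) \<partial>(m \<Otimes>\<^sub>M \<mu>)) = ennreal (- Re (G \<zeta>))" for \<zeta>
      unfolding G_def by (rule one_minus_cos_jump(1)[OF _ fin]) measurable
    show "0 \<le> - Re (G \<zeta>)" for \<zeta>
      using one_minus_cos_jump(2)[OF _ fin] unfolding G_def by simp
  qed (use int zero in auto)
  then show isq: "integrable (m \<Otimes>\<^sub>M \<mu>) (\<lambda>z. (jump f z)\<^sup>2)"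
    by (intro integrableI_nonneg) (auto simp: le_less_trans)
  define \<psi> where "\<psi> \<zeta> = levy_exponent (m \<Otimes>\<^sub>M \<mu>) (jump f) \<zeta>" for \<zeta>
  have "integrable (m \<Otimes>\<^sub>M \<mu>) (\<lambda>z. jump f z - sin (jump f z))"
  proof (rule Bochner_Integration.integrable_bound[OF isq])
    show "AE z in m \<Otimes>\<^sub>M \<mu>. norm (jump f z - sin (jump f z)) \<le> norm ((jump f z)\<^sup>2)"
      using abs_sin_diff_linear_le[of "jump f _" 0] by (intro always_eventually) simp
  qed measurable
  then have isin: "complex_integrable (m \<Otimes>\<^sub>M \<mu>) (\<lambda>z. \<i> * complex_of_real (\<zeta> * (jump f z - sin (jump f z))))" for \<zeta>
    by (intro integrable_mult_right integrable_of_real)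
  define c where "c = (LINT z|(m \<Otimes>\<^sub>M \<mu>). jump f z - sin (jump f z))"
  \<comment> \<open>Passing from sin y to y as compensator adds a term linear in \<zeta>, which is
    absorbed into the character \<phi>.\<close>
  have G\<psi>: "G \<zeta> = \<psi> \<zeta> + \<i> * complex_of_real (\<zeta> * c)" for \<zeta>
  proof -
    have "G \<zeta> = (CLINT z|(m \<Otimes>\<^sub>M \<mu>). (iexp (\<zeta> * jump f z) - 1 - \<i> * complex_of_real (\<zeta> * jump f z))
       + \<i> * complex_of_real (\<zeta> * (jump f z - sin (jump f z))))"
      unfolding G_def levy_comp_def by (intro Bochner_Integration.integral_cong) (auto simp: algebra_simps)
    also have "\<dots> = \<psi> \<zeta> + (CLINT z|(m \<Otimes>\<^sub>M \<mu>). \<i> * complex_of_real (\<zeta> * (jump f z - sin (jump f z))))"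
      unfolding \<psi>_def levy_exponent_def
      by (rule Bochner_Integration.integral_add[OF levy_exponent_integrable[OF _ isq] isin]) measurable
    also have "(CLINT z|(m \<Otimes>\<^sub>M \<mu>). \<i> * complex_of_real (\<zeta> * (jump f z - sin (jump f z)))) = \<i> * complex_of_real (\<zeta> * c)"
      unfolding c_def by (simp only: integral_mult_right_zero integral_complex_of_real)
    finally show ?thesis .
  qed
  define \<phi> where "\<phi> \<zeta> = \<theta> \<zeta> * iexp (\<zeta> * c)" for \<zeta>
  have \<phi>: "char (distr M borel Y) \<zeta> = \<phi> \<zeta> * exp (\<psi> \<zeta>)" for \<zeta>
    by (simp add: \<theta>(1) G\<psi> exp_add \<phi>_def)
  have \<phi>1: "cmod (\<phi> \<zeta>) = 1" for \<zeta> by (simp add: \<phi>_def norm_mult \<theta>(2))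
  have \<phi>add: "\<phi> (\<zeta> + \<eta>) = \<phi> \<zeta> * \<phi> \<eta>" for \<zeta> \<eta>
    by (simp add: \<phi>_def \<theta>(3) exp_add distrib_right distrib_left)
  have \<phi>0: "\<phi> 0 = 1" using \<phi>add[of 0 0] \<phi>1[of 0] by auto
  have \<phi>pow: "\<phi> (real n * \<zeta>) = \<phi> \<zeta> ^ n" for n \<zeta>
    by (induction n) (auto simp: \<phi>0 \<phi>add distrib_right)
  define V where "V = (LINT z|(m \<Otimes>\<^sub>M \<mu>). (jump f z)\<^sup>2)"
  have V0: "0 \<le> V" unfolding V_def by (intro integral_nonneg_AE) auto
  have \<psi>le: "cmod (\<psi> \<zeta>) \<le> \<zeta>\<^sup>2 / 2 * V" for \<zeta>
    unfolding \<psi>_def V_def by (rule norm_levy_exponent_le[OF _ isq]) measurable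
  have Re\<psi>: "Re (\<psi> \<zeta>) \<le> 0" for \<zeta>
    unfolding \<psi>_def by (rule Re_levy_exponent(2)[OF _ isq]) measurable
  have iY: "integrable M Y" using square_integrable_imp_integrable[OF _ int] by simp
  have dev: "cmod (char (distr M borel Y) \<zeta> - 1) \<le> \<zeta>\<^sup>2 / 2 * v" for \<zeta>
  proof -
    have "integrable M (\<lambda>\<omega>. iexp (\<zeta> * Y \<omega>))" by (intro integrable_iexp) auto
    then have "char (distr M borel Y) \<zeta> - 1 = levy_exponent M Y \<zeta>"
      unfolding char_def levy_exponent_def
      by (subst integral_distr) (use iY zero in \<open>auto simp: prob_space\<close>)
    then show ?thesis using norm_levy_exponent_le[OF _ int] by (simp add: v_def)
  qed
  define C where "C = exp (V / 2) * ((v + V) / 2)"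
  \<comment> \<open>\<phi> - 1 is exp(-\<psi>) times the difference of two deviations from 1, each
    O(h^2); for |h| <= 1 the prefactor is at most exp(V/2).\<close>
  have \<phi>dev: "cmod (\<phi> h - 1) \<le> C * h\<^sup>2" if "\<bar>h\<bar> \<le> 1" for h
  proof -
    have "h\<^sup>2 \<le> 1" using that by (simp add: abs_square_le_1)
    have "(\<phi> h - 1) = exp (- \<psi> h) * ((char (distr M borel Y) h - 1) - (exp (\<psi> h) - 1))"
      by (simp add: \<phi> exp_minus field_simps)
    then have "cmod (\<phi> h - 1) = cmod (exp (- \<psi> h)) * cmod ((char (distr M borel Y) h - 1) - (exp (\<psi> h) - 1))"
      by (simp add: norm_mult)
    also have "\<dots> \<le> exp (V / 2) * (h\<^sup>2 / 2 * v + h\<^sup>2 / 2 * V)"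
    proof (rule mult_mono)
      have "- Re (\<psi> h) \<le> cmod (\<psi> h)" using abs_Re_le_cmod[of "\<psi> h"] by linarith
      also have "\<dots> \<le> 1 / 2 * V" using \<psi>le[of h] mult_right_mono[OF \<open>h\<^sup>2 \<le> 1\<close> V0] by simp
      finally show "cmod (exp (- \<psi> h)) \<le> exp (V / 2)" by simp
      have "cmod (exp (\<psi> h) - 1) \<le> h\<^sup>2 / 2 * V" using norm_exp_minus_1_le[OF Re\<psi>] \<psi>le order_trans by blast
      then show "cmod ((char (distr M borel Y) h - 1) - (exp (\<psi> h) - 1)) \<le> h\<^sup>2 / 2 * v + h\<^sup>2 / 2 * V"
        using norm_triangle_ineq4[of "char (distr M borel Y) h - 1" "exp (\<psi> h) - 1"] dev[of h] by linarith
    qed auto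
    also have "\<dots> = C * h\<^sup>2" by (simp add: C_def field_simps)
    finally show ?thesis .
  qed
  \<comment> \<open>\<phi>(\<zeta>) is the n-th power of \<phi>(\<zeta>/n), hence within n C
    (\<zeta>/n)^2 of 1, which tends to 0.\<close>
  have "\<phi> \<zeta> = 1"
  proof -
    have "(\<lambda>n. C * \<zeta>\<^sup>2 * inverse (real (Suc n))) \<longlonglongrightarrow> C * \<zeta>\<^sup>2 * 0"
      by (intro tendsto_intros LIMSEQ_inverse_real_of_nat)
    moreover have "\<forall>\<^sub>F n in sequentially. cmod (\<phi> \<zeta> - 1) \<le> C * \<zeta>\<^sup>2 * inverse (real (Suc n))"
    proof -
      obtain n0 :: nat where n0: "\<bar>\<zeta>\<bar> \<le> real n0" using real_arch_simple by blast
      have "cmod (\<phi> \<zeta> - 1) \<le> C * \<zeta>\<^sup>2 * inverse (real (Suc n))" if "n \<ge> n0" for n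
      proof -
        define h where "h = \<zeta> / real (Suc n)"
        have "\<bar>\<zeta>\<bar> \<le> real (Suc n)" using n0 that by linarith
        then have h: "\<bar>h\<bar> \<le> 1" by (simp add: h_def)
        have \<zeta>: "\<zeta> = real (Suc n) * h" by (simp add: h_def)
        have "cmod (\<phi> \<zeta> - 1) = cmod (\<phi> h ^ Suc n - 1 ^ Suc n)" by (subst \<zeta>) (simp only: \<phi>pow power_one)
        also have "\<dots> \<le> real (Suc n) * cmod (\<phi> h - 1)" by (rule norm_power_diff) (auto simp: \<phi>1)
        also have "\<dots> \<le> real (Suc n) * (C * h\<^sup>2)" using \<phi>dev[OF h] by (intro mult_left_mono) auto
        also have "\<dots> = C * \<zeta>\<^sup>2 * inverse (real (Suc n))" by (simp add: h_def power2_eq_square field_simps del: of_nat_Suc)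
        finally show ?thesis .
      qed
      then show ?thesis unfolding eventually_sequentially by blast
    qed
    ultimately have "cmod (\<phi> \<zeta> - 1) \<le> C * \<zeta>\<^sup>2 * 0"
      by (rule tendsto_lowerbound) simp
    then show ?thesis by simp
  qed
  then show "char (distr M borel Y) \<zeta> = exp (levy_exponent (m \<Otimes>\<^sub>M \<mu>) (jump f) \<zeta>)"
    using \<phi>[of \<zeta>] by (simp add: \<psi>_def)
qed

end

section \<open>Riemann sums in mean square\<close>

text \<open>The cells are half-open and therefore disjoint, so squaring a step function squares its
  terms without cross products.\<close>

lemma sum_indicator_partition:
  fixes \<delta> s :: real and a :: "nat \<Rightarrow> real"
  assumes "0 \<le> \<delta>"
  shows "(\<Sum>i<n. indicator {\<delta> * real i..<\<delta> * real (Suc i)} s) = (indicator {0..<\<delta> * real n} s :: real)"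
    and "(\<Sum>i<n. indicator {\<delta> * real i..<\<delta> * real (Suc i)} s * a i)\<^sup>2
      = (\<Sum>i<n. indicator {\<delta> * real i..<\<delta> * real (Suc i)} s * (a i)\<^sup>2)"
proof -
  have mono: "\<delta> * real i \<le> \<delta> * real j" if "i \<le> j" for i j using assms that by (intro mult_left_mono) auto
  show "(\<Sum>i<n. indicator {\<delta> * real i..<\<delta> * real (Suc i)} s) = (indicator {0..<\<delta> * real n} s :: real)"
  proof (induction n)
    case (Suc n)
    then show ?case using mono[of 0 n] mono[of n "Suc n"] by (auto simp: indicator_def)
  qed simp
  show "(\<Sum>i<n. indicator {\<delta> * real i..<\<delta> * real (Suc i)} s * a i)\<^sup>2
      = (\<Sum>i<n. indicator {\<delta> * real i..<\<delta> * real (Suc i)} s * (a i)\<^sup>2)"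
  proof (induction n)
    case (Suc n)
    show ?case
    proof (cases "s \<in> {\<delta> * real n..<\<delta> * real (Suc n)}")
      case True
      have "indicator {\<delta> * real i..<\<delta> * real (Suc i)} s = (0::real)" if "i < n" for i
        using mono[of "Suc i" n] that True by (auto simp: indicator_def)
      then show ?thesis using True by simp
    next
      case False
      then show ?thesis using Suc.IH by simp
    qed
  qed simp
qed

text \<open>Stated over a general measure because it is applied both to the paths of X on the
  probability space and to the kernel on the control space. One factor t comes from Cauchy-Schwarz
  on [0, t], the other from integrating the bound c over that interval after Tonelli.\<close>

lemma nn_integral_riemann_sum_error_le:
  fixes W :: "real \<Rightarrow> 'b \<Rightarrow> real"
  assumes N: "sigma_finite_measure N"
    and W: "(\<lambda>(s, x). W s x) \<in> borel_measurable (borel \<Otimes>\<^sub>M N)"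
    and t: "0 < t" and n: "0 < n"
    and c: "0 \<le> c" "\<And>u v. 0 \<le> u \<Longrightarrow> u \<le> v \<Longrightarrow> v \<le> u + t / real n \<Longrightarrow> (\<integral>\<^sup>+x. ennreal ((W v x - W u x)\<^sup>2) \<partial>N) \<le> ennreal c"
    and int: "AE x in N. set_integrable lborel {0..t} (\<lambda>s. W s x)"
  shows "(\<integral>\<^sup>+x. ennreal (((LINT s:{0..t}|lborel. W s x) - (\<Sum>i<n. t / real n * W (t / real n * real i) x))\<^sup>2) \<partial>N) \<le> ennreal (t\<^sup>2 * c)"
proof -
  interpret N: sigma_finite_measure N by fact
  interpret LN: pair_sigma_finite lborel N ..
  have Wm [measurable]: "(\<lambda>z. W (fst z) (snd z)) \<in> borel_measurable (borel \<Otimes>\<^sub>M N)" using W by (simp add: case_prod_beta)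
  have Ws [measurable]: "(\<lambda>x. W s x) \<in> borel_measurable N" for s
    using measurable_compose[OF measurable_Pair1'[of s borel N] Wm] by simp
  have [measurable]: "(\<lambda>z. W s (fst z)) \<in> borel_measurable (N \<Otimes>\<^sub>M lborel)"
    "(\<lambda>z. W s (snd z)) \<in> borel_measurable (lborel \<Otimes>\<^sub>M N)" for s
    using measurable_compose[OF measurable_fst Ws] measurable_compose[OF measurable_snd Ws] by auto
  have "(\<lambda>z. (snd z, fst z)) \<in> N \<Otimes>\<^sub>M borel \<rightarrow>\<^sub>M borel \<Otimes>\<^sub>M N" by measurable
  from measurable_compose[OF this Wm] have [measurable]: "(\<lambda>z. W (snd z) (fst z)) \<in> borel_measurable (N \<Otimes>\<^sub>M borel)"
    by simp
  define \<delta> where "\<delta> = t / real n"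
  have \<delta>: "0 < \<delta>" "\<delta> * real n = t" using t n by (auto simp: \<delta>_def)
  define I where "I i = {\<delta> * real i..<\<delta> * real (Suc i)}" for i
  have [measurable]: "I i \<in> sets borel" for i by (simp add: I_def)
  have emI: "emeasure lborel (I i) = ennreal \<delta>" for i
    using \<delta> by (simp add: I_def algebra_simps)
  define h where "h s x = (\<Sum>i<n. indicator (I i) s * (W s x - W (\<delta> * real i) x))" for s x
  have hsq: "(h s x)\<^sup>2 = (\<Sum>i<n. indicator (I i) s * (W s x - W (\<delta> * real i) x)\<^sup>2)" for s x
    unfolding h_def I_def by (rule sum_indicator_partition(2)) (use \<delta> in simp)
  have hsupp: "h s x = indicator {0..<t} s * h s x" for s x
  proof (cases "s \<in> {0..<t}")
    case False
    then have "(\<Sum>i<n. indicator (I i) s) = (0::real)"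
      using sum_indicator_partition(1)[where \<delta> = \<delta> and n = n and s = s] \<delta> by (simp add: I_def)
    then have "\<forall>i<n. indicator (I i) s = (0::real)" by (subst (asm) sum_nonneg_eq_0_iff) auto
    then show ?thesis by (simp add: h_def)
  qed simp
  have key: "AE x in N. ennreal (((LINT s:{0..t}|lborel. W s x) - (\<Sum>i<n. \<delta> * W (\<delta> * real i) x))\<^sup>2)
     \<le> ennreal t * (\<integral>\<^sup>+s. ennreal ((h s x)\<^sup>2) \<partial>lborel)"
    using int
  proof eventually_elim
    case (elim x)
    note iW = elim[unfolded set_integrable_def real_scaleR_def]
    \<comment> \<open>For the given x, measurability in s is taken from integrability on {0..t}, and
      all cells lie in that interval.\<close>
    have mh [measurable]: "(\<lambda>s. h s x) \<in> borel_measurable lborel"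
    proof -
      have "(\<lambda>s. \<Sum>i<n. indicator (I i) s * (indicator {0..t} s * W s x - W (\<delta> * real i) x)) \<in> borel_measurable lborel"
        using borel_measurable_integrable[OF iW] by measurable
      moreover have "indicator (I i) s * (indicator {0..t} s * W s x - W (\<delta> * real i) x) = indicator (I i) s * (W s x - W (\<delta> * real i) x)"
        if "i < n" for i s
      proof (cases "s \<in> I i")
        case True
        have "\<delta> * real (Suc i) \<le> \<delta> * real n" using \<delta> that by (intro mult_left_mono) auto
        moreover have "0 \<le> \<delta> * real i" using \<delta> by simp
        moreover have "\<delta> * real i \<le> s" "s < \<delta> * real (Suc i)" using True by (simp_all add: I_def)
        ultimately have "0 \<le> s" "s \<le> t" using \<delta>(2) by linarith+
        then have "s \<in> {0..t}" by simp
        then show ?thesis by simp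
      qed simp
      then have "(\<lambda>s. \<Sum>i<n. indicator (I i) s * (indicator {0..t} s * W s x - W (\<delta> * real i) x)) = (\<lambda>s. h s x)"
        unfolding h_def by (intro ext sum.cong refl) (simp only: lessThan_iff)
      ultimately show ?thesis by (simp only:)
    qed
    have ii: "integrable lborel (\<lambda>s. indicator (I i) s * W s x)" if "i < n" for i
    proof (rule Bochner_Integration.integrable_cong[THEN iffD1, OF refl _ integrable_mult_indicator[OF _ iW, of "I i"]])
      fix s
      have "s \<in> {0..t}" if "s \<in> I i"
      proof -
        have "\<delta> * real (Suc i) \<le> \<delta> * real n" using \<delta> \<open>i < n\<close> by (intro mult_left_mono) auto
        moreover have "0 \<le> \<delta> * real i" using \<delta> by simp
        moreover have "\<delta> * real i \<le> s" "s < \<delta> * real (Suc i)" using that by (simp_all add: I_def)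
        ultimately have "0 \<le> s" "s \<le> t" using \<delta>(2) by linarith+
        then show ?thesis by simp
      qed
      then show "indicator (I i) s *\<^sub>R (indicator {0..t} s * W s x) = indicator (I i) s * W s x"
        by (auto simp: indicator_def)
    qed simp
    have ic: "integrable lborel (\<lambda>s. indicator (I i) s * W (\<delta> * real i) x)" for i
      by (intro integrable_mult_left integrable_real_indicator) (auto simp: emI)
    \<comment> \<open>The cells cover {0..<t}; the right end point is a null set.\<close>
    have "(LINT s:{0..t}|lborel. W s x) = (LINT s|lborel. indicator {0..<t} s * W s x)"
      unfolding set_lebesgue_integral_def real_scaleR_def
    proof (rule integral_cong_AE)
      show "AE s in lborel. indicator {0..t} s * W s x = indicator {0..<t} s * W s x"
        using AE_lborel_singleton[of t] by eventually_elim (auto simp: indicator_def)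
      have "(\<lambda>s. indicator {0..<t} s * (indicator {0..t} s * W s x)) \<in> borel_measurable lborel"
        using borel_measurable_integrable[OF iW] by measurable
      moreover have "(\<lambda>s. indicator {0..<t} s * (indicator {0..t} s * W s x)) = (\<lambda>s. indicator {0..<t} s * W s x)"
        by (auto simp: indicator_def)
      ultimately show "(\<lambda>s. indicator {0..<t} s * W s x) \<in> borel_measurable lborel" by simp
    qed (use iW in simp)
    also have "\<dots> = (LINT s|lborel. (\<Sum>i<n. indicator (I i) s * W s x))"
      using sum_indicator_partition(1)[where \<delta> = \<delta> and n = n] \<delta> unfolding I_def by (simp add: sum_distrib_right[symmetric])
    also have "\<dots> = (\<Sum>i<n. LINT s|lborel. indicator (I i) s * W s x)"
      using ii by (intro Bochner_Integration.integral_sum) auto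
    finally have eq1: "(LINT s:{0..t}|lborel. W s x) = (\<Sum>i<n. LINT s|lborel. indicator (I i) s * W s x)" .
    have "(\<Sum>i<n. \<delta> * W (\<delta> * real i) x) = (\<Sum>i<n. LINT s|lborel. indicator (I i) s * W (\<delta> * real i) x)"
      using emI \<delta> by (intro sum.cong) (auto simp: measure_def)
    with eq1 have "(LINT s:{0..t}|lborel. W s x) - (\<Sum>i<n. \<delta> * W (\<delta> * real i) x)
      = (\<Sum>i<n. LINT s|lborel. indicator (I i) s * W s x - indicator (I i) s * W (\<delta> * real i) x)"
      using ii ic by (simp add: sum_subtractf)
    also have "\<dots> = (LINT s|lborel. h s x)"
      unfolding h_def right_diff_distrib
      by (rule Bochner_Integration.integral_sum[symmetric]) (use ii ic in \<open>auto intro!: Bochner_Integration.integrable_diff\<close>)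
    finally have eq: "(LINT s:{0..t}|lborel. W s x) - (\<Sum>i<n. \<delta> * W (\<delta> * real i) x) = (LINT s|lborel. h s x)" .
    have inth: "integrable lborel (\<lambda>s. h s x)"
      unfolding h_def right_diff_distrib
      by (intro Bochner_Integration.integrable_sum Bochner_Integration.integrable_diff ic) (use ii in auto)
    have "ennreal ((LINT s|lborel. h s x)\<^sup>2) = (ennreal (norm (LINT s|lborel. h s x)))\<^sup>2"
      by (simp add: ennreal_power)
    also have "\<dots> \<le> (\<integral>\<^sup>+s. ennreal (norm (h s x)) \<partial>lborel)\<^sup>2"
      using integral_norm_bound_ennreal[OF inth] by (intro power_mono) auto
    also have "(\<integral>\<^sup>+s. ennreal (norm (h s x)) \<partial>lborel) = (\<integral>\<^sup>+s. indicator {0..<t} s * ennreal (norm (h s x)) \<partial>lborel)"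
      by (intro nn_integral_cong, subst hsupp) (auto simp: indicator_def)
    also have "(\<integral>\<^sup>+s. indicator {0..<t} s * ennreal (norm (h s x)) \<partial>lborel)\<^sup>2
       \<le> (\<integral>\<^sup>+s. (indicator {0..<t} s)\<^sup>2 \<partial>lborel) * (\<integral>\<^sup>+s. (ennreal (norm (h s x)))\<^sup>2 \<partial>lborel)"
      by (rule Cauchy_Schwarz_nn_integral) measurable
    also have "(\<integral>\<^sup>+s. (indicator {0..<t} s)\<^sup>2 \<partial>lborel) = (\<integral>\<^sup>+s. indicator {0..<t} s \<partial>lborel)"
      by (intro nn_integral_cong) (auto simp: indicator_def)
    also have "\<dots> = ennreal t" using t by simp
    finally show ?case unfolding eq by (simp add: ennreal_power)
  qed
  have "(\<integral>\<^sup>+x. ennreal (((LINT s:{0..t}|lborel. W s x) - (\<Sum>i<n. t / real n * W (t / real n * real i) x))\<^sup>2) \<partial>N)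
     \<le> (\<integral>\<^sup>+x. ennreal t * (\<integral>\<^sup>+s. ennreal ((h s x)\<^sup>2) \<partial>lborel) \<partial>N)"
    using key unfolding \<delta>_def by (intro nn_integral_mono_AE) simp
  also have "\<dots> = ennreal t * (\<integral>\<^sup>+x. (\<integral>\<^sup>+s. ennreal ((h s x)\<^sup>2) \<partial>lborel) \<partial>N)"
    unfolding h_def by (rule nn_integral_cmult) measurable
  also have "(\<integral>\<^sup>+x. (\<integral>\<^sup>+s. ennreal ((h s x)\<^sup>2) \<partial>lborel) \<partial>N) = (\<integral>\<^sup>+s. (\<integral>\<^sup>+x. ennreal ((h s x)\<^sup>2) \<partial>N) \<partial>lborel)"
    unfolding h_def by (rule LN.Fubini') measurable
  also have "\<dots> \<le> (\<integral>\<^sup>+s. ennreal c * indicator {0..<t} s \<partial>lborel)"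
  proof (rule nn_integral_mono)
    fix s :: real
    have "(\<integral>\<^sup>+x. ennreal ((h s x)\<^sup>2) \<partial>N) = (\<integral>\<^sup>+x. (\<Sum>i<n. indicator (I i) s * ennreal ((W s x - W (\<delta> * real i) x)\<^sup>2)) \<partial>N)"
      unfolding hsq by (intro nn_integral_cong, subst sum_ennreal[symmetric]) (auto intro!: sum.cong simp: indicator_def)
    also have "\<dots> = (\<Sum>i<n. indicator (I i) s * (\<integral>\<^sup>+x. ennreal ((W s x - W (\<delta> * real i) x)\<^sup>2) \<partial>N))"
      by (subst nn_integral_sum) (auto simp: nn_integral_cmult)
    also have "\<dots> \<le> (\<Sum>i<n. indicator (I i) s * ennreal c)"
    proof (rule sum_mono)
      fix i
      show "indicator (I i) s * (\<integral>\<^sup>+x. ennreal ((W s x - W (\<delta> * real i) x)\<^sup>2) \<partial>N) \<le> indicator (I i) s * ennreal c"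
      proof (cases "s \<in> I i")
        case True
        then have "(\<integral>\<^sup>+x. ennreal ((W s x - W (\<delta> * real i) x)\<^sup>2) \<partial>N) \<le> ennreal c"
          using \<delta> by (intro c(2)) (auto simp: I_def \<delta>_def[symmetric] algebra_simps)
        then show ?thesis using True by simp
      qed simp
    qed
    also have "\<dots> = ennreal (\<Sum>i<n. indicator (I i) s) * ennreal c"
      by (subst sum_ennreal[symmetric]) (auto simp: sum_distrib_right[symmetric] ennreal_indicator)
    also have "(\<Sum>i<n. indicator (I i) s) = (indicator {0..<t} s :: real)"
      using sum_indicator_partition(1)[where \<delta> = \<delta> and n = n and s = s] \<delta> by (simp add: I_def)
    finally show "(\<integral>\<^sup>+x. ennreal ((h s x)\<^sup>2) \<partial>N) \<le> ennreal c * indicator {0..<t} s"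
      by (simp add: ennreal_indicator mult.commute)
  qed
  also have "(\<integral>\<^sup>+s. ennreal c * indicator {0..<t} s \<partial>lborel) = ennreal c * ennreal t"
    using t by (subst nn_integral_cmult_indicator) auto
  also have "ennreal t * (ennreal c * ennreal t) = ennreal (t\<^sup>2 * c)"
    using t c by (simp add: ennreal_mult'[symmetric] power2_eq_square mult_ac)
  finally show ?thesis by (simp add: mult_left_mono)
qed

text \<open>The inequality d <= e + d^2/e trades distance for squared distance, so only nonnegative
  integrals of squares occur, and they may be infinite for the first indices.\<close>

lemma (in prob_space) char_tendsto_of_L2:
  fixes R :: "nat \<Rightarrow> 'a \<Rightarrow> real"
  assumes [measurable]: "\<And>n. R n \<in> borel_measurable M" "Z \<in> borel_measurable M"
    and lim: "(\<lambda>n. \<integral>\<^sup>+\<omega>. ennreal ((R n \<omega> - Z \<omega>)\<^sup>2) \<partial>M) \<longlonglongrightarrow> 0"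
  shows "(\<lambda>n. char (distr M borel (R n)) \<zeta>) \<longlonglongrightarrow> char (distr M borel Z) \<zeta>"
proof (rule LIMSEQ_I)
  fix r :: real assume r: "0 < r"
  define D where "D = 1 + \<bar>\<zeta>\<bar>"
  have D: "0 < D" "\<bar>\<zeta>\<bar> < D" by (auto simp: D_def)
  define e where "e = r / (2 * D)"
  have e: "e > 0" using r D by (simp add: e_def)
  have ze: "\<bar>\<zeta>\<bar> * (2 * e) < r"
  proof -
    have "\<bar>\<zeta>\<bar> * (2 * e) < D * (2 * e)" using e D by (intro mult_strict_right_mono) auto
    also have "D * (2 * e) = r" using D by (simp add: e_def)
    finally show ?thesis .
  qed
  have "\<forall>\<^sub>F n in sequentially. (\<integral>\<^sup>+\<omega>. ennreal ((R n \<omega> - Z \<omega>)\<^sup>2) \<partial>M) < ennreal (e\<^sup>2)"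
    by (rule order_tendstoD(2)[OF lim]) (use e in simp)
  then obtain n0 where n0: "\<And>n. n \<ge> n0 \<Longrightarrow> (\<integral>\<^sup>+\<omega>. ennreal ((R n \<omega> - Z \<omega>)\<^sup>2) \<partial>M) \<le> ennreal (e\<^sup>2)"
    by (auto simp: eventually_sequentially intro: less_imp_le)
  show "\<exists>no. \<forall>n\<ge>no. norm (char (distr M borel (R n)) \<zeta> - char (distr M borel Z) \<zeta>) < r"
  proof (intro exI[of _ n0] allI impI)
    fix n assume n: "n0 \<le> n"
    have i1: "integrable M (\<lambda>\<omega>. iexp (\<zeta> * R n \<omega>))" and i2: "integrable M (\<lambda>\<omega>. iexp (\<zeta> * Z \<omega>))"
      by (intro integrable_iexp; simp)+
    have "char (distr M borel (R n)) \<zeta> - char (distr M borel Z) \<zeta> = (CLINT \<omega>|M. iexp (\<zeta> * R n \<omega>) - iexp (\<zeta> * Z \<omega>))"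
      using i1 i2 unfolding char_def by (simp add: integral_distr)
    then have "ennreal (norm (char (distr M borel (R n)) \<zeta> - char (distr M borel Z) \<zeta>))
       \<le> (\<integral>\<^sup>+\<omega>. ennreal (norm (iexp (\<zeta> * R n \<omega>) - iexp (\<zeta> * Z \<omega>))) \<partial>M)"
      using integral_norm_bound_ennreal[OF Bochner_Integration.integrable_diff[OF i1 i2]] by simp
    also have "\<dots> \<le> (\<integral>\<^sup>+\<omega>. ennreal (\<bar>\<zeta>\<bar> * e) + ennreal (\<bar>\<zeta>\<bar> / e) * ennreal ((R n \<omega> - Z \<omega>)\<^sup>2) \<partial>M)"
    proof (rule nn_integral_mono)
      fix \<omega>
      define d where "d = \<bar>R n \<omega> - Z \<omega>\<bar>"
      have "norm (iexp (\<zeta> * R n \<omega>) - iexp (\<zeta> * Z \<omega>)) \<le> \<bar>\<zeta>\<bar> * d"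
        using norm_iexp_diff_le[of "\<zeta> * R n \<omega>" "\<zeta> * Z \<omega>"] by (simp add: d_def abs_mult[symmetric] right_diff_distrib)
      also have "\<dots> \<le> \<bar>\<zeta>\<bar> * (e + d\<^sup>2 / e)"
      proof (rule mult_left_mono)
        have "d \<le> e + d * d / e"
        proof (cases "d \<le> e")
          case True then show ?thesis using e by (simp add: add_increasing2 d_def)
        next
          case False
          then have "d * 1 \<le> d * (d / e)" using e by (intro mult_left_mono) (auto simp: d_def)
          then show ?thesis using e by simp
        qed
        then show "d \<le> e + d\<^sup>2 / e" by (simp add: power2_eq_square)
      qed simp
      also have "\<dots> = \<bar>\<zeta>\<bar> * e + \<bar>\<zeta>\<bar> / e * (R n \<omega> - Z \<omega>)\<^sup>2" by (simp add: d_def distrib_left)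
      finally have "ennreal (norm (iexp (\<zeta> * R n \<omega>) - iexp (\<zeta> * Z \<omega>))) \<le> ennreal (\<bar>\<zeta>\<bar> * e + \<bar>\<zeta>\<bar> / e * (R n \<omega> - Z \<omega>)\<^sup>2)"
        by (rule ennreal_leI)
      also have "\<dots> = ennreal (\<bar>\<zeta>\<bar> * e) + ennreal (\<bar>\<zeta>\<bar> / e) * ennreal ((R n \<omega> - Z \<omega>)\<^sup>2)"
        using e by (simp add: ennreal_mult'[symmetric])
      finally show "ennreal (norm (iexp (\<zeta> * R n \<omega>) - iexp (\<zeta> * Z \<omega>))) \<le> ennreal (\<bar>\<zeta>\<bar> * e) + ennreal (\<bar>\<zeta>\<bar> / e) * ennreal ((R n \<omega> - Z \<omega>)\<^sup>2)" .
    qed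
    also have "\<dots> = ennreal (\<bar>\<zeta>\<bar> * e) + ennreal (\<bar>\<zeta>\<bar> / e) * (\<integral>\<^sup>+\<omega>. ennreal ((R n \<omega> - Z \<omega>)\<^sup>2) \<partial>M)"
      by (subst nn_integral_add) (auto simp: nn_integral_cmult emeasure_space_1)
    also have "\<dots> \<le> ennreal (\<bar>\<zeta>\<bar> * e) + ennreal (\<bar>\<zeta>\<bar> / e) * ennreal (e\<^sup>2)"
      using n0[OF n] by (intro add_left_mono mult_left_mono) auto
    also have "\<dots> = ennreal (\<bar>\<zeta>\<bar> * (2 * e))"
      using e by (simp add: ennreal_mult'[symmetric] ennreal_plus[symmetric] power2_eq_square del: ennreal_plus)
    finally have "norm (char (distr M borel (R n)) \<zeta> - char (distr M borel Z) \<zeta>) \<le> \<bar>\<zeta>\<bar> * (2 * e)"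
      by (subst (asm) ennreal_le_iff) (use e in auto)
    then show "norm (char (distr M borel (R n)) \<zeta> - char (distr M borel Z) \<zeta>) < r" using ze by linarith
  qed
qed

text \<open>The analogue of \<open>levy_comp_diff_le_weighted\<close> for full compensation, with
  plain squares in place of truncated ones.\<close>

lemma norm_iexp_taylor1_diff_le:
  assumes "e > 0"
  shows "cmod ((iexp (\<zeta> * x) - 1 - \<i> * complex_of_real (\<zeta> * x)) - (iexp (\<zeta> * y) - 1 - \<i> * complex_of_real (\<zeta> * y)))
    \<le> \<zeta>\<^sup>2 * e * y\<^sup>2 + \<zeta>\<^sup>2 * (1 / e + 1) * (x - y)\<^sup>2"
proof -
  define d where "d = x - y"
  let ?t1 = "iexp (\<zeta> * y) * (iexp (\<zeta> * d) - 1 - \<i> * complex_of_real (\<zeta> * d))"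
  let ?t2 = "\<i> * complex_of_real (\<zeta> * d) * (iexp (\<zeta> * y) - 1)"
  have "(iexp (\<zeta> * x) - 1 - \<i> * complex_of_real (\<zeta> * x)) - (iexp (\<zeta> * y) - 1 - \<i> * complex_of_real (\<zeta> * y)) = ?t1 + ?t2"
    by (simp add: d_def algebra_simps exp_add[symmetric])
  then have "cmod ((iexp (\<zeta> * x) - 1 - \<i> * complex_of_real (\<zeta> * x)) - (iexp (\<zeta> * y) - 1 - \<i> * complex_of_real (\<zeta> * y)))
    \<le> cmod ?t1 + cmod ?t2" by (metis norm_triangle_ineq)
  moreover have "cmod ?t1 \<le> \<zeta>\<^sup>2 * d\<^sup>2"
  proof -
    have "cmod ?t1 \<le> (\<zeta> * d)\<^sup>2 / 2"
      using norm_iexp_taylor1_le[of "\<zeta> * d"] by (simp only: norm_mult norm_exp_i_times mult_1)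
    also have "\<dots> \<le> \<zeta>\<^sup>2 * d\<^sup>2" by (simp add: power_mult_distrib)
    finally show ?thesis .
  qed
  moreover have "cmod ?t2 \<le> \<zeta>\<^sup>2 * (\<bar>d\<bar> * \<bar>y\<bar>)"
  proof -
    have "cmod ?t2 = (\<bar>\<zeta>\<bar> * \<bar>d\<bar>) * cmod (iexp (\<zeta> * y) - 1)"
      by (simp only: norm_mult norm_ii norm_of_real abs_mult mult_1)
    also have "\<dots> \<le> (\<bar>\<zeta>\<bar> * \<bar>d\<bar>) * \<bar>\<zeta> * y\<bar>" by (intro mult_left_mono norm_iexp_diff_1_le) auto
    also have "\<dots> = \<bar>\<zeta>\<bar> * \<bar>\<zeta>\<bar> * (\<bar>d\<bar> * \<bar>y\<bar>)" by (simp add: abs_mult)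
    finally show ?thesis by (simp only: power2_eq_square abs_mult_self_eq)
  qed
  moreover have "\<zeta>\<^sup>2 * (\<bar>d\<bar> * \<bar>y\<bar>) \<le> \<zeta>\<^sup>2 * (e * y\<^sup>2 + d\<^sup>2 / e)"
  proof (rule mult_left_mono)
    have "e * (\<bar>d\<bar> / e - \<bar>y\<bar>)\<^sup>2 = d\<^sup>2 / e - 2 * (\<bar>d\<bar> * \<bar>y\<bar>) + e * y\<^sup>2"
      using assms by (simp add: power2_diff power_divide) (simp add: field_simps power2_eq_square)
    moreover have "0 \<le> e * (\<bar>d\<bar> / e - \<bar>y\<bar>)\<^sup>2" "0 \<le> d\<^sup>2 / e" "0 \<le> e * y\<^sup>2" using assms by simp_all
    ultimately show "\<bar>d\<bar> * \<bar>y\<bar> \<le> e * y\<^sup>2 + d\<^sup>2 / e" by linarith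
  qed simp
  moreover have "\<zeta>\<^sup>2 * (e * y\<^sup>2 + d\<^sup>2 / e) + \<zeta>\<^sup>2 * d\<^sup>2 = \<zeta>\<^sup>2 * e * y\<^sup>2 + \<zeta>\<^sup>2 * (1 / e + 1) * d\<^sup>2"
    by (simp add: distrib_left distrib_right)
  ultimately show ?thesis unfolding d_def by linarith
qed

lemma levy_exponent_tendsto_of_L2:
  fixes y :: "nat \<Rightarrow> 's \<Rightarrow> real"
  assumes m [measurable]: "\<And>n. y n \<in> borel_measurable N" "z \<in> borel_measurable N"
    and int: "\<And>n. integrable N (\<lambda>x. (y n x)\<^sup>2)" "integrable N (\<lambda>x. (z x)\<^sup>2)"
    and lim: "(\<lambda>n. \<integral>\<^sup>+x. ennreal ((y n x - z x)\<^sup>2) \<partial>N) \<longlonglongrightarrow> 0"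
  shows "(\<lambda>n. levy_exponent N (y n) \<zeta>) \<longlonglongrightarrow> levy_exponent N z \<zeta>"
proof (rule LIMSEQ_I)
  fix r :: real assume r: "0 < r"
  define V where "V = (LINT x|N. (z x)\<^sup>2)"
  have V: "0 \<le> V" "(\<integral>\<^sup>+x. ennreal ((z x)\<^sup>2) \<partial>N) = ennreal V"
    unfolding V_def using int(2) by (auto intro!: integral_nonneg_AE nn_integral_eq_integral)
  \<comment> \<open>Sized by the second moment V of the limit kernel, so that \<zeta>^2 e V < r/2;
    the added ones keep the denominator positive.\<close>
  define e where "e = r / (2 * ((\<zeta>\<^sup>2 + 1) * (V + 1)))"
  have P: "0 < (\<zeta>\<^sup>2 + 1) * (V + 1)" using V by (intro mult_pos_pos) (auto intro: add_nonneg_pos)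
  have e: "e > 0" using r P by (simp add: e_def)
  have half: "\<zeta>\<^sup>2 * e * V < r / 2"
  proof -
    have "\<zeta>\<^sup>2 * V < (\<zeta>\<^sup>2 + 1) * (V + 1)" by (simp add: algebra_simps) (use V zero_le_power2[of \<zeta>] in linarith)
    then have "\<zeta>\<^sup>2 * V * e < (\<zeta>\<^sup>2 + 1) * (V + 1) * e" using e by (rule mult_strict_right_mono)
    also have "\<dots> = r / 2" unfolding e_def using P by (simp only: times_divide_eq_right) (simp add: field_simps)
    finally show ?thesis by (simp add: mult_ac)
  qed
  define c where "c = \<zeta>\<^sup>2 * (1 / e + 1)"
  have c: "0 \<le> c" using e by (simp add: c_def)
  have "\<forall>\<^sub>F n in sequentially. (\<integral>\<^sup>+x. ennreal ((y n x - z x)\<^sup>2) \<partial>N) < ennreal (r / (2 * (c + 1)))"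
    by (rule order_tendstoD(2)[OF lim]) (use r c in simp)
  then obtain n0 where n0: "\<And>n. n \<ge> n0 \<Longrightarrow> (\<integral>\<^sup>+x. ennreal ((y n x - z x)\<^sup>2) \<partial>N) \<le> ennreal (r / (2 * (c + 1)))"
    by (auto simp: eventually_sequentially intro: less_imp_le)
  have chalf: "c * (r / (2 * (c + 1))) \<le> r / 2"
    using c r by (simp add: field_simps)
  show "\<exists>no. \<forall>n\<ge>no. norm (levy_exponent N (y n) \<zeta> - levy_exponent N z \<zeta>) < r"
  proof (intro exI[of _ n0] allI impI)
    fix n assume n: "n0 \<le> n"
    note i1 = levy_exponent_integrable[OF m(1)[of n] int(1)[of n], of \<zeta>] and i2 = levy_exponent_integrable[OF m(2) int(2), of \<zeta>]
    have "ennreal (norm (levy_exponent N (y n) \<zeta> - levy_exponent N z \<zeta>))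
      = ennreal (norm (CLINT x|N. (iexp (\<zeta> * y n x) - 1 - \<i> * complex_of_real (\<zeta> * y n x)) - (iexp (\<zeta> * z x) - 1 - \<i> * complex_of_real (\<zeta> * z x))))"
      unfolding levy_exponent_def by (subst Bochner_Integration.integral_diff[OF i1 i2]) simp
    also have "\<dots> \<le> (\<integral>\<^sup>+x. ennreal (norm ((iexp (\<zeta> * y n x) - 1 - \<i> * complex_of_real (\<zeta> * y n x)) - (iexp (\<zeta> * z x) - 1 - \<i> * complex_of_real (\<zeta> * z x)))) \<partial>N)"
      by (rule integral_norm_bound_ennreal[OF Bochner_Integration.integrable_diff[OF i1 i2]])
    also have "\<dots> \<le> (\<integral>\<^sup>+x. ennreal (\<zeta>\<^sup>2 * e) * ennreal ((z x)\<^sup>2) + ennreal c * ennreal ((y n x - z x)\<^sup>2) \<partial>N)"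
    proof (rule nn_integral_mono)
      fix x
      have "ennreal (norm ((iexp (\<zeta> * y n x) - 1 - \<i> * complex_of_real (\<zeta> * y n x)) - (iexp (\<zeta> * z x) - 1 - \<i> * complex_of_real (\<zeta> * z x))))
        \<le> ennreal (\<zeta>\<^sup>2 * e * (z x)\<^sup>2 + c * (y n x - z x)\<^sup>2)"
        unfolding c_def by (intro ennreal_leI norm_iexp_taylor1_diff_le e)
      also have "\<dots> = ennreal (\<zeta>\<^sup>2 * e) * ennreal ((z x)\<^sup>2) + ennreal c * ennreal ((y n x - z x)\<^sup>2)"
        using e c by (simp add: ennreal_mult')
      finally show "ennreal (norm ((iexp (\<zeta> * y n x) - 1 - \<i> * complex_of_real (\<zeta> * y n x)) - (iexp (\<zeta> * z x) - 1 - \<i> * complex_of_real (\<zeta> * z x))))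
        \<le> ennreal (\<zeta>\<^sup>2 * e) * ennreal ((z x)\<^sup>2) + ennreal c * ennreal ((y n x - z x)\<^sup>2)" .
    qed
    also have "\<dots> = ennreal (\<zeta>\<^sup>2 * e) * ennreal V + ennreal c * (\<integral>\<^sup>+x. ennreal ((y n x - z x)\<^sup>2) \<partial>N)"
      by (subst nn_integral_add) (auto simp: nn_integral_cmult V)
    also have "\<dots> \<le> ennreal (\<zeta>\<^sup>2 * e) * ennreal V + ennreal c * ennreal (r / (2 * (c + 1)))"
      using n0[OF n] by (intro add_left_mono mult_left_mono) auto
    also have "\<dots> = ennreal (\<zeta>\<^sup>2 * e * V + c * (r / (2 * (c + 1))))"
      using e c r V by (simp add: ennreal_mult'[symmetric])
    finally have "norm (levy_exponent N (y n) \<zeta> - levy_exponent N z \<zeta>) \<le> \<zeta>\<^sup>2 * e * V + c * (r / (2 * (c + 1)))"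
      by (subst (asm) ennreal_le_iff) (use e c r V in auto)
    then show "norm (levy_exponent N (y n) \<zeta> - levy_exponent N z \<zeta>) < r" using half chalf by linarith
  qed
qed

section \<open>The integrated kernel\<close>

text \<open>Closed form of F_t: the integrand lives on u >= max(0, s/\<xi>), where it starts at the
  value exp(min(s, 0)) and decays to exp(s - \<xi> t) at u = t.\<close>

definition integrated_kernel :: "real \<Rightarrow> real \<times> real \<Rightarrow> real" where
  "integrated_kernel t z = (if snd z \<le> fst z * t then (exp (min (snd z) 0) - exp (snd z - fst z * t)) / fst z else 0)"

locale rate_law = prob_space \<pi> for \<pi> :: "real measure" +
  assumes sets_rate: "sets \<pi> = sets (restrict_space borel {0<..})"
begin

lemma space_rate: "space \<pi> = {0<..}"
  using sets_eq_imp_space_eq[OF sets_rate] by (simp add: space_restrict_space)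

lemma rate_measurable [measurable (raw)]:
  "f \<in> borel \<rightarrow>\<^sub>M K \<Longrightarrow> f \<in> \<pi> \<rightarrow>\<^sub>M K"
  by (simp add: measurable_cong_sets[OF sets_rate refl] measurable_restrict_space1)

sublocale rate_lborel: pair_sigma_finite \<pi> lborel ..

abbreviation control :: "(real \<times> real) measure" where
  "control \<equiv> \<pi> \<Otimes>\<^sub>M lborel"

lemma fst_control [measurable]: "fst \<in> borel_measurable control"
proof (rule measurable_compose[where g = "\<lambda>x::real. x", OF measurable_fst])
  show "(\<lambda>x. x) \<in> borel_measurable \<pi>" by (rule rate_measurable) simp
qed

lemma snd_control [measurable]: "snd \<in> borel_measurable control"
  by (rule measurable_compose[OF measurable_snd]) simp

lemma supOU_kernel_eq: "supOU_kernel t z = exp (snd z - fst z * t) * indicator {..fst z * t} (snd z)"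
  by (cases z) (auto simp: supOU_kernel_def indicator_def)

lemma supOU_kernel_joint_measurable:
  "(\<lambda>(u, z). supOU_kernel u z) \<in> borel_measurable (borel \<Otimes>\<^sub>M control)"
proof -
  have [measurable]: "(\<lambda>p. fst (snd p)) \<in> borel_measurable (borel \<Otimes>\<^sub>M control)" "(\<lambda>p. snd (snd p)) \<in> borel_measurable (borel \<Otimes>\<^sub>M control)"
    by (auto intro: measurable_compose[OF measurable_snd fst_control] measurable_compose[OF measurable_snd snd_control])
  have "(\<lambda>p. if snd (snd p) \<le> fst (snd p) * fst p then exp (snd (snd p) - fst (snd p) * fst p) else 0) \<in> borel_measurable (borel \<Otimes>\<^sub>M control)"
    by measurable
  also have "(\<lambda>p. if snd (snd p) \<le> fst (snd p) * fst p then exp (snd (snd p) - fst (snd p) * fst p) else 0) = (\<lambda>(u, z). supOU_kernel u z)"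
    by (auto simp: supOU_kernel_eq indicator_def)
  finally show ?thesis .
qed

lemma supOU_kernel_measurable [measurable]: "supOU_kernel u \<in> borel_measurable control"
  using measurable_compose[OF measurable_Pair1'[of u borel control] supOU_kernel_joint_measurable] by simp

lemma nn_integral_exp_atMost:
  fixes c g :: real assumes g: "g > 0"
  shows "(\<integral>\<^sup>+s. ennreal (exp (g * (s - c))) * indicator {..c} s \<partial>lborel) = ennreal (1 / g)"
proof -
  have "(\<integral>\<^sup>+s. ennreal (exp (g * (s - c))) * indicator {..c} s \<partial>lborel)
    = ennreal \<bar>-1\<bar> * (\<integral>\<^sup>+s. ennreal (exp (g * ((c + (-1) * s) - c))) * indicator {..c} (c + (-1) * s) \<partial>lborel)"
    by (rule nn_integral_real_affine) auto
  also have "\<dots> = (\<integral>\<^sup>+s. ennreal (exp (- g * s)) * indicator {0..} s \<partial>lborel)"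
    by (auto intro!: nn_integral_cong simp: indicator_def)
  also have "\<dots> = ennreal (exp (- g * 0) / g)"
    by (rule nn_integral_has_integral_lebesgue'[OF _ has_integral_exp_minus_to_infinity[OF g]]) simp
  finally show ?thesis by simp
qed

text \<open>For each \<xi> the shift by \<xi> t disappears under the integral over s, leaving 1/2
  independently of rate and time.\<close>

lemma nn_integral_supOU_kernel_square:
  "(\<integral>\<^sup>+z. ennreal ((supOU_kernel t z)\<^sup>2) \<partial>control) = ennreal (1 / 2)"
proof -
  have "(\<integral>\<^sup>+z. ennreal ((supOU_kernel t z)\<^sup>2) \<partial>control) = (\<integral>\<^sup>+\<xi>. \<integral>\<^sup>+s. ennreal ((supOU_kernel t (\<xi>, s))\<^sup>2) \<partial>lborel \<partial>\<pi>)"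
    by (rule lborel.nn_integral_fst[symmetric]) measurable
  also have "\<dots> = (\<integral>\<^sup>+\<xi>. ennreal (1 / 2) \<partial>\<pi>)"
  proof (rule nn_integral_cong)
    fix \<xi> :: real
    have "(\<integral>\<^sup>+s. ennreal ((supOU_kernel t (\<xi>, s))\<^sup>2) \<partial>lborel) = (\<integral>\<^sup>+s. ennreal (exp (2 * (s - \<xi> * t))) * indicator {..\<xi> * t} s \<partial>lborel)"
      by (intro nn_integral_cong) (auto simp: supOU_kernel_eq indicator_def power2_eq_square exp_add[symmetric])
    also have "\<dots> = ennreal (1 / 2)" by (rule nn_integral_exp_atMost) simp
    finally show "(\<integral>\<^sup>+s. ennreal ((supOU_kernel t (\<xi>, s))\<^sup>2) \<partial>lborel) = ennreal (1 / 2)" .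
  qed
  finally show ?thesis by (simp add: emeasure_space_1)
qed

text \<open>One minus the correlation of the supOU process at lag h, which is the Laplace transform
  of \<pi>.\<close>

definition decorrelation :: "real \<Rightarrow> real" where
  "decorrelation h = (LINT \<xi>|\<pi>. 1 - exp (- \<xi> * h))"

lemma decorrelation_integrable: "0 \<le> h \<Longrightarrow> integrable \<pi> (\<lambda>\<xi>. 1 - exp (- \<xi> * h))"
  by (rule integrable_const_bound[of _ 1]) (auto intro!: AE_I2 simp: space_rate)

lemma decorrelation_nonneg: "0 \<le> h \<Longrightarrow> 0 \<le> decorrelation h"
  unfolding decorrelation_def by (intro integral_nonneg_AE) (auto intro!: AE_I2 simp: space_rate)

text \<open>With E = exp(-\<xi>(v - u)), the range s <= \<xi> u contributes (1 - E)^2/2 and the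
  range between \<xi> u and \<xi> v contributes (1 - E^2)/2; they add up to 1 - E.\<close>

lemma nn_integral_supOU_kernel_diff_le:
  assumes uv: "u \<le> v" "v \<le> u + h"
  shows "(\<integral>\<^sup>+z. ennreal ((supOU_kernel v z - supOU_kernel u z)\<^sup>2) \<partial>control) \<le> ennreal (decorrelation h)"
proof -
  have h: "0 \<le> h" using uv by simp
  have "(\<integral>\<^sup>+z. ennreal ((supOU_kernel v z - supOU_kernel u z)\<^sup>2) \<partial>control)
    = (\<integral>\<^sup>+\<xi>. \<integral>\<^sup>+s. ennreal ((supOU_kernel v (\<xi>, s) - supOU_kernel u (\<xi>, s))\<^sup>2) \<partial>lborel \<partial>\<pi>)"
    by (rule lborel.nn_integral_fst[symmetric]) measurable
  also have "\<dots> \<le> (\<integral>\<^sup>+\<xi>. ennreal (1 - exp (- \<xi> * h)) \<partial>\<pi>)"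
  proof (rule nn_integral_mono)
    fix \<xi> assume "\<xi> \<in> space \<pi>"
    then have \<xi>: "0 < \<xi>" by (simp add: space_rate)
    define a b where "a = \<xi> * u" and "b = \<xi> * v"
    have ab: "a \<le> b" using \<xi> uv by (simp add: a_def b_def)
    define E where "E = exp (a - b)"
    have E: "0 < E" "E \<le> 1" using ab by (auto simp: E_def)
    have "(\<integral>\<^sup>+s. ennreal ((supOU_kernel v (\<xi>, s) - supOU_kernel u (\<xi>, s))\<^sup>2) \<partial>lborel)
       \<le> (\<integral>\<^sup>+s. ennreal ((1 - E)\<^sup>2) * (ennreal (exp (2 * (s - a))) * indicator {..a} s) + ennreal (exp (2 * (s - b))) * indicator {a..b} s \<partial>lborel)"
    proof (rule nn_integral_mono)
      fix s
      show "ennreal ((supOU_kernel v (\<xi>, s) - supOU_kernel u (\<xi>, s))\<^sup>2)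
        \<le> ennreal ((1 - E)\<^sup>2) * (ennreal (exp (2 * (s - a))) * indicator {..a} s) + ennreal (exp (2 * (s - b))) * indicator {a..b} s"
      proof -
        consider "s \<le> a" | "a < s" "s \<le> b" | "b < s" by linarith
        then show ?thesis
        proof cases
          case 1
          then have "supOU_kernel v (\<xi>, s) - supOU_kernel u (\<xi>, s) = exp (s - b) - exp (s - a)"
            using ab by (simp add: supOU_kernel_eq a_def b_def)
          also have "\<dots> = - (exp (s - a) * (1 - E))" by (simp add: E_def right_diff_distrib exp_add[symmetric])
          finally have "(supOU_kernel v (\<xi>, s) - supOU_kernel u (\<xi>, s))\<^sup>2 = (1 - E)\<^sup>2 * exp (2 * (s - a))"
            by (simp only: power2_minus power_mult_distrib exp_double) (rule mult.commute)
          then show ?thesis using 1 by (simp add: ennreal_mult')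
        next
          case 2
          then have "supOU_kernel v (\<xi>, s) - supOU_kernel u (\<xi>, s) = exp (s - b)"
            by (simp add: supOU_kernel_eq a_def b_def)
          then have "(supOU_kernel v (\<xi>, s) - supOU_kernel u (\<xi>, s))\<^sup>2 = exp (2 * (s - b))"
            by (simp only: exp_double)
          then show ?thesis using 2 by simp
        next
          case 3
          then show ?thesis using ab by (simp add: supOU_kernel_eq a_def b_def)
        qed
      qed
    qed
    also have "\<dots> = ennreal ((1 - E)\<^sup>2) * (\<integral>\<^sup>+s. ennreal (exp (2 * (s - a))) * indicator {..a} s \<partial>lborel)
       + (\<integral>\<^sup>+s. ennreal (exp (2 * (s - b))) * indicator {a..b} s \<partial>lborel)"
      by (subst nn_integral_add) (auto simp: nn_integral_cmult)
    also have "(\<integral>\<^sup>+s. ennreal (exp (2 * (s - a))) * indicator {..a} s \<partial>lborel) = ennreal (1 / 2)"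
      by (rule nn_integral_exp_atMost) simp
    also have "(\<integral>\<^sup>+s. ennreal (exp (2 * (s - b))) * indicator {a..b} s \<partial>lborel) = ennreal (exp (2 * (b - b)) / 2 - exp (2 * (a - b)) / 2)"
      by (rule nn_integral_FTC_Icc[OF _ _ _ ab]) (auto intro!: derivative_eq_intros)
    also have "exp (2 * (b - b)) / 2 - exp (2 * (a - b)) / 2 = (1 - E\<^sup>2) / 2"
      by (simp add: E_def exp_double[symmetric] diff_divide_distrib)
    also have "ennreal ((1 - E)\<^sup>2) * ennreal (1 / 2) + ennreal ((1 - E\<^sup>2) / 2) = ennreal ((1 - E)\<^sup>2 * (1 / 2) + (1 - E\<^sup>2) / 2)"
      using E by (subst ennreal_mult'[symmetric], simp, subst ennreal_plus) (auto simp: power_le_one)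
    also have "(1 - E)\<^sup>2 * (1 / 2) + (1 - E\<^sup>2) / 2 = 1 - E" by (simp add: power2_eq_square field_simps)
    also have "ennreal (1 - E) \<le> ennreal (1 - exp (- \<xi> * h))"
    proof (rule ennreal_leI)
      have "\<xi> * (v - u) \<le> \<xi> * h" using \<xi> uv by (intro mult_left_mono) auto
      then show "1 - E \<le> 1 - exp (- \<xi> * h)" by (simp add: E_def a_def b_def algebra_simps)
    qed
    finally show "(\<integral>\<^sup>+s. ennreal ((supOU_kernel v (\<xi>, s) - supOU_kernel u (\<xi>, s))\<^sup>2) \<partial>lborel) \<le> ennreal (1 - exp (- \<xi> * h))" .
  qed
  also have "\<dots> = ennreal (decorrelation h)"
    unfolding decorrelation_def using decorrelation_integrable[OF h] h
    by (intro nn_integral_eq_integral) (auto intro!: AE_I2 simp: space_rate)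
  finally show ?thesis .
qed

lemma decorrelation_tendsto: "(\<lambda>n. decorrelation (t / real n)) \<longlonglongrightarrow> 0" if t: "0 \<le> t"
proof -
  have "(\<lambda>n. LINT \<xi>|\<pi>. 1 - exp (- \<xi> * (t / real n))) \<longlonglongrightarrow> (LINT \<xi>|\<pi>. 0)"
  proof (rule integral_dominated_convergence[where w = "\<lambda>_. 1"])
    show "AE \<xi> in \<pi>. (\<lambda>n. 1 - exp (- \<xi> * (t / real n))) \<longlonglongrightarrow> 0"
    proof (rule AE_I2)
      fix \<xi>
      have "(\<lambda>n. 1 - exp (- \<xi> * (t / real n))) \<longlonglongrightarrow> 1 - exp (- \<xi> * 0)"
        by (intro tendsto_intros lim_const_over_n)
      then show "(\<lambda>n. 1 - exp (- \<xi> * (t / real n))) \<longlonglongrightarrow> 0" by simp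
    qed
    show "AE \<xi> in \<pi>. norm (1 - exp (- \<xi> * (t / real n))) \<le> 1" for n
      using t by (intro AE_I2) (auto simp: space_rate)
  qed auto
  then show ?thesis by (simp add: decorrelation_def)
qed

lemma integrated_kernel_measurable [measurable]: "integrated_kernel t \<in> borel_measurable control"
  unfolding integrated_kernel_def[abs_def] by measurable

lemma integrated_kernel:
  assumes t: "0 \<le> t" and \<xi>: "0 < fst z"
  shows "set_integrable lborel {0..t} (\<lambda>u. supOU_kernel u z)"
    and "(LINT u:{0..t}|lborel. supOU_kernel u z) = integrated_kernel t z"
proof -
  define \<xi> s where "\<xi> = fst z" and "s = snd z"
  have \<xi>0: "0 < \<xi>" using \<xi> by (simp add: \<xi>_def)
  define u0 where "u0 = max 0 (s / \<xi>)"
  have iff: "s \<le> \<xi> * u \<longleftrightarrow> s / \<xi> \<le> u" for u using \<xi>0 by (simp add: field_simps)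
  have f: "indicator {0..t} u * supOU_kernel u z = indicator {u0..t} u * exp (s - \<xi> * u)" for u
    using iff[of u] by (auto simp: supOU_kernel_eq indicator_def u0_def \<xi>_def[symmetric] s_def[symmetric])
  have "integrable lborel (\<lambda>u. indicator {0..t} u * supOU_kernel u z) \<and>
     (LINT u|lborel. indicator {0..t} u * supOU_kernel u z) = integrated_kernel t z"
  proof (cases "s \<le> \<xi> * t")
    case True
    then have ut: "u0 \<le> t" using iff[of t] t by (simp add: u0_def)
    have "has_bochner_integral lborel (\<lambda>u. indicator {u0..t} u *\<^sub>R exp (s - \<xi> * u)) ((- exp (s - \<xi> * t) / \<xi>) - (- exp (s - \<xi> * u0) / \<xi>))"
    proof (rule has_bochner_integral_FTC_Icc[OF ut])
      show "((\<lambda>u. - exp (s - \<xi> * u) / \<xi>) has_vector_derivative exp (s - \<xi> * x)) (at x within {u0..t})" for x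
        unfolding has_real_derivative_iff_has_vector_derivative[symmetric]
        using \<xi>0 by (auto intro!: derivative_eq_intros)
    qed (auto intro!: continuous_intros)
    moreover have "s - \<xi> * u0 = min s 0" using \<xi>0 by (auto simp: u0_def max_def min_def field_simps)
    then have "(- exp (s - \<xi> * t) / \<xi>) - (- exp (s - \<xi> * u0) / \<xi>) = integrated_kernel t z"
      using True by (simp add: integrated_kernel_def \<xi>_def[symmetric] s_def[symmetric] diff_divide_distrib)
    ultimately show ?thesis unfolding f by (simp add: has_bochner_integral_iff)
  next
    case False
    then have "\<not> u0 \<le> t" using iff[of t] by (simp add: u0_def)
    then have "indicator {u0..t} u * exp (s - \<xi> * u) = 0" for u by (simp add: indicator_def)
    then show ?thesis unfolding f using False by (simp add: integrated_kernel_def \<xi>_def[symmetric] s_def[symmetric])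
  qed
  then show "set_integrable lborel {0..t} (\<lambda>u. supOU_kernel u z)"
    and "(LINT u:{0..t}|lborel. supOU_kernel u z) = integrated_kernel t z"
    unfolding set_integrable_def set_lebesgue_integral_def by simp_all
qed

section \<open>The size of the integrated kernel\<close>

text \<open>Two regimes meet at \<xi> = 1/t: for slower rates there is little decay and the time t
  bounds the integral, for faster rates the total integral 1/\<xi> of the exponential does. The
  bound by t uses exp v >= 1 + v.\<close>

lemma integrated_kernel_bounds:
  assumes t: "0 \<le> t" and \<xi>: "0 < fst z"
  shows "0 \<le> integrated_kernel t z"
    and "integrated_kernel t z \<le> min t (1 / fst z) * exp (min (snd z) 0) * indicator {..fst z * t} (snd z)"
proof -
  define \<xi> s where "\<xi> = fst z" and "s = snd z"
  have \<xi>0: "0 < \<xi>" using \<xi> by (simp add: \<xi>_def)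
  define k where "k = min s 0"
  have k: "k \<le> s" "k \<le> 0" by (auto simp: k_def)
  have H: "integrated_kernel t z = (if s \<le> \<xi> * t then (exp k - exp (s - \<xi> * t)) / \<xi> else 0)"
    by (simp add: integrated_kernel_def \<xi>_def s_def k_def)
  have "s - \<xi> * t \<le> k" if "s \<le> \<xi> * t" using that \<xi>0 t by (auto simp: k_def min_def)
  then show "0 \<le> integrated_kernel t z" unfolding H using \<xi>0 by auto
  show "integrated_kernel t z \<le> min t (1 / fst z) * exp (min (snd z) 0) * indicator {..fst z * t} (snd z)"
  proof (cases "s \<le> \<xi> * t")
    case True
    have "(exp k - exp (s - \<xi> * t)) / \<xi> \<le> 1 / \<xi> * exp k" using \<xi>0 by (simp add: divide_right_mono)
    moreover have "(exp k - exp (s - \<xi> * t)) / \<xi> \<le> t * exp k"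
    proof -
      have "exp (s - \<xi> * t) = exp k * exp (s - k - \<xi> * t)" by (simp add: exp_add[symmetric])
      moreover have "exp k * (1 + (s - k - \<xi> * t)) \<le> exp k * exp (s - k - \<xi> * t)" by (intro mult_left_mono exp_ge_add_one_self) auto
      moreover have "exp k * (1 - \<xi> * t) \<le> exp k * (1 + (s - k - \<xi> * t))" using k by (intro mult_left_mono) auto
      moreover have "exp k * (1 - \<xi> * t) = exp k - exp k * (\<xi> * t)" by (simp add: right_diff_distrib)
      ultimately have "exp k - exp (s - \<xi> * t) \<le> exp k * (\<xi> * t)" by linarith
      then show ?thesis using \<xi>0 by (simp add: divide_le_eq mult_ac)
    qed
    ultimately have "(exp k - exp (s - \<xi> * t)) / \<xi> \<le> min t (1 / \<xi>) * exp k" by (simp add: min_def)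
    then show ?thesis using True unfolding H by (simp add: \<xi>_def s_def k_def)
  next
    case False
    then show ?thesis unfolding H by (simp add: \<xi>_def s_def)
  qed
qed

text \<open>The free exponent \<theta>, through min(t, 1/\<xi>)^\<gamma> <= t^(\<gamma>-\<theta>)
  \<xi>^(-\<theta>), decides which negative moment of \<pi> is spent. It is taken as \<theta> =
  \<gamma> for linear growth below 1 + \<alpha>, just below 1 + \<alpha> with \<gamma> = 2 for the
  variance, and as 1 for mere finiteness.\<close>

lemma integrated_kernel_moment_le:
  assumes t: "0 < t" and \<theta>: "1 \<le> \<theta>" "\<theta> \<le> \<gamma>"
  shows "(\<integral>\<^sup>+z. ennreal (integrated_kernel t z powr \<gamma>) \<partial>control)
    \<le> ennreal (2 * t powr (\<gamma> - \<theta> + 1)) * (\<integral>\<^sup>+\<xi>. ennreal (\<xi> powr (1 - \<theta>)) \<partial>\<pi>)"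
proof -
  have "(\<integral>\<^sup>+z. ennreal (integrated_kernel t z powr \<gamma>) \<partial>control)
    = (\<integral>\<^sup>+\<xi>. \<integral>\<^sup>+s. ennreal (integrated_kernel t (\<xi>, s) powr \<gamma>) \<partial>lborel \<partial>\<pi>)"
    by (rule lborel.nn_integral_fst[symmetric]) measurable
  also have "\<dots> \<le> (\<integral>\<^sup>+\<xi>. ennreal (2 * t powr (\<gamma> - \<theta> + 1)) * ennreal (\<xi> powr (1 - \<theta>)) \<partial>\<pi>)"
  proof (rule nn_integral_mono)
    fix \<xi> assume "\<xi> \<in> space \<pi>"
    then have \<xi>: "0 < \<xi>" by (simp add: space_rate)
    \<comment> \<open>With this height the half-line s <= 0 contributes k^\<gamma>/\<gamma> and the
      plateau 0 <= s <= \<xi> t at most k^\<gamma> \<xi> t; each is bounded by the same power of t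
      and \<xi>, hence the factor 2.\<close>
    define k where "k = min t (1 / \<xi>)"
    have k: "0 < k" "k \<le> t" "k \<le> 1 / \<xi>" using t \<xi> by (auto simp: k_def)
    have "(\<integral>\<^sup>+s. ennreal (integrated_kernel t (\<xi>, s) powr \<gamma>) \<partial>lborel)
      \<le> (\<integral>\<^sup>+s. ennreal (k powr \<gamma>) * (ennreal (exp (\<gamma> * (s - 0))) * indicator {..0} s) + ennreal (k powr \<gamma>) * indicator {0..\<xi> * t} s \<partial>lborel)"
    proof (rule nn_integral_mono)
      fix s
      have b: "0 \<le> integrated_kernel t (\<xi>, s)" "integrated_kernel t (\<xi>, s) \<le> k * exp (min s 0) * indicator {..\<xi> * t} s"
        using integrated_kernel_bounds[of t "(\<xi>, s)"] t \<xi> by (simp_all add: k_def)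
      have "integrated_kernel t (\<xi>, s) powr \<gamma> \<le> (k * exp (min s 0) * indicator {..\<xi> * t} s) powr \<gamma>"
        using b \<theta> by (intro powr_mono2) auto
      also have "(k * exp (min s 0) * indicator {..\<xi> * t} s) powr \<gamma> = k powr \<gamma> * exp (\<gamma> * min s 0) * indicator {..\<xi> * t} s"
        using k \<theta> by (simp add: indicator_def powr_mult exp_powr_real mult.commute)
      finally have le: "integrated_kernel t (\<xi>, s) powr \<gamma> \<le> k powr \<gamma> * exp (\<gamma> * min s 0) * indicator {..\<xi> * t} s" .
      consider "s \<le> 0" | "0 < s" "s \<le> \<xi> * t" | "\<xi> * t < s" "0 < s" using \<xi> t by (smt (verit) mult_pos_pos)
      then show "ennreal (integrated_kernel t (\<xi>, s) powr \<gamma>)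
        \<le> ennreal (k powr \<gamma>) * (ennreal (exp (\<gamma> * (s - 0))) * indicator {..0} s) + ennreal (k powr \<gamma>) * indicator {0..\<xi> * t} s"
      proof cases
        case 1
        have "s \<le> \<xi> * t" using 1 \<xi> t by (smt (verit) mult_pos_pos)
        then have "ennreal (integrated_kernel t (\<xi>, s) powr \<gamma>) \<le> ennreal (k powr \<gamma> * exp (\<gamma> * s))"
          using le 1 by (intro ennreal_leI) (simp add: min_absorb1)
        also have "\<dots> = ennreal (k powr \<gamma>) * (ennreal (exp (\<gamma> * (s - 0))) * indicator {..0} s)"
          using 1 by (simp add: ennreal_mult')
        finally show ?thesis by (rule order_trans) simp
      next
        case 2
        then show ?thesis using le by (auto intro!: ennreal_leI simp: min_absorb2)
      next
        case 3
        then show ?thesis using le by (simp add: min_absorb2 ennreal_neg)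
      qed
    qed
    also have "\<dots> = ennreal (k powr \<gamma>) * (\<integral>\<^sup>+s. ennreal (exp (\<gamma> * (s - 0))) * indicator {..0} s \<partial>lborel) + ennreal (k powr \<gamma>) * emeasure lborel {0..\<xi> * t}"
      by (subst nn_integral_add) (auto simp: nn_integral_cmult)
    also have "(\<integral>\<^sup>+s. ennreal (exp (\<gamma> * (s - 0))) * indicator {..0} s \<partial>lborel) = ennreal (1 / \<gamma>)"
      by (rule nn_integral_exp_atMost) (use \<theta> in simp)
    also have "emeasure lborel {0..\<xi> * t} = ennreal (\<xi> * t)" using \<xi> t by simp
    also have "ennreal (k powr \<gamma>) * ennreal (1 / \<gamma>) + ennreal (k powr \<gamma>) * ennreal (\<xi> * t) = ennreal (k powr \<gamma> * (1 / \<gamma>) + k powr \<gamma> * (\<xi> * t))"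
      using \<theta> \<xi> t by (simp add: ennreal_mult'[symmetric] del: times_divide_eq_right)
    also have "\<dots> \<le> ennreal (2 * t powr (\<gamma> - \<theta> + 1) * \<xi> powr (1 - \<theta>))"
    proof (rule ennreal_leI)
      have e: "1 / \<xi> = \<xi> powr - 1" using \<xi> by (simp add: powr_minus_divide)
      have "k powr \<gamma> * (1 / \<gamma>) \<le> k powr \<gamma> * 1" using \<theta> by (intro mult_left_mono) auto
      also have "k powr \<gamma> * 1 = k powr (\<gamma> - \<theta> + 1) * k powr (\<theta> - 1)" by (simp add: powr_add[symmetric])
      also have "\<dots> \<le> t powr (\<gamma> - \<theta> + 1) * (1 / \<xi>) powr (\<theta> - 1)" using k \<theta> by (intro mult_mono powr_mono2) auto
      also have "(1 / \<xi>) powr (\<theta> - 1) = \<xi> powr (1 - \<theta>)" unfolding e powr_powr by simp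
      finally have A: "k powr \<gamma> * (1 / \<gamma>) \<le> t powr (\<gamma> - \<theta> + 1) * \<xi> powr (1 - \<theta>)" .
      have "k powr \<gamma> * (\<xi> * t) = k powr (\<gamma> - \<theta>) * k powr \<theta> * (\<xi> * t)" by (simp add: powr_add[symmetric])
      also have "\<dots> \<le> t powr (\<gamma> - \<theta>) * (1 / \<xi>) powr \<theta> * (\<xi> * t)" using k \<theta> \<xi> t by (intro mult_right_mono mult_mono powr_mono2) auto
      also have "(1 / \<xi>) powr \<theta> = \<xi> powr - \<theta>" unfolding e powr_powr by simp
      also have "t powr (\<gamma> - \<theta>) * \<xi> powr - \<theta> * (\<xi> * t) = (t powr (\<gamma> - \<theta>) * t powr 1) * (\<xi> powr - \<theta> * \<xi> powr 1)" using \<xi> t by simp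
      also have "\<dots> = t powr (\<gamma> - \<theta> + 1) * \<xi> powr (1 - \<theta>)" by (simp only: powr_add[symmetric]) (simp add: algebra_simps)
      finally show "k powr \<gamma> * (1 / \<gamma>) + k powr \<gamma> * (\<xi> * t) \<le> 2 * t powr (\<gamma> - \<theta> + 1) * \<xi> powr (1 - \<theta>)"
        using A by simp
    qed
    also have "\<dots> = ennreal (2 * t powr (\<gamma> - \<theta> + 1)) * ennreal (\<xi> powr (1 - \<theta>))" by (rule ennreal_mult) auto
    finally show "(\<integral>\<^sup>+s. ennreal (integrated_kernel t (\<xi>, s) powr \<gamma>) \<partial>lborel) \<le> ennreal (2 * t powr (\<gamma> - \<theta> + 1)) * ennreal (\<xi> powr (1 - \<theta>))" .
  qed
  also have "\<dots> = ennreal (2 * t powr (\<gamma> - \<theta> + 1)) * (\<integral>\<^sup>+\<xi>. ennreal (\<xi> powr (1 - \<theta>)) \<partial>\<pi>)"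
    by (rule nn_integral_cmult) measurable
  finally show ?thesis .
qed

lemma nn_integral_rate_interval: "(\<integral>\<^sup>+x. indicator {y<..4*y} x \<partial>\<pi>) = emeasure \<pi> {y<..4*y}" if "0 < y"
proof -
  have "{y<..4*y} \<in> sets \<pi>" using that by (auto simp: sets_rate sets_restrict_space_iff)
  then show ?thesis by simp
qed

lemma control_rectangle:
  assumes y: "0 < y" and ab: "a \<le> b"
  shows "{y<..4*y} \<times> {a<..b} \<in> sets control"
    and "emeasure control ({y<..4*y} \<times> {a<..b}) = emeasure \<pi> {y<..4*y} * ennreal (b - a)"
proof -
  have s: "{y<..4*y} \<in> sets \<pi>" using y by (auto simp: sets_rate sets_restrict_space_iff)
  then show "{y<..4*y} \<times> {a<..b} \<in> sets control" by simp
  show "emeasure control ({y<..4*y} \<times> {a<..b}) = emeasure \<pi> {y<..4*y} * ennreal (b - a)"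
    using s ab by (subst lborel.emeasure_pair_measure_Times) auto
qed

text \<open>Rates between 1/(4t) and 1/t carry the variance: there \<xi> t <= 1, so for -1 < s <= 0
  the kernel is at least exp(-2) t.\<close>

lemma integrated_kernel_square_ge:
  assumes t: "0 < t"
  shows "ennreal (exp (-4) * t\<^sup>2) * emeasure \<pi> {1/(4*t)<..4*(1/(4*t))} \<le> (\<integral>\<^sup>+z. ennreal ((integrated_kernel t z)\<^sup>2) \<partial>control)"
proof -
  define y where "y = 1 / (4 * t)"
  have y: "0 < y" using t by (simp add: y_def)
  let ?R = "{y<..4*y} \<times> {-1<..0}"
  have "ennreal (exp (-4) * t\<^sup>2) * emeasure \<pi> {y<..4*y} = (\<integral>\<^sup>+z. ennreal (exp (-4) * t\<^sup>2) * indicator ?R z \<partial>control)"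
    using control_rectangle[OF y, of "-1" 0] by (subst nn_integral_cmult_indicator) auto
  also have "\<dots> \<le> (\<integral>\<^sup>+z. ennreal ((integrated_kernel t z)\<^sup>2) \<partial>control)"
  proof (rule nn_integral_mono)
    fix z
    show "ennreal (exp (-4) * t\<^sup>2) * indicator ?R z \<le> ennreal ((integrated_kernel t z)\<^sup>2)"
    proof (cases "z \<in> ?R")
      case True
      define \<xi> s where "\<xi> = fst z" and "s = snd z"
      have yx: "y < \<xi>" "\<xi> \<le> 4 * y" and s: "-1 < s" "s \<le> 0"
        using True by (auto simp: \<xi>_def s_def)
      have "\<xi> * t \<le> 4 * y * t" using yx t by (intro mult_right_mono) auto
      then have \<xi>: "0 < \<xi>" "\<xi> * t \<le> 1" using yx y t by (auto simp: y_def)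
      have "0 \<le> \<xi> * t" using \<xi> t by simp
      then have "s \<le> \<xi> * t" using s by linarith
      then have H: "integrated_kernel t z = exp s * (1 - exp (- (\<xi> * t))) / \<xi>"
        using s by (simp add: integrated_kernel_def \<xi>_def[symmetric] s_def[symmetric] right_diff_distrib exp_add[symmetric] min_absorb1)
      have "exp (- (\<xi> * t)) * (1 + \<xi> * t) \<le> exp (- (\<xi> * t)) * exp (\<xi> * t)"
        using exp_ge_add_one_self[of "\<xi> * t"] by (intro mult_left_mono) auto
      then have "exp (- (\<xi> * t)) * (\<xi> * t) \<le> 1 - exp (- (\<xi> * t))" by (simp add: exp_add[symmetric] distrib_left)
      moreover have "exp (-1) * (\<xi> * t) \<le> exp (- (\<xi> * t)) * (\<xi> * t)" using \<xi> t by (intro mult_right_mono) auto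
      ultimately have "exp (-1) * (\<xi> * t) \<le> 1 - exp (- (\<xi> * t))" by linarith
      moreover have "exp (-1) \<le> exp s" using s by simp
      ultimately have "exp (-1) * (exp (-1) * (\<xi> * t)) \<le> exp s * (1 - exp (- (\<xi> * t)))"
        using \<xi> t by (intro mult_mono) auto
      then have "exp (-1) * (exp (-1) * (\<xi> * t)) / \<xi> \<le> integrated_kernel t z"
        unfolding H using \<xi> by (intro divide_right_mono) auto
      then have "exp (-2) * t \<le> integrated_kernel t z"
        using \<xi> by (simp add: exp_add[symmetric] mult.assoc[symmetric])
      then have "(exp (-2) * t)\<^sup>2 \<le> (integrated_kernel t z)\<^sup>2" using t by (intro power_mono) auto
      then have "exp (-4) * t\<^sup>2 \<le> (integrated_kernel t z)\<^sup>2" by (simp add: power_mult_distrib exp_double[symmetric])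
      then show ?thesis using True by (auto intro: ennreal_leI)
    qed simp
  qed
  finally show ?thesis unfolding y_def .
qed

text \<open>Stopping at s = y t - 1 leaves a unit of decay: exp(s - \<xi> t) <= exp(-1) <= 1/2, so
  the kernel is comparable to 1/\<xi>, and hence to 1/y, on the whole rectangle.\<close>

lemma integrated_kernel_rectangle:
  assumes z: "z \<in> {y<..4*y} \<times> {0<..y * t - 1}" and y: "0 < y" and t: "0 < t"
  shows "1 / (8 * y) \<le> integrated_kernel t z" "integrated_kernel t z \<le> 1 / y"
proof -
  define \<xi> s where "\<xi> = fst z" and "s = snd z"
  have \<xi>: "y < \<xi>" "\<xi> \<le> 4 * y" and s: "0 < s" "s \<le> y * t - 1" using z by (auto simp: \<xi>_def s_def)
  have "y * t \<le> \<xi> * t" using \<xi> t by simp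
  then have s': "s \<le> \<xi> * t - 1" using s by linarith
  then have sle: "s \<le> \<xi> * t" by simp
  then have H: "integrated_kernel t z = (1 - exp (s - \<xi> * t)) / \<xi>"
    using s by (simp add: integrated_kernel_def \<xi>_def[symmetric] s_def[symmetric] min_absorb2)
  have "exp (s - \<xi> * t) \<le> exp (-1)" using s' by simp
  also have "\<dots> \<le> 1 / 2" using exp_ge_add_one_self[of 1] by (simp add: exp_minus field_simps)
  finally have e: "exp (s - \<xi> * t) \<le> 1 / 2" .
  have "1 / (8 * y) = (1 / 2) / (4 * y)" by simp
  also have "\<dots> \<le> (1 - exp (s - \<xi> * t)) / \<xi>" using e \<xi> y sle by (intro frac_le) auto
  finally show "1 / (8 * y) \<le> integrated_kernel t z" unfolding H .
  have "(1 - exp (s - \<xi> * t)) / \<xi> \<le> 1 / y" using \<xi> y sle by (intro frac_le) auto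
  then show "integrated_kernel t z \<le> 1 / y" unfolding H .
qed

end

section \<open>Growth exponents and convexity\<close>

text \<open>For $f(t) = E|Y(t)|^q$ the two predicates say that the limsup, resp. liminf, of $\log f(t) / \log t$ is at most,
  resp. at least, $u$; phrased with powers, they remain meaningful when $f$ vanishes.\<close>

definition growth_le :: "(real \<Rightarrow> real) \<Rightarrow> real \<Rightarrow> bool" where
  "growth_le f u \<longleftrightarrow> (\<forall>e>0. \<forall>\<^sub>F t in at_top. f t \<le> t powr (u + e))"

definition growth_ge :: "(real \<Rightarrow> real) \<Rightarrow> real \<Rightarrow> bool" where
  "growth_ge f l \<longleftrightarrow> (\<forall>e>0. \<forall>\<^sub>F t in at_top. t powr (l - e) \<le> f t)"

text \<open>The lower bound makes f eventually positive, so that the logarithm is genuine.\<close>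

lemma growth_imp_log_limit:
  assumes "growth_le f u" "growth_ge f u"
  shows "((\<lambda>t. ln (f t) / ln t) \<longlongrightarrow> u) at_top"
proof (rule tendstoI)
  fix e :: real assume e: "e > 0"
  have "\<forall>\<^sub>F t in at_top. f t \<le> t powr (u + e / 2)" "\<forall>\<^sub>F t in at_top. t powr (u - e / 2) \<le> f t"
    using assms e by (auto simp: growth_le_def growth_ge_def)
  then show "\<forall>\<^sub>F t in at_top. dist (ln (f t) / ln t) u < e"
    using eventually_gt_at_top[of 1]
  proof eventually_elim
    case (elim t)
    have l: "ln t > 0" using elim by simp
    have pos: "0 < t powr (u - e / 2)" using elim by simp
    from order.strict_trans2[OF this elim(2)] have f: "0 < f t" .
    have pos2: "0 < t powr (u + e / 2)" using elim by simp
    note ln_le_cancel_iff[OF f pos2, THEN iffD2, OF elim(1)]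
    then have "ln (f t) / ln t \<le> u + e / 2" using l elim by (simp add: ln_powr divide_le_eq)
    moreover note ln_le_cancel_iff[OF pos f, THEN iffD2, OF elim(2)]
    then have "u - e / 2 \<le> ln (f t) / ln t" using l elim by (simp add: ln_powr le_divide_eq)
    ultimately show ?case using e by (simp add: dist_real_def abs_if)
  qed
qed

lemma eventually_const_le_powr:
  fixes c e :: real assumes "e > 0" shows "\<forall>\<^sub>F t in at_top. c \<le> t powr e"
  using eventually_ge_at_top[of "max 1 c powr (1 / e)"]
proof eventually_elim
  case (elim t)
  have "c \<le> (max 1 c powr (1 / e)) powr e" using assms by (simp add: powr_powr)
  also have "\<dots> \<le> t powr e" using elim assms by (intro powr_mono2) auto
  finally show ?case .
qed
  
lemma growth_leI:
  assumes "\<forall>\<^sub>F t in at_top. f t \<le> C * t powr u" shows "growth_le f u"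
  unfolding growth_le_def
proof (intro allI impI)
  fix e :: real assume "e > 0"
  from eventually_const_le_powr[OF this, of C] assms eventually_gt_at_top[of 0]
  show "\<forall>\<^sub>F t in at_top. f t \<le> t powr (u + e)"
  proof eventually_elim
    case (elim t)
    have "C * t powr u \<le> t powr e * t powr u" using elim by (intro mult_right_mono) auto
    then have "C * t powr u \<le> t powr (u + e)" by (simp only: powr_add mult.commute)
    then show ?case using elim by linarith
  qed
qed

lemma growth_geI:
  assumes "\<forall>\<^sub>F t in at_top. c * t powr u \<le> f t" "c > 0" shows "growth_ge f u"
  unfolding growth_ge_def
proof (intro allI impI)
  fix e :: real assume "e > 0"
  from eventually_const_le_powr[OF this, of "1 / c"] assms(1) eventually_gt_at_top[of 0]
  show "\<forall>\<^sub>F t in at_top. t powr (u - e) \<le> f t"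
  proof eventually_elim
    case (elim t)
    have "1 \<le> c * t powr e" using elim assms(2) by (simp add: field_simps)
    then have "1 * t powr (u - e) \<le> c * t powr e * t powr (u - e)" by (intro mult_right_mono) auto
    also have "\<dots> = c * t powr u" by (simp add: mult.assoc powr_add[symmetric])
    finally show ?case using elim by simp
  qed
qed

lemma growth_le_closure:
  assumes "\<And>e. e > 0 \<Longrightarrow> \<exists>v\<le>u + e. growth_le f v" shows "growth_le f u"
  unfolding growth_le_def
proof (intro allI impI)
  fix e :: real assume e: "e > 0"
  then obtain v where v: "v \<le> u + e/2" "growth_le f v" using assms[of "e/2"] by auto
  then have "\<forall>\<^sub>F t in at_top. f t \<le> t powr (v + e/2)" using e by (simp add: growth_le_def)
  then show "\<forall>\<^sub>F t in at_top. f t \<le> t powr (u + e)"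
    using eventually_ge_at_top[of 1]
  proof eventually_elim
    case (elim t)
    have "t powr (v + e/2) \<le> t powr (u + e)" using elim v by (intro powr_mono) auto
    then show ?case using elim by linarith
  qed
qed

lemma growth_ge_closure:
  assumes "\<And>e. e > 0 \<Longrightarrow> \<exists>v\<ge>u - e. growth_ge f v" shows "growth_ge f u"
  unfolding growth_ge_def
proof (intro allI impI)
  fix e :: real assume e: "e > 0"
  then obtain v where v: "v \<ge> u - e/2" "growth_ge f v" using assms[of "e/2"] by auto
  then have "\<forall>\<^sub>F t in at_top. t powr (v - e/2) \<le> f t" using e by (simp add: growth_ge_def)
  then show "\<forall>\<^sub>F t in at_top. t powr (u - e) \<le> f t"
    using eventually_ge_at_top[of 1]
  proof eventually_elim
    case (elim t)
    have "t powr (u - e) \<le> t powr (v - e/2)" using elim v by (intro powr_mono) auto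
    then show ?case using elim by linarith
  qed
qed

text \<open>The split is log-convexity of moments in additive form, with a free scale s to be
  optimised. Being linear in the moments it loses only a factor 2 and involves no division by a
  moment that might vanish. At q = 0 only an upper bound is asked for because
  \<open>0 powr 0\<close> is 0.\<close>

locale moment_family =
  fixes m :: "real \<Rightarrow> real \<Rightarrow> real"
  assumes moment_nonneg: "\<And>q t. 0 \<le> m q t"
    and moment_zero: "\<And>t. m 0 t \<le> 1"
    and moment_split: "\<And>q1 q q2 s t. 0 \<le> q1 \<Longrightarrow> q1 \<le> q \<Longrightarrow> q \<le> q2 \<Longrightarrow> 0 < s \<Longrightarrow> 1 \<le> t \<Longrightarrow>
      m q t \<le> s powr (q - q1) * m q1 t + s powr (q - q2) * m q2 t"
begin

lemma growth_le_interpolate: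
  assumes q: "0 \<le> q1" "q1 < q2" "q1 \<le> q" "q \<le> q2" and u: "growth_le (m q1) u1" "growth_le (m q2) u2"
  shows "growth_le (m q) (u1 + (q - q1) * ((u2 - u1) / (q2 - q1)))"
proof (rule growth_le_closure)
  fix e :: real assume e: "e > 0"
  \<comment> \<open>At scale s = t^x, with x the slope of the chord, both summands have the same
    order.\<close>
  define x where "x = (u2 - u1) / (q2 - q1)"
  have x: "x * (q2 - q1) = u2 - u1" using q by (simp add: x_def)
  have "\<forall>\<^sub>F t in at_top. m q1 t \<le> t powr (u1 + e)" "\<forall>\<^sub>F t in at_top. m q2 t \<le> t powr (u2 + e)"
    using u e by (auto simp: growth_le_def)
  then have "\<forall>\<^sub>F t in at_top. m q t \<le> 2 * t powr (u1 + (q - q1) * x + e)"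
    using eventually_ge_at_top[of 1]
  proof eventually_elim
    case (elim t)
    have "m q t \<le> (t powr x) powr (q - q1) * m q1 t + (t powr x) powr (q - q2) * m q2 t"
      using q elim by (intro moment_split) auto
    also have "\<dots> \<le> (t powr x) powr (q - q1) * t powr (u1 + e) + (t powr x) powr (q - q2) * t powr (u2 + e)"
      using elim by (intro add_mono mult_left_mono) auto
    also have "\<dots> = t powr (x * (q - q1) + (u1 + e)) + t powr (x * (q - q2) + (u2 + e))"
      by (simp only: powr_powr powr_add)
    also have "x * (q - q2) + (u2 + e) = u1 + (q - q1) * x + e" using x by (simp add: algebra_simps)
    also have "x * (q - q1) + (u1 + e) = u1 + (q - q1) * x + e" by simp
    finally show ?case by simp
  qed
  then have "growth_le (m q) (u1 + (q - q1) * x + e)" by (rule growth_leI)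
  then show "\<exists>v\<le>u1 + (q - q1) * ((u2 - u1) / (q2 - q1)) + e. growth_le (m q) v" unfolding x_def by blast
qed

text \<open>Convexity read backwards: q0 lies between q and q', so a lower bound at q0 and an upper
  bound at q' force a lower bound at q, on the line through the two points. The split at q0 is used
  with s chosen so that the q' term is negligible.\<close>

lemma growth_ge_extrapolate:
  assumes q: "0 < q" "0 < q'" "(q < q0 \<and> q0 < q') \<or> (q' < q0 \<and> q0 < q)"
    and l: "growth_ge (m q0) l0" and u: "growth_le (m q') u'"
  shows "growth_ge (m q) (l0 + (q - q0) * ((l0 - u') / (q0 - q')))"
proof (rule growth_ge_closure)
  fix e0 :: real assume e0: "e0 > 0"
  define r where "r = (q - q0) / (q0 - q')"
  have r: "r > 0" using q by (auto simp: r_def zero_less_divide_iff)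
  \<comment> \<open>The slope below is lowered by 3e so that the q' term becomes t^(l0 - 2e),
    eventually at most half of t^(l0 - e). The total loss at q is e (1 + 3r), set equal to
    e0.\<close>
  define e where "e = e0 / (1 + 3 * r)"
  have e: "e > 0" "e * (1 + 3 * r) = e0" using e0 r by (auto simp: e_def)
  define x where "x = (l0 - u' - 3 * e) / (q0 - q')"
  have x: "x * (q0 - q') = l0 - u' - 3 * e" using q by (auto simp: x_def)
  have xq: "x * (q - q0) = r * (l0 - u') - 3 * e * r"   proof -
    have "x * (q - q0) = (l0 - u' - 3 * e) * r" by (simp add: x_def r_def)
    then show ?thesis by (simp add: algebra_simps)
  qed
  have "\<forall>\<^sub>F t in at_top. t powr (l0 - e) \<le> m q0 t" "\<forall>\<^sub>F t in at_top. m q' t \<le> t powr (u' + e)"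
    using u l e by (auto simp: growth_le_def growth_ge_def)
  then have "\<forall>\<^sub>F t in at_top. 1/2 * t powr (l0 - e + x * (q - q0)) \<le> m q t"
    using eventually_ge_at_top[of 1] eventually_const_le_powr[OF e(1), of 2]
  proof eventually_elim
    case (elim t)
    define s where "s = t powr x"
    have s: "s > 0" using elim by (simp add: s_def)
    have "m q0 t \<le> s powr (q0 - q) * m q t + s powr (q0 - q') * m q' t"
    proof (cases "q < q'")
      case True
      then show ?thesis using q elim s by (intro moment_split) auto
    next
      case False
      then have "m q0 t \<le> s powr (q0 - q') * m q' t + s powr (q0 - q) * m q t"
        using q elim s by (intro moment_split) auto
      then show ?thesis by simp
    qed
    also have "s powr (q0 - q') * m q' t \<le> s powr (q0 - q') * t powr (u' + e)"
      using elim by (intro mult_left_mono) auto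
    also have "s powr (q0 - q') * t powr (u' + e) = t powr (l0 - 2 * e)"
      by (simp only: s_def powr_powr powr_add[symmetric] x) simp
    finally have "t powr (l0 - e) - t powr (l0 - 2 * e) \<le> s powr (q0 - q) * m q t" using elim by simp
    moreover have "2 * t powr (l0 - 2 * e) \<le> t powr (l0 - e)"
    proof -
      have "2 * t powr (l0 - 2 * e) \<le> t powr e * t powr (l0 - 2 * e)" using elim by (intro mult_right_mono) auto
      also have "\<dots> = t powr (l0 - e)" by (simp add: powr_add[symmetric])
      finally show ?thesis .
    qed
    ultimately have "1/2 * t powr (l0 - e) \<le> s powr (q0 - q) * m q t" by simp
    then have "s powr (q - q0) * (1/2 * t powr (l0 - e)) \<le> s powr (q - q0) * (s powr (q0 - q) * m q t)"
      by (intro mult_left_mono) auto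
    also have "\<dots> = m q t" using s by (simp add: mult.assoc[symmetric] powr_add[symmetric])
    also have "s powr (q - q0) * (1/2 * t powr (l0 - e)) = 1/2 * t powr (l0 - e + x * (q - q0))"
      by (simp add: s_def powr_powr powr_add)
    finally show ?case .
  qed
  then have "growth_ge (m q) (l0 - e + x * (q - q0))" by (rule growth_geI) simp
  moreover have "l0 - e + x * (q - q0) = l0 + (q - q0) * ((l0 - u') / (q0 - q')) - e0"
  proof -
    have "(q - q0) * ((l0 - u') / (q0 - q')) = r * (l0 - u')" by (simp add: r_def)
    then show ?thesis using xq e(2) by (simp add: algebra_simps)
  qed
  ultimately show "\<exists>v\<ge>l0 + (q - q0) * ((l0 - u') / (q0 - q')) - e0. growth_ge (m q) v" by fastforce
qed

text \<open>The exponents known a priori are the points $(\gamma, 1)$ for $\gamma$ slightly below $1 + \alpha$, the point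
  $(2, 2 - \alpha)$ and, as an upper bound only, $(q, q)$ for arbitrarily large $q$.\<close>

lemma moment_growth:
  assumes alpha: "0 < \<alpha>" "\<alpha> < 1" and g0: "g0 < 1 + \<alpha>"
    and small: "\<And>g. g0 < g \<Longrightarrow> 1 < g \<Longrightarrow> g < 1 + \<alpha> \<Longrightarrow> growth_le (m g) 1"
    and two: "growth_le (m 2) (2 - \<alpha>)" "growth_ge (m 2) (2 - \<alpha>)"
    and large: "\<And>K. \<exists>x\<ge>K. growth_le (m x) x"
    and low: "\<And>q. 0 < q \<Longrightarrow> q \<le> 2 \<Longrightarrow> growth_ge (m q) (q / (1 + \<alpha>))"
    and q: "0 < q"
  shows "q \<le> 1 + \<alpha> \<Longrightarrow> growth_le (m q) (q / (1 + \<alpha>)) \<and> growth_ge (m q) (q / (1 + \<alpha>))"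
    and "1 + \<alpha> \<le> q \<Longrightarrow> growth_le (m q) (q - \<alpha>) \<and> growth_ge (m q) (q - \<alpha>)"
proof -
  define G where "G = max 1 g0"
  have G: "G < 1 + \<alpha>" using alpha g0 by (simp add: G_def)
  have near: "\<forall>\<^sub>F g in at_left (1 + \<alpha>). G < g \<and> g < 1 + \<alpha>"
    unfolding eventually_at_left[OF G] using G by blast
  have near': "\<exists>g. G < g \<and> g < 1 + \<alpha> \<and> P g" if "\<forall>\<^sub>F g in at_left (1 + \<alpha>). P g" for P
  proof -
    have "\<forall>\<^sub>F g in at_left (1 + \<alpha>). G < g \<and> g < 1 + \<alpha> \<and> P g" using near that by eventually_elim simp
    from eventually_happens'[OF _ this] show ?thesis by simp
  qed
  have up1: "growth_le (m g) 1" if "G < g" "g < 1 + \<alpha>" for g using that small by (simp add: G_def)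
  have up_small: "growth_le (m q) (q / (1 + \<alpha>))" if "q < 1 + \<alpha>"
  proof (rule growth_le_closure)
    fix e :: real assume e: "e > 0"
    have "((\<lambda>g. q / g) \<longlongrightarrow> q / (1 + \<alpha>)) (at_left (1 + \<alpha>))"
      using alpha by (intro tendsto_intros) auto
    then have "\<forall>\<^sub>F g in at_left (1 + \<alpha>). q / g < q / (1 + \<alpha>) + e" by (rule order_tendstoD) (use e in simp)
    moreover have "\<forall>\<^sub>F g in at_left (1 + \<alpha>). q < g" 
      by (rule order_tendstoD[OF tendsto_ident_at]) (use that in simp)
    ultimately have "\<forall>\<^sub>F g in at_left (1 + \<alpha>). q / g < q / (1 + \<alpha>) + e \<and> q < g" by eventually_elim simp
    from near'[OF this] obtain g where g: "G < g" "g < 1 + \<alpha>" "q / g < q / (1 + \<alpha>) + e" "q < g" by blast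
    \<comment> \<open>Chord from (0, 0) to (g, 1), with g close to 1 + \<alpha>.\<close>
    have "growth_le (m 0) 0" by (rule growth_leI[where C = 1], rule eventually_mono[OF eventually_gt_at_top[of 0]]) (use moment_zero in simp)
    from growth_le_interpolate[OF _ _ _ _ this up1[OF g(1,2)], of q] have "growth_le (m q) (q / g)"
      using q g(4) by simp
    then show "\<exists>v\<le>q / (1 + \<alpha>) + e. growth_le (m q) v" using g(3) by (intro exI[of _ "q / g"]) auto
  qed
  \<comment> \<open>Chord from (g, 1) to (2, 2 - \<alpha>); its value at q tends to q - \<alpha> as
    g tends to 1 + \<alpha>.\<close>
  have up_mid: "growth_le (m q) (q - \<alpha>)" if "1 + \<alpha> \<le> q" "q < 2"
  proof (rule growth_le_closure)
    fix e :: real assume e: "e > 0"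
    have "((\<lambda>g. 1 + (q - g) * ((2 - \<alpha> - 1) / (2 - g))) \<longlongrightarrow> 1 + (q - (1 + \<alpha>)) * ((2 - \<alpha> - 1) / (2 - (1 + \<alpha>)))) (at_left (1 + \<alpha>))"
      using alpha by (intro tendsto_intros) auto
    moreover have "1 + (q - (1 + \<alpha>)) * ((2 - \<alpha> - 1) / (2 - (1 + \<alpha>))) = q - \<alpha>" using alpha by (simp add: field_simps)
    ultimately have "\<forall>\<^sub>F g in at_left (1 + \<alpha>). 1 + (q - g) * ((2 - \<alpha> - 1) / (2 - g)) < q - \<alpha> + e"
      by (intro order_tendstoD(2)[where a = "q - \<alpha> + e"]) (use e in auto)
    from near'[OF this] obtain g where g: "G < g" "g < 1 + \<alpha>" "1 + (q - g) * ((2 - \<alpha> - 1) / (2 - g)) < q - \<alpha> + e" by blast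
    have "growth_le (m q) (1 + (q - g) * ((2 - \<alpha> - 1) / (2 - g)))"
      using g that alpha by (intro growth_le_interpolate up1 two) (auto simp: G_def)
    then show "\<exists>v\<le>q - \<alpha> + e. growth_le (m q) v" using g(3) by (meson less_imp_le)
  qed
  have inv: "((\<lambda>x::real. c / (x + d)) \<longlongrightarrow> 0) at_top" for c d :: real
  proof -
    have "filterlim (\<lambda>x::real. d + x) at_top at_top"
      by (rule filterlim_tendsto_add_at_top[OF tendsto_const filterlim_ident])
    then show ?thesis by (intro real_tendsto_divide_at_top[OF tendsto_const]) (simp add: add.commute)
  qed
  have pick: "\<exists>x\<ge>K. P x \<and> growth_le (m x) x" if ev: "\<forall>\<^sub>F x in at_top. P x" for P and K :: real
  proof -
    obtain K' where "\<And>x. x \<ge> K' \<Longrightarrow> P x" using ev unfolding eventually_at_top_linorder by blast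
    then show ?thesis using large[of "max K K'"] by auto
  qed
  \<comment> \<open>Between 2 and a far exponent x the chord has slope 1 + \<alpha>/(x - 2).\<close>
  have up_big: "growth_le (m q) (q - \<alpha>)" if "2 < q"
  proof (rule growth_le_closure)
    fix e :: real assume e: "e > 0"
    have "((\<lambda>x. (2 - \<alpha>) + (q - 2) * (1 + \<alpha> / (x + (-2)))) \<longlongrightarrow> (2 - \<alpha>) + (q - 2) * (1 + 0)) at_top"
      by (intro tendsto_intros inv)
    then have "\<forall>\<^sub>F x in at_top. (2 - \<alpha>) + (q - 2) * (1 + \<alpha> / (x + (-2))) < q - \<alpha> + e"
      by (rule order_tendstoD) (use e in simp)
    from pick[OF this, of "q"] obtain x
      where x: "(2 - \<alpha>) + (q - 2) * (1 + \<alpha> / (x + (-2))) < q - \<alpha> + e" "q \<le> x" "growth_le (m x) x" by blast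
    have "growth_le (m q) ((2 - \<alpha>) + (q - 2) * ((x - (2 - \<alpha>)) / (x - 2)))"
      using that x by (intro growth_le_interpolate two x(3)) auto
    moreover have "(x - (2 - \<alpha>)) / (x - 2) = 1 + \<alpha> / (x + (-2))"
      using that x by (simp add: field_simps)
    ultimately have "growth_le (m q) ((2 - \<alpha>) + (q - 2) * (1 + \<alpha> / (x + (-2))))" by (simp only:)
    with x(1) show "\<exists>v\<le>q - \<alpha> + e. growth_le (m q) v" by (meson less_imp_le)
  qed
  have up: "growth_le (m q) (q - \<alpha>)" if "1 + \<alpha> \<le> q"
    using up_mid up_big two(1) that by (cases "q < 2"; cases "q = 2") auto
  \<comment> \<open>The chord through (x, x) and (2, 2 - \<alpha>), extended to the left of 2,
    bounds the exponent from below.\<close>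
  have lo_mid: "growth_ge (m q) (q - \<alpha>)" if "1 + \<alpha> \<le> q" "q < 2"
  proof (rule growth_ge_closure)
    fix e :: real assume e: "e > 0"
    have "((\<lambda>x. (2 - \<alpha>) + (q - 2) * (1 + \<alpha> / (x + (-2)))) \<longlongrightarrow> (2 - \<alpha>) + (q - 2) * (1 + 0)) at_top"
      by (intro tendsto_intros inv)
    then have "\<forall>\<^sub>F x in at_top. (2 - \<alpha>) + (q - 2) * (1 + \<alpha> / (x + (-2))) > q - \<alpha> - e"
      by (rule order_tendstoD) (use e in simp)
    from pick[OF this, of "4"] obtain x
      where x: "(2 - \<alpha>) + (q - 2) * (1 + \<alpha> / (x + (-2))) > q - \<alpha> - e" "4 \<le> x" "growth_le (m x) x" by blast
    have "growth_ge (m q) ((2 - \<alpha>) + (q - 2) * (((2 - \<alpha>) - x) / (2 - x)))"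
      using that x q by (intro growth_ge_extrapolate two x(3)) auto
    moreover have "((2 - \<alpha>) - x) / (2 - x) = 1 + \<alpha> / (x + (-2))"
      using x by (simp add: field_simps)
    ultimately have "growth_ge (m q) ((2 - \<alpha>) + (q - 2) * (1 + \<alpha> / (x + (-2))))" by (simp only:)
    with x(1) show "\<exists>v\<ge>q - \<alpha> - e. growth_ge (m q) v" by (meson less_imp_le)
  qed
  \<comment> \<open>The chord through (g, 1) and (2, 2 - \<alpha>), extended to the right of 2; its
    slope (1 - \<alpha>)/(2 - g) tends to 1.\<close>
  have lo_big: "growth_ge (m q) (q - \<alpha>)" if "2 < q"
  proof (rule growth_ge_closure)
    fix e :: real assume e: "e > 0"
    have "((\<lambda>g. (2 - \<alpha>) + (q - 2) * ((2 - \<alpha> - 1) / (2 - g))) \<longlongrightarrow> (2 - \<alpha>) + (q - 2) * ((2 - \<alpha> - 1) / (2 - (1 + \<alpha>)))) (at_left (1 + \<alpha>))"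
      using alpha by (intro tendsto_intros) auto
    moreover have "(2 - \<alpha>) + (q - 2) * ((2 - \<alpha> - 1) / (2 - (1 + \<alpha>))) = q - \<alpha>" using alpha by (simp add: field_simps)
    ultimately have "\<forall>\<^sub>F g in at_left (1 + \<alpha>). (2 - \<alpha>) + (q - 2) * ((2 - \<alpha> - 1) / (2 - g)) > q - \<alpha> - e"
      by (intro order_tendstoD(1)[where a = "q - \<alpha> - e"]) (use e in auto)
    from near'[OF this] obtain g where g: "G < g" "g < 1 + \<alpha>" "(2 - \<alpha>) + (q - 2) * ((2 - \<alpha> - 1) / (2 - g)) > q - \<alpha> - e" by blast
    have "growth_ge (m q) ((2 - \<alpha>) + (q - 2) * ((2 - \<alpha> - 1) / (2 - g)))"
      using g that alpha by (intro growth_ge_extrapolate up1 two) (auto simp: G_def)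
    then show "\<exists>v\<ge>q - \<alpha> - e. growth_ge (m q) v" using g(3) by (meson less_imp_le)
  qed
  have lo: "growth_ge (m q) (q - \<alpha>)" if "1 + \<alpha> \<le> q"
    using lo_mid lo_big two(2) that by (cases "q < 2"; cases "q = 2") auto
  show "growth_le (m q) (q / (1 + \<alpha>)) \<and> growth_ge (m q) (q / (1 + \<alpha>))" if "q \<le> 1 + \<alpha>"
  proof
    show "growth_ge (m q) (q / (1 + \<alpha>))" using that alpha q by (intro low) auto
    show "growth_le (m q) (q / (1 + \<alpha>))"
    proof (cases "q = 1 + \<alpha>")
      case True then show ?thesis using up alpha by simp
    next
      case False then show ?thesis using up_small that by simp
    qed
  qed
  show "growth_le (m q) (q - \<alpha>) \<and> growth_ge (m q) (q - \<alpha>)" if "1 + \<alpha> \<le> q"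
    using up lo that by blast
qed

end

section \<open>The integrated supOU process\<close>

locale finite_variance_supOU = pure_jump_levy_basis M "\<pi> \<Otimes>\<^sub>M lborel" a \<mu> \<Lambda> + rate: rate_law \<pi>
  for M :: "'w measure" and \<pi> :: "real measure" and a :: real and \<mu> :: "real measure"
    and \<Lambda> :: "(real \<times> real) set \<Rightarrow> 'w \<Rightarrow> real" +
  fixes X :: "real \<Rightarrow> 'w \<Rightarrow> real"
  assumes joint: "(\<lambda>(t, \<omega>). X t \<omega>) \<in> borel_measurable (borel \<Otimes>\<^sub>M M)"
    and stoch_int: "\<And>t. has_stochastic_integral M (\<pi> \<Otimes>\<^sub>M lborel) \<Lambda> (supOU_kernel t) (X t)"
    and square_int: "\<And>t. integrable M (\<lambda>\<omega>. (X t \<omega>)\<^sup>2)"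
    and mean_zero: "\<And>t. expectation (X t) = 0"
begin

abbreviation N :: "((real \<times> real) \<times> real) measure" where
  "N \<equiv> rate.control \<Otimes>\<^sub>M \<mu>"

lemma joint_measurable [measurable]: "(\<lambda>p. X (fst p) (snd p)) \<in> borel_measurable (borel \<Otimes>\<^sub>M M)"
  using joint by (simp add: case_prod_beta)

lemma X_measurable [measurable]: "X t \<in> borel_measurable M"
  using measurable_compose[OF measurable_Pair1'[of t borel M] joint_measurable] by simp

lemma X_swap_measurable [measurable]: "(\<lambda>p. X (snd p) (fst p)) \<in> borel_measurable (M \<Otimes>\<^sub>M borel)"
proof -
  have "(\<lambda>p. (snd p, fst p)) \<in> M \<Otimes>\<^sub>M borel \<rightarrow>\<^sub>M borel \<Otimes>\<^sub>M M" by measurable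
  from measurable_compose[OF this joint_measurable] show ?thesis by simp
qed

lemma X_integrable: "integrable M (X t)"
  using square_integrable_imp_integrable[OF _ square_int] by simp

lemma lincomb_approximates:
  fixes c :: "nat \<Rightarrow> real"
  shows "\<exists>F. approximates F (\<lambda>z. \<Sum>i<n. c i * supOU_kernel (t i) z) (\<lambda>\<omega>. \<Sum>i<n. c i * X (t i) \<omega>)"
    and "integrable M (\<lambda>\<omega>. (\<Sum>i<n. c i * X (t i) \<omega>)\<^sup>2)"
    and "expectation (\<lambda>\<omega>. \<Sum>i<n. c i * X (t i) \<omega>) = 0"
proof -
  show "\<exists>F. approximates F (\<lambda>z. \<Sum>i<n. c i * supOU_kernel (t i) z) (\<lambda>\<omega>. \<Sum>i<n. c i * X (t i) \<omega>)"
  proof (induction n)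
    case 0
    obtain F where "approximates F (supOU_kernel 0) (X 0)"
      using has_stochastic_integral_imp_approximates[OF stoch_int[of 0]] by blast
    \<comment> \<open>The empty sum is realised as 0 X(0) + 0 X(0), which gives the zero kernel an
      approximating sequence.\<close>
    from approximates_lincomb[OF this this, of 0 0] show ?case by auto
  next
    case (Suc n)
    then obtain F where F: "approximates F (\<lambda>z. \<Sum>i<n. c i * supOU_kernel (t i) z) (\<lambda>\<omega>. \<Sum>i<n. c i * X (t i) \<omega>)" by blast
    obtain G where G: "approximates G (supOU_kernel (t n)) (X (t n))"
      using has_stochastic_integral_imp_approximates[OF stoch_int[of "t n"]] by blast
    from approximates_lincomb[OF F G, of 1 "c n"] show ?case by auto
  qed
  show "integrable M (\<lambda>\<omega>. (\<Sum>i<n. c i * X (t i) \<omega>)\<^sup>2)"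
  proof (induction n)
    case (Suc n)
    have "integrable M (\<lambda>\<omega>. 2 * (\<Sum>i<n. c i * X (t i) \<omega>)\<^sup>2 + 2 * (c n)\<^sup>2 * (X (t n) \<omega>)\<^sup>2)"
      using Suc.IH square_int[of "t n"] by (intro Bochner_Integration.integrable_add integrable_mult_right)
    then show ?case
    proof (rule Bochner_Integration.integrable_bound)
      show "AE \<omega> in M. norm ((\<Sum>i<Suc n. c i * X (t i) \<omega>)\<^sup>2) \<le> norm (2 * (\<Sum>i<n. c i * X (t i) \<omega>)\<^sup>2 + 2 * (c n)\<^sup>2 * (X (t n) \<omega>)\<^sup>2)"
      proof (intro always_eventually allI)
        fix \<omega>
        have "(u + v)\<^sup>2 \<le> 2 * u\<^sup>2 + 2 * v\<^sup>2" for u v :: real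
          using zero_le_power2[of "u - v"] by (simp add: power2_eq_square algebra_simps)
        from this[of "\<Sum>i<n. c i * X (t i) \<omega>" "c n * X (t n) \<omega>"]
        show "norm ((\<Sum>i<Suc n. c i * X (t i) \<omega>)\<^sup>2) \<le> norm (2 * (\<Sum>i<n. c i * X (t i) \<omega>)\<^sup>2 + 2 * (c n)\<^sup>2 * (X (t n) \<omega>)\<^sup>2)"
          by (simp add: power_mult_distrib mult.assoc)
      qed
    qed measurable
  qed simp
  show "expectation (\<lambda>\<omega>. \<Sum>i<n. c i * X (t i) \<omega>) = 0"
    by (subst Bochner_Integration.integral_sum) (auto intro: X_integrable simp: mean_zero)
qed

text \<open>With coefficients and times free, this covers X itself, its increments and its Riemann
  sums; the third part transfers mean-square bounds from the kernel to these variables.\<close>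

lemma lincomb_char:
  fixes c :: "nat \<Rightarrow> real"
  shows "integrable N (\<lambda>z. (jump (\<lambda>z. \<Sum>i<n. c i * supOU_kernel (t i) z) z)\<^sup>2)"
    and "char (distr M borel (\<lambda>\<omega>. \<Sum>i<n. c i * X (t i) \<omega>)) \<zeta>
      = exp (levy_exponent N (jump (\<lambda>z. \<Sum>i<n. c i * supOU_kernel (t i) z)) \<zeta>)"
    and "(\<integral>\<^sup>+\<omega>. ennreal ((\<Sum>i<n. c i * X (t i) \<omega>)\<^sup>2) \<partial>M)
      \<le> (\<integral>\<^sup>+z. ennreal ((jump (\<lambda>z. \<Sum>i<n. c i * supOU_kernel (t i) z) z)\<^sup>2) \<partial>N)"
proof -
  obtain F where F: "approximates F (\<lambda>z. \<Sum>i<n. c i * supOU_kernel (t i) z) (\<lambda>\<omega>. \<Sum>i<n. c i * X (t i) \<omega>)"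
    using lincomb_approximates(1) by blast
  show int: "integrable N (\<lambda>z. (jump (\<lambda>z. \<Sum>i<n. c i * supOU_kernel (t i) z) z)\<^sup>2)"
    by (rule char_approximates(1)[OF F lincomb_approximates(2,3)])
  show ch: "char (distr M borel (\<lambda>\<omega>. \<Sum>i<n. c i * X (t i) \<omega>)) \<zeta>
      = exp (levy_exponent N (jump (\<lambda>z. \<Sum>i<n. c i * supOU_kernel (t i) z)) \<zeta>)" for \<zeta>
    by (rule char_approximates(2)[OF F lincomb_approximates(2,3)])
  have "(\<integral>\<^sup>+\<omega>. ennreal ((\<Sum>i<n. c i * X (t i) \<omega>)\<^sup>2) \<partial>M) \<le> ennreal (LINT z|N. (jump (\<lambda>z. \<Sum>i<n. c i * supOU_kernel (t i) z) z)\<^sup>2)"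
    by (rule nn_integral_square_le[OF _ _ int ch]) measurable
  then show "(\<integral>\<^sup>+\<omega>. ennreal ((\<Sum>i<n. c i * X (t i) \<omega>)\<^sup>2) \<partial>M)
      \<le> (\<integral>\<^sup>+z. ennreal ((jump (\<lambda>z. \<Sum>i<n. c i * supOU_kernel (t i) z) z)\<^sup>2) \<partial>N)"
    using int by (subst nn_integral_eq_integral) auto
qed

lemma char_X: "char (distr M borel (X t)) \<zeta> = exp (levy_exponent N (jump (supOU_kernel t)) \<zeta>)"
  using lincomb_char(2)[where n = 1 and c = "\<lambda>_. 1" and t = "\<lambda>_. t"] by simp

lemma nn_integral_N_mult:
  assumes [measurable]: "f \<in> borel_measurable rate.control" "g \<in> borel_measurable borel"
  shows "(\<integral>\<^sup>+z. f (fst z) * g (snd z) \<partial>N) = (\<integral>\<^sup>+z. f z \<partial>rate.control) * (\<integral>\<^sup>+x. g x \<partial>\<mu>)"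
proof -
  have "(\<integral>\<^sup>+z. f (fst z) * g (snd z) \<partial>N) = (\<integral>\<^sup>+z. \<integral>\<^sup>+x. f z * g x \<partial>\<mu> \<partial>rate.control)"
    by (subst mu.nn_integral_fst[symmetric]) auto
  also have "\<dots> = (\<integral>\<^sup>+z. f z * (\<integral>\<^sup>+x. g x \<partial>\<mu>) \<partial>rate.control)"
    by (intro nn_integral_cong nn_integral_cmult) measurable
  also have "\<dots> = (\<integral>\<^sup>+z. f z \<partial>rate.control) * (\<integral>\<^sup>+x. g x \<partial>\<mu>)"
    by (rule nn_integral_multc) measurable
  finally show ?thesis .
qed

definition jump_variance :: real where
  "jump_variance = enn2real (\<integral>\<^sup>+x. ennreal (x\<^sup>2) \<partial>\<mu>)"

text \<open>Finiteness is inherited from the variance of X: the kernel at time 0 times the jump is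
  square integrable, and the kernel alone contributes the positive factor 1/2.\<close>

lemma jump_variance: "(\<integral>\<^sup>+x. ennreal (x\<^sup>2) \<partial>\<mu>) = ennreal jump_variance" "0 \<le> jump_variance"
proof -
  have int: "integrable N (\<lambda>z. (jump (supOU_kernel 0) z)\<^sup>2)"
    using lincomb_char(1)[where n = 1 and c = "\<lambda>_. 1" and t = "\<lambda>_. 0"] by simp
  have "(\<integral>\<^sup>+z. ennreal ((jump (supOU_kernel 0) z)\<^sup>2) \<partial>N) = (\<integral>\<^sup>+z. ennreal ((supOU_kernel 0 (fst z))\<^sup>2) * ennreal ((snd z)\<^sup>2) \<partial>N)"
    by (intro nn_integral_cong) (simp add: power_mult_distrib ennreal_mult')
  also have "\<dots> = ennreal (1 / 2) * (\<integral>\<^sup>+x. ennreal (x\<^sup>2) \<partial>\<mu>)"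
    by (subst nn_integral_N_mult) (auto simp: rate.nn_integral_supOU_kernel_square)
  finally have eq: "(\<integral>\<^sup>+z. ennreal ((jump (supOU_kernel 0) z)\<^sup>2) \<partial>N) = ennreal (1 / 2) * (\<integral>\<^sup>+x. ennreal (x\<^sup>2) \<partial>\<mu>)" .
  have "(\<integral>\<^sup>+z. ennreal ((jump (supOU_kernel 0) z)\<^sup>2) \<partial>N) < \<infinity>"
    by (subst nn_integral_eq_integral[OF int]) auto
  then have "ennreal (1 / 2) * (\<integral>\<^sup>+x. ennreal (x\<^sup>2) \<partial>\<mu>) < \<infinity>" unfolding eq .
  then have "(\<integral>\<^sup>+x. ennreal (x\<^sup>2) \<partial>\<mu>) < \<infinity>"
    by (auto simp: ennreal_mult_less_top)
  then show "(\<integral>\<^sup>+x. ennreal (x\<^sup>2) \<partial>\<mu>) = ennreal jump_variance" by (simp add: jump_variance_def)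
  show "0 \<le> jump_variance" by (simp add: jump_variance_def)
qed

lemma nn_integral_jump_square:
  assumes [measurable]: "f \<in> borel_measurable rate.control"
  shows "(\<integral>\<^sup>+z. ennreal ((jump f z)\<^sup>2) \<partial>N) = (\<integral>\<^sup>+z. ennreal ((f z)\<^sup>2) \<partial>rate.control) * ennreal jump_variance"
proof -
  have "(\<integral>\<^sup>+z. ennreal ((jump f z)\<^sup>2) \<partial>N) = (\<integral>\<^sup>+z. ennreal ((f (fst z))\<^sup>2) * ennreal ((snd z)\<^sup>2) \<partial>N)"
    by (intro nn_integral_cong) (simp add: power_mult_distrib ennreal_mult')
  also have "\<dots> = (\<integral>\<^sup>+z. ennreal ((f z)\<^sup>2) \<partial>rate.control) * ennreal jump_variance"
    unfolding jump_variance(1)[symmetric] by (rule nn_integral_N_mult) measurable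
  finally show ?thesis .
qed

lemma nn_integral_X_square_le: "(\<integral>\<^sup>+\<omega>. ennreal ((X t \<omega>)\<^sup>2) \<partial>M) \<le> ennreal (jump_variance / 2)"
proof -
  have "(\<integral>\<^sup>+\<omega>. ennreal ((X t \<omega>)\<^sup>2) \<partial>M) \<le> (\<integral>\<^sup>+z. ennreal ((jump (supOU_kernel t) z)\<^sup>2) \<partial>N)"
    using lincomb_char(3)[where n = 1 and c = "\<lambda>_. 1" and t = "\<lambda>_. t"] by simp
  also have "\<dots> = ennreal (1 / 2) * ennreal jump_variance"
    by (simp only: nn_integral_jump_square[OF rate.supOU_kernel_measurable] rate.nn_integral_supOU_kernel_square)
  also have "\<dots> = ennreal (jump_variance / 2)"
    using jump_variance(2) by (subst ennreal_mult'[symmetric]) auto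
  finally show ?thesis .
qed

lemma nn_integral_X_diff_le:
  assumes "u \<le> v" "v \<le> u + h"
  shows "(\<integral>\<^sup>+\<omega>. ennreal ((X v \<omega> - X u \<omega>)\<^sup>2) \<partial>M) \<le> ennreal (rate.decorrelation h * jump_variance)"
proof -
  have "(\<integral>\<^sup>+\<omega>. ennreal ((X v \<omega> - X u \<omega>)\<^sup>2) \<partial>M) \<le> (\<integral>\<^sup>+z. ennreal ((jump (\<lambda>z. supOU_kernel v z - supOU_kernel u z) z)\<^sup>2) \<partial>N)"
    using lincomb_char(3)[where n = 2 and c = "\<lambda>i. if i = 0 then 1 else -1" and t = "\<lambda>i. if i = 0 then v else u"]
    by (simp add: numeral_2_eq_2)
  also have "\<dots> = (\<integral>\<^sup>+z. ennreal ((supOU_kernel v z - supOU_kernel u z)\<^sup>2) \<partial>rate.control) * ennreal jump_variance"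
    by (rule nn_integral_jump_square) measurable
  also have "\<dots> \<le> ennreal (rate.decorrelation h) * ennreal jump_variance"
    by (intro mult_right_mono rate.nn_integral_supOU_kernel_diff_le assms) simp
  also have "\<dots> = ennreal (rate.decorrelation h * jump_variance)"
    using jump_variance(2) by (rule ennreal_mult''[symmetric])
  finally show ?thesis .
qed

sublocale PL: pair_sigma_finite M lborel ..

lemma integrable_path_product:
  "integrable (M \<Otimes>\<^sub>M lborel) (\<lambda>p. indicator {0..t} (snd p) * X (snd p) (fst p))"
proof (rule integrableI_bounded)
  show "(\<lambda>p. indicator {0..t} (snd p) * X (snd p) (fst p)) \<in> borel_measurable (M \<Otimes>\<^sub>M lborel)" by measurable
  have "(\<integral>\<^sup>+p. ennreal (norm (indicator {0..t} (snd p) * X (snd p) (fst p))) \<partial>(M \<Otimes>\<^sub>M lborel))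
    = (\<integral>\<^sup>+s. \<integral>\<^sup>+\<omega>. ennreal (norm (indicator {0..t} s * X s \<omega>)) \<partial>M \<partial>lborel)"
    by (subst PL.nn_integral_snd[symmetric]) (auto simp: case_prod_beta)
  also have "\<dots> \<le> (\<integral>\<^sup>+s. ennreal (1 + jump_variance / 2) * indicator {0..t} s \<partial>lborel)"
  proof (rule nn_integral_mono)
    fix s :: real
    have "(\<integral>\<^sup>+\<omega>. ennreal (norm (indicator {0..t} s * X s \<omega>)) \<partial>M) \<le> (\<integral>\<^sup>+\<omega>. indicator {0..t} s * (1 + ennreal ((X s \<omega>)\<^sup>2)) \<partial>M)"
    proof (rule nn_integral_mono)
      fix \<omega>
      have "\<bar>X s \<omega>\<bar> \<le> 1 + (X s \<omega>)\<^sup>2"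
        using zero_le_power2[of "\<bar>X s \<omega>\<bar> - 1"] by (simp add: power2_eq_square algebra_simps)
      then have "ennreal \<bar>X s \<omega>\<bar> \<le> ennreal (1 + (X s \<omega>)\<^sup>2)" by (rule ennreal_leI)
      then show "ennreal (norm (indicator {0..t} s * X s \<omega>)) \<le> indicator {0..t} s * (1 + ennreal ((X s \<omega>)\<^sup>2))"
        by (simp add: indicator_def)
    qed
    also have "\<dots> = indicator {0..t} s * (1 + (\<integral>\<^sup>+\<omega>. ennreal ((X s \<omega>)\<^sup>2) \<partial>M))"
      by (subst nn_integral_cmult, measurable, subst nn_integral_add) (auto simp: emeasure_space_1)
    also have "\<dots> \<le> indicator {0..t} s * (1 + ennreal (jump_variance / 2))"
      by (intro mult_left_mono add_left_mono nn_integral_X_square_le) simp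
    finally show "(\<integral>\<^sup>+\<omega>. ennreal (norm (indicator {0..t} s * X s \<omega>)) \<partial>M) \<le> ennreal (1 + jump_variance / 2) * indicator {0..t} s"
      using jump_variance(2) by (simp add: mult.commute)
  qed
  also have "\<dots> = ennreal (1 + jump_variance / 2) * emeasure lborel {0..t}" by (subst nn_integral_cmult_indicator) auto
  also have "\<dots> < \<infinity>" using emeasure_compact_finite[of "{0..t}"] by (simp add: ennreal_mult_less_top)
  finally show "(\<integral>\<^sup>+p. ennreal (norm (indicator {0..t} (snd p) * X (snd p) (fst p))) \<partial>(M \<Otimes>\<^sub>M lborel)) < \<infinity>" .
qed

text \<open>Joint measurability and bounded second moments give product integrability, so
  \<open>integrated_process\<close> is a genuine integral for almost every path.\<close>

lemma AE_path_integrable: "AE \<omega> in M. set_integrable lborel {0..t} (\<lambda>s. X s \<omega>)"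
  using PL.AE_integrable_fst'[OF integrable_path_product[of t]] unfolding set_integrable_def by simp

abbreviation Z :: "real \<Rightarrow> 'w \<Rightarrow> real" where "Z \<equiv> integrated_process X"

lemma Z_measurable [measurable]: "Z t \<in> borel_measurable M"
proof -
  have "(\<lambda>\<omega>. LINT s|lborel. indicator {0..t} s * X s \<omega>) \<in> borel_measurable M"
    by (rule lborel.borel_measurable_lebesgue_integral) (simp add: case_prod_beta)
  then show ?thesis unfolding integrated_process_def[abs_def] set_lebesgue_integral_def by simp
qed

lemma Z_mean_zero: "expectation (Z t) = 0"
proof -
  have "expectation (Z t) = (LINT \<omega>|M. LINT s|lborel. indicator {0..t} s * X s \<omega>)"
    unfolding integrated_process_def[abs_def] set_lebesgue_integral_def by simp
  also have "\<dots> = (LINT s|lborel. LINT \<omega>|M. indicator {0..t} s * X s \<omega>)"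
    by (rule PL.Fubini_integral[symmetric], unfold case_prod_beta, rule integrable_path_product)
  also have "\<dots> = 0" by (simp add: mean_zero)
  finally show ?thesis .
qed

lemma integrated_kernel_square_finite:
  assumes t: "0 < t" shows "integrable N (\<lambda>z. (jump (integrated_kernel t) z)\<^sup>2)"
proof (rule integrableI_nonneg)
  have "(\<integral>\<^sup>+z. ennreal ((integrated_kernel t z)\<^sup>2) \<partial>rate.control) = (\<integral>\<^sup>+z. ennreal (integrated_kernel t z powr 2) \<partial>rate.control)"
    using rate.integrated_kernel_bounds(1)[of t] t rate.space_rate
    by (intro nn_integral_cong) (auto simp: space_pair_measure)
  also have "\<dots> \<le> ennreal (2 * t powr (2 - 1 + 1)) * (\<integral>\<^sup>+\<xi>. ennreal (\<xi> powr (1 - 1)) \<partial>\<pi>)"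
    by (rule rate.integrated_kernel_moment_le) (use t in auto)
  also have "(\<integral>\<^sup>+\<xi>. ennreal (\<xi> powr (1 - 1)) \<partial>\<pi>) = 1"
    using rate.emeasure_space_1 by (subst nn_integral_cong[where v = "\<lambda>_. 1"]) (auto simp: rate.space_rate)
  finally have "(\<integral>\<^sup>+z. ennreal ((integrated_kernel t z)\<^sup>2) \<partial>rate.control) < \<infinity>"
    by (simp add: le_less_trans)
  then show "(\<integral>\<^sup>+z. ennreal ((jump (integrated_kernel t) z)\<^sup>2) \<partial>N) < \<infinity>"
    by (subst nn_integral_jump_square) (auto simp: ennreal_mult_less_top)
qed auto

text \<open>Riemann sums of X and of the kernel on the same grid correspond by
  \<open>lincomb_char\<close>. Both converge in mean square with the same error bound, proportional
  to the decorrelation over one mesh, so the formula passes to the limit on both sides.\<close>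

theorem char_Z:
  assumes t: "0 < t"
  shows "char (distr M borel (Z t)) \<zeta> = exp (levy_exponent N (jump (integrated_kernel t)) \<zeta>)"
proof -
  define R where "R n \<omega> = (\<Sum>i<n. t / real n * X (t / real n * real i) \<omega>)" for n \<omega>
  define f where "f n z = (\<Sum>i<n. t / real n * supOU_kernel (t / real n * real i) z)" for n z
  have [measurable]: "R n \<in> borel_measurable M" "f n \<in> borel_measurable rate.control" for n
    unfolding R_def[abs_def] f_def[abs_def] by measurable
  have lim: "(\<lambda>n. c * rate.decorrelation (t / real n)) \<longlonglongrightarrow> 0" for c
    using tendsto_mult[OF tendsto_const[of c] rate.decorrelation_tendsto[of t]] t by simp
  have lim': "(\<lambda>n. ennreal (c * rate.decorrelation (t / real n))) \<longlonglongrightarrow> 0" for c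
    using tendsto_ennrealI[OF lim[of c]] by simp
  have dec: "0 \<le> rate.decorrelation (t / real n)" for n
    using t by (intro rate.decorrelation_nonneg) simp
  have "(\<lambda>n. \<integral>\<^sup>+\<omega>. ennreal ((R n \<omega> - Z t \<omega>)\<^sup>2) \<partial>M) \<longlonglongrightarrow> 0"
  proof (rule tendsto_sandwich[OF _ _ tendsto_const lim'[of "t\<^sup>2 * jump_variance"]])
    show "\<forall>\<^sub>F n in sequentially. (\<integral>\<^sup>+\<omega>. ennreal ((R n \<omega> - Z t \<omega>)\<^sup>2) \<partial>M) \<le> ennreal (t\<^sup>2 * jump_variance * rate.decorrelation (t / real n))"
      using eventually_gt_at_top[of 0]
    proof eventually_elim
      case (elim n)
      have "(\<integral>\<^sup>+\<omega>. ennreal (((LINT s:{0..t}|lborel. X s \<omega>) - (\<Sum>i<n. t / real n * X (t / real n * real i) \<omega>))\<^sup>2) \<partial>M)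
         \<le> ennreal (t\<^sup>2 * (rate.decorrelation (t / real n) * jump_variance))"
        by (rule nn_integral_riemann_sum_error_le[OF sigma_finite_measure_axioms joint t elim])
          (use dec jump_variance(2) nn_integral_X_diff_le AE_path_integrable in auto)
      then show ?case
        unfolding R_def integrated_process_def by (subst power2_commute) (simp add: mult_ac)
    qed
  qed simp
  then have 1: "(\<lambda>n. char (distr M borel (R n)) \<zeta>) \<longlonglongrightarrow> char (distr M borel (Z t)) \<zeta>"
    by (intro char_tendsto_of_L2) measurable
  have "(\<lambda>n. \<integral>\<^sup>+z. ennreal ((jump (f n) z - jump (integrated_kernel t) z)\<^sup>2) \<partial>N) \<longlonglongrightarrow> 0"
  proof (rule tendsto_sandwich[OF _ _ tendsto_const lim'[of "t\<^sup>2 * jump_variance"]])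
    show "\<forall>\<^sub>F n in sequentially. (\<integral>\<^sup>+z. ennreal ((jump (f n) z - jump (integrated_kernel t) z)\<^sup>2) \<partial>N) \<le> ennreal (t\<^sup>2 * jump_variance * rate.decorrelation (t / real n))"
      using eventually_gt_at_top[of 0]
    proof eventually_elim
      case (elim n)
      have "(\<integral>\<^sup>+z. ennreal ((jump (f n) z - jump (integrated_kernel t) z)\<^sup>2) \<partial>N)
        = (\<integral>\<^sup>+z. ennreal ((jump (\<lambda>z. f n z - integrated_kernel t z) z)\<^sup>2) \<partial>N)"
        by (simp add: left_diff_distrib)
      also have "\<dots> = (\<integral>\<^sup>+z. ennreal ((f n z - integrated_kernel t z)\<^sup>2) \<partial>rate.control) * ennreal jump_variance"
        by (rule nn_integral_jump_square) measurable
      also have "(\<integral>\<^sup>+z. ennreal ((f n z - integrated_kernel t z)\<^sup>2) \<partial>rate.control)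
        = (\<integral>\<^sup>+z. ennreal (((LINT s:{0..t}|lborel. supOU_kernel s z) - (\<Sum>i<n. t / real n * supOU_kernel (t / real n * real i) z))\<^sup>2) \<partial>rate.control)"
      proof (rule nn_integral_cong)
        fix z assume "z \<in> space rate.control"
        then have "0 < fst z" by (auto simp: space_pair_measure rate.space_rate)
        then have "(LINT s:{0..t}|lborel. supOU_kernel s z) = integrated_kernel t z"
          using t by (intro rate.integrated_kernel(2)) auto
        then show "ennreal ((f n z - integrated_kernel t z)\<^sup>2)
          = ennreal (((LINT s:{0..t}|lborel. supOU_kernel s z) - (\<Sum>i<n. t / real n * supOU_kernel (t / real n * real i) z))\<^sup>2)"
          by (simp only: f_def power2_commute)
      qed
      also have "\<dots> \<le> ennreal (t\<^sup>2 * rate.decorrelation (t / real n))"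
      proof (rule nn_integral_riemann_sum_error_le[OF m.sigma_finite_measure_axioms rate.supOU_kernel_joint_measurable t elim dec])
        show "AE z in rate.control. set_integrable lborel {0..t} (\<lambda>s. supOU_kernel s z)"
          using t by (intro AE_I2 rate.integrated_kernel(1)) (auto simp: space_pair_measure rate.space_rate)
      qed (rule rate.nn_integral_supOU_kernel_diff_le)
      also have "ennreal (t\<^sup>2 * rate.decorrelation (t / real n)) * ennreal jump_variance = ennreal (t\<^sup>2 * jump_variance * rate.decorrelation (t / real n))"
        using jump_variance(2) by (subst ennreal_mult''[symmetric]) (auto simp: mult_ac)
      finally show ?case by (simp add: mult_right_mono)
    qed
  qed simp
  then have "(\<lambda>n. levy_exponent N (jump (f n)) \<zeta>) \<longlonglongrightarrow> levy_exponent N (jump (integrated_kernel t)) \<zeta>"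
  proof (intro levy_exponent_tendsto_of_L2 integrated_kernel_square_finite[OF t])
    show "integrable N (\<lambda>z. (jump (f n) z)\<^sup>2)" for n unfolding f_def[abs_def] by (rule lincomb_char(1))
  qed measurable
  then have "(\<lambda>n. exp (levy_exponent N (jump (f n)) \<zeta>)) \<longlonglongrightarrow> exp (levy_exponent N (jump (integrated_kernel t)) \<zeta>)"
    by (rule tendsto_exp)
  moreover have "exp (levy_exponent N (jump (f n)) \<zeta>) = char (distr M borel (R n)) \<zeta>" for n
    unfolding R_def[abs_def] f_def[abs_def] by (rule lincomb_char(2)[symmetric])
  ultimately have 2: "(\<lambda>n. char (distr M borel (R n)) \<zeta>) \<longlonglongrightarrow> exp (levy_exponent N (jump (integrated_kernel t)) \<zeta>)" by simp
  from LIMSEQ_unique[OF 1 2] show ?thesis .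
qed

end

section \<open>Crude moment bounds from stationarity\<close>

text \<open>Jensen's inequality for the exponents 2^j by repeated Cauchy-Schwarz, each step doubling
  the exponent; it holds for infinite integrals as well.\<close>

lemma nn_integral_interval_power_le:
  fixes f :: "real \<Rightarrow> ennreal"
  assumes [measurable]: "f \<in> borel_measurable lborel" and t: "0 < t"
  shows "(\<integral>\<^sup>+s. f s * indicator {0..t} s \<partial>lborel) ^ (2 ^ j) \<le> ennreal (t ^ (2 ^ j - 1)) * (\<integral>\<^sup>+s. f s ^ (2 ^ j) * indicator {0..t} s \<partial>lborel)"
proof (induction j)
  case (Suc j)
  let ?I = "\<lambda>n. \<integral>\<^sup>+s. f s ^ n * indicator {0..t} s \<partial>lborel"
  have "(\<integral>\<^sup>+s. f s * indicator {0..t} s \<partial>lborel) ^ (2 ^ Suc j) = ((\<integral>\<^sup>+s. f s * indicator {0..t} s \<partial>lborel) ^ (2 ^ j))\<^sup>2"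
    by (simp add: power_mult[symmetric] mult.commute)
  also have "\<dots> \<le> (ennreal (t ^ (2 ^ j - 1)) * ?I (2 ^ j))\<^sup>2" using Suc.IH by (rule power_mono) simp
  also have "\<dots> = (ennreal (t ^ (2 ^ j - 1)))\<^sup>2 * (?I (2 ^ j))\<^sup>2" by (rule power_mult_distrib)
  also have "(?I (2 ^ j))\<^sup>2 \<le> ?I (2 ^ Suc j) * ennreal t"
  proof -
    have "(?I (2 ^ j))\<^sup>2 = (\<integral>\<^sup>+s. (f s ^ (2 ^ j) * indicator {0..t} s) * indicator {0..t} s \<partial>lborel)\<^sup>2"
      by (intro arg_cong[where f = "\<lambda>x. x\<^sup>2"] nn_integral_cong) (simp add: indicator_def)
    also have "\<dots> \<le> (\<integral>\<^sup>+s. (f s ^ (2 ^ j) * indicator {0..t} s)\<^sup>2 \<partial>lborel) * (\<integral>\<^sup>+s. (indicator {0..t} s)\<^sup>2 \<partial>lborel)"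
      by (rule Cauchy_Schwarz_nn_integral) measurable
    also have "(\<integral>\<^sup>+s. (f s ^ (2 ^ j) * indicator {0..t} s)\<^sup>2 \<partial>lborel) = ?I (2 ^ Suc j)"
      by (intro nn_integral_cong) (auto simp: indicator_def power_mult[symmetric] mult.commute)
    also have "(\<integral>\<^sup>+s. (indicator {0..t} s)\<^sup>2 \<partial>lborel) = (\<integral>\<^sup>+s. indicator {0..t} s \<partial>lborel)"
      by (intro nn_integral_cong) (auto simp: indicator_def)
    also have "\<dots> = ennreal t" using t by simp
    finally show ?thesis .
  qed
  then have "(ennreal (t ^ (2 ^ j - 1)))\<^sup>2 * (?I (2 ^ j))\<^sup>2 \<le> (ennreal (t ^ (2 ^ j - 1)))\<^sup>2 * (?I (2 ^ Suc j) * ennreal t)"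
    by (rule mult_left_mono) simp
  also have "\<dots> = ennreal ((t ^ (2 ^ j - 1))\<^sup>2 * t) * ?I (2 ^ Suc j)"
    using t by (simp add: ennreal_power[symmetric] ennreal_mult' mult_ac)
  also have "(t ^ (2 ^ j - 1))\<^sup>2 * t = t ^ (2 ^ Suc j - 1)"
  proof -
    have "(2 ^ j - 1) * 2 + 1 = 2 ^ Suc j - (1::nat)" by (cases "2 ^ j :: nat") auto
    then show ?thesis by (metis power_add power_mult power_one_right)
  qed
  finally show ?case .
qed simp

context finite_variance_supOU
begin

text \<open>For fixed \<xi> the translation of s by \<xi> t removes t from the kernel, and Lebesgue
  measure is translation invariant.\<close>

lemma levy_exponent_stationary:
  "levy_exponent N (jump (supOU_kernel t)) \<zeta> = levy_exponent N (jump (supOU_kernel 0)) \<zeta>"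
proof -
  define r where "r y = iexp (\<zeta> * y) - 1 - \<i> * complex_of_real (\<zeta> * y)" for y
  define h :: "real \<Rightarrow> real" where "h u = exp u * indicator {..0} u" for u
  define G where "G y = (CLINT x|\<mu>. r (y * x))" for y
  have "levy_exponent N (jump (supOU_kernel t)) \<zeta> = (CLINT \<xi>|\<pi>. CLINT s|lborel. G (h s))" for t
  proof -
    have "integrable N (\<lambda>z. (jump (supOU_kernel t) z)\<^sup>2)"
      using lincomb_char(1)[where n = 1 and c = "\<lambda>_. 1" and t = "\<lambda>_. t"] by simp
    from levy_exponent_integrable[OF _ this, of \<zeta>]
    have int: "complex_integrable N (\<lambda>z. r (jump (supOU_kernel t) z))" unfolding r_def by simp
    have "levy_exponent N (jump (supOU_kernel t)) \<zeta> = (CLINT z|rate.control. G (supOU_kernel t z))"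
      unfolding levy_exponent_def r_def[symmetric] G_def using N.integral_fst'[OF int] by simp
    also have "\<dots> = (CLINT \<xi>|\<pi>. CLINT s|lborel. G (supOU_kernel t (\<xi>, s)))"
      using N.integrable_fst'[OF int] by (intro rate.rate_lborel.integral_fst'[symmetric]) (simp add: G_def)
    also have "\<dots> = (CLINT \<xi>|\<pi>. CLINT s|lborel. G (h s))"
    proof (rule Bochner_Integration.integral_cong[OF refl])
      fix \<xi> :: real
      have "(CLINT s|lborel. G (supOU_kernel t (\<xi>, s))) = \<bar>1\<bar> *\<^sub>R (CLINT s|lborel. G (supOU_kernel t (\<xi>, \<xi> * t + 1 * s)))"
        by (rule lborel_integral_real_affine) simp
      also have "\<dots> = (CLINT s|lborel. G (h s))" by (simp add: rate.supOU_kernel_eq h_def indicator_def)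
      finally show "(CLINT s|lborel. G (supOU_kernel t (\<xi>, s))) = (CLINT s|lborel. G (h s))" .
    qed
    finally show ?thesis .
  qed
  then show ?thesis by simp
qed

text \<open>Analyticity concerns X 1 alone; equality of the marginals carries its moments to every
  time.\<close>

lemma distr_X: "distr M borel (X t) = distr M borel (X 1)"
proof (rule Levy_uniqueness)
  show "char (distr M borel (X t)) = char (distr M borel (X 1))"
    by (rule ext) (simp only: char_X levy_exponent_stationary[of t] levy_exponent_stationary[of 1])
qed (intro real_distribution_distr X_measurable)+

lemma nn_integral_X_power: "(\<integral>\<^sup>+\<omega>. ennreal (\<bar>X t \<omega>\<bar> ^ n) \<partial>M) = (\<integral>\<^sup>+\<omega>. ennreal (\<bar>X 1 \<omega>\<bar> ^ n) \<partial>M)"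
proof -
  have *: "(\<integral>\<^sup>+\<omega>. ennreal (\<bar>X t \<omega>\<bar> ^ n) \<partial>M) = (\<integral>\<^sup>+x. ennreal (\<bar>x\<bar> ^ n) \<partial>distr M borel (X t))" for t
    by (subst nn_integral_distr) auto
  show ?thesis unfolding * distr_X[of t] ..
qed

text \<open>Exponents 2^j suffice because the crude bound is called for only at arbitrarily large
  exponents.\<close>

lemma nn_integral_Z_power_le:
  assumes t: "0 < t"
  shows "(\<integral>\<^sup>+\<omega>. ennreal (\<bar>Z t \<omega>\<bar> ^ (2 ^ j)) \<partial>M) \<le> ennreal (t ^ (2 ^ j)) * (\<integral>\<^sup>+\<omega>. ennreal (\<bar>X 1 \<omega>\<bar> ^ (2 ^ j)) \<partial>M)"
proof -
  have "(\<integral>\<^sup>+\<omega>. ennreal (\<bar>Z t \<omega>\<bar> ^ (2 ^ j)) \<partial>M)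
     \<le> (\<integral>\<^sup>+\<omega>. ennreal (t ^ (2 ^ j - 1)) * (\<integral>\<^sup>+s. ennreal (\<bar>X s \<omega>\<bar> ^ (2 ^ j)) * indicator {0..t} s \<partial>lborel) \<partial>M)"
  proof (rule nn_integral_mono_AE)
    show "AE \<omega> in M. ennreal (\<bar>Z t \<omega>\<bar> ^ (2 ^ j)) \<le> ennreal (t ^ (2 ^ j - 1)) * (\<integral>\<^sup>+s. ennreal (\<bar>X s \<omega>\<bar> ^ (2 ^ j)) * indicator {0..t} s \<partial>lborel)"
      using AE_path_integrable[of t] AE_space
    proof eventually_elim
      case (elim \<omega>)
      have [measurable]: "(\<lambda>s. X s \<omega>) \<in> borel_measurable borel"
        using measurable_compose[OF measurable_Pair2'[OF elim(2)] joint_measurable] by simp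
      have "ennreal (\<bar>Z t \<omega>\<bar>) \<le> (\<integral>\<^sup>+s. ennreal (norm (indicator {0..t} s *\<^sub>R X s \<omega>)) \<partial>lborel)"
        unfolding integrated_process_def set_lebesgue_integral_def real_norm_def[symmetric]
        by (rule integral_norm_bound_ennreal) (use elim(1) in \<open>simp add: set_integrable_def\<close>)
      also have "\<dots> = (\<integral>\<^sup>+s. ennreal \<bar>X s \<omega>\<bar> * indicator {0..t} s \<partial>lborel)"
        by (intro nn_integral_cong) (simp add: indicator_def)
      finally have "ennreal (\<bar>Z t \<omega>\<bar>) ^ (2 ^ j) \<le> (\<integral>\<^sup>+s. ennreal \<bar>X s \<omega>\<bar> * indicator {0..t} s \<partial>lborel) ^ (2 ^ j)"
        by (intro power_mono) auto
      also have "\<dots> \<le> ennreal (t ^ (2 ^ j - 1)) * (\<integral>\<^sup>+s. ennreal \<bar>X s \<omega>\<bar> ^ (2 ^ j) * indicator {0..t} s \<partial>lborel)"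
        by (rule nn_integral_interval_power_le[OF _ t]) measurable
      finally show ?case by (simp add: ennreal_power)
    qed
  qed
  also have "\<dots> = ennreal (t ^ (2 ^ j - 1)) * (\<integral>\<^sup>+\<omega>. (\<integral>\<^sup>+s. ennreal (\<bar>X s \<omega>\<bar> ^ (2 ^ j)) * indicator {0..t} s \<partial>lborel) \<partial>M)"
    by (rule nn_integral_cmult) measurable
  also have "(\<integral>\<^sup>+\<omega>. (\<integral>\<^sup>+s. ennreal (\<bar>X s \<omega>\<bar> ^ (2 ^ j)) * indicator {0..t} s \<partial>lborel) \<partial>M)
     = (\<integral>\<^sup>+s. (\<integral>\<^sup>+\<omega>. ennreal (\<bar>X s \<omega>\<bar> ^ (2 ^ j)) * indicator {0..t} s \<partial>M) \<partial>lborel)"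
    by (rule PL.Fubini'[symmetric]) (simp add: case_prod_beta)
  also have "\<dots> = (\<integral>\<^sup>+s. (\<integral>\<^sup>+\<omega>. ennreal (\<bar>X 1 \<omega>\<bar> ^ (2 ^ j)) \<partial>M) * indicator {0..t} s \<partial>lborel)"
  proof (rule nn_integral_cong)
    fix s :: real
    have "(\<integral>\<^sup>+\<omega>. ennreal (\<bar>X s \<omega>\<bar> ^ (2 ^ j)) * indicator {0..t} s \<partial>M) = (\<integral>\<^sup>+\<omega>. ennreal (\<bar>X s \<omega>\<bar> ^ (2 ^ j)) \<partial>M) * indicator {0..t} s"
      by (rule nn_integral_multc) measurable
    then show "(\<integral>\<^sup>+\<omega>. ennreal (\<bar>X s \<omega>\<bar> ^ (2 ^ j)) * indicator {0..t} s \<partial>M) = (\<integral>\<^sup>+\<omega>. ennreal (\<bar>X 1 \<omega>\<bar> ^ (2 ^ j)) \<partial>M) * indicator {0..t} s"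
      unfolding nn_integral_X_power[of s] .
  qed
  also have "\<dots> = (\<integral>\<^sup>+\<omega>. ennreal (\<bar>X 1 \<omega>\<bar> ^ (2 ^ j)) \<partial>M) * ennreal t"
    using t by (subst nn_integral_cmult_indicator) auto
  also have "ennreal (t ^ (2 ^ j - 1)) * ((\<integral>\<^sup>+\<omega>. ennreal (\<bar>X 1 \<omega>\<bar> ^ (2 ^ j)) \<partial>M) * ennreal t)
     = ennreal (t ^ (2 ^ j - 1) * t) * (\<integral>\<^sup>+\<omega>. ennreal (\<bar>X 1 \<omega>\<bar> ^ (2 ^ j)) \<partial>M)"
    using t by (simp add: ennreal_mult' mult_ac)
  also have "t ^ (2 ^ j - 1) * t = t ^ (2 ^ j)"
    by (subst power_Suc2[symmetric]) (simp add: one_le_power)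
  finally show ?thesis .
qed

end

section \<open>The two properties of the jump measure that enter the growth estimates\<close>

text \<open>Jumps bounded away from 0 and from infinity can all be seen by one frequency in the
  range where 1 - cos is quadratic. Cutting the mass at 1 makes w a real number.\<close>

lemma jump_mass_pos:
  assumes \<mu>: "levy_measure \<mu>" and nz: "emeasure \<mu> UNIV \<noteq> 0"
  obtains \<delta> w where "0 < \<delta>" "\<delta> \<le> 1" "0 < w" "ennreal w \<le> emeasure \<mu> {x. \<delta> \<le> \<bar>x\<bar> \<and> \<bar>x\<bar> \<le> 1 / \<delta>}"
proof -
  have sets: "sets \<mu> = sets borel" and z: "emeasure \<mu> {0} = 0" using \<mu> by (auto simp: levy_measure_def)
  define A where "A n = {x::real. inverse (real (Suc n)) \<le> \<bar>x\<bar> \<and> \<bar>x\<bar> \<le> 1 / inverse (real (Suc n))}" for n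
  have As: "A n \<in> sets \<mu>" for n unfolding sets A_def by simp
  have U: "(\<Union>n. A n) \<union> {0} = UNIV"
  proof -
    have "x \<in> (\<Union>n. A n)" if "x \<noteq> 0" for x
    proof -
      from reals_Archimedean[of "\<bar>x\<bar>"] that obtain n where n: "inverse (real (Suc n)) < \<bar>x\<bar>" by auto
      obtain k :: nat where k: "\<bar>x\<bar> \<le> real k" using real_arch_simple by blast
      have "inverse (real (Suc (max n k))) \<le> inverse (real (Suc n))" by (intro le_imp_inverse_le) auto
      then have "inverse (real (Suc (max n k))) \<le> \<bar>x\<bar>" using n by linarith
      moreover have "\<bar>x\<bar> \<le> real (Suc (max n k))" using k by simp
      then have "\<bar>x\<bar> \<le> 1 / inverse (real (Suc (max n k)))" by (simp only: divide_inverse inverse_inverse_eq mult_1)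
      ultimately have "x \<in> A (max n k)" by (simp add: A_def)
      then show ?thesis by blast
    qed
    then show ?thesis by blast
  qed
  have "\<exists>n. emeasure \<mu> (A n) \<noteq> 0"
  proof (rule ccontr)
    assume "\<not> ?thesis"
    then have "A n \<in> null_sets \<mu>" for n using As by (auto simp: null_sets_def)
    moreover have "{0} \<in> null_sets \<mu>" using z sets by (auto simp: null_sets_def)
    ultimately have "(\<Union>n. A n) \<union> {0} \<in> null_sets \<mu>" by (intro null_sets.Un null_sets_UN) auto
    then show False using nz unfolding U by (auto simp: null_sets_def)
  qed
  then obtain n where n: "0 < emeasure \<mu> (A n)" by (auto simp: zero_less_iff_neq_zero)
  define w where "w = enn2real (min 1 (emeasure \<mu> (A n)))"
  have w: "ennreal w = min 1 (emeasure \<mu> (A n))" unfolding w_def by (rule ennreal_enn2real) (simp add: min_less_iff_disj)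
  show ?thesis
  proof (rule that[of "inverse (real (Suc n))" w])
    have "0 < ennreal w" unfolding w using n by simp
    then show "0 < w" by simp
    show "ennreal w \<le> emeasure \<mu> {x. inverse (real (Suc n)) \<le> \<bar>x\<bar> \<and> \<bar>x\<bar> \<le> 1 / inverse (real (Suc n))}"
      unfolding w A_def[symmetric] by simp
  qed (auto simp: inverse_le_1_iff)
qed

text \<open>Some \<gamma> < g has a finite integral over small jumps, and |x|^g <= |x|^\<gamma> for
  |x| <= 1; large jumps are dominated by x^2.\<close>

lemma jump_moment_finite:
  assumes \<mu>: "levy_measure \<mu>" and sq: "(\<integral>\<^sup>+x. ennreal (x\<^sup>2) \<partial>\<mu>) < \<infinity>"
    and g: "blumenthal_getoor_index \<mu> < g" "0 < g" "g \<le> 2"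
  shows "(\<integral>\<^sup>+x. ennreal (\<bar>x\<bar> powr g) \<partial>\<mu>) < \<infinity>"
proof -
  have [measurable_cong]: "sets \<mu> = sets borel" using \<mu> by (auto simp: levy_measure_def)
  let ?S = "{\<gamma>. 0 \<le> \<gamma> \<and> (\<integral>\<^sup>+x\<in>{-1..1}. ennreal (\<bar>x\<bar> powr \<gamma>) \<partial>\<mu>) < \<infinity>}"
  have "(\<integral>\<^sup>+x\<in>{-1..1}. ennreal (\<bar>x\<bar> powr 2) \<partial>\<mu>) \<le> (\<integral>\<^sup>+x. ennreal (x\<^sup>2) \<partial>\<mu>)"
    by (intro nn_integral_mono) (auto simp: indicator_def)
  \<comment> \<open>Makes the index an infimum over a nonempty set, so that elements below g can be
    extracted.\<close>
  then have "2 \<in> ?S" using sq by (auto intro: le_less_trans)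
  then obtain \<gamma> where \<gamma>: "\<gamma> \<in> ?S" "\<gamma> < g"
    using g(1) cInf_lessD[of ?S g] unfolding blumenthal_getoor_index_def by blast
  have "(\<integral>\<^sup>+x. ennreal (\<bar>x\<bar> powr g) \<partial>\<mu>) \<le> (\<integral>\<^sup>+x. ennreal (\<bar>x\<bar> powr \<gamma>) * indicator {-1..1} x + ennreal (x\<^sup>2) \<partial>\<mu>)"
  proof (rule nn_integral_mono)
    fix x :: real
    show "ennreal (\<bar>x\<bar> powr g) \<le> ennreal (\<bar>x\<bar> powr \<gamma>) * indicator {-1..1} x + ennreal (x\<^sup>2)"
    proof (cases "\<bar>x\<bar> \<le> 1")
      case True
      then have "ennreal (\<bar>x\<bar> powr g) \<le> ennreal (\<bar>x\<bar> powr \<gamma>)"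
        using \<gamma> by (intro ennreal_leI powr_mono') auto
      also have "\<dots> \<le> ennreal (\<bar>x\<bar> powr \<gamma>) * indicator {-1..1} x + ennreal (x\<^sup>2)"
        using True by (simp add: indicator_def abs_le_iff)
      finally show ?thesis .
    next
      case False
      then have "\<bar>x\<bar> powr g \<le> \<bar>x\<bar> powr 2" using g by (intro powr_mono) auto
      also have "\<bar>x\<bar> powr 2 = x\<^sup>2" using False by simp
      finally have "ennreal (\<bar>x\<bar> powr g) \<le> ennreal (x\<^sup>2)" by (rule ennreal_leI)
      then show ?thesis by (rule order_trans) simp
    qed
  qed
  also have "\<dots> = (\<integral>\<^sup>+x\<in>{-1..1}. ennreal (\<bar>x\<bar> powr \<gamma>) \<partial>\<mu>) + (\<integral>\<^sup>+x. ennreal (x\<^sup>2) \<partial>\<mu>)"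
    by (rule nn_integral_add) measurable
  also have "\<dots> < \<infinity>" using \<gamma> sq by simp
  finally show ?thesis .
qed

section \<open>Scaling exponents\<close>

text \<open>The interface to the growth estimates: analyticity survives as finite even moments, and
  regular variation as negative moments of order below \<alpha> together with lower mass bounds on
  windows.\<close>

locale regular_supOU = finite_variance_supOU +
  fixes \<alpha> :: real
  assumes X_moments: "\<And>k. (\<integral>\<^sup>+\<omega>. ennreal (X 1 \<omega> ^ (2 * k)) \<partial>M) < \<infinity>"
    and alpha: "0 < \<alpha>" "\<alpha> < 1"
    and neg_moment: "\<And>\<beta>. 0 \<le> \<beta> \<Longrightarrow> \<beta> < \<alpha> \<Longrightarrow> (\<integral>\<^sup>+\<xi>. ennreal (\<xi> powr - \<beta>) \<partial>\<pi>) < \<infinity>"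
    and mass_ge: "\<And>e. 0 < e \<Longrightarrow> \<exists>c>0. \<exists>y1>0. \<forall>y. 0 < y \<longrightarrow> y \<le> y1 \<longrightarrow>
      ennreal (c * y powr (\<alpha> + e)) \<le> (\<integral>\<^sup>+\<xi>. indicator {y<..4*y} \<xi> \<partial>\<pi>)"
    and mu_nonzero: "emeasure \<mu> UNIV \<noteq> 0"
    and BG: "blumenthal_getoor_index \<mu> < 1 + \<alpha>"
begin

definition Zmoment :: "real \<Rightarrow> real \<Rightarrow> real" where
  "Zmoment q t = expectation (\<lambda>\<omega>. \<bar>Z t \<omega>\<bar> powr q)"

lemma Z_power_integrable:
  assumes t: "0 < t" shows "integrable M (\<lambda>\<omega>. \<bar>Z t \<omega>\<bar> ^ (2 ^ Suc j))"
proof (rule integrableI_nonneg)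
  have "(\<integral>\<^sup>+\<omega>. ennreal (\<bar>Z t \<omega>\<bar> ^ (2 ^ Suc j)) \<partial>M) \<le> ennreal (t ^ (2 ^ Suc j)) * (\<integral>\<^sup>+\<omega>. ennreal (\<bar>X 1 \<omega>\<bar> ^ (2 ^ Suc j)) \<partial>M)"
    by (rule nn_integral_Z_power_le[OF t])
  also have "(\<integral>\<^sup>+\<omega>. ennreal (\<bar>X 1 \<omega>\<bar> ^ (2 ^ Suc j)) \<partial>M) = (\<integral>\<^sup>+\<omega>. ennreal (X 1 \<omega> ^ (2 * 2 ^ j)) \<partial>M)"
    by (simp add: power_mult)
  also have "ennreal (t ^ (2 ^ Suc j)) * \<dots> < \<infinity>" using X_moments[of "2 ^ j"] by (simp add: ennreal_mult_less_top)
  finally show "(\<integral>\<^sup>+\<omega>. ennreal (\<bar>Z t \<omega>\<bar> ^ (2 ^ Suc j)) \<partial>M) < \<infinity>" .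
qed auto

lemma Z_powr_integrable:
  assumes t: "0 < t" and q: "0 \<le> q" shows "integrable M (\<lambda>\<omega>. \<bar>Z t \<omega>\<bar> powr q)"
proof -
  obtain n :: nat where n: "q \<le> real n" using real_arch_simple by blast
  have "n \<le> 2 ^ Suc n" unfolding power_Suc using less_exp[of n] by linarith
  then have "real n \<le> real (2 ^ Suc n)" by (rule of_nat_mono)
  then have q': "q \<le> real (2 ^ Suc n)" using n by linarith
  have "integrable M (\<lambda>\<omega>. 1 + \<bar>Z t \<omega>\<bar> ^ (2 ^ Suc n))"
    by (intro Bochner_Integration.integrable_add Z_power_integrable t) simp
  then show ?thesis
  proof (rule Bochner_Integration.integrable_bound)
    show "AE \<omega> in M. norm (\<bar>Z t \<omega>\<bar> powr q) \<le> norm (1 + \<bar>Z t \<omega>\<bar> ^ (2 ^ Suc n))"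
    proof (intro always_eventually allI)
      fix \<omega>
      have "x powr q \<le> 1 + x ^ (2 ^ Suc n)" if "0 \<le> x" for x :: real
      proof (cases "x \<le> 1")
        case True
        then have "x powr q \<le> 1" using that q by (simp add: powr_le1)
        then show ?thesis using that by (simp add: add_increasing2)
      next
        case False
        then have "x powr q \<le> x powr (real (2 ^ Suc n))" using q' by (intro powr_mono) auto
        also have "\<dots> = x ^ (2 ^ Suc n)" using False by (subst powr_realpow) auto
        finally show ?thesis by simp
      qed
      from this[of "\<bar>Z t \<omega>\<bar>"] show "norm (\<bar>Z t \<omega>\<bar> powr q) \<le> norm (1 + \<bar>Z t \<omega>\<bar> ^ (2 ^ Suc n))" by simp
    qed
  qed measurable
qed

lemma ennreal_Zmoment:
  "0 < t \<Longrightarrow> 0 \<le> q \<Longrightarrow> (\<integral>\<^sup>+\<omega>. ennreal (\<bar>Z t \<omega>\<bar> powr q) \<partial>M) = ennreal (Zmoment q t)"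
  unfolding Zmoment_def by (rule nn_integral_eq_integral) (auto intro: Z_powr_integrable)

lemma Zmoment_nonneg: "0 \<le> Zmoment q t"
  unfolding Zmoment_def by (intro integral_nonneg_AE) auto

sublocale moments: moment_family Zmoment
proof
  show "0 \<le> Zmoment q t" for q t by (rule Zmoment_nonneg)
  \<comment> \<open>With \<open>0 powr 0 = 0\<close>, the moment of order 0 is the probability that
    Z t is nonzero.\<close>
  show "Zmoment 0 t \<le> 1" for t
  proof -
    have "Zmoment 0 t \<le> expectation (\<lambda>_. 1)"
      unfolding Zmoment_def
      by (intro integral_mono integrable_const_bound[of _ 1]) auto
    then show ?thesis by (simp add: prob_space)
  qed
  fix q1 q q2 s t :: real
  assume q: "0 \<le> q1" "q1 \<le> q" "q \<le> q2" and s: "0 < s" and t: "1 \<le> t"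
  have pt: "x powr q \<le> s powr (q - q1) * x powr q1 + s powr (q - q2) * x powr q2" if "0 \<le> x" for x
  proof (cases "x = 0")
    case False
    then have x: "0 < x" using that by simp
    show ?thesis
    proof (cases "x \<le> s")
      case True
      have "x powr q = x powr (q - q1) * x powr q1" by (simp add: powr_add[symmetric])
      also have "\<dots> \<le> s powr (q - q1) * x powr q1" using True x q by (intro mult_right_mono powr_mono2) auto
      finally show ?thesis by (rule order_trans) simp
    next
      case False
      have "x powr q = x powr (q - q2) * x powr q2" by (simp add: powr_add[symmetric])
      also have "\<dots> \<le> s powr (q - q2) * x powr q2" using False x s q by (intro mult_right_mono powr_mono2') auto
      finally show ?thesis by (rule order_trans) simp
    qed
  qed simp
  have i: "integrable M (\<lambda>\<omega>. \<bar>Z t \<omega>\<bar> powr r)" if "0 \<le> r" for r using t that by (intro Z_powr_integrable) auto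
  have "Zmoment q t \<le> expectation (\<lambda>\<omega>. s powr (q - q1) * \<bar>Z t \<omega>\<bar> powr q1 + s powr (q - q2) * \<bar>Z t \<omega>\<bar> powr q2)"
    unfolding Zmoment_def using q by (intro integral_mono pt i Bochner_Integration.integrable_add integrable_mult_right) auto
  also have "\<dots> = s powr (q - q1) * Zmoment q1 t + s powr (q - q2) * Zmoment q2 t"
    unfolding Zmoment_def using q by (subst Bochner_Integration.integral_add) (auto intro!: i)
  finally show "Zmoment q t \<le> s powr (q - q1) * Zmoment q1 t + s powr (q - q2) * Zmoment q2 t" .
qed

lemma growth_large: "\<exists>x\<ge>K. growth_le (Zmoment x) x"
proof -
  obtain n :: nat where n: "K \<le> real n" using real_arch_simple by blast
  have "n \<le> 2 ^ Suc n" unfolding power_Suc using less_exp[of n] by linarith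
  then have "real n \<le> real (2 ^ Suc n)" by (rule of_nat_mono)
  then have K: "K \<le> real (2 ^ Suc n)" using n by linarith
  define B where "B = enn2real (\<integral>\<^sup>+\<omega>. ennreal (\<bar>X 1 \<omega>\<bar> ^ (2 ^ Suc n)) \<partial>M)"
  have "(\<integral>\<^sup>+\<omega>. ennreal (\<bar>X 1 \<omega>\<bar> ^ (2 ^ Suc n)) \<partial>M) = (\<integral>\<^sup>+\<omega>. ennreal (X 1 \<omega> ^ (2 * 2 ^ n)) \<partial>M)"
    by (simp add: power_mult)
  then have B: "(\<integral>\<^sup>+\<omega>. ennreal (\<bar>X 1 \<omega>\<bar> ^ (2 ^ Suc n)) \<partial>M) = ennreal B"
    unfolding B_def using X_moments[of "2 ^ n"] by simp
  have B0: "0 \<le> B" by (simp add: B_def)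
  have "growth_le (Zmoment (real (2 ^ Suc n))) (real (2 ^ Suc n))"
  proof (rule growth_leI[where C = B], rule eventually_mono[OF eventually_gt_at_top[of 0]])
    fix t :: real assume t: "0 < t"
    have "ennreal (Zmoment (real (2 ^ Suc n)) t) = (\<integral>\<^sup>+\<omega>. ennreal (\<bar>Z t \<omega>\<bar> ^ (2 ^ Suc n)) \<partial>M)"
    proof (subst ennreal_Zmoment[OF t, symmetric], simp, rule nn_integral_cong)
      fix \<omega>
      show "ennreal (\<bar>Z t \<omega>\<bar> powr real (2 ^ Suc n)) = ennreal (\<bar>Z t \<omega>\<bar> ^ (2 ^ Suc n))"
      proof (cases "Z t \<omega> = 0")
        case False
        then have "0 < \<bar>Z t \<omega>\<bar>" by simp
        then show ?thesis by (simp only: powr_realpow)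
      qed simp
    qed
    also have "\<dots> \<le> ennreal (t ^ (2 ^ Suc n)) * ennreal B"
      using nn_integral_Z_power_le[OF t, of "Suc n"] unfolding B .
    also have "\<dots> = ennreal (t ^ (2 ^ Suc n) * B)" using t by (simp add: ennreal_mult')
    finally have "Zmoment (real (2 ^ Suc n)) t \<le> t ^ (2 ^ Suc n) * B"
      using B0 t by (subst (asm) ennreal_le_iff) auto
    also have "t ^ (2 ^ Suc n) = t powr real (2 ^ Suc n)" using t by (rule powr_realpow[symmetric])
    finally show "Zmoment (real (2 ^ Suc n)) t \<le> B * t powr real (2 ^ Suc n)" by (simp only: mult.commute)
  qed
  then show ?thesis using K by blast
qed

lemma nn_integral_jump_powr:
  assumes t: "0 < t"
  shows "(\<integral>\<^sup>+z. ennreal (\<bar>jump (integrated_kernel t) z\<bar> powr g) \<partial>N)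
    = (\<integral>\<^sup>+z. ennreal (integrated_kernel t z powr g) \<partial>rate.control) * (\<integral>\<^sup>+x. ennreal (\<bar>x\<bar> powr g) \<partial>\<mu>)"
proof -
  have "(\<integral>\<^sup>+z. ennreal (\<bar>jump (integrated_kernel t) z\<bar> powr g) \<partial>N)
    = (\<integral>\<^sup>+z. ennreal (integrated_kernel t (fst z) powr g) * ennreal (\<bar>snd z\<bar> powr g) \<partial>N)"
  proof (rule nn_integral_cong)
    fix z assume "z \<in> space N"
    then have "0 \<le> integrated_kernel t (fst z)"
      using t by (intro rate.integrated_kernel_bounds) (auto simp: space_pair_measure rate.space_rate)
    then show "ennreal (\<bar>jump (integrated_kernel t) z\<bar> powr g) = ennreal (integrated_kernel t (fst z) powr g) * ennreal (\<bar>snd z\<bar> powr g)"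
      by (simp add: abs_mult powr_mult ennreal_mult')
  qed
  also have "\<dots> = (\<integral>\<^sup>+z. ennreal (integrated_kernel t z powr g) \<partial>rate.control) * (\<integral>\<^sup>+x. ennreal (\<bar>x\<bar> powr g) \<partial>\<mu>)"
    by (rule nn_integral_N_mult) measurable
  finally show ?thesis .
qed

text \<open>Here g above the Blumenthal-Getoor index makes the jump moment finite and g < 1 +
  \<alpha> makes the rate moment of order 1 - g finite; with \<theta> = \<gamma> = g the kernel
  moment is linear in t.\<close>

lemma growth_small:
  assumes g: "blumenthal_getoor_index \<mu> < g" "1 < g" "g < 1 + \<alpha>"
  shows "growth_le (Zmoment g) 1"
proof -
  have g2: "g < 2" using g alpha by simp
  obtain J where J: "(\<integral>\<^sup>+x. ennreal (\<bar>x\<bar> powr g) \<partial>\<mu>) = ennreal J" "0 \<le> J"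
    using jump_moment_finite[OF levy, of g] g g2 jump_variance(1)
    by (cases "\<integral>\<^sup>+x. ennreal (\<bar>x\<bar> powr g) \<partial>\<mu>") auto
  obtain S where S: "(\<integral>\<^sup>+\<xi>. ennreal (\<xi> powr (1 - g)) \<partial>\<pi>) = ennreal S" "0 \<le> S"
    using neg_moment[of "g - 1"] g by (cases "\<integral>\<^sup>+\<xi>. ennreal (\<xi> powr (1 - g)) \<partial>\<pi>") auto
  define c where "c = 1 / (4 * (2 - g))"
  define C where "C = 1 / (2 * (2 - g)) + 2 / (g - 1)"
  have c: "0 < c" and C: "0 \<le> C" using g g2 by (auto simp: c_def C_def intro!: add_nonneg_nonneg)
  show ?thesis
  proof (rule growth_leI[where C = "C * (2 * S * J) / c"], rule eventually_mono[OF eventually_gt_at_top[of 0]])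
    fix t :: real assume t: "0 < t"
    have "ennreal (c * Zmoment g t) = ennreal c * (\<integral>\<^sup>+\<omega>. ennreal (\<bar>Z t \<omega>\<bar> powr g) \<partial>M)"
      using c g t Zmoment_nonneg by (subst ennreal_Zmoment) (auto simp: ennreal_mult')
    also have "\<dots> \<le> ennreal C * (\<integral>\<^sup>+z. ennreal (\<bar>jump (integrated_kernel t) z\<bar> powr g) \<partial>N)"
      unfolding c_def C_def
      by (rule abs_moment_le_levy_moment[OF _ _ N.sigma_finite_measure_axioms integrated_kernel_square_finite[OF t] char_Z[OF t] g(2) g2]) measurable
    also have "(\<integral>\<^sup>+z. ennreal (\<bar>jump (integrated_kernel t) z\<bar> powr g) \<partial>N)
      = (\<integral>\<^sup>+z. ennreal (integrated_kernel t z powr g) \<partial>rate.control) * ennreal J"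
      unfolding nn_integral_jump_powr[OF t] J ..
    also have "(\<integral>\<^sup>+z. ennreal (integrated_kernel t z powr g) \<partial>rate.control) \<le> ennreal (2 * t powr (g - g + 1)) * ennreal S"
      unfolding S(1)[symmetric] by (rule rate.integrated_kernel_moment_le) (use t g in auto)
    then have "ennreal C * ((\<integral>\<^sup>+z. ennreal (integrated_kernel t z powr g) \<partial>rate.control) * ennreal J)
      \<le> ennreal C * (ennreal (2 * t powr (g - g + 1)) * ennreal S * ennreal J)"
      by (intro mult_left_mono mult_right_mono) auto
    also have "\<dots> = ennreal (C * (2 * S * J) * t)"
      using C S J t by (simp add: ennreal_mult'[symmetric] mult_ac)
    finally have "c * Zmoment g t \<le> C * (2 * S * J) * t"
      using C S J t by (subst (asm) ennreal_le_iff) auto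
    then show "Zmoment g t \<le> C * (2 * S * J) / c * t powr 1" using c t by (simp add: field_simps)
  qed
qed

lemma jump_variance_pos: "0 < jump_variance"
proof -
  obtain \<delta> w where d: "0 < \<delta>" "\<delta> \<le> 1" "0 < w" "ennreal w \<le> emeasure \<mu> {x. \<delta> \<le> \<bar>x\<bar> \<and> \<bar>x\<bar> \<le> 1 / \<delta>}"
    using jump_mass_pos[OF levy mu_nonzero] by metis
  have "0 < ennreal (\<delta>\<^sup>2) * ennreal w" using d by (simp add: ennreal_zero_less_mult_iff)
  also have "\<dots> \<le> ennreal (\<delta>\<^sup>2) * emeasure \<mu> {x. \<delta> \<le> \<bar>x\<bar> \<and> \<bar>x\<bar> \<le> 1 / \<delta>}" using d by (intro mult_left_mono) auto
  also have "\<dots> = (\<integral>\<^sup>+x. ennreal (\<delta>\<^sup>2) * indicator {x. \<delta> \<le> \<bar>x\<bar> \<and> \<bar>x\<bar> \<le> 1 / \<delta>} x \<partial>\<mu>)"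
    by (rule nn_integral_cmult_indicator[symmetric]) (simp add: sets_mu)
  also have "\<dots> \<le> (\<integral>\<^sup>+x. ennreal (x\<^sup>2) \<partial>\<mu>)"
  proof (rule nn_integral_mono)
    fix x
    show "ennreal (\<delta>\<^sup>2) * indicator {x. \<delta> \<le> \<bar>x\<bar> \<and> \<bar>x\<bar> \<le> 1 / \<delta>} x \<le> ennreal (x\<^sup>2)"
    proof (cases "\<delta> \<le> \<bar>x\<bar> \<and> \<bar>x\<bar> \<le> 1 / \<delta>")
      case True
      then have "\<delta>\<^sup>2 \<le> \<bar>x\<bar>\<^sup>2" using d by (intro power_mono) auto
      then show ?thesis using True by (simp add: ennreal_leI)
    qed simp
  qed
  finally show ?thesis unfolding jump_variance(1) by simp
qed

lemma nn_integral_Z_square: "0 < t \<Longrightarrow> (\<integral>\<^sup>+\<omega>. ennreal ((Z t \<omega>)\<^sup>2) \<partial>M) = ennreal (Zmoment 2 t)"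
  by (subst ennreal_Zmoment[symmetric]) (auto intro!: nn_integral_cong)

lemma nn_integral_integrated_kernel_square:
  assumes t: "0 < t"
  shows "(\<integral>\<^sup>+z. ennreal ((integrated_kernel t z)\<^sup>2) \<partial>rate.control) = (\<integral>\<^sup>+z. ennreal (integrated_kernel t z powr 2) \<partial>rate.control)"
  using rate.integrated_kernel_bounds(1)[of t] t rate.space_rate
  by (intro nn_integral_cong) (auto simp: space_pair_measure)

lemma growth_two_le: "growth_le (Zmoment 2) (2 - \<alpha>)"
proof (rule growth_le_closure)
  fix e :: real assume e: "0 < e"
  \<comment> \<open>Small enough for the target e, while the order \<alpha> - d of the negative
    moment stays positive.\<close>
  define d where "d = min e \<alpha> / 2"
  have d: "0 < d" "d < e" "d < \<alpha>" using e alpha by (auto simp: d_def min_def)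
  obtain S where S: "(\<integral>\<^sup>+\<xi>. ennreal (\<xi> powr (1 - (1 + \<alpha> - d))) \<partial>\<pi>) = ennreal S" "0 \<le> S"
    using neg_moment[of "\<alpha> - d"] d by (cases "\<integral>\<^sup>+\<xi>. ennreal (\<xi> powr (1 - (1 + \<alpha> - d))) \<partial>\<pi>") auto
  have "growth_le (Zmoment 2) (2 - \<alpha> + d)"
  proof (rule growth_leI[where C = "2 * S * jump_variance"], rule eventually_mono[OF eventually_gt_at_top[of 0]])
    fix t :: real assume t: "0 < t"
    have "ennreal (Zmoment 2 t) \<le> ennreal (LINT z|N. (jump (integrated_kernel t) z)\<^sup>2)"
      unfolding nn_integral_Z_square[OF t, symmetric]
      by (rule nn_integral_square_le[OF _ _ integrated_kernel_square_finite[OF t] char_Z[OF t]]) measurable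
    also have "\<dots> = (\<integral>\<^sup>+z. ennreal ((jump (integrated_kernel t) z)\<^sup>2) \<partial>N)"
      by (rule nn_integral_eq_integral[OF integrated_kernel_square_finite[OF t], symmetric]) simp
    also have "\<dots> = (\<integral>\<^sup>+z. ennreal (integrated_kernel t z powr 2) \<partial>rate.control) * ennreal jump_variance"
      unfolding nn_integral_jump_square[OF rate.integrated_kernel_measurable] nn_integral_integrated_kernel_square[OF t] ..
    also have "\<dots> \<le> (ennreal (2 * t powr (2 - (1 + \<alpha> - d) + 1)) * ennreal S) * ennreal jump_variance"
      unfolding S(1)[symmetric]
      by (rule mult_right_mono, rule rate.integrated_kernel_moment_le) (use t d alpha in auto)
    also have "\<dots> = ennreal (2 * S * jump_variance * t powr (2 - \<alpha> + d))"
      using S jump_variance(2) by (simp add: ennreal_mult'[symmetric] mult_ac) (simp add: algebra_simps)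
    finally show "Zmoment 2 t \<le> 2 * S * jump_variance * t powr (2 - \<alpha> + d)"
      using S jump_variance(2) by (subst (asm) ennreal_le_iff) auto
  qed
  then show "\<exists>v\<le>2 - \<alpha> + e. growth_le (Zmoment 2) v" using d by (intro exI[of _ "2 - \<alpha> + d"]) auto
qed

text \<open>The window from 1/(4t) to 1/t has mass of order at least t^(-\<alpha>-e), and the
  squared kernel there is of order t^2.\<close>

lemma growth_two_ge: "growth_ge (Zmoment 2) (2 - \<alpha>)"
proof (rule growth_ge_closure)
  fix e :: real assume e: "0 < e"
  obtain c y1 where c: "0 < c" "0 < y1" "\<And>y. 0 < y \<Longrightarrow> y \<le> y1 \<Longrightarrow>
      ennreal (c * y powr (\<alpha> + e)) \<le> (\<integral>\<^sup>+\<xi>. indicator {y<..4*y} \<xi> \<partial>\<pi>)"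
    using mass_ge[OF e] by blast
  define K where "K = exp (-4) * (c * (1/4) powr (\<alpha> + e)) * jump_variance / 2"
  have K: "0 < K" using c jump_variance_pos by (simp add: K_def)
  have "growth_ge (Zmoment 2) (2 - \<alpha> - e)"
  proof (rule growth_geI[OF _ K])
    show "\<forall>\<^sub>F t in at_top. K * t powr (2 - \<alpha> - e) \<le> Zmoment 2 t"
      using eventually_ge_at_top[of "1 / (4 * y1)"] eventually_gt_at_top[of 0]
    proof eventually_elim
      case (elim t)
      then have t: "0 < t" and y: "1 / (4 * t) \<le> y1" using c by (auto simp: field_simps)
      have "ennreal (exp (-4) * t\<^sup>2) * ennreal (c * (1 / (4 * t)) powr (\<alpha> + e))
        \<le> ennreal (exp (-4) * t\<^sup>2) * emeasure \<pi> {1 / (4*t)<..4 * (1 / (4*t))}"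
      proof (rule mult_left_mono)
        have y0: "0 < 1 / (4 * t)" using t by simp
        show "ennreal (c * (1 / (4 * t)) powr (\<alpha> + e)) \<le> emeasure \<pi> {1 / (4*t)<..4 * (1 / (4*t))}"
          using c(3)[OF y0 y] unfolding rate.nn_integral_rate_interval[OF y0] .
      qed simp
      also have "\<dots> \<le> (\<integral>\<^sup>+z. ennreal ((integrated_kernel t z)\<^sup>2) \<partial>rate.control)"
        by (rule rate.integrated_kernel_square_ge[OF t])
      finally have "ennreal (exp (-4) * t\<^sup>2) * ennreal (c * (1 / (4 * t)) powr (\<alpha> + e)) * ennreal jump_variance
        \<le> (\<integral>\<^sup>+z. ennreal ((integrated_kernel t z)\<^sup>2) \<partial>rate.control) * ennreal jump_variance"
        by (rule mult_right_mono) simp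
      also have "\<dots> = (\<integral>\<^sup>+z. ennreal ((jump (integrated_kernel t) z)\<^sup>2) \<partial>N)"
        by (rule nn_integral_jump_square[symmetric]) measurable
      also have "\<dots> \<le> ennreal (2 * expectation (\<lambda>\<omega>. (Z t \<omega>)\<^sup>2))"
      proof (rule nn_integral_square_ge[where Q = "\<lambda>\<zeta>. - Re (levy_exponent N (jump (integrated_kernel t)) \<zeta>)"])
        show "integrable M (\<lambda>\<omega>. (Z t \<omega>)\<^sup>2)" using Z_power_integrable[OF t, of 0] by simp
        show "cmod (char (distr M borel (Z t)) \<zeta>) = exp (- (- Re (levy_exponent N (jump (integrated_kernel t)) \<zeta>)))" for \<zeta>
          unfolding char_Z[OF t] by simp
        show "(\<integral>\<^sup>+z. ennreal (1 - cos (\<zeta> * jump (integrated_kernel t) z)) \<partial>N) = ennreal (- Re (levy_exponent N (jump (integrated_kernel t)) \<zeta>))" for \<zeta>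
          by (rule Re_levy_exponent(1)[OF _ integrated_kernel_square_finite[OF t]]) measurable
        show "0 \<le> - Re (levy_exponent N (jump (integrated_kernel t)) \<zeta>)" for \<zeta>
          using Re_levy_exponent(2)[OF _ integrated_kernel_square_finite[OF t]] by simp
      qed (auto simp: Z_mean_zero)
      also have "expectation (\<lambda>\<omega>. (Z t \<omega>)\<^sup>2) = Zmoment 2 t"
        unfolding Zmoment_def by (intro Bochner_Integration.integral_cong) auto
      finally have "ennreal (exp (-4) * t\<^sup>2 * (c * (1 / (4 * t)) powr (\<alpha> + e)) * jump_variance) \<le> ennreal (2 * Zmoment 2 t)"
        using c jump_variance(2) by (simp add: ennreal_mult'[symmetric])
      then have le: "exp (-4) * t\<^sup>2 * (c * (1 / (4 * t)) powr (\<alpha> + e)) * jump_variance \<le> 2 * Zmoment 2 t"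
        using Zmoment_nonneg[of 2 t] by (subst (asm) ennreal_le_iff) auto
      have "(1 / (4 * t)) powr (\<alpha> + e) = ((1/4) * t powr - 1) powr (\<alpha> + e)" using t by (simp add: powr_minus_divide)
      also have "\<dots> = (1/4) powr (\<alpha> + e) * (t powr - 1) powr (\<alpha> + e)" by (rule powr_mult)
      also have "(t powr - 1) powr (\<alpha> + e) = t powr (- (\<alpha> + e))" by (simp only: powr_powr mult_minus1)
      finally have p: "(1 / (4 * t)) powr (\<alpha> + e) = (1/4) powr (\<alpha> + e) * t powr (- (\<alpha> + e))" .
      have "t\<^sup>2 * t powr (- (\<alpha> + e)) = t powr 2 * t powr (- (\<alpha> + e))" using t by simp
      also have "\<dots> = t powr (2 - \<alpha> - e)" by (simp only: powr_add[symmetric]) (simp add: algebra_simps)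
      finally have p2: "t\<^sup>2 * t powr (- (\<alpha> + e)) = t powr (2 - \<alpha> - e)" .
      have "2 * (K * t powr (2 - \<alpha> - e)) = exp (-4) * t\<^sup>2 * (c * (1 / (4 * t)) powr (\<alpha> + e)) * jump_variance"
        unfolding p p2[symmetric] K_def by (simp add: mult_ac)
      then show ?case using le by linarith
    qed
  qed
  then show "\<exists>v\<ge>2 - \<alpha> - e. growth_ge (Zmoment 2) v" by blast
qed

text \<open>At rates near y = t^(-\<eta>) the rectangle of
  \<open>integrated_kernel_rectangle\<close> has control measure at least c/2, whatever t, and its
  jumps of moderate size contribute about 1/y = t^\<eta> each. Hence the exponent at frequency
  \<zeta> of order y stays away from 0, and \<open>abs_moment_ge_char\<close> yields t^(\<eta>
  q).\<close>

lemma growth_low: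
  assumes q: "0 < q" "q \<le> 2" shows "growth_ge (Zmoment q) (q / (1 + \<alpha>))"
proof (rule growth_ge_closure)
  fix e0 :: real assume e0: "0 < e0"
  obtain \<delta> w where d: "0 < \<delta>" "\<delta> \<le> 1" "0 < w" "ennreal w \<le> emeasure \<mu> {x. \<delta> \<le> \<bar>x\<bar> \<and> \<bar>x\<bar> \<le> 1 / \<delta>}"
    using jump_mass_pos[OF levy mu_nonzero] by metis
  define e where "e = e0 * (1 + \<alpha>)"
  have e: "0 < e" using e0 alpha by (simp add: e_def)
  \<comment> \<open>Slightly below 1/(1 + \<alpha>), so that the mass bound y^(\<alpha>+e/2) times
    the length y t is exactly 1.\<close>
  define \<eta> where "\<eta> = 1 / (1 + \<alpha> + e / 2)"
  have \<eta>: "0 < \<eta>" "\<eta> < 1" "\<eta> * (1 + \<alpha> + e / 2) = 1" using alpha e by (auto simp: \<eta>_def field_simps)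
  \<comment> \<open>The defect 1/(1 + \<alpha>) - \<eta> is at most e0/2, and q <= 2.\<close>
  have \<eta>q: "q / (1 + \<alpha>) - e0 \<le> \<eta> * q"
  proof -
    have "1 / (1 + \<alpha>) - \<eta> = (e / 2) / ((1 + \<alpha>) * (1 + \<alpha> + e / 2))"
      using alpha e by (simp add: \<eta>_def field_simps)
    also have "\<dots> \<le> (e / 2) / ((1 + \<alpha>) * 1)" using alpha e by (intro divide_left_mono mult_left_mono) auto
    also have "\<dots> = e0 / 2"
    proof -
      have "1 + \<alpha> \<noteq> 0" using alpha by simp
      then have "e / (1 + \<alpha>) = e0" unfolding e_def by (rule nonzero_mult_div_cancel_right)
      moreover have "e / 2 / ((1 + \<alpha>) * 1) = e / (1 + \<alpha>) / 2"
        by (simp only: mult_1_left mult_1_right divide_divide_eq_left mult.commute)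
      ultimately show ?thesis by (simp only:)
    qed
    finally have "(1 / (1 + \<alpha>) - \<eta>) * q \<le> e0 / 2 * 2" using q e0 by (intro mult_mono) auto
    then show ?thesis by (simp add: left_diff_distrib)
  qed
  obtain c y1 where c: "0 < c" "0 < y1" "\<And>y. 0 < y \<Longrightarrow> y \<le> y1 \<Longrightarrow>
      ennreal (c * y powr (\<alpha> + e / 2)) \<le> (\<integral>\<^sup>+\<xi>. indicator {y<..4*y} \<xi> \<partial>\<pi>)"
    using mass_ge[of "e/2"] e by auto
  \<comment> \<open>On the chosen set \<zeta> times the contribution is at least \<delta>^2/8 in
    modulus, and 1 - cos u >= u^2/4.\<close>
  define k where "k = (\<delta>\<^sup>2 / 8)\<^sup>2 / 4"
  have k: "0 < k" using d by (simp add: k_def)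
  define c0 where "c0 = k * (c / 2 * w)"
  have c0: "0 < c0" using k c d by (simp add: c0_def)
  define K where "K = (1 - exp (- c0)) / (2 * \<delta> powr q)"
  have K: "0 < K" using c0 d by (simp add: K_def)
  have "growth_ge (Zmoment q) (\<eta> * q)"
  proof (rule growth_geI[OF _ K])
    have "\<forall>\<^sub>F t in at_top. 1 / y1 \<le> t powr \<eta>" "\<forall>\<^sub>F t in at_top. 2 \<le> t powr (1 - \<eta>)"
      using \<eta> by (auto intro: eventually_const_le_powr)
    then show "\<forall>\<^sub>F t in at_top. K * t powr (\<eta> * q) \<le> Zmoment q t"
      using eventually_gt_at_top[of 0]
    proof eventually_elim
      case (elim t)
      then have t: "0 < t" by simp
      define y where "y = t powr - \<eta>"
      have y: "0 < y" using t by (simp add: y_def)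
      have "y = 1 / t powr \<eta>" by (simp add: y_def powr_minus_divide)
      moreover have "1 / t powr \<eta> \<le> y1" using elim c t by (simp add: field_simps)
      ultimately have yy1: "y \<le> y1" by simp
      have yt: "y * t = t powr (1 - \<eta>)"
        using t powr_add[of t "-\<eta>" 1] by (simp add: y_def)
      \<comment> \<open>Then y t - 1 >= y t / 2, so giving up the unit of decay costs only a factor
        2.\<close>
      have yt2: "2 \<le> y * t" using elim yt by simp
      let ?R = "{y<..4*y} \<times> {0<..y * t - 1}" and ?A = "{x. \<delta> \<le> \<bar>x\<bar> \<and> \<bar>x\<bar> \<le> 1 / \<delta>}"
      have Rs: "?R \<in> sets rate.control" by (rule rate.control_rectangle(1)[OF y]) (use yt2 in simp)
      have As: "?A \<in> sets \<mu>" by (simp add: sets_mu)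
      have R: "ennreal (c / 2) \<le> emeasure rate.control ?R"
      proof -
        have cc: "c * y powr (\<alpha> + e / 2) * (y * t / 2) = c / 2"
        proof -
          have "y powr (\<alpha> + e / 2) * (y * t) = t powr (- \<eta> * (\<alpha> + e / 2)) * t powr (1 - \<eta>)"
            unfolding yt by (simp add: y_def powr_powr)
          also have "\<dots> = t powr (1 - \<eta> * (1 + \<alpha> + e / 2))"
            by (simp only: powr_add[symmetric]) (simp add: algebra_simps)
          also have "\<dots> = 1" using t \<eta>(3) by simp
          finally have "c / 2 * (y powr (\<alpha> + e / 2) * (y * t)) = c / 2" by (simp only: mult_1_right)
          then show ?thesis by (simp add: mult.assoc)
        qed
        have "ennreal (c * y powr (\<alpha> + e / 2) * (y * t / 2)) = ennreal (c * y powr (\<alpha> + e / 2)) * ennreal (y * t / 2)"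
          using c by (intro ennreal_mult') simp
        then have "ennreal (c / 2) = ennreal (c * y powr (\<alpha> + e / 2)) * ennreal (y * t / 2)" unfolding cc .
        also have "\<dots> \<le> emeasure \<pi> {y<..4*y} * ennreal (y * t - 1 - 0)"
        proof (rule mult_mono)
          show "ennreal (c * y powr (\<alpha> + e / 2)) \<le> emeasure \<pi> {y<..4*y}"
            using c(3)[OF y yy1] unfolding rate.nn_integral_rate_interval[OF y] .
          have "y * t / 2 \<le> y * t - 1 - 0" using yt2 by linarith
          then show "ennreal (y * t / 2) \<le> ennreal (y * t - 1 - 0)" by (rule ennreal_leI)
        qed auto
        also have "\<dots> = emeasure rate.control ?R"
          using yt2 by (intro rate.control_rectangle(2)[OF y, symmetric]) simp
        finally show ?thesis .
      qed
      \<comment> \<open>Kernel at most 1/y and jump at most 1/\<delta> keep the argument of the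
        cosine within [-1, 1], the range of \<open>one_minus_cos_ge\<close>.\<close>
      define \<zeta> where "\<zeta> = \<delta> * y"
      have \<zeta>: "0 < \<zeta>" using d y by (simp add: \<zeta>_def)
      have "ennreal c0 = ennreal k * (ennreal (c / 2) * ennreal w)"
        using k c d by (simp add: c0_def ennreal_mult'[symmetric])
      also have "\<dots> \<le> ennreal k * (emeasure rate.control ?R * emeasure \<mu> ?A)"
        using R d by (intro mult_left_mono mult_mono) auto
      also have "\<dots> = ennreal k * ((\<integral>\<^sup>+z. indicator ?R z \<partial>rate.control) * (\<integral>\<^sup>+x. indicator ?A x \<partial>\<mu>))"
        using Rs As by simp
      also have "\<dots> = ennreal k * (\<integral>\<^sup>+z. indicator ?R (fst z) * indicator ?A (snd z) \<partial>N)"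
        using Rs As by (subst nn_integral_N_mult) (auto simp: sets_mu)
      also have "\<dots> = (\<integral>\<^sup>+z. ennreal k * (indicator ?R (fst z) * indicator ?A (snd z)) \<partial>N)"
        using Rs As by (intro nn_integral_cmult[symmetric] borel_measurable_times_ennreal
          measurable_compose[OF measurable_fst borel_measurable_indicator] measurable_compose[OF measurable_snd borel_measurable_indicator])
      also have "\<dots> \<le> (\<integral>\<^sup>+z. ennreal (1 - cos (\<zeta> * jump (integrated_kernel t) z)) \<partial>N)"
      proof (rule nn_integral_mono)
        fix z
        show "ennreal k * (indicator ?R (fst z) * indicator ?A (snd z)) \<le> ennreal (1 - cos (\<zeta> * jump (integrated_kernel t) z))"
        proof (cases "fst z \<in> ?R \<and> snd z \<in> ?A")
          case True
          then have R: "fst z \<in> ?R" and x: "\<delta> \<le> \<bar>snd z\<bar>" "\<bar>snd z\<bar> \<le> 1 / \<delta>" by simp_all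
          note r = rate.integrated_kernel_rectangle[OF R y t]
          have d0: "0 < \<delta>" using d by simp
          have yH: "1 / 8 \<le> y * integrated_kernel t (fst z)" "y * integrated_kernel t (fst z) \<le> 1"
            using mult_left_mono[OF r(1), of y] mult_left_mono[OF r(2), of y] y by simp_all
          have dx: "\<delta> * \<delta> \<le> \<delta> * \<bar>snd z\<bar>" "\<delta> * \<bar>snd z\<bar> \<le> 1"
            using mult_left_mono[OF x(1), of \<delta>] mult_left_mono[OF x(2), of \<delta>] d0 by simp_all
          have "0 \<le> y * integrated_kernel t (fst z)" using yH by linarith
          then have abs: "\<bar>\<zeta> * jump (integrated_kernel t) z\<bar> = (\<delta> * \<bar>snd z\<bar>) * (y * integrated_kernel t (fst z))"
            using d0 abs_of_nonneg[of "y * integrated_kernel t (fst z)"] by (simp add: \<zeta>_def abs_mult)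
          have "(\<delta> * \<bar>snd z\<bar>) * (y * integrated_kernel t (fst z)) \<le> 1 * 1"
            using yH dx d0 by (intro mult_mono) linarith+
          then have le1: "\<bar>\<zeta> * jump (integrated_kernel t) z\<bar> \<le> 1" unfolding abs by (simp only: mult_1_left)
          have "\<delta> * \<delta> * (1 / 8) \<le> (\<delta> * \<bar>snd z\<bar>) * (y * integrated_kernel t (fst z))"
            using yH dx d0 by (intro mult_mono) auto
          then have "\<delta>\<^sup>2 / 8 \<le> \<bar>\<zeta> * jump (integrated_kernel t) z\<bar>" unfolding abs by (simp add: power2_eq_square)
          then have "(\<delta>\<^sup>2 / 8)\<^sup>2 \<le> (\<bar>\<zeta> * jump (integrated_kernel t) z\<bar>)\<^sup>2" by (intro power_mono) auto
          then have "k \<le> (\<zeta> * jump (integrated_kernel t) z)\<^sup>2 / 4" by (simp add: k_def)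
          also have "\<dots> \<le> 1 - cos (\<zeta> * jump (integrated_kernel t) z)" by (rule one_minus_cos_ge[OF le1])
          finally have "ennreal k \<le> ennreal (1 - cos (\<zeta> * jump (integrated_kernel t) z))" by (rule ennreal_leI)
          then show ?thesis using True by (simp add: indicator_def)
        qed (auto simp: indicator_def)
      qed
      also have "\<dots> = ennreal (- Re (levy_exponent N (jump (integrated_kernel t)) \<zeta>))"
        by (rule Re_levy_exponent(1)[OF _ integrated_kernel_square_finite[OF t]]) measurable
      finally have "c0 \<le> - Re (levy_exponent N (jump (integrated_kernel t)) \<zeta>)"
        using Re_levy_exponent(2)[OF _ integrated_kernel_square_finite[OF t], of \<zeta>]
        by (subst (asm) ennreal_le_iff) auto
      then have "cmod (char (distr M borel (Z t)) \<zeta>) \<le> exp (- c0)" unfolding char_Z[OF t] by simp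
      then have "(1 - exp (- c0)) / (2 * \<zeta> powr q) \<le> Zmoment q t"
        unfolding Zmoment_def using q \<zeta> t by (intro abs_moment_ge_char Z_powr_integrable) auto
      moreover have "\<zeta> powr q = \<delta> powr q * t powr (- (\<eta> * q))"
        using d t by (simp add: \<zeta>_def y_def powr_mult powr_powr)
      moreover have "(1 - exp (- c0)) / (2 * (\<delta> powr q * t powr (- (\<eta> * q)))) = K * t powr (\<eta> * q)"
        unfolding K_def powr_minus divide_inverse inverse_mult_distrib inverse_inverse_eq by (simp only: mult.assoc)
      ultimately show ?case by (simp only:)
    qed
  qed
  then show "\<exists>v\<ge>q / (1 + \<alpha>) - e0. growth_ge (Zmoment q) v" using \<eta>q by blast
qed

theorem scaling_exponent:
  assumes q: "0 < q"
  shows "q \<le> 1 + \<alpha> \<Longrightarrow> has_scaling_exponent M Z q (1 / (1 + \<alpha>) * q)"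
    and "1 + \<alpha> \<le> q \<Longrightarrow> has_scaling_exponent M Z q (q - \<alpha>)"
proof -
  \<comment> \<open>The threshold g0 of the convexity argument is the Blumenthal-Getoor
    index.\<close>
  note G = moments.moment_growth[OF alpha BG growth_small growth_two_le growth_two_ge growth_large growth_low q]
  show "q \<le> 1 + \<alpha> \<Longrightarrow> has_scaling_exponent M Z q (1 / (1 + \<alpha>) * q)"
    using G(1) growth_imp_log_limit unfolding has_scaling_exponent_def Zmoment_def by simp
  show "1 + \<alpha> \<le> q \<Longrightarrow> has_scaling_exponent M Z q (q - \<alpha>)"
    using G(2) growth_imp_log_limit unfolding has_scaling_exponent_def Zmoment_def by simp
qed

end

theorem theorem4p2:
  fixes M :: "'w measure" and X :: "real \<Rightarrow> 'w \<Rightarrow> real"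
    and a b \<alpha> :: real and \<mu> \<pi> :: "real measure"
    and \<kappa>\<^sub>X :: "real \<Rightarrow> complex" and p l :: "real \<Rightarrow> real"
  assumes supOU: "supOU_process M a b \<mu> \<pi> X"
    and mu_nonzero: "emeasure \<mu> UNIV \<noteq> 0"
    and finite_variance: "\<And>t. integrable M (\<lambda>\<omega>. (X t \<omega>)\<^sup>2)"
    and zero_mean: "\<And>t. (LINT \<omega>|M. X t \<omega>) = 0"
    and cumulant: "has_cumulant_function (distr M borel (X 1)) \<kappa>\<^sub>X"
    and analytic: "analytic_near_zero \<kappa>\<^sub>X"
    and p_measurable: "p \<in> borel_measurable (restrict_space lborel {0<..})"
    and p_nonneg: "\<And>x. 0 < x \<Longrightarrow> 0 \<le> p x"
    and density: "\<pi> = density (restrict_space lborel {0<..}) (\<lambda>x. ennreal (p x))"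
    and alpha: "0 < \<alpha>" "\<alpha> < 1"
    and slowly_varying: "slowly_varying l"
    and p_asymp: "p \<sim>[at_right 0] (\<lambda>x. \<alpha> * l (1 / x) * x powr (\<alpha> - 1))"
    and b_zero: "b = 0"
    and BG: "blumenthal_getoor_index \<mu> < 1 + \<alpha>"
  shows "\<forall>q>0.
    (q \<le> 1 + \<alpha> \<longrightarrow> has_scaling_exponent M (integrated_process X) q (1 / (1 + \<alpha>) * q)) \<and>
    (q \<ge> 1 + \<alpha> \<longrightarrow> has_scaling_exponent M (integrated_process X) q (q - \<alpha>))"
proof -
  have M: "prob_space M" and quad: "characteristic_quadruple a b \<mu> \<pi>"
    and joint: "(\<lambda>(t, \<omega>). X t \<omega>) \<in> borel_measurable (borel \<Otimes>\<^sub>M M)"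
    using supOU unfolding supOU_process_def by auto
  obtain \<Lambda> where \<Lambda>: "levy_basis M (\<pi> \<Otimes>\<^sub>M lborel) (levy_khintchine a 0 \<mu>) \<Lambda>"
    and stoch: "\<And>t. has_stochastic_integral M (\<pi> \<Otimes>\<^sub>M lborel) \<Lambda> (supOU_kernel t) (X t)"
    using supOU b_zero unfolding supOU_process_def by auto
  have \<pi>: "prob_space \<pi>" "sets \<pi> = sets (restrict_space borel {0<..})" and levy: "levy_measure \<mu>"
    using quad by (auto simp: characteristic_quadruple_def)
  interpret M: prob_space M by fact
  interpret \<pi>: rate_law \<pi> by (intro rate_law.intro rate_law_axioms.intro \<pi>)
  interpret finite_variance_supOU M \<pi> a \<mu> \<Lambda> X
  proof (intro_locales)
    show "levy_basis_space_axioms M (\<pi> \<Otimes>\<^sub>M lborel) (levy_khintchine a 0 \<mu>) \<Lambda>"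
      by (rule levy_basis_space_axioms.intro[OF \<Lambda>])
    show "pure_jump_levy_basis_axioms \<mu>" by (rule pure_jump_levy_basis_axioms.intro[OF levy])
    show "finite_variance_supOU_axioms M \<pi> \<Lambda> X"
      by (rule finite_variance_supOU_axioms.intro[OF joint stoch finite_variance zero_mean])
  qed
  interpret regular_supOU M \<pi> a \<mu> \<Lambda> X \<alpha>
  proof
    show "(\<integral>\<^sup>+\<omega>. ennreal (X 1 \<omega> ^ (2 * k)) \<partial>M) < \<infinity>" for k
      by (rule M.even_moments_finite_of_analytic[OF X_measurable cumulant analytic])
    show "(\<integral>\<^sup>+\<xi>. ennreal (\<xi> powr - \<beta>) \<partial>\<pi>) < \<infinity>" if "0 \<le> \<beta>" "\<beta> < \<alpha>" for \<beta>
      by (rule regular_variation_neg_moment_finite[OF \<pi>(1) p_measurable density alpha(1) slowly_varying p_asymp that])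
    show "\<exists>c>0. \<exists>y1>0. \<forall>y. 0 < y \<longrightarrow> y \<le> y1 \<longrightarrow>
      ennreal (c * y powr (\<alpha> + e)) \<le> (\<integral>\<^sup>+\<xi>. indicator {y<..4*y} \<xi> \<partial>\<pi>)" if "0 < e" for e
      using regular_variation_mass_ge[OF \<pi>(1) p_measurable density alpha(1) slowly_varying p_asymp that] by metis
  qed (use alpha mu_nonzero BG in auto)
  show ?thesis using scaling_exponent by blast
qed

end
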